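(* Let $\Omega\subset\mathbb{R}^N$ ($N\ge 2$) be a bounded domain, let $s\in(0,1)$, $1<p\le sq$, let $F$ satisfy $\Lambda^{-1}|\xi|^p\le F(x,\xi)\le\Lambda|\xi|^p$ with $\Lambda>1$, and let $K_{sq}(x,y)=a(x,y)|x-y|^{-N-sq}$ with $a:\mathbb{R}^N\times\mathbb{R}^N\to[0,\infty)$ measurable, symmetric, and $a\in L^\infty_{\mathrm{loc}}(\Omega\times\Omega)$. Assume $$\frac qp\le 1+\frac{p}{N-p}\ \text{ if } 1<p<N,\qquad q<\infty\ \text{ if } p\ge N,$$ and $f\in L^\gamma_{\mathrm{loc}}(\Omega)$ with $$\gamma>\max\Big\{\frac{q}{q-p},\frac{p}{p-1},\frac Np\Big\}\ \text{ if } p\le N,\qquad \gamma=1\ \text{ if } p>N.$$ Then any minimizer $u\in\mathcal{A}(\Omega)\cap L^{q-1}_{a,sq}(\Omega,\mathbb{R}^N)$ of $\mathcal{E}(\cdot;\Omega)$ is locally bounded in $\Omega$.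
   Context: Functional: $F:\Omega\times\mathbb{R}^N\to\mathbb{R}$ is a Carathéodory function, and $$\mathcal{E}(u;\Omega)=\int_\Omega (F(x,Du)-f(x)u)\,dx+\iint_{\mathcal{C}_\Omega}|u(x)-u(y)|^qK_{sq}(x,y)\,dx\,dy,\qquad \mathcal{C}_\Omega=(\mathbb{R}^N\times\mathbb{R}^N)\setminus\big((\mathbb{R}^N\setminus\Omega)\times(\mathbb{R}^N\setminus\Omega)\big).$$ $\mathcal{A}(\Omega)$ is the set of $v:\mathbb{R}^N\to\mathbb{R}$ (measurable) with $v|_\Omega\in L^p(\Omega)$ and $\mathcal{E}(v;\Omega)<\infty$ (understood to mean that $v|_\Omega$ is weakly differentiable and the integrals are well defined and finite; otherwise $\mathcal{E}(v;\Omega)=+\infty$). $u\in\mathcal{A}(\Omega)$ is a minimizer if $\mathcal{E}(u;\Omega)\le\mathcal{E}(v;\Omega)$ for every measurable $v:\mathbb{R}^N\to\mathbb{R}$ with $v=u$ a.e. in $\mathbb{R}^N\setminus\Omega$. Weighted tail space: $$L^{q-1}_{a,sq}(\Omega,\mathbb{R}^N)=\Big\{v\in L^{q-1}_{\mathrm{loc}}(\mathbb{R}^N):\ \operatorname*{ess\,sup}_{x\in\Omega}\int_{\mathbb{R}^N}a(x,y)\frac{|v(y)|^{q-1}}{(1+|y|)^{N+sq}}\,dy<\infty\Big\}.$$ *)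

theory Defs
  imports "HOL-Analysis.Analysis" "HOL-Probability.Essential_Supremum"
begin

text \<open>
  Functions on a subset of the Euclidean space are represented by total functions of which
  only the values on that subset matter. Measurability is Lebesgue measurability, and
  pointwise statements about elements of Lebesgue spaces are meant almost everywhere.
\<close>

definition Lspace :: "real \<Rightarrow> 'a::euclidean_space set \<Rightarrow> ('a \<Rightarrow> 'b::euclidean_space) set" where
  "Lspace r U = {g. g \<in> borel_measurable (lebesgue_on U) \<and>
      integrable (lebesgue_on U) (\<lambda>x. norm (g x) powr r)}"

definition Lspace_loc :: "real \<Rightarrow> 'a::euclidean_space set \<Rightarrow> ('a \<Rightarrow> 'b::euclidean_space) set" where
  "Lspace_loc r U = {g. g \<in> borel_measurable (lebesgue_on U) \<and>
      (\<forall>K. compact K \<and> K \<subseteq> U \<longrightarrow> g \<in> Lspace r K)}"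

definition Linf_loc :: "'a::euclidean_space set \<Rightarrow> ('a \<Rightarrow> 'b::euclidean_space) set" where
  "Linf_loc U = {g. g \<in> borel_measurable (lebesgue_on U) \<and>
      (\<forall>K. compact K \<and> K \<subseteq> U \<longrightarrow> (\<exists>C. AE x in lebesgue_on K. norm (g x) \<le> C))}"

primrec Ck :: "nat \<Rightarrow> ('a::euclidean_space \<Rightarrow> real) \<Rightarrow> bool" where
  "Ck 0 \<phi> \<longleftrightarrow> continuous_on UNIV \<phi>"
| "Ck (Suc k) \<phi> \<longleftrightarrow> (\<forall>x. \<phi> differentiable (at x)) \<and>
     (\<forall>b\<in>Basis. Ck k (\<lambda>x. frechet_derivative \<phi> (at x) b))"

definition test_functions :: "'a::euclidean_space set \<Rightarrow> ('a \<Rightarrow> real) set" where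
  "test_functions U = {\<phi>. (\<forall>k. Ck k \<phi>) \<and>
      compact (closure {x. \<phi> x \<noteq> 0}) \<and> closure {x. \<phi> x \<noteq> 0} \<subseteq> U}"

definition is_weak_gradient ::
    "'a::euclidean_space set \<Rightarrow> ('a \<Rightarrow> real) \<Rightarrow> ('a \<Rightarrow> 'a) \<Rightarrow> bool" where
  "is_weak_gradient U v G \<longleftrightarrow> v \<in> Lspace_loc 1 U \<and> G \<in> Lspace_loc 1 U \<and>
     (\<forall>\<phi>\<in>test_functions U. \<forall>b\<in>Basis.
        (\<integral>x. v x * frechet_derivative \<phi> (at x) b \<partial>lebesgue_on U) =
        - (\<integral>x. (G x \<bullet> b) * \<phi> x \<partial>lebesgue_on U))"

definition weakly_differentiable_on :: "('a::euclidean_space \<Rightarrow> real) \<Rightarrow> 'a set \<Rightarrow> bool" where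
  "weakly_differentiable_on v U \<longleftrightarrow> (\<exists>G. is_weak_gradient U v G)"

text \<open>The weak gradient is unique up to null sets; an arbitrary representative is chosen.\<close>

definition weak_gradient :: "'a::euclidean_space set \<Rightarrow> ('a \<Rightarrow> real) \<Rightarrow> 'a \<Rightarrow> 'a" where
  "weak_gradient U v = (SOME G. is_weak_gradient U v G)"

definition caratheodory :: "'a::euclidean_space set \<Rightarrow> ('a \<Rightarrow> 'a \<Rightarrow> real) \<Rightarrow> bool" where
  "caratheodory U F \<longleftrightarrow>
     (\<forall>\<xi>. (\<lambda>x. F x \<xi>) \<in> borel_measurable (lebesgue_on U)) \<and>
     (AE x in lebesgue_on U. continuous_on UNIV (F x))"

definition cross_region :: "'a set \<Rightarrow> ('a \<times> 'a) set" where
  "cross_region U = UNIV - (- U) \<times> (- U)"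

text \<open>On the diagonal, a null set, this kernel has the value \<open>0\<close> since \<open>0 powr t = 0\<close>.\<close>

definition nonlocal_kernel ::
    "('a::euclidean_space \<Rightarrow> 'a \<Rightarrow> real) \<Rightarrow> real \<Rightarrow> real \<Rightarrow> 'a \<Rightarrow> 'a \<Rightarrow> real" where
  "nonlocal_kernel a s q x y = a x y * norm (x - y) powr (- real DIM('a) - s * q)"

definition local_integrand ::
    "('a::euclidean_space \<Rightarrow> 'a \<Rightarrow> real) \<Rightarrow> ('a \<Rightarrow> real) \<Rightarrow> 'a set \<Rightarrow> ('a \<Rightarrow> real) \<Rightarrow> 'a \<Rightarrow> real" where
  "local_integrand F f U v x = F x (weak_gradient U v x) - f x * v x"

definition nonlocal_integrand ::
    "('a::euclidean_space \<Rightarrow> 'a \<Rightarrow> real) \<Rightarrow> real \<Rightarrow> ('a \<Rightarrow> real) \<Rightarrow> 'a \<times> 'a \<Rightarrow> real" where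
  "nonlocal_integrand K q v = (\<lambda>(x, y). \<bar>v x - v y\<bar> powr q * K x y)"

definition energy ::
    "('a::euclidean_space \<Rightarrow> 'a \<Rightarrow> real) \<Rightarrow> ('a \<Rightarrow> real) \<Rightarrow> ('a \<Rightarrow> 'a \<Rightarrow> real) \<Rightarrow> real \<Rightarrow>
      'a set \<Rightarrow> ('a \<Rightarrow> real) \<Rightarrow> ereal" where
  "energy F f K q U v =
     (if weakly_differentiable_on v U \<and>
         integrable (lebesgue_on U) (local_integrand F f U v) \<and>
         integrable (lebesgue_on (cross_region U)) (nonlocal_integrand K q v)
      then ereal ((\<integral>x. local_integrand F f U v x \<partial>lebesgue_on U) +
                  (\<integral>z. nonlocal_integrand K q v z \<partial>lebesgue_on (cross_region U)))
      else \<infinity>)"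

definition admissible ::
    "('a::euclidean_space \<Rightarrow> 'a \<Rightarrow> real) \<Rightarrow> ('a \<Rightarrow> real) \<Rightarrow> ('a \<Rightarrow> 'a \<Rightarrow> real) \<Rightarrow> real \<Rightarrow> real \<Rightarrow>
      'a set \<Rightarrow> ('a \<Rightarrow> real) set" where
  "admissible F f K p q U =
     {v \<in> borel_measurable lebesgue. v \<in> Lspace p U \<and> energy F f K q U v < \<infinity>}"

definition minimizer ::
    "('a::euclidean_space \<Rightarrow> 'a \<Rightarrow> real) \<Rightarrow> ('a \<Rightarrow> real) \<Rightarrow> ('a \<Rightarrow> 'a \<Rightarrow> real) \<Rightarrow> real \<Rightarrow> real \<Rightarrow>
      'a set \<Rightarrow> ('a \<Rightarrow> real) \<Rightarrow> bool" where
  "minimizer F f K p q U u \<longleftrightarrow> u \<in> admissible F f K p q U \<and>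
     (\<forall>v \<in> borel_measurable lebesgue.
        (AE x in lebesgue_on (- U). v x = u x) \<longrightarrow> energy F f K q U u \<le> energy F f K q U v)"

definition weighted_tail_space ::
    "('a::euclidean_space \<Rightarrow> 'a \<Rightarrow> real) \<Rightarrow> real \<Rightarrow> real \<Rightarrow> 'a set \<Rightarrow> ('a \<Rightarrow> real) set" where
  "weighted_tail_space a s q U = {v \<in> Lspace_loc (q - 1) UNIV.
     esssup (lebesgue_on U) (\<lambda>x. \<integral>\<^sup>+ y. ennreal
       (a x y * \<bar>v y\<bar> powr (q - 1) / (1 + norm y) powr (real DIM('a) + s * q)) \<partial>lebesgue) < \<infinity>}"

end

theory Submission
  imports Defs
begin

text \<open>
  For \<open>p \<le> N\<close> the minimizer is compared with \<open>u - \<eta>\<^sup>m (u - k)\<^sub>+\<close>. The nonlocal energy changes by at most the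
  truncated function in \<open>L\<^sup>q\<close> near the diagonal plus a tail term that is linear in \<open>(u - k)\<^sub>+\<close>, and hole
  filling removes the gradient on the annulus, which gives a Caccioppoli inequality for \<open>(u - k)\<^sub>+\<close>. Since
  \<open>q\<close> is at most the Sobolev exponent of \<open>p\<close>, the Sobolev inequality and the condition on \<open>\<gamma>\<close> turn it into a
  superlinear recursion for the \<open>L\<^sup>q\<close> norms on shrinking balls and rising levels, so De Giorgi's iteration
  bounds \<open>u\<close> from above; \<open>- u\<close> minimizes the functional with \<open>F x (- \<xi>)\<close> and \<open>- f\<close>. For \<open>p > N\<close> finiteness
  of the energy alone puts a nonlinear function of \<open>u\<close> into a Sobolev space that embeds into \<open>L\<^sup>\<infinity>\<close>.
\<close>

text \<open>The kernel weight \<open>a\<close> may vanish, so the nonlocal term offers no coercivity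
  and its increase must be bounded with the density of u itself carrying the constant one. This is
  why the cut-off enters as a power with exponent m \<ge> q: convexity with weight \<eta>^m leaves
  an error of size \<eta>^(m-q), which stays bounded. Near the diagonal the Lipschitz bound of
  \<eta> turns |x-y|^(-N-sq) into |x-y|^(q-N-sq), integrable because s < 1; away from it the error
  is w(x) w(y)^(q-1), and the tail space integrates the second factor uniformly in x. All losses in
  the radii are absorbed in the single exponent \<open>bexp\<close>. For p \<le> N, the bound
  \<gamma> > p/(p-1) makes f u locally integrable, so that finite energy yields Du in L^p locally,
  and \<gamma> > q/(q-p) says that the recursion exponent q/(p \<gamma>') exceeds one, \<gamma>'
  being conjugate to \<gamma>. The Sobolev and Morrey bounds both rest on one pointwise estimate of
  |v| by the Riesz potential of |Dv|. Since the given data are only Lebesgue measurable, Borel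
  representatives are fixed before any argument on the product space.\<close>

abbreviation nn_lborel :: "('a::euclidean_space \<Rightarrow> real) \<Rightarrow> ennreal"  (binder "\<integral>\<^sub>+" 10)
  where "nn_lborel f \<equiv> \<integral>\<^sup>+x. ennreal (f x) \<partial>lborel"

section \<open>Smooth functions\<close>

abbreviation dderiv :: "('a::euclidean_space \<Rightarrow> real) \<Rightarrow> 'a \<Rightarrow> 'a \<Rightarrow> real" where
  "dderiv \<phi> b x \<equiv> frechet_derivative \<phi> (at x) b"

definition smooth :: "('a::euclidean_space \<Rightarrow> real) \<Rightarrow> bool" where
  "smooth \<phi> \<longleftrightarrow> (\<forall>k. Ck k \<phi>)"

lemma dderiv_eqI: "(\<phi> has_derivative D) (at x) \<Longrightarrow> dderiv \<phi> b x = D b"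
  by (simp add: frechet_derivative_at[symmetric])

text \<open>The derivative may be supplied as any family \<open>D\<close>, which keeps the choice
  operator behind \<open>frechet_derivative\<close> out of the smoothness inductions.\<close>

lemma Ck_SucI:
  assumes "\<And>x. (\<phi> has_derivative D x) (at x)" "\<And>b. b \<in> Basis \<Longrightarrow> Ck k (\<lambda>x. D x b)"
  shows "Ck (Suc k) \<phi>"
proof -
  have "(\<lambda>x. dderiv \<phi> b x) = (\<lambda>x. D x b)" for b
    using dderiv_eqI[OF assms(1)] by auto
  thus ?thesis using assms by (auto simp: differentiable_def)
qed

lemma Ck_SucD:
  assumes "Ck (Suc k) \<phi>"
  shows "(\<phi> has_derivative frechet_derivative \<phi> (at x)) (at x)"
    and "b \<in> Basis \<Longrightarrow> Ck k (\<lambda>x. dderiv \<phi> b x)"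
  using assms by (auto simp: frechet_derivative_works)

lemma Ck_Suc_imp: "Ck (Suc k) \<phi> \<Longrightarrow> Ck k \<phi>"
proof (induction k arbitrary: \<phi>)
  case 0 thus ?case
    by (auto simp: continuous_on_eq_continuous_at intro!: differentiable_imp_continuous_within)
qed (auto)

lemma Ck_const: "Ck k (\<lambda>x. c)"
  by (induction k arbitrary: c) auto

lemma Ck_inner: "Ck k (\<lambda>x. x \<bullet> c)"
proof (cases k)
  case 0 thus ?thesis by (auto intro!: continuous_intros)
next
  case (Suc j)
  show ?thesis unfolding Suc
    by (rule Ck_SucI[where D="\<lambda>x h. h \<bullet> c"]) (auto intro!: derivative_eq_intros Ck_const)
qed

lemma Ck_add: "Ck k f \<Longrightarrow> Ck k g \<Longrightarrow> Ck k (\<lambda>x. f x + g x)"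
proof (induction k arbitrary: f g)
  case 0 thus ?case by (auto intro!: continuous_intros)
next
  case (Suc k)
  show ?case
  proof (rule Ck_SucI[where D="\<lambda>x h. dderiv f h x + dderiv g h x"])
    fix b :: 'a assume b: "b \<in> Basis"
    show "Ck k (\<lambda>x. dderiv f b x + dderiv g b x)"
      by (rule Suc.IH) (rule Ck_SucD(2)[OF Suc.prems(1) b] Ck_SucD(2)[OF Suc.prems(2) b])+
  qed (rule has_derivative_add; rule Ck_SucD(1)[OF Suc.prems(1)] Ck_SucD(1)[OF Suc.prems(2)])
qed

lemma Ck_mult: "Ck k f \<Longrightarrow> Ck k g \<Longrightarrow> Ck k (\<lambda>x. f x * g x)"
proof (induction k arbitrary: f g)
  case 0 thus ?case by (auto intro!: continuous_intros)
next
  case (Suc k)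
  show ?case
  proof (rule Ck_SucI[where D="\<lambda>x h. f x * dderiv g h x + dderiv f h x * g x"])
    fix b :: 'a assume b: "b \<in> Basis"
    show "Ck k (\<lambda>x. f x * dderiv g b x + dderiv f b x * g x)"
      by (rule Ck_add; rule Suc.IH)
        (rule Ck_Suc_imp[OF Suc.prems(1)] Ck_Suc_imp[OF Suc.prems(2)]
           Ck_SucD(2)[OF Suc.prems(1) b] Ck_SucD(2)[OF Suc.prems(2) b])+
  qed (rule has_derivative_mult; rule Ck_SucD(1)[OF Suc.prems(1)] Ck_SucD(1)[OF Suc.prems(2)])
qed

lemma Ck_comp_real:
  fixes \<psi> :: "real \<Rightarrow> real"
  shows "Ck k \<psi> \<Longrightarrow> Ck k \<phi> \<Longrightarrow> Ck k (\<lambda>x. \<psi> (\<phi> x))"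
proof (induction k arbitrary: \<psi> \<phi>)
  case 0 thus ?case
    using continuous_on_compose2[of UNIV \<psi> UNIV \<phi>] by auto
next
  case (Suc k)
  \<comment> \<open>\<open>Ck\<close> speaks only of directions in \<open>Basis\<close>, which for
    the reals is {1}; every other direction is reduced to it by linearity.\<close>
  have lin: "dderiv \<psi> h t = h * dderiv \<psi> 1 t" for h t
  proof -
    have "linear (frechet_derivative \<psi> (at t))"
      using Suc.prems by (auto intro: linear_frechet_derivative)
    from linear_cmul[OF this, of h 1] show ?thesis by simp
  qed
  have "((\<lambda>x. \<psi> (\<phi> x)) has_derivative (\<lambda>h. dderiv \<phi> h x * dderiv \<psi> 1 (\<phi> x))) (at x)" for x
    using has_derivative_compose[OF Ck_SucD(1)[OF Suc.prems(2)] Ck_SucD(1)[OF Suc.prems(1)], of x]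
    by (subst (asm) lin)
  then show ?case
  proof (rule Ck_SucI)
    fix b :: 'a assume b: "b \<in> Basis"
    have "Ck k (\<lambda>t. dderiv \<psi> 1 t)" by (rule Ck_SucD(2)[OF Suc.prems(1)]) simp
    thus "Ck k (\<lambda>x. dderiv \<phi> b x * dderiv \<psi> 1 (\<phi> x))"
      by (intro Ck_mult Ck_SucD(2)[OF Suc.prems(2) b] Suc.IH[OF _ Ck_Suc_imp[OF Suc.prems(2)]])
  qed
qed

text \<open>The exponent is generalised in the induction because each derivative lowers it by one;
  positivity of \<open>\<phi>\<close> keeps all these powers differentiable.\<close>

lemma Ck_powr: "Ck k \<phi> \<Longrightarrow> (\<And>x. \<phi> x > 0) \<Longrightarrow> Ck k (\<lambda>x. \<phi> x powr \<alpha>)"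
proof (induction k arbitrary: \<alpha>)
  case 0 thus ?case by (auto intro!: continuous_intros simp: less_imp_neq[symmetric])
next
  case (Suc k)
  have "((\<lambda>x. \<phi> x powr \<alpha>) has_derivative (\<lambda>h. \<alpha> * (\<phi> x powr (\<alpha> - 1) * dderiv \<phi> h x))) (at x)" for x
    using has_derivative_powr[OF Ck_SucD(1)[OF Suc.prems(1)] has_derivative_const, of x \<alpha>] Suc.prems(2)[of x]
    by (auto simp: powr_diff field_simps)
  then show ?case
  proof (rule Ck_SucI)
    fix b :: 'a assume b: "b \<in> Basis"
    show "Ck k (\<lambda>x. \<alpha> * (\<phi> x powr (\<alpha> - 1) * dderiv \<phi> b x))"
      by (intro Ck_mult Ck_const Ck_SucD(2)[OF Suc.prems(1) b] Suc.IH Ck_Suc_imp[OF Suc.prems(1)] Suc.prems(2))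
  qed
qed

text \<open>The classical flat function exp(-1/t) together with its quotients by powers of t. The
  family is closed under differentiation up to linear combinations, so one induction proves that
  every member is smooth.\<close>

definition flat :: "nat \<Rightarrow> real \<Rightarrow> real" where
  "flat m t = (if t \<le> 0 then 0 else exp (- 1 / t) / t ^ m)"

text \<open>With M = m + 1, raising 1/(M t) \<le> exp (1/(M t)) to the power M gives exp(-1/t) \<le>
  (M t)^M. This absorbs the denominator t^m and leaves one factor t, as needed for the limit at
  0.\<close>

lemma flat_bound: assumes "t > 0" shows "flat m t \<le> real (Suc m) ^ Suc m * t"
proof -
  have "1 / (Suc m * t) \<le> exp (1 / (Suc m * t))" using exp_ge_add_one_self[of "1 / (Suc m * t)"] by linarith
  hence "(1 / (Suc m * t)) ^ Suc m \<le> exp (1 / (Suc m * t)) ^ Suc m"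
    using assms by (intro power_mono) auto
  also have "\<dots> = exp (1 / t)"
    using assms by (subst exp_of_nat_mult[symmetric]) (simp add: divide_simps del: of_nat_Suc)
  finally have "1 \<le> exp (1 / t) * (Suc m * t) ^ Suc m"
    using assms by (simp add: power_divide divide_le_eq field_simps del: power_Suc of_nat_Suc)
  hence "exp (- 1 / t) \<le> (Suc m * t) ^ Suc m"
    using assms by (simp add: exp_minus field_simps del: power_Suc of_nat_Suc)
  also have "\<dots> = (real (Suc m) ^ Suc m * t) * t ^ m"
    by (simp add: power_mult_distrib)
  finally show ?thesis using assms by (simp add: flat_def divide_le_eq del: power_Suc of_nat_Suc)
qed

lemma flat_nonneg: "flat m t \<ge> 0" by (simp add: flat_def)

lemma flat_has_derivative:
  "(flat m has_real_derivative (- real m * flat (Suc m) t + flat (Suc (Suc m)) t)) (at t)"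
proof -
  consider "t < 0" | "t > 0" | "t = 0" by linarith
  then show ?thesis
  proof cases
    case 1
    have "((\<lambda>t. 0) has_real_derivative 0) (at t)" by simp
    then have "(flat m has_real_derivative 0) (at t)"
      by (rule has_field_derivative_transform_within_open[where S="{..<0}"])
        (use 1 in \<open>auto simp: flat_def\<close>)
    then show ?thesis using 1 by (simp add: flat_def)
  next
    case 2
    define E where "E = exp (- 1 / t)"
    have "((\<lambda>t. exp (- 1 / t) * inverse t ^ m) has_real_derivative
       (E * (inverse t * inverse t) * inverse t ^ m + real m * (inverse t ^ (m - 1) * (- (inverse t * inverse t))) * E)) (at t)"
      using 2 by (auto intro!: derivative_eq_intros simp: E_def divide_inverse)
    moreover have "E * (inverse t * inverse t) * inverse t ^ m + real m * (inverse t ^ (m - 1) * (- (inverse t * inverse t))) * E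
       = - real m * (E / t ^ Suc m) + E / t ^ Suc (Suc m)"
      by (cases m) (auto simp: divide_inverse power_inverse algebra_simps)
    ultimately have "((\<lambda>t. exp (- 1 / t) / t ^ m) has_real_derivative
       (- real m * (exp (- 1 / t) / t ^ Suc m) + exp (- 1 / t) / t ^ Suc (Suc m))) (at t)"
      by (simp only: E_def power_inverse divide_inverse)
    then have "(flat m has_real_derivative (- real m * (exp (- 1 / t) / t ^ Suc m) + exp (- 1 / t) / t ^ Suc (Suc m))) (at t)"
      by (rule has_field_derivative_transform_within_open[where S="{0<..}"])
        (use 2 in \<open>auto simp: flat_def\<close>)
    then show ?thesis using 2 by (simp add: flat_def)
  next
    case 3
    \<comment> \<open>The difference quotient of \<open>flat m\<close> at 0 is exactly
      \<open>flat (Suc m)\<close>, so the derivative there is a limit already controlled by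
      \<open>flat_bound\<close>.\<close>
    have "((\<lambda>h. flat (Suc m) h) \<longlongrightarrow> 0) (at 0)"
    proof (rule tendsto_sandwich[where f="\<lambda>_. 0" and h="\<lambda>h. real (Suc (Suc m)) ^ Suc (Suc m) * \<bar>h\<bar>"])
      show "\<forall>\<^sub>F h in at 0. flat (Suc m) h \<le> real (Suc (Suc m)) ^ Suc (Suc m) * \<bar>h\<bar>"
      proof (rule always_eventually, rule allI)
        fix h :: real
        show "flat (Suc m) h \<le> real (Suc (Suc m)) ^ Suc (Suc m) * \<bar>h\<bar>"
        proof (cases "h > 0")
          case True thus ?thesis using flat_bound[OF True, of "Suc m"] by simp
        next
          case False
          hence "flat (Suc m) h = 0" by (simp add: flat_def)
          thus ?thesis by (simp del: power_Suc)
        qed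
      qed
      have "((\<lambda>h. real (Suc (Suc m)) ^ Suc (Suc m) * \<bar>h\<bar>) \<longlongrightarrow> real (Suc (Suc m)) ^ Suc (Suc m) * \<bar>0\<bar>) (at 0)"
        by (intro tendsto_intros)
      thus "((\<lambda>h. real (Suc (Suc m)) ^ Suc (Suc m) * \<bar>h\<bar>) \<longlongrightarrow> 0) (at (0::real))" by (simp del: power_Suc)
    qed (auto simp: flat_nonneg)
    moreover have "(flat m (0 + h) - flat m 0) / h = flat (Suc m) h" for h
      by (auto simp: flat_def)
    ultimately have "(flat m has_real_derivative 0) (at 0)"
      by (simp add: DERIV_def)
    then show ?thesis using 3 by (simp add: flat_def)
  qed
qed

lemma Ck_flat: "Ck k (flat m)"
proof (induction k arbitrary: m)
  case 0
  show ?case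
    using DERIV_isCont[OF flat_has_derivative] by (force simp: continuous_on_eq_continuous_at)
next
  case (Suc k)
  show ?case
  proof (rule Ck_SucI[where D="\<lambda>t h. (- real m * flat (Suc m) t + flat (Suc (Suc m)) t) * h"])
    show "Ck k (\<lambda>t. (- real m * flat (Suc m) t + flat (Suc (Suc m)) t) * b)" for b
      by (intro Ck_mult Ck_add Ck_const Suc.IH)
    show "(flat m has_derivative (\<lambda>h. (- real m * flat (Suc m) t + flat (Suc (Suc m)) t) * h)) (at t)" for t
      using flat_has_derivative unfolding has_field_derivative_def .
  qed
qed

lemma smooth_const [simp]: "smooth (\<lambda>x. c)"
  and smooth_inner [simp]: "smooth (\<lambda>x. x \<bullet> d)"
  and smooth_add: "smooth f \<Longrightarrow> smooth g \<Longrightarrow> smooth (\<lambda>x. f x + g x)"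
  and smooth_mult: "smooth f \<Longrightarrow> smooth g \<Longrightarrow> smooth (\<lambda>x. f x * g x)"
  and smooth_comp: "smooth \<psi> \<Longrightarrow> smooth f \<Longrightarrow> smooth (\<lambda>x. \<psi> (f x))"
  and smooth_powr: "smooth f \<Longrightarrow> (\<And>x. f x > 0) \<Longrightarrow> smooth (\<lambda>x. f x powr \<alpha>)"
  and smooth_flat: "smooth (flat m)"
  by (auto simp: smooth_def Ck_const Ck_inner Ck_add Ck_mult Ck_comp_real Ck_powr Ck_flat)

lemma smooth_cmult: "smooth f \<Longrightarrow> smooth (\<lambda>x. c * f x)"
  by (rule smooth_mult[OF smooth_const])

lemma smooth_minus: "smooth f \<Longrightarrow> smooth (\<lambda>x. - f x)"
  using smooth_cmult[of f "-1"] by simp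

lemma smooth_diff: "smooth f \<Longrightarrow> smooth g \<Longrightarrow> smooth (\<lambda>x. f x - g x)"
  using smooth_add[OF _ smooth_minus, of f g] by simp

lemma smooth_power: "smooth f \<Longrightarrow> smooth (\<lambda>x. f x ^ n)"
  by (induction n) (auto intro: smooth_mult)

lemma smooth_prod: "finite I \<Longrightarrow> (\<And>i. i \<in> I \<Longrightarrow> smooth (f i)) \<Longrightarrow> smooth (\<lambda>x. \<Prod>i\<in>I. f i x)"
  by (induction I rule: finite_induct) (auto intro: smooth_mult)

lemma smooth_sum: "finite I \<Longrightarrow> (\<And>i. i \<in> I \<Longrightarrow> smooth (f i)) \<Longrightarrow> smooth (\<lambda>x. \<Sum>i\<in>I. f i x)"
  by (induction I rule: finite_induct) (auto intro: smooth_add)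

lemma smooth_exp: "smooth (exp :: real \<Rightarrow> real)"
proof -
  have "Ck k (exp :: real \<Rightarrow> real)" for k
  proof (induction k)
    case 0 show ?case by (auto intro!: continuous_intros)
  next
    case (Suc k)
    show ?case
      by (rule Ck_SucI[where D="\<lambda>x h. exp x * h"])
       (rule DERIV_exp[unfolded has_field_derivative_def], rule Ck_mult[OF Suc Ck_const])
  qed
  thus ?thesis by (simp add: smooth_def)
qed

lemma smooth_norm_sq: "smooth (\<lambda>x. (norm (x - c))\<^sup>2)"
proof -
  have eq: "(\<lambda>x. (norm (x - c))\<^sup>2) = (\<lambda>x. \<Sum>b\<in>Basis. (x \<bullet> b - c \<bullet> b)\<^sup>2)"
    unfolding power2_norm_eq_inner
    by (subst euclidean_inner) (simp only: inner_diff_left power2_eq_square)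
  show ?thesis unfolding eq
    by (intro smooth_sum smooth_power smooth_diff) auto
qed

lemma smooth_continuous: "smooth f \<Longrightarrow> continuous_on UNIV f"
  unfolding smooth_def by (drule spec[of _ 0]) simp

lemma smooth_has_derivative: "smooth f \<Longrightarrow> (f has_derivative frechet_derivative f (at x)) (at x)"
  unfolding smooth_def by (rule Ck_SucD(1), erule spec)

lemma smooth_dderiv: "smooth f \<Longrightarrow> b \<in> Basis \<Longrightarrow> smooth (\<lambda>x. dderiv f b x)"
  unfolding smooth_def by (intro allI Ck_SucD(2)) auto

lemma smooth_measurable: "smooth f \<Longrightarrow> f \<in> borel_measurable borel"
  by (simp add: borel_measurable_continuous_onI smooth_continuous)

lemma has_derivative_translate:
  assumes "(f has_derivative D) (at (x + c))"
  shows "((\<lambda>x. f (x + c)) has_derivative D) (at x)"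
proof -
  have "((\<lambda>x. x + c) has_derivative (\<lambda>h. h)) (at x)" by (auto intro!: derivative_eq_intros)
  from has_derivative_compose[OF this assms] show ?thesis .
qed

lemma has_derivative_reflect:
  assumes "(f has_derivative D) (at (c - x))"
  shows "((\<lambda>x. f (c - x)) has_derivative (\<lambda>h. D (- h))) (at x)"
proof -
  have "((\<lambda>x. c - x) has_derivative (\<lambda>h. - h)) (at x)" by (auto intro!: derivative_eq_intros)
  from has_derivative_compose[OF this assms] show ?thesis .
qed

lemma smooth_translate: assumes "smooth f" shows "smooth (\<lambda>x. f (x + c))"
proof -
  have "Ck k f \<Longrightarrow> Ck k (\<lambda>x. f (x + c))" for k and f :: "'a \<Rightarrow> real"
  proof (induction k arbitrary: f)
    case 0 thus ?case by (auto intro!: continuous_on_compose2[of UNIV f] continuous_intros)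
  next
    case (Suc k)
    have "((\<lambda>x. f (x + c)) has_derivative (\<lambda>h. dderiv f h (x + c))) (at x)" for x
      by (rule has_derivative_translate[OF Ck_SucD(1)[OF Suc.prems]])
    then show ?case
      by (rule Ck_SucI) (rule Suc.IH, rule Ck_SucD(2)[OF Suc.prems], assumption)
  qed
  thus ?thesis using assms by (simp add: smooth_def)
qed

lemma smooth_reflect: assumes "smooth f" shows "smooth (\<lambda>x. f (c - x))"
proof -
  have "Ck k f \<Longrightarrow> Ck k (\<lambda>x. f (c - x))" for k and f :: "'a \<Rightarrow> real"
  proof (induction k arbitrary: f)
    case 0 thus ?case by (auto intro!: continuous_on_compose2[of UNIV f] continuous_intros)
  next
    case (Suc k)
    have lin: "linear (frechet_derivative f (at x))" for x
      using Suc.prems by (auto intro: linear_frechet_derivative)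
    have "((\<lambda>x. f (c - x)) has_derivative (\<lambda>h. (- 1) * dderiv f h (c - x))) (at x)" for x
      using has_derivative_reflect[OF Ck_SucD(1)[OF Suc.prems], of c x] by (simp add: linear_neg[OF lin])
    then show ?case
      by (rule Ck_SucI) (rule Ck_mult[OF Ck_const], rule Suc.IH, rule Ck_SucD(2)[OF Suc.prems], assumption)
  qed
  thus ?thesis using assms by (simp add: smooth_def)
qed

lemma dderiv_mult:
  "smooth f \<Longrightarrow> smooth g \<Longrightarrow> dderiv (\<lambda>x. f x * g x) b x = f x * dderiv g b x + dderiv f b x * g x"
  by (rule dderiv_eqI[OF has_derivative_mult[OF smooth_has_derivative smooth_has_derivative]])

lemma dderiv_translate:
  assumes "smooth f" shows "dderiv (\<lambda>x. f (x + c)) b x = dderiv f b (x + c)"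
proof -
  have "((\<lambda>x. f (x + c)) has_derivative (\<lambda>h. dderiv f h (x + c))) (at x)" for x
    by (rule has_derivative_translate[OF smooth_has_derivative[OF assms]])
  thus ?thesis by (rule dderiv_eqI)
qed

lemma test_functions_iff:
  "\<phi> \<in> test_functions U \<longleftrightarrow> smooth \<phi> \<and> compact (closure {x. \<phi> x \<noteq> 0}) \<and> closure {x. \<phi> x \<noteq> 0} \<subseteq> U"
  by (auto simp: test_functions_def smooth_def)

lemma test_functionI:
  assumes "smooth \<phi>" "compact K" "K \<subseteq> U" "\<And>x. x \<notin> K \<Longrightarrow> \<phi> x = 0"
  shows "\<phi> \<in> test_functions U"
proof -
  have "closure {x. \<phi> x \<noteq> 0} \<subseteq> K"
    using assms by (intro closure_minimal) (auto intro: compact_imp_closed)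
  moreover from this have "compact (closure {x. \<phi> x \<noteq> 0})"
    using assms(2) by (metis closed_closure compact_Int_closed inf.absorb_iff2)
  ultimately show ?thesis using assms by (auto simp: test_functions_iff)
qed

lemma dderiv_zero_outside:
  assumes "closed K" "\<And>x. x \<notin> K \<Longrightarrow> \<phi> x = 0" "x \<notin> K"
  shows "dderiv \<phi> b x = 0"
proof -
  have "((\<lambda>x. 0::real) has_derivative (\<lambda>_. 0)) (at x)" by simp
  then have "(\<phi> has_derivative (\<lambda>_. 0)) (at x)"
    by (rule has_derivative_transform_within_open[of _ _ _ _ "- K"]) (use assms in auto)
  thus ?thesis by (rule dderiv_eqI)
qed

lemma test_function_support:
  assumes "\<phi> \<in> test_functions U"
  obtains K where "compact K" "K \<subseteq> U" "\<And>x. x \<notin> K \<Longrightarrow> \<phi> x = 0" "\<And>x b. x \<notin> K \<Longrightarrow> dderiv \<phi> b x = 0"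
proof -
  let ?K = "closure {x. \<phi> x \<noteq> 0}"
  have z: "\<phi> x = 0" if "x \<notin> ?K" for x
    using that closure_subset[of "{x. \<phi> x \<noteq> 0}"] by auto
  have "dderiv \<phi> b x = 0" if "x \<notin> ?K" for x b
  proof (rule dderiv_zero_outside[where K = ?K])
    show "\<phi> x = 0" if "x \<notin> ?K" for x by (rule z[OF that])
  qed (use that in simp_all)
  moreover have "compact ?K" "?K \<subseteq> U" using assms by (simp_all add: test_functions_iff)
  ultimately show thesis using z by (intro that[of ?K])
qed

lemma continuous_compact_support_bounded:
  fixes f :: "'a::euclidean_space \<Rightarrow> real"
  assumes "continuous_on UNIV f" "compact K" "\<And>x. x \<notin> K \<Longrightarrow> f x = 0"
  obtains B where "B \<ge> 0" "\<And>x. \<bar>f x\<bar> \<le> B"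
proof -
  have "bounded (f ` K)"
    using assms by (meson compact_continuous_image compact_imp_bounded continuous_on_subset subset_UNIV)
  then obtain B where "\<And>x. x \<in> K \<Longrightarrow> \<bar>f x\<bar> \<le> B" by (auto simp: bounded_iff)
  hence "\<bar>f x\<bar> \<le> max B 0" for x using assms(3)[of x] by (cases "x \<in> K") force+
  thus ?thesis by (intro that[of "max B 0"]) auto
qed

lemma test_function_bounded:
  assumes "\<phi> \<in> test_functions U" "b \<in> Basis"
  obtains B where "B \<ge> 0" "\<And>x. \<bar>\<phi> x\<bar> \<le> B" "\<And>x. \<bar>dderiv \<phi> b x\<bar> \<le> B"
proof -
  from assms have sm: "smooth \<phi>" by (simp add: test_functions_iff)
  obtain K where K: "compact K" "\<And>x. x \<notin> K \<Longrightarrow> \<phi> x = 0" "\<And>x b. x \<notin> K \<Longrightarrow> dderiv \<phi> b x = 0"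
    using test_function_support[OF assms(1)] by metis
  obtain B1 where B1: "B1 \<ge> 0" "\<And>x. \<bar>\<phi> x\<bar> \<le> B1"
    using continuous_compact_support_bounded[OF smooth_continuous[OF sm] K(1,2)] by metis
  obtain B2 where B2: "B2 \<ge> 0" "\<And>x. \<bar>dderiv \<phi> b x\<bar> \<le> B2"
    using continuous_compact_support_bounded[OF smooth_continuous[OF smooth_dderiv[OF sm assms(2)]] K(1,3)] by metis
  show ?thesis
  proof (rule that[of "B1 + B2"])
    fix x show "\<bar>\<phi> x\<bar> \<le> B1 + B2" "\<bar>dderiv \<phi> b x\<bar> \<le> B1 + B2"
      using B1(1) B2(1) B1(2)[of x] B2(2)[of x] by linarith+
  qed (use B1 B2 in simp)
qed

lemma test_functions_mono: "U \<subseteq> V \<Longrightarrow> test_functions U \<subseteq> test_functions V"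
  by (auto simp: test_functions_def)

lemma test_functions_mult:
  assumes "\<phi> \<in> test_functions U" "smooth \<psi>"
  shows "(\<lambda>x. \<psi> x * \<phi> x) \<in> test_functions U"
proof -
  obtain K where "compact K" "K \<subseteq> U" "\<And>x. x \<notin> K \<Longrightarrow> \<phi> x = 0"
    using test_function_support[OF assms(1)] by metis
  thus ?thesis using assms by (intro test_functionI[of _ K]) (auto simp: test_functions_iff intro: smooth_mult)
qed

subsection \<open>Cut-off functions\<close>

text \<open>A smooth step from 1 to 0 across [0,1]. The quotient is written with
  \<open>powr (- 1)\<close> so that \<open>smooth_powr\<close> applies.\<close>

definition transition :: "real \<Rightarrow> real" where
  "transition t = flat 0 (1 - t) * (flat 0 (1 - t) + flat 0 t) powr (- 1)"

lemma transition_denom_pos: "flat 0 (1 - t) + flat 0 t > 0"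
  by (cases "t > 0") (auto simp: flat_def add_nonneg_pos add_pos_nonneg)

lemma smooth_transition: "smooth transition"
proof -
  have 1: "smooth (\<lambda>t. flat 0 (1 - t))" by (rule smooth_reflect[OF smooth_flat])
  show ?thesis unfolding transition_def
    by (intro smooth_mult smooth_powr smooth_add 1 smooth_flat transition_denom_pos)
qed

lemma transition_simps: "t \<le> 0 \<Longrightarrow> transition t = 1" "t \<ge> 1 \<Longrightarrow> transition t = 0"
  "0 \<le> transition t" "transition t \<le> 1"
  using transition_denom_pos[of t] flat_nonneg[of 0 t] flat_nonneg[of 0 "1 - t"]
  by (auto simp: transition_def powr_minus field_simps) (auto simp: flat_def)

lemma transition_deriv:
  obtains L where "L > 0" "\<And>t. \<bar>dderiv transition 1 t\<bar> \<le> L"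
    "\<And>t. t > 1 \<Longrightarrow> dderiv transition 1 t = 0" "\<And>t h. dderiv transition h t = h * dderiv transition 1 t"
proof -
  have sm: "smooth (\<lambda>t. dderiv transition 1 t)" by (rule smooth_dderiv[OF smooth_transition]) auto
  have z1: "dderiv transition b t = 0" if "t > 1" for t b
    by (rule dderiv_zero_outside[of "{..1}"]) (use that in \<open>auto simp: transition_simps\<close>)
  have z2: "dderiv transition 1 t = 0" if "t < 0" for t
  proof -
    have "((\<lambda>x. 1::real) has_derivative (\<lambda>_. 0)) (at t)" by simp
    then have "(transition has_derivative (\<lambda>_. 0)) (at t)"
      by (rule has_derivative_transform_within_open[of _ _ _ _ "{..<0}"]) (use that in \<open>auto simp: transition_simps\<close>)
    thus ?thesis by (rule dderiv_eqI)
  qed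
  have z: "dderiv transition 1 t = 0" if "t \<notin> {0..1}" for t
    using that z1[of t 1] z2[of t] by auto
  obtain B where B: "B \<ge> 0" "\<And>t. \<bar>dderiv transition 1 t\<bar> \<le> B"
    using continuous_compact_support_bounded[OF smooth_continuous[OF sm] compact_Icc z] by blast
  have lin: "dderiv transition h t = h * dderiv transition 1 t" for h t
    using linear_cmul[OF has_derivative_linear[OF smooth_has_derivative[OF smooth_transition, of t]], of h 1] by simp
  show ?thesis
  proof (rule that[of "B + 1"])
    show "\<bar>dderiv transition 1 t\<bar> \<le> B + 1" for t using B(2)[of t] by linarith
    show "dderiv transition 1 t = 0" if "t > 1" for t using z1[OF that] .
    show "dderiv transition h t = h * dderiv transition 1 t" for h t by (rule lin)
  qed (use B in simp)
qed

definition cutoff :: "real \<Rightarrow> 'a::euclidean_space \<Rightarrow> real \<Rightarrow> real \<Rightarrow> ('a \<Rightarrow> real) \<Rightarrow> bool" where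
  "cutoff L x0 \<rho> r \<zeta> \<longleftrightarrow> smooth \<zeta> \<and> (\<forall>x. 0 \<le> \<zeta> x \<and> \<zeta> x \<le> 1) \<and>
       (\<forall>x\<in>cball x0 \<rho>. \<zeta> x = 1) \<and> (\<forall>x. x \<notin> ball x0 r \<longrightarrow> \<zeta> x = 0) \<and>
       (\<forall>x h. \<bar>dderiv \<zeta> h x\<bar> \<le> L / (r - \<rho>) * norm h) \<and>
       (\<forall>x y. \<bar>\<zeta> x - \<zeta> y\<bar> \<le> L / (r - \<rho>) * norm (x - y))"

text \<open>One \<open>L\<close> serves all centres and radii. The transition is evaluated at
  (|x-x0|^2 - \<rho>^2) / (r^2 - \<rho>^2), which is smooth even at the centre and whose gradient on
  the ball of radius r is at most 2r / ((r-\<rho>)(r+\<rho>)) \<le> 2/(r-\<rho>). The later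
  iterations need precisely this explicit dependence on the gap.\<close>

lemma cutoff_exists:
  obtains L :: real where "L > 0"
    "\<And>(x0::'a::euclidean_space) \<rho> r. 0 < \<rho> \<Longrightarrow> \<rho> < r \<Longrightarrow> \<exists>\<zeta>. cutoff L x0 \<rho> r \<zeta>"
proof -
  obtain L where L: "L > 0" "\<And>t. \<bar>dderiv transition 1 t\<bar> \<le> L"
    "\<And>t. t > 1 \<Longrightarrow> dderiv transition 1 t = 0" "\<And>t h. dderiv transition h t = h * dderiv transition 1 t"
    using transition_deriv by blast
  show ?thesis
  proof (rule that[of "2 * L"])
    fix x0 :: 'a and \<rho> r :: real assume r: "0 < \<rho>" "\<rho> < r"
    define d where "d = r\<^sup>2 - \<rho>\<^sup>2"
    have d: "d = (r - \<rho>) * (r + \<rho>)" "d > 0" using r by (auto simp: d_def power2_eq_square algebra_simps mult_strict_mono)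
    define q where "q = (\<lambda>x. inverse d * ((norm (x - x0))\<^sup>2 + - \<rho>\<^sup>2))"
    define \<zeta> where "\<zeta> = (\<lambda>x. transition (q x))"
    have smq: "smooth q" unfolding q_def by (intro smooth_cmult smooth_add smooth_norm_sq smooth_const)
    have sm: "smooth \<zeta>" unfolding \<zeta>_def by (rule smooth_comp[OF smooth_transition smq])
    have "((\<lambda>x. (norm (x - x0))\<^sup>2) has_derivative (\<lambda>h. 2 * ((x - x0) \<bullet> h))) (at x)" for x
      unfolding power2_norm_eq_inner by (auto intro!: derivative_eq_intros simp: inner_commute)
    from has_derivative_add_const[OF this]
    have "((\<lambda>x. (norm (x - x0))\<^sup>2 + - \<rho>\<^sup>2) has_derivative (\<lambda>h. 2 * ((x - x0) \<bullet> h))) (at x)" for x .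
    from has_derivative_mult_right[OF this]
    have dq: "(q has_derivative (\<lambda>h. inverse d * (2 * ((x - x0) \<bullet> h)))) (at x)" for x
      unfolding q_def .
    have dz: "(\<zeta> has_derivative (\<lambda>h. dderiv transition 1 (q x) * (inverse d * (2 * ((x - x0) \<bullet> h))))) (at x)" for x
      using has_derivative_compose[OF dq smooth_has_derivative[OF smooth_transition], of x]
      unfolding \<zeta>_def by (subst (asm) L(4)) (simp add: mult.commute)
    have bd: "\<bar>dderiv transition 1 (q x) * (inverse d * (2 * ((x - x0) \<bullet> h)))\<bar> \<le> 2 * L / (r - \<rho>) * norm h" for x h
    proof (cases "norm (x - x0) > r")
      case True
      hence "(norm (x - x0))\<^sup>2 > r\<^sup>2" using r by (intro power_strict_mono) auto
      hence "q x > 1" using d by (auto simp: q_def d_def field_simps)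
      thus ?thesis using L(1,3) r by simp
    next
      case False
      have "\<bar>dderiv transition 1 (q x) * (inverse d * (2 * ((x - x0) \<bullet> h)))\<bar>
        = \<bar>dderiv transition 1 (q x)\<bar> * (inverse d * (2 * \<bar>(x - x0) \<bullet> h\<bar>))"
        using d(2) by (simp add: abs_mult)
      also have "\<dots> \<le> L * (inverse d * (2 * (r * norm h)))"
        using L(1,2) d r False Cauchy_Schwarz_ineq2[of "x - x0" h]
        by (intro mult_mono mult_nonneg_nonneg) (auto intro: order_trans[OF _ mult_right_mono])
      also have "\<dots> = 2 * L * norm h / (r - \<rho>) * (r / (r + \<rho>))"
        using r by (simp add: d(1) field_simps)
      also have "\<dots> \<le> 2 * L * norm h / (r - \<rho>) * 1"
        using r L(1) by (intro mult_left_mono) auto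
      finally show ?thesis by simp
    qed
    have bd2: "\<bar>dderiv \<zeta> h x\<bar> \<le> 2 * L / (r - \<rho>) * norm h" for x h
      using bd by (subst dderiv_eqI[OF dz])
    have lip: "\<bar>\<zeta> x - \<zeta> y\<bar> \<le> 2 * L / (r - \<rho>) * norm (x - y)" for x y
    proof -
      have "norm (\<zeta> x - \<zeta> y) \<le> 2 * L / (r - \<rho>) * norm (x - y)"
        by (rule differentiable_bound[OF convex_UNIV])
          (use dz bd in \<open>auto intro!: onorm_bound simp: L(1) less_imp_le r\<close>)
      thus ?thesis by simp
    qed
    have one: "\<zeta> x = 1" if "x \<in> cball x0 \<rho>" for x
    proof -
      have "(norm (x - x0))\<^sup>2 \<le> \<rho>\<^sup>2"
        using that r by (intro power_mono) (auto simp: dist_norm norm_minus_commute)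
      hence "q x \<le> 0" using d(2) by (simp add: q_def mult_nonneg_nonpos)
      thus ?thesis by (simp add: \<zeta>_def transition_simps)
    qed
    have zero: "\<zeta> x = 0" if "x \<notin> ball x0 r" for x
    proof -
      have "(norm (x - x0))\<^sup>2 \<ge> r\<^sup>2"
        using that r by (intro power_mono) (auto simp: dist_norm norm_minus_commute)
      hence "q x \<ge> 1" using d(2) by (simp add: q_def d_def field_simps)
      thus ?thesis by (auto simp: \<zeta>_def transition_simps)
    qed
    show "\<exists>\<zeta>. cutoff (2 * L) x0 \<rho> r \<zeta>"
      by (rule exI[of _ \<zeta>]) (use sm one zero bd2 lip in \<open>auto simp: cutoff_def \<zeta>_def transition_simps\<close>)
  qed (use L(1) in auto)
qed

section \<open>Lebesgue integration\<close>

text \<open>Hoelder's inequality with upper bounds in place of norms. Normalising by A^(1/p) and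
  B^(1/p') reduces it to Young's inequality; vanishing bounds are treated apart because the
  normalisation divides by them.\<close>

lemma nn_integral_Holder:
  fixes f g :: "'b \<Rightarrow> real"
  assumes pq: "p > 1" "p' > 1" "1 / p + 1 / p' = 1"
    and [measurable]: "f \<in> borel_measurable M" "g \<in> borel_measurable M"
    and nonneg: "\<And>x. f x \<ge> 0" "\<And>x. g x \<ge> 0"
    and A: "(\<integral>\<^sup>+x. ennreal (f x powr p) \<partial>M) \<le> ennreal A" "A \<ge> 0"
    and B: "(\<integral>\<^sup>+x. ennreal (g x powr p') \<partial>M) \<le> ennreal B" "B \<ge> 0"
  shows "(\<integral>\<^sup>+x. ennreal (f x * g x) \<partial>M) \<le> ennreal (A powr (1 / p) * B powr (1 / p'))"
proof -
  consider "A = 0" | "B = 0" | "A > 0" "B > 0" using A B by linarith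
  then show ?thesis
  proof cases
    case 1
    hence "AE x in M. f x powr p = 0" using A by (simp add: nn_integral_0_iff_AE)
    hence "AE x in M. f x * g x = 0" by eventually_elim simp
    hence "(\<integral>\<^sup>+x. ennreal (f x * g x) \<partial>M) = 0"
      by (subst nn_integral_0_iff_AE) (auto elim: eventually_mono)
    thus ?thesis by simp
  next
    case 2
    hence "AE x in M. g x powr p' = 0" using B by (simp add: nn_integral_0_iff_AE)
    hence "AE x in M. f x * g x = 0" by eventually_elim simp
    hence "(\<integral>\<^sup>+x. ennreal (f x * g x) \<partial>M) = 0"
      by (subst nn_integral_0_iff_AE) (auto elim: eventually_mono)
    thus ?thesis by simp
  next
    case 3
    define a where "a = A powr (1 / p)"
    define b where "b = B powr (1 / p')"
    have ab: "a > 0" "b > 0" "a powr p = A" "b powr p' = B"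
      using 3 pq by (auto simp: a_def b_def powr_powr)
    have "f x * g x \<le> a * b / p / A * f x powr p + a * b / p' / B * g x powr p'" for x
    proof -
      have "f x / a * (g x / b) \<le> (f x / a) powr p / p + (g x / b) powr p' / p'"
        using pq nonneg ab by (intro Youngs_inequality) auto
      hence "f x / a * (g x / b) * (a * b) \<le> ((f x / a) powr p / p + (g x / b) powr p' / p') * (a * b)"
        using ab by (intro mult_right_mono) auto
      also have "(f x / a) powr p = f x powr p / A" using ab nonneg by (simp add: powr_divide)
      also have "(g x / b) powr p' = g x powr p' / B" using ab nonneg by (simp add: powr_divide)
      finally show ?thesis using ab by (simp add: field_simps)
    qed
    hence "(\<integral>\<^sup>+x. ennreal (f x * g x) \<partial>M) \<le>
       (\<integral>\<^sup>+x. ennreal (a * b / p / A) * ennreal (f x powr p) + ennreal (a * b / p' / B) * ennreal (g x powr p') \<partial>M)"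
      using ab pq 3
      by (intro nn_integral_mono) (simp add: ennreal_mult'[symmetric] ennreal_plus[symmetric] ennreal_leI del: ennreal_plus)
    also have "\<dots> = ennreal (a * b / p / A) * (\<integral>\<^sup>+x. ennreal (f x powr p) \<partial>M) + ennreal (a * b / p' / B) * (\<integral>\<^sup>+x. ennreal (g x powr p') \<partial>M)"
      by (simp add: nn_integral_add nn_integral_cmult)
    also have "\<dots> \<le> ennreal (a * b / p / A) * ennreal A + ennreal (a * b / p' / B) * ennreal B"
      using A B by (intro add_mono mult_left_mono) auto
    also have "\<dots> = ennreal (a * b * (1 / p + 1 / p'))"
      using ab pq 3 by (simp add: ennreal_mult'[symmetric] ennreal_plus[symmetric] field_simps del: ennreal_plus)
    finally show ?thesis using pq by (simp add: a_def b_def)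
  qed
qed

lemma conjugate_exponent:
  fixes p :: real assumes "p > 1"
  obtains p' where "p' > 1" "1 / p + 1 / p' = 1" "p' = p / (p - 1)"
proof (rule that[of "p / (p - 1)"])
  show "1 < p / (p - 1)" "1 / p + 1 / (p / (p - 1)) = 1" using assms by (auto simp: field_simps)
qed simp

lemma nn_integral_lborel_affine:
  fixes f :: "'a::euclidean_space \<Rightarrow> ennreal"
  assumes [measurable]: "f \<in> borel_measurable borel" and "c \<noteq> 0"
  shows "(\<integral>\<^sup>+x. f x \<partial>lborel) = ennreal (\<bar>c\<bar> ^ DIM('a)) * (\<integral>\<^sup>+x. f (t + c *\<^sub>R x) \<partial>lborel)"
  by (subst lborel_affine[OF assms(2), of t])
    (simp add: nn_integral_density nn_integral_distr nn_integral_cmult)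

lemma nn_integral_lborel_shift:
  fixes f :: "'a::euclidean_space \<Rightarrow> ennreal"
  assumes "f \<in> borel_measurable borel"
  shows "(\<integral>\<^sup>+x. f (x + t) \<partial>lborel) = (\<integral>\<^sup>+x. f x \<partial>lborel)"
  using nn_integral_lborel_affine[OF assms, of 1 t] by (simp add: add.commute)

lemma nn_integral_lborel_reflect:
  fixes f :: "'a::euclidean_space \<Rightarrow> ennreal"
  assumes "f \<in> borel_measurable borel"
  shows "(\<integral>\<^sup>+x. f (t - x) \<partial>lborel) = (\<integral>\<^sup>+x. f x \<partial>lborel)"
  using nn_integral_lborel_affine[OF assms, of "- 1" t] by simp

lemma lborel_shift:
  fixes t :: "'a::euclidean_space"
  shows "distr lborel borel (\<lambda>x. x + t) = lborel"
proof -
  have "(\<lambda>x. x + t) = (+) t" by (auto simp: add.commute)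
  thus ?thesis using lborel_distr_plus[of t] by simp
qed

lemma integrable_indicator_cball: "integrable lborel (indicator (cball (c::'a::euclidean_space) r) :: 'a \<Rightarrow> real)"
  using emeasure_lborel_cball_finite[of c r] by (intro integrable_real_indicator) auto

lemma integrable_lborel_shift:
  fixes f :: "'a::euclidean_space \<Rightarrow> 'b::{banach, second_countable_topology}"
  assumes "integrable lborel f"
  shows "integrable lborel (\<lambda>x. f (x + t))"
  using assms integrable_distr_eq[of "\<lambda>x. x + t" lborel borel f]
  by (auto simp: lborel_shift borel_measurable_integrable)

lemma integral_lborel_shift:
  fixes f :: "'a::euclidean_space \<Rightarrow> 'b::{banach, second_countable_topology}"
  assumes "f \<in> borel_measurable borel"
  shows "(LBINT x. f (x + t)) = (LBINT x. f x)"
  using integral_distr[of "\<lambda>x. x + t" lborel borel f] assms by (simp add: lborel_shift)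

subsection \<open>Integrals of powers of the norm\<close>

text \<open>A layer count in place of polar coordinates: the integrand is dominated by the sum of
  the functions equal to \<open>b i\<close> on the ball of radius \<open>r i\<close>, and the masses
  of these form a geometric series.\<close>

lemma nn_integral_dyadic_balls:
  fixes h :: "'a::euclidean_space \<Rightarrow> real"
  assumes h: "\<And>x. h x \<le> 0 \<or> (\<exists>i::nat. norm x < r i \<and> h x \<le> b i)"
    and nonneg: "\<And>i. b i \<ge> 0" "\<And>i. r i \<ge> 0"
    and D: "\<And>i. b i * r i ^ DIM('a) \<le> D * \<theta> ^ i" "0 \<le> \<theta>" "\<theta> < 1"
  shows "(\<integral>\<^sub>+x. h x) \<le> ennreal (unit_ball_vol DIM('a) * D / (1 - \<theta>))"
proof -
  have "(\<integral>\<^sub>+x. h x) \<le> (\<integral>\<^sup>+x. (\<Sum>i. ennreal (b i) * indicator (ball (0::'a) (r i)) x) \<partial>lborel)"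
  proof (rule nn_integral_mono)
    fix x :: 'a
    show "ennreal (h x) \<le> (\<Sum>i. ennreal (b i) * indicator (ball 0 (r i)) x)"
    proof (cases "h x \<le> 0")
      case False
      then obtain i where i: "norm x < r i" "h x \<le> b i" using h by blast
      hence "ennreal (h x) \<le> ennreal (b i) * indicator (ball 0 (r i)) x" by (simp add: ennreal_leI)
      also have "\<dots> \<le> (\<Sum>i. ennreal (b i) * indicator (ball 0 (r i)) x)"
        using sum_le_suminf[of "\<lambda>i. ennreal (b i) * indicator (ball 0 (r i)) x" "{i}"]
        by (simp del: sum_mult_indicator)
      finally show ?thesis .
    qed (simp add: ennreal_neg)
  qed
  also have "\<dots> = (\<Sum>i. ennreal (b i) * emeasure lborel (ball (0::'a) (r i)))"
    by (subst nn_integral_suminf)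
      (auto simp: nn_integral_cmult_indicator intro!: borel_measurable_times_ennreal borel_measurable_indicator)
  also have "\<dots> = (\<Sum>i. ennreal (unit_ball_vol DIM('a) * (b i * r i ^ DIM('a))))"
    using nonneg by (intro suminf_cong) (auto simp: emeasure_ball ennreal_mult'[symmetric] mult_ac)
  also have "\<dots> \<le> (\<Sum>i. ennreal (unit_ball_vol DIM('a) * (D * \<theta> ^ i)))"
    using D by (intro suminf_le ennreal_leI mult_left_mono) auto
  also have "\<dots> = ennreal (\<Sum>i. unit_ball_vol DIM('a) * (D * \<theta> ^ i))"
  proof (rule suminf_ennreal2)
    show "0 \<le> unit_ball_vol DIM('a) * (D * \<theta> ^ i)" for i
    proof -
      have "0 \<le> b i * r i ^ DIM('a)" by (intro mult_nonneg_nonneg zero_le_power nonneg)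
      also have "\<dots> \<le> D * \<theta> ^ i" by (rule D(1))
      finally show ?thesis by simp
    qed
    show "summable (\<lambda>i. unit_ball_vol DIM('a) * (D * \<theta> ^ i))"
      using D by (intro summable_mult summable_geometric) auto
  qed
  also have "(\<Sum>i. unit_ball_vol DIM('a) * (D * \<theta> ^ i)) = unit_ball_vol DIM('a) * D / (1 - \<theta>)"
    using D suminf_geometric[of \<theta>] by (simp add: suminf_mult summable_geometric)
  finally show ?thesis .
qed

lemma norm_powr_near:
  fixes \<alpha> :: real
  assumes "\<alpha> < DIM('a::euclidean_space)"
  obtains C where "C > 0" "\<And>\<delta>. \<delta> > 0 \<Longrightarrow>
    (\<integral>\<^sub>+x. indicator (ball (0::'a) \<delta>) x * norm x powr (- \<alpha>)) \<le> ennreal (C * \<delta> powr (DIM('a) - \<alpha>))"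
proof -
  define \<theta> where "\<theta> = (2::real) powr (- (DIM('a) - \<alpha>))"
  have th: "0 \<le> \<theta>" "\<theta> < 1" using assms by (auto simp: \<theta>_def powr_less_one)
  define C where "C = unit_ball_vol DIM('a) * 2 powr \<bar>\<alpha>\<bar> / (1 - \<theta>)"
  show ?thesis
  proof (rule that[of C])
    show "C > 0" using th by (simp add: C_def)
    fix \<delta> :: real assume \<delta>: "\<delta> > 0"
    define r where "r = (\<lambda>i::nat. \<delta> / 2 ^ i)"
    \<comment> \<open>In the layer between r_i / 2 and r_i the power of the norm differs from that
      of r_i by a factor of at most 2 powr \<bar>\<alpha>\<bar>, whatever the sign of \<alpha>;
      later uses include \<alpha> \<le> 0.\<close>
    define b where "b = (\<lambda>i. 2 powr \<bar>\<alpha>\<bar> * r i powr (- \<alpha>))"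
    have r: "r i > 0" for i using \<delta> by (simp add: r_def)
    have "(\<integral>\<^sub>+x. indicator (ball (0::'a) \<delta>) x * norm x powr (- \<alpha>))
      \<le> ennreal (unit_ball_vol DIM('a) * (2 powr \<bar>\<alpha>\<bar> * \<delta> powr (DIM('a) - \<alpha>)) / (1 - \<theta>))"
    proof (rule nn_integral_dyadic_balls[where r=r and b=b])
      fix x :: 'a
      show "indicator (ball 0 \<delta>) x * norm x powr - \<alpha> \<le> 0 \<or> (\<exists>i. norm x < r i \<and> indicator (ball 0 \<delta>) x * norm x powr - \<alpha> \<le> b i)"
      proof (cases "x \<noteq> 0 \<and> norm x < \<delta>")
        case True
        have "(\<lambda>i. r i) \<longlonglongrightarrow> 0"
          unfolding r_def by (rule LIMSEQ_divide_realpow_zero) simp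
        hence "eventually (\<lambda>i. r i < norm x) sequentially" using True by (intro order_tendstoD) auto
        then obtain n where "r n < norm x" by (meson eventually_sequentially order_refl)
        hence ex: "r n \<le> norm x" by simp
        define k where "k = (LEAST n. r n \<le> norm x)"
        have k: "r k \<le> norm x" unfolding k_def by (rule LeastI[of "\<lambda>n. r n \<le> norm x", OF ex])
        have "k \<noteq> 0" using k True by (auto simp: r_def intro: ccontr)
        then obtain i where i: "k = Suc i" by (cases k) auto
        have ri: "norm x < r i" using not_less_Least[of i "\<lambda>n. r n \<le> norm x"] i by (force simp: k_def)
        have rk: "r i / 2 \<le> norm x" using k by (simp add: i r_def)
        have "norm x powr (- \<alpha>) \<le> b i"
        proof (cases "\<alpha> \<ge> 0")
          case True
          have "norm x powr (- \<alpha>) \<le> (r i / 2) powr (- \<alpha>)"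
            using True rk r[of i] by (intro powr_mono2') auto
          also have "\<dots> = b i" using True r[of i] by (simp add: b_def powr_divide powr_minus field_simps)
          finally show ?thesis .
        next
          case False
          have "norm x powr (- \<alpha>) \<le> 1 * (r i) powr (- \<alpha>)"
            using False ri by (simp add: powr_mono2)
          also have "\<dots> \<le> b i" unfolding b_def by (intro mult_right_mono) (auto simp: ge_one_powr_ge_zero)
          finally show ?thesis .
        qed
        thus ?thesis using True ri by (intro disjI2 exI[of _ i]) auto
      qed (auto simp: indicator_def)
      show "b i * r i ^ DIM('a) \<le> 2 powr \<bar>\<alpha>\<bar> * \<delta> powr (real DIM('a) - \<alpha>) * \<theta> ^ i" for i
      proof -
        have "b i * r i ^ DIM('a) = 2 powr \<bar>\<alpha>\<bar> * r i powr (real DIM('a) - \<alpha>)"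
          using r[of i] by (simp add: b_def powr_realpow[symmetric] powr_add[symmetric])
        also have "r i powr (real DIM('a) - \<alpha>) = \<delta> powr (real DIM('a) - \<alpha>) * \<theta> ^ i"
        proof -
          have "r i = \<delta> * 2 powr (- real i)" by (simp add: r_def powr_minus powr_realpow divide_inverse)
          thus ?thesis using \<delta> by (simp add: \<theta>_def powr_mult powr_powr powr_power algebra_simps)
        qed
        finally show ?thesis by simp
      qed
    qed (use r th in \<open>auto simp: b_def less_imp_le\<close>)
    thus "(\<integral>\<^sub>+x. indicator (ball (0::'a) \<delta>) x * norm x powr (- \<alpha>)) \<le> ennreal (C * \<delta> powr (DIM('a) - \<alpha>))"
      by (simp add: C_def mult_ac)
  qed
qed

lemma norm_powr_far:
  fixes \<alpha> :: real
  assumes "\<alpha> > DIM('a::euclidean_space)"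
  obtains C where "C > 0" "\<And>\<delta>. \<delta> > 0 \<Longrightarrow>
    (\<integral>\<^sub>+x. indicator (- ball (0::'a) \<delta>) x * norm x powr (- \<alpha>)) \<le> ennreal (C * \<delta> powr (DIM('a) - \<alpha>))"
proof -
  define \<theta> where "\<theta> = (2::real) powr (DIM('a) - \<alpha>)"
  have th: "0 \<le> \<theta>" "\<theta> < 1" using assms by (auto simp: \<theta>_def powr_less_one)
  define C where "C = unit_ball_vol DIM('a) * 2 ^ DIM('a) / (1 - \<theta>)"
  show ?thesis
  proof (rule that[of C])
    show "C > 0" using th by (simp add: C_def)
    fix \<delta> :: real assume \<delta>: "\<delta> > 0"
    define r where "r = (\<lambda>i::nat. \<delta> * 2 ^ i)"
    define b where "b = (\<lambda>i. r i powr (- \<alpha>))"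
    have r: "r i > 0" for i using \<delta> by (simp add: r_def)
    have "(\<integral>\<^sub>+x. indicator (- ball (0::'a) \<delta>) x * norm x powr (- \<alpha>))
      \<le> ennreal (unit_ball_vol DIM('a) * (2 ^ DIM('a) * \<delta> powr (DIM('a) - \<alpha>)) / (1 - \<theta>))"
    proof (rule nn_integral_dyadic_balls[where r="\<lambda>i. 2 * r i" and b=b])
      fix x :: 'a
      show "indicator (- ball 0 \<delta>) x * norm x powr - \<alpha> \<le> 0 \<or> (\<exists>i. norm x < 2 * r i \<and> indicator (- ball 0 \<delta>) x * norm x powr - \<alpha> \<le> b i)"
      proof (cases "norm x \<ge> \<delta>")
        case True
        obtain n where "norm x / \<delta> < 2 ^ n" using real_arch_pow[of 2 "norm x / \<delta>"] by auto
        hence ex: "norm x < r n" using \<delta> by (simp add: r_def field_simps)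
        define k where "k = (LEAST n. norm x < r n)"
        have k: "norm x < r k" unfolding k_def by (rule LeastI[of "\<lambda>n. norm x < r n", OF ex])
        have "k \<noteq> 0" using k True by (auto simp: r_def intro: ccontr)
        then obtain i where i: "k = Suc i" by (cases k) auto
        have ri: "r i \<le> norm x" using not_less_Least[of i "\<lambda>n. norm x < r n"] i by (force simp: k_def)
        have rk: "norm x < 2 * r i" using k by (simp add: i r_def)
        have "norm x powr (- \<alpha>) \<le> b i"
          unfolding b_def using ri r[of i] assms by (intro powr_mono2') auto
        thus ?thesis using True rk by (intro disjI2 exI[of _ i]) auto
      qed (auto simp: indicator_def)
      show "b i * (2 * r i) ^ DIM('a) \<le> 2 ^ DIM('a) * \<delta> powr (real DIM('a) - \<alpha>) * \<theta> ^ i" for i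
      proof -
        have "b i * (2 * r i) ^ DIM('a) = 2 ^ DIM('a) * r i powr (real DIM('a) - \<alpha>)"
          using r[of i] by (simp add: b_def power_mult_distrib powr_realpow[symmetric] powr_add[symmetric])
        also have "r i powr (real DIM('a) - \<alpha>) = \<delta> powr (real DIM('a) - \<alpha>) * \<theta> ^ i"
        proof -
          have "r i = \<delta> * 2 powr (real i)" by (simp add: r_def powr_realpow)
          thus ?thesis using \<delta> by (simp add: \<theta>_def powr_mult powr_powr powr_power algebra_simps)
        qed
        finally show ?thesis by simp
      qed
    qed (use r th in \<open>auto simp: b_def less_imp_le\<close>)
    thus "(\<integral>\<^sub>+x. indicator (- ball (0::'a) \<delta>) x * norm x powr (- \<alpha>)) \<le> ennreal (C * \<delta> powr (DIM('a) - \<alpha>))"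
      by (simp add: C_def mult_ac)
  qed
qed

subsection \<open>The fundamental lemma of the calculus of variations\<close>

text \<open>Lebesgue differentiation along the cubes with lower corner x: the averages all vanish
  and converge to \<open>f x\<close> for almost every x.\<close>

lemma AE_zero_of_cbox_integrals:
  fixes f :: "'a::euclidean_space \<Rightarrow> real"
  assumes f: "integrable lborel f"
    and z: "\<And>a b. (LBINT x. indicator (cbox a b) x * f x) = 0"
  shows "AE x in lborel. f x = 0"
proof -
  have ib: "(f has_integral 0) (cbox a b)" for a b
  proof -
    have "integrable lborel (\<lambda>x. indicator (cbox a b) x *\<^sub>R f x)"
      by (rule integrable_mult_indicator[OF _ f]) simp
    from has_integral_integral_lborel[OF this]
    have "((\<lambda>x. indicator (cbox a b) x * f x) has_integral 0) UNIV" using z[of a b] by simp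
    hence "((\<lambda>x. if x \<in> cbox a b then f x else 0) has_integral 0) UNIV"
      by (rule has_integral_eq[rotated]) (auto simp: indicator_def)
    thus ?thesis by (simp add: has_integral_restrict_UNIV)
  qed
  hence "f integrable_on cbox a b" for a b by blast
  then obtain N where N: "negligible N" "\<And>x e. \<lbrakk>x \<notin> N; 0 < e\<rbrakk> \<Longrightarrow>
               \<exists>d>0. \<forall>h. 0 < h \<and> h < d \<longrightarrow>
                         norm(integral (cbox x (x + h *\<^sub>R One)) f /\<^sub>R h ^ DIM('a) - f x) < e"
    using integrable_ccontinuous_explicit[of f] by metis
  have "f x = 0" if xN: "x \<notin> N" for x
  proof (rule ccontr)
    assume "f x \<noteq> 0"
    then obtain d where d: "d > 0" "\<And>h. 0 < h \<Longrightarrow> h < d \<Longrightarrow>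
       norm(integral (cbox x (x + h *\<^sub>R One)) f /\<^sub>R h ^ DIM('a) - f x) < \<bar>f x\<bar>"
      using N(2)[OF xN, of "\<bar>f x\<bar>"] by auto
    from d(2)[of "d / 2"] d(1) show False
      using integral_unique[OF ib] by simp
  qed
  moreover have "AE x in lborel. x \<notin> N"
    using N(1) unfolding negligible_iff_null_sets by (metis AE_completion_iff AE_not_in)
  ultimately show ?thesis by (auto elim: eventually_mono)
qed

text \<open>A product of flat functions of the coordinates is smooth and positive exactly on the
  open box, so 1 - exp(-n \<beta>) increases to its indicator.\<close>

lemma box_indicator_approx:
  fixes l u :: "'a::euclidean_space"
  obtains \<phi> :: "nat \<Rightarrow> 'a \<Rightarrow> real" where "\<And>n. smooth (\<phi> n)" "\<And>n x. 0 \<le> \<phi> n x \<and> \<phi> n x \<le> 1"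
    "\<And>n x. x \<notin> box l u \<Longrightarrow> \<phi> n x = 0" "\<And>x. (\<lambda>n. \<phi> n x) \<longlonglongrightarrow> indicator (box l u) x"
proof -
  define \<beta> where "\<beta> = (\<lambda>x::'a. \<Prod>b\<in>Basis. flat 0 (x \<bullet> b + - (l \<bullet> b)) * flat 0 (u \<bullet> b + - 1 * (x \<bullet> b)))"
  have fs: "smooth (\<lambda>x. flat 0 (h x))" if "smooth h" for h :: "'a \<Rightarrow> real"
    by (rule smooth_comp[OF smooth_flat that])
  have sm\<beta>: "smooth \<beta>"
    unfolding \<beta>_def by (intro smooth_prod smooth_mult fs smooth_add smooth_const smooth_inner finite_Basis)
  have b0: "\<beta> x \<ge> 0" for x by (auto simp: \<beta>_def flat_nonneg intro!: prod_nonneg)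
  have flat0: "flat 0 t > 0 \<longleftrightarrow> t > 0" "flat 0 t = 0 \<longleftrightarrow> t \<le> 0" for t by (auto simp: flat_def)
  have bin: "\<beta> x > 0" if "x \<in> box l u" for x
    using that unfolding \<beta>_def by (intro prod_pos mult_pos_pos) (auto simp: box_def flat0)
  have bout: "\<beta> x = 0" if "x \<notin> box l u" for x
    using that by (force simp: \<beta>_def box_def flat0 not_less)
  have s1: "smooth (\<lambda>x. exp (- real n * \<beta> x))" for n
    by (rule smooth_comp[OF smooth_exp smooth_cmult[OF sm\<beta>]])
  show ?thesis
  proof (rule that[of "\<lambda>n x. 1 - exp (- real n * \<beta> x)"])
    show "smooth (\<lambda>x. 1 - exp (- real n * \<beta> x))" for n by (rule smooth_diff[OF smooth_const s1])
    show "(\<lambda>n. 1 - exp (- real n * \<beta> x)) \<longlonglongrightarrow> indicator (box l u) x" for x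
    proof (cases "x \<in> box l u")
      case True
      have "(\<lambda>n. exp (- \<beta> x) ^ n) \<longlonglongrightarrow> 0" using bin[OF True] by (intro LIMSEQ_power_zero) simp
      from tendsto_diff[OF tendsto_const this]
      have "(\<lambda>n. 1 - exp (- \<beta> x) ^ n) \<longlonglongrightarrow> 1 - 0" .
      thus ?thesis using True by (simp add: exp_of_nat_mult[symmetric] mult.commute)
    qed (simp add: bout)
  qed (use b0 bout in auto)
qed

text \<open>Dominated convergence along \<open>box_indicator_approx\<close> makes the integrals over
  boxes inside U vanish. A box met with a fixed closed box in U is again such a box, so Lebesgue
  differentiation applies there, and countably many closed boxes exhaust U.\<close>

lemma fundamental_lemma:
  fixes g :: "'a::euclidean_space \<Rightarrow> real"
  assumes U: "open U"
    and int: "\<And>K. compact K \<Longrightarrow> K \<subseteq> U \<Longrightarrow> integrable lborel (\<lambda>x. indicator K x * g x)"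
    and z: "\<And>\<phi>. \<phi> \<in> test_functions U \<Longrightarrow> (LBINT x. g x * \<phi> x) = 0"
  shows "AE x\<in>U in lborel. g x = 0"
proof -
  have box0: "(LBINT x. indicator (box l u) x * g x) = 0" if sub: "cbox l u \<subseteq> U" for l u
  proof -
    obtain \<phi> :: "nat \<Rightarrow> 'a \<Rightarrow> real" where \<phi>: "\<And>n. smooth (\<phi> n)" "\<And>n x. 0 \<le> \<phi> n x \<and> \<phi> n x \<le> 1"
      "\<And>n x. x \<notin> box l u \<Longrightarrow> \<phi> n x = 0" "\<And>x. (\<lambda>n. \<phi> n x) \<longlonglongrightarrow> indicator (box l u) x"
      using box_indicator_approx[of l u] by blast
    have sm[measurable]: "\<phi> n \<in> borel_measurable borel" for n by (rule smooth_measurable[OF \<phi>(1)])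
    define h where "h = (\<lambda>x. indicator (cbox l u) x * g x)"
    have h: "integrable lborel h" unfolding h_def by (rule int[OF compact_cbox sub])
    have [measurable]: "h \<in> borel_measurable borel" using h by (simp add: borel_measurable_integrable)
    have "(LBINT x. g x * \<phi> n x) = 0" for n
      using \<phi>(1)[of n] \<phi>(3)[of _ n] box_subset_cbox[of l u] sub
      by (intro z test_functionI[where K="cbox l u"]) auto
    moreover have "g x * \<phi> n x = h x * \<phi> n x" for n x
      using \<phi>(3)[of x n] box_subset_cbox[of l u] by (auto simp: h_def indicator_def)
    ultimately have "(LBINT x. h x * \<phi> n x) = 0" for n by simp
    moreover have "(\<lambda>n. \<integral>x. h x * \<phi> n x \<partial>lborel) \<longlonglongrightarrow> (LBINT x. h x * indicator (box l u) x)"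
    proof (rule integral_dominated_convergence[where w="\<lambda>x. \<bar>h x\<bar>"])
      show "AE x in lborel. norm (h x * \<phi> n x) \<le> \<bar>h x\<bar>" for n
        using \<phi>(2)[of n] by (intro AE_I2) (simp add: abs_mult mult_left_le)
      show "AE x in lborel. (\<lambda>n. h x * \<phi> n x) \<longlonglongrightarrow> h x * indicator (box l u) x"
        by (intro AE_I2 tendsto_intros \<phi>)
    qed (use h in auto)
    ultimately have "(LBINT x. h x * indicator (box l u) x) = 0"
      by (simp add: LIMSEQ_const_iff)
    moreover have "h x * indicator (box l u) x = indicator (box l u) x * g x" for x
      using box_subset_cbox[of l u] by (auto simp: h_def indicator_def)
    ultimately show ?thesis by simp
  qed
  have cb: "AE x in lborel. x \<in> cbox c d \<longrightarrow> g x = 0" if sub: "cbox c d \<subseteq> U" for c d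
  proof -
    have "AE x in lborel. indicator (cbox c d) x * g x = 0"
    proof (rule AE_zero_of_cbox_integrals)
      show "integrable lborel (\<lambda>x. indicator (cbox c d) x * g x)" by (rule int[OF compact_cbox sub])
      fix a b :: 'a
      obtain l u where lu: "cbox a b \<inter> cbox c d = cbox l u"
        using Int_interval by blast
      have "(LBINT x. indicator (cbox a b) x * (indicator (cbox c d) x * g x))
        = (LBINT x. indicator (cbox l u) x * g x)"
        unfolding lu[symmetric] by (simp add: indicator_inter_arith mult.assoc)
      also have "\<dots> = (LBINT x. indicator (box l u) x * g x)"
      proof (rule integral_cong_AE)
        have i: "integrable lborel (\<lambda>x. indicator (cbox l u) x * g x)"
          using lu sub by (intro int) auto
        thus "(\<lambda>x. indicator (cbox l u) x * g x) \<in> borel_measurable lborel" by simp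
        have "(\<lambda>x. indicator (box l u) x * g x) = (\<lambda>x. indicator (box l u) x * (indicator (cbox l u) x * g x))"
          using box_subset_cbox[of l u] by (intro ext) (auto simp: indicator_def dest: subsetD)
        also have "\<dots> \<in> borel_measurable lborel" using i by measurable
        finally show "(\<lambda>x. indicator (box l u) x * g x) \<in> borel_measurable lborel" .
        show "AE x in lborel. indicator (cbox l u) x * g x = indicator (box l u) x * g x"
          using AE_not_in[OF null_sets_cbox_Diff_box[of l u]]
          by (rule eventually_mono) (auto simp: indicator_def dest: subsetD[OF box_subset_cbox])
      qed
      also have "\<dots> = 0" using lu sub by (intro box0) auto
      finally show "(LBINT x. indicator (cbox a b) x * (indicator (cbox c d) x * g x)) = 0" .
    qed
    thus ?thesis by (rule eventually_mono) (auto simp: indicator_def)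
  qed
  obtain D where D: "countable D" "\<And>X. X \<in> D \<Longrightarrow> X \<subseteq> U \<and> (\<exists>a b. X = cbox a b)" "\<Union>D = U"
    using open_countable_Union_open_cbox[OF U] by (metis Pow_iff subsetD)
  have "AE x in lborel. \<forall>X\<in>D. x \<in> X \<longrightarrow> g x = 0"
    using D(2) cb by (subst AE_ball_countable[OF D(1)]) blast
  thus ?thesis by (rule eventually_mono) (use D(3) in blast)
qed

subsection \<open>Continuity of translations in \<open>L\<^sup>1\<close>\<close>

text \<open>The values are truncated by \<open>T\<close> and the support by \<open>\<kappa>\<close>,
  after which g is replaced by continuous functions converging to it almost everywhere. The two
  truncations provide the dominating function for this last replacement, which pointwise convergence
  alone would not.\<close>

lemma L1_approx_continuous:
  fixes g :: "'a::euclidean_space \<Rightarrow> real"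
  assumes g: "integrable lborel g" and e: "e > 0"
  obtains c K where "continuous_on UNIV c" "compact K" "\<And>x. x \<notin> K \<Longrightarrow> c x = 0"
    "integrable lborel c" "(LBINT x. \<bar>g x - c x\<bar>) < e"
proof -
  have gm[measurable]: "g \<in> borel_measurable borel" using g by (simp add: borel_measurable_integrable)
  have "g \<in> borel_measurable lebesgue" by (rule measurable_completion) simp
  hence "g measurable_on UNIV" by (intro lebesgue_measurable_imp_measurable_on) auto
  then obtain N h where N: "negligible N" "\<And>n. continuous_on UNIV (h n)" "\<And>x. x \<notin> N \<Longrightarrow> (\<lambda>n. h n x) \<longlonglongrightarrow> g x"
    unfolding measurable_on_def by auto
  have hm[measurable]: "h n \<in> borel_measurable borel" for n
    using N(2) by (rule borel_measurable_continuous_onI)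
  have AEN: "AE x in lborel. x \<notin> N"
    using N(1) unfolding negligible_iff_null_sets by (metis AE_completion_iff AE_not_in)
  define T where "T = (\<lambda>(n::nat) t::real. max (- real n) (min (real n) t))"
  define \<kappa> where "\<kappa> = (\<lambda>(n::nat) x::'a. max 0 (min 1 (real n + 1 - norm x)))"
  have [measurable]: "\<kappa> n \<in> borel_measurable borel" "T n \<in> borel_measurable borel" for n
    unfolding \<kappa>_def T_def by measurable
  have k: "0 \<le> \<kappa> n x" "\<kappa> n x \<le> 1" for n x by (auto simp: \<kappa>_def)
  have kout: "\<kappa> n x = 0" if "x \<notin> cball 0 (real n + 1)" for n x using that by (auto simp: \<kappa>_def)
  have ki: "integrable lborel (\<lambda>x. 2 * real n * \<kappa> n x)" for n
  proof (rule Bochner_Integration.integrable_bound)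
    show "integrable lborel (\<lambda>x. 2 * real n * indicator (cball (0::'a) (real n + 1)) x)"
      by (intro integrable_mult_right integrable_indicator_cball)
    show "AE x in lborel. norm (2 * real n * \<kappa> n x) \<le> norm (2 * real n * indicator (cball (0::'a) (real n + 1)) x)"
      using k kout by (intro AE_I2) (auto simp: indicator_def abs_mult mult_left_le)
  qed simp
  have T: "\<bar>T n t\<bar> \<le> \<bar>t\<bar>" "\<bar>T n t\<bar> \<le> n" for n t by (auto simp: T_def)
  have "(\<lambda>n. \<integral>x. \<bar>g x - T n (g x) * \<kappa> n x\<bar> \<partial>lborel) \<longlonglongrightarrow> (\<integral>x. (0::real) \<partial>(lborel :: 'a measure))"
  proof (rule integral_dominated_convergence[where w="\<lambda>x. 2 * \<bar>g x\<bar>"])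
    show "AE x in lborel. (\<lambda>n. \<bar>g x - T n (g x) * \<kappa> n x\<bar>) \<longlonglongrightarrow> 0"
    proof (intro AE_I2 tendsto_eventually)
      fix x
      obtain m :: nat where m: "max \<bar>g x\<bar> (norm x) \<le> m" using real_arch_simple by blast
      show "\<forall>\<^sub>F n in sequentially. \<bar>g x - T n (g x) * \<kappa> n x\<bar> = 0"
        by (rule eventually_sequentiallyI[of m]) (use m in \<open>auto simp: T_def \<kappa>_def\<close>)
    qed
    show "AE x in lborel. norm \<bar>g x - T n (g x) * \<kappa> n x\<bar> \<le> 2 * \<bar>g x\<bar>" for n
    proof (rule AE_I2)
      fix x
      have "\<bar>T n (g x) * \<kappa> n x\<bar> \<le> \<bar>g x\<bar> * 1"
        unfolding abs_mult using T k by (intro mult_mono) auto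
      thus "norm \<bar>g x - T n (g x) * \<kappa> n x\<bar> \<le> 2 * \<bar>g x\<bar>" by simp
    qed
  qed (use g in auto)
  hence "eventually (\<lambda>n. (LBINT x. \<bar>g x - T n (g x) * \<kappa> n x\<bar>) < e / 2) sequentially"
    using e by (intro order_tendstoD) auto
  then obtain M where M: "(LBINT x. \<bar>g x - T M (g x) * \<kappa> M x\<bar>) < e / 2"
    by (meson eventually_sequentially order_refl)
  have conv: "(\<lambda>n. \<integral>x. \<bar>T M (g x) * \<kappa> M x - T M (h n x) * \<kappa> M x\<bar> \<partial>lborel) \<longlonglongrightarrow> (\<integral>x. (0::real) \<partial>(lborel :: 'a measure))"
  proof (rule integral_dominated_convergence[where w="\<lambda>x. 2 * real M * \<kappa> M x"])
    show "AE x in lborel. (\<lambda>n. \<bar>T M (g x) * \<kappa> M x - T M (h n x) * \<kappa> M x\<bar>) \<longlonglongrightarrow> 0"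
      using AEN
    proof eventually_elim
      case (elim x)
      have "(\<lambda>n. \<bar>T M (g x) * \<kappa> M x - T M (h n x) * \<kappa> M x\<bar>) \<longlonglongrightarrow> \<bar>T M (g x) * \<kappa> M x - T M (g x) * \<kappa> M x\<bar>"
        unfolding T_def by (intro tendsto_intros N(3)[OF elim])
      thus ?case by simp
    qed
    show "AE x in lborel. norm \<bar>T M (g x) * \<kappa> M x - T M (h n x) * \<kappa> M x\<bar> \<le> 2 * real M * \<kappa> M x" for n
    proof (rule AE_I2)
      fix x
      have "\<bar>T M (g x) - T M (h n x)\<bar> * \<kappa> M x \<le> (2 * M) * \<kappa> M x"
        using T(2)[of M "g x"] T(2)[of M "h n x"] k by (intro mult_right_mono) auto
      thus "norm \<bar>T M (g x) * \<kappa> M x - T M (h n x) * \<kappa> M x\<bar> \<le> 2 * real M * \<kappa> M x"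
        using k by (simp add: left_diff_distrib[symmetric] abs_mult)
    qed
  qed (use ki in auto)
  hence "eventually (\<lambda>n. (LBINT x. \<bar>T M (g x) * \<kappa> M x - T M (h n x) * \<kappa> M x\<bar>) < e / 2) sequentially"
    using e by (intro order_tendstoD) auto
  then obtain n where n: "(LBINT x. \<bar>T M (g x) * \<kappa> M x - T M (h n x) * \<kappa> M x\<bar>) < e / 2"
    by (meson eventually_sequentially order_refl)
  have ti: "integrable lborel (\<lambda>x. T M (y x) * \<kappa> M x)" if [measurable]: "y \<in> borel_measurable borel" for y
  proof (rule Bochner_Integration.integrable_bound[OF ki[of M]])
    show "AE x in lborel. norm (T M (y x) * \<kappa> M x) \<le> norm (2 * real M * \<kappa> M x)"
    proof (rule AE_I2)
      fix x
      have "\<bar>T M (y x)\<bar> * \<kappa> M x \<le> (2 * M) * \<kappa> M x"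
        using T(2)[of M "y x"] k by (intro mult_right_mono) auto
      thus "norm (T M (y x) * \<kappa> M x) \<le> norm (2 * real M * \<kappa> M x)" using k by (simp add: abs_mult)
    qed
  qed simp
  show ?thesis
  proof (rule that[of "\<lambda>x. T M (h n x) * \<kappa> M x" "cball 0 (real M + 1)"])
    show "continuous_on UNIV (\<lambda>x. T M (h n x) * \<kappa> M x)"
      unfolding T_def \<kappa>_def by (intro continuous_intros N(2))
    have "(LBINT x. \<bar>g x - T M (h n x) * \<kappa> M x\<bar>) \<le>
       (LBINT x. \<bar>g x - T M (g x) * \<kappa> M x\<bar> + \<bar>T M (g x) * \<kappa> M x - T M (h n x) * \<kappa> M x\<bar>)"
      using g ti by (intro integral_mono) auto
    also have "\<dots> < e" using M n g ti by simp
    finally show "(LBINT x. \<bar>g x - T M (h n x) * \<kappa> M x\<bar>) < e" .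
  qed (use ti kout in auto)
qed

text \<open>For a continuous function with compact support this is dominated convergence; in general
  the error of approximation by such a function is unchanged by translation.\<close>

lemma L1_translation_continuous:
  fixes g :: "'a::euclidean_space \<Rightarrow> real"
  assumes g: "integrable lborel g"
  shows "((\<lambda>h. \<integral>x. \<bar>g (x + h) - g x\<bar> \<partial>lborel) \<longlongrightarrow> 0) (at 0)"
proof -
  have "\<forall>X. (\<forall>i. X i \<noteq> 0) \<longrightarrow> X \<longlonglongrightarrow> 0 \<longrightarrow> (\<lambda>n. \<integral>x. \<bar>g (x + X n) - g x\<bar> \<partial>lborel) \<longlonglongrightarrow> 0"
  proof (intro allI impI)
    fix X :: "nat \<Rightarrow> 'a" assume X: "X \<longlonglongrightarrow> 0"
    show "(\<lambda>n. \<integral>x. \<bar>g (x + X n) - g x\<bar> \<partial>lborel) \<longlonglongrightarrow> 0"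
    proof (rule LIMSEQ_I)
      fix e :: real assume e: "e > 0"
      obtain c K where c: "continuous_on UNIV c" "compact K" "\<And>x. x \<notin> K \<Longrightarrow> c x = 0"
        "integrable lborel c" "(LBINT x. \<bar>g x - c x\<bar>) < e / 4"
        using L1_approx_continuous[OF g, of "e / 4"] e by auto
      have [measurable]: "g \<in> borel_measurable borel" "c \<in> borel_measurable borel"
        using g c(4) by (auto simp: borel_measurable_integrable)
      obtain B where B: "B \<ge> 0" "\<And>x. \<bar>c x\<bar> \<le> B"
        using continuous_compact_support_bounded[OF c(1-3)] by blast
      obtain R where R: "\<And>x. x \<in> K \<Longrightarrow> norm x \<le> R"
        using compact_imp_bounded[OF c(2)] by (auto simp: bounded_iff)
      have "bounded (range X)" using X convergent_imp_bounded by blast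
      then obtain Q where Q: "\<And>n. norm (X n) \<le> Q" by (auto simp: bounded_iff)
      have "(\<lambda>n. \<integral>x. \<bar>c (x + X n) - c x\<bar> \<partial>lborel) \<longlonglongrightarrow> (\<integral>x. (0::real) \<partial>(lborel :: 'a measure))"
      proof (rule integral_dominated_convergence[where w="\<lambda>x. 2 * B * indicator (cball 0 (R + Q)) x"])
        show "AE x in lborel. (\<lambda>n. \<bar>c (x + X n) - c x\<bar>) \<longlonglongrightarrow> 0"
        proof (rule AE_I2)
          fix x
          have "isCont c (x + 0)" using c(1) by (simp add: continuous_on_eq_continuous_at)
          hence "(\<lambda>n. c (x + X n)) \<longlonglongrightarrow> c (x + 0)"
            by (rule isCont_tendsto_compose) (intro tendsto_intros X)
          hence "(\<lambda>n. \<bar>c (x + X n) - c x\<bar>) \<longlonglongrightarrow> \<bar>c (x + 0) - c x\<bar>" by (intro tendsto_intros)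
          thus "(\<lambda>n. \<bar>c (x + X n) - c x\<bar>) \<longlonglongrightarrow> 0" by simp
        qed
        show "AE x in lborel. norm \<bar>c (x + X n) - c x\<bar> \<le> 2 * B * indicator (cball 0 (R + Q)) x" for n
        proof (rule AE_I2)
          fix x
          show "norm \<bar>c (x + X n) - c x\<bar> \<le> 2 * B * indicator (cball 0 (R + Q)) x"
          proof (cases "x \<in> cball 0 (R + Q)")
            case True thus ?thesis using B(2)[of x] B(2)[of "x + X n"] by auto
          next
            case False
            have "x \<notin> K" using False R[of x] Q[of 0] norm_ge_zero[of "X 0"] by (force simp del: norm_ge_zero)
            moreover have "norm x \<le> norm (x + X n) + norm (X n)" using norm_triangle_ineq4[of "x + X n" "X n"] by simp
            hence "x + X n \<notin> K" using False R[of "x + X n"] Q[of n] by force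
            ultimately show ?thesis using c(3) B by simp
          qed
        qed
        show "integrable lborel (\<lambda>x. 2 * B * indicator (cball (0::'a) (R + Q)) x)"
          by (intro integrable_mult_right integrable_indicator_cball)
      qed auto
      hence "eventually (\<lambda>n. (LBINT x. \<bar>c (x + X n) - c x\<bar>) < e / 2) sequentially"
        using e by (intro order_tendstoD) auto
      then obtain n0 where n0: "\<And>n. n \<ge> n0 \<Longrightarrow> (LBINT x. \<bar>c (x + X n) - c x\<bar>) < e / 2"
        by (auto simp: eventually_sequentially)
      have "(LBINT x. \<bar>g (x + X n) - g x\<bar>) < e" if n: "n \<ge> n0" for n
      proof -
        note sh = integrable_lborel_shift[OF g, of "X n"] integrable_lborel_shift[OF c(4), of "X n"]
        have "(LBINT x. \<bar>g (x + X n) - g x\<bar>) \<le>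
          (LBINT x. \<bar>g (x + X n) - c (x + X n)\<bar> + \<bar>c (x + X n) - c x\<bar> + \<bar>g x - c x\<bar>)"
          using g c(4) sh by (intro integral_mono) auto
        also have "\<dots> = (LBINT x. \<bar>g (x + X n) - c (x + X n)\<bar>) + (LBINT x. \<bar>c (x + X n) - c x\<bar>) + (LBINT x. \<bar>g x - c x\<bar>)"
          using g c(4) sh by simp
        also have "(LBINT x. \<bar>g (x + X n) - c (x + X n)\<bar>) = (LBINT x. \<bar>g x - c x\<bar>)"
          using integral_lborel_shift[of "\<lambda>x. \<bar>g x - c x\<bar>" "X n"] by simp
        finally show ?thesis using c(5) n0[OF n] by linarith
      qed
      thus "\<exists>no. \<forall>n\<ge>no. norm ((LBINT x. \<bar>g (x + X n) - g x\<bar>) - 0) < e"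
        by (intro exI[of _ n0]) auto
    qed
  qed
  thus ?thesis by (auto simp: tendsto_at_iff_sequentially o_def)
qed

section \<open>Weak gradients on the whole space\<close>

text \<open>Global integrability of both functions is required so that translations, convolutions
  and Fubini can be used freely. Functions given on an open set enter only after multiplication by a
  cut-off, see \<open>lwgrad_cutoff\<close>.\<close>

definition wgrad :: "('a::euclidean_space \<Rightarrow> real) \<Rightarrow> ('a \<Rightarrow> 'a) \<Rightarrow> bool" where
  "wgrad v G \<longleftrightarrow> integrable lborel v \<and> integrable lborel G \<and>
     (\<forall>\<phi>\<in>test_functions UNIV. \<forall>b\<in>Basis.
        (LBINT x. v x * dderiv \<phi> b x) = - (LBINT x. (G x \<bullet> b) * \<phi> x))"

definition sgrad :: "('a::euclidean_space \<Rightarrow> real) \<Rightarrow> 'a \<Rightarrow> 'a" where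
  "sgrad \<zeta> x = (\<Sum>b\<in>Basis. dderiv \<zeta> b x *\<^sub>R b)"

lemma sgrad_inner_Basis: "b \<in> Basis \<Longrightarrow> sgrad \<zeta> x \<bullet> b = dderiv \<zeta> b x"
  by (simp add: sgrad_def inner_sum_left inner_Basis if_distrib cong: if_cong)

text \<open>The directional bound is applied to the direction \<open>sgrad \<zeta> x\<close>
  itself.\<close>

lemma norm_sgrad_le:
  assumes "smooth \<zeta>" "\<And>h. \<bar>dderiv \<zeta> h x\<bar> \<le> c * norm h"
  shows "norm (sgrad \<zeta> x) \<le> c"
proof -
  have lin: "linear (frechet_derivative \<zeta> (at x))"
    by (rule has_derivative_linear[OF smooth_has_derivative[OF assms(1)]])
  have "dderiv \<zeta> h x = sgrad \<zeta> x \<bullet> h" for h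
  proof -
    have "dderiv \<zeta> h x = dderiv \<zeta> (\<Sum>b\<in>Basis. (h \<bullet> b) *\<^sub>R b) x" by (simp add: euclidean_representation)
    also have "\<dots> = (\<Sum>b\<in>Basis. (h \<bullet> b) * dderiv \<zeta> b x)" by (simp add: linear_sum[OF lin] linear_cmul[OF lin])
    also have "\<dots> = sgrad \<zeta> x \<bullet> h" by (simp add: sgrad_def inner_sum_left mult.commute inner_commute[of h])
    finally show ?thesis .
  qed
  from this[of "sgrad \<zeta> x"] assms(2)[of "sgrad \<zeta> x"]
  have "norm (sgrad \<zeta> x) * norm (sgrad \<zeta> x) \<le> c * norm (sgrad \<zeta> x)"
    by (simp add: power2_norm_eq_inner[symmetric] power2_eq_square)
  moreover have "0 \<le> c"
  proof -
    obtain b :: 'a where "b \<in> Basis" using nonempty_Basis by blast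
    thus ?thesis using assms(2)[of b] by (simp add: order_trans[OF abs_ge_zero])
  qed
  ultimately show ?thesis by (cases "sgrad \<zeta> x = 0") auto
qed

lemma integrable_mult_bounded:
  fixes v \<phi> :: "'b \<Rightarrow> real"
  assumes "integrable M v" "\<phi> \<in> borel_measurable M" "\<And>x. \<bar>\<phi> x\<bar> \<le> B"
  shows "integrable M (\<lambda>x. v x * \<phi> x)"
proof (rule Bochner_Integration.integrable_bound)
  show "integrable M (\<lambda>x. B * v x)" using assms by simp
  show "AE x in M. norm (v x * \<phi> x) \<le> norm (B * v x)"
  proof (rule AE_I2)
    fix x show "norm (v x * \<phi> x) \<le> norm (B * v x)"
      using mult_left_mono[OF assms(3)[of x], of "\<bar>v x\<bar>"] assms(3)[of x]
      by (auto simp: abs_mult mult.commute intro: order_trans[OF _ mult_right_mono[OF abs_ge_self]])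
  qed
qed (use assms in auto)

lemma integrable_mult_test:
  fixes v :: "'a::euclidean_space \<Rightarrow> real"
  assumes "integrable lborel v" "\<phi> \<in> test_functions U"
  shows "integrable lborel (\<lambda>x. v x * \<phi> x)" "b \<in> Basis \<Longrightarrow> integrable lborel (\<lambda>x. v x * dderiv \<phi> b x)"
proof -
  have sm: "smooth \<phi>" using assms(2) by (simp add: test_functions_iff)
  obtain b0 :: 'a where b0: "b0 \<in> Basis" using nonempty_Basis by blast
  obtain B where "\<And>x. \<bar>\<phi> x\<bar> \<le> B" using test_function_bounded[OF assms(2) b0] by metis
  thus "integrable lborel (\<lambda>x. v x * \<phi> x)"
    using smooth_measurable[OF sm] by (intro integrable_mult_bounded[OF assms(1)]) auto
  assume b: "b \<in> Basis"
  obtain B where "\<And>x. \<bar>dderiv \<phi> b x\<bar> \<le> B" using test_function_bounded[OF assms(2) b] by metis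
  thus "integrable lborel (\<lambda>x. v x * dderiv \<phi> b x)"
    using smooth_measurable[OF smooth_dderiv[OF sm b]] by (intro integrable_mult_bounded[OF assms(1)]) auto
qed

lemma wgradD:
  assumes "wgrad v G"
  shows "integrable lborel v" "integrable lborel G" "integrable lborel (\<lambda>x. G x \<bullet> b)"
    "v \<in> borel_measurable borel" "G \<in> borel_measurable borel"
  using assms by (auto simp: wgrad_def dest: borel_measurable_integrable)

lemma wgrad_test:
  "wgrad v G \<Longrightarrow> \<phi> \<in> test_functions U \<Longrightarrow> b \<in> Basis \<Longrightarrow>
    (LBINT x. v x * dderiv \<phi> b x) = - (LBINT x. (G x \<bullet> b) * \<phi> x)"
  using test_functions_mono[of U UNIV] by (auto simp: wgrad_def)

lemma wgrad_scale: "wgrad v G \<Longrightarrow> wgrad (\<lambda>x. c * v x) (\<lambda>x. c *\<^sub>R G x)"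
  by (auto simp: wgrad_def mult.assoc)

lemma wgrad_diff:
  assumes "wgrad v G" "wgrad w H"
  shows "wgrad (\<lambda>x. v x - w x) (\<lambda>x. G x - H x)"
  unfolding wgrad_def
proof (intro conjI ballI)
  fix \<phi> :: "'a \<Rightarrow> real" and b :: 'a assume \<phi>: "\<phi> \<in> test_functions UNIV" and b: "b \<in> Basis"
  note i = integrable_mult_test[OF wgradD(1)[OF assms(1)] \<phi>] integrable_mult_test[OF wgradD(1)[OF assms(2)] \<phi>]
    integrable_mult_test[OF wgradD(3)[OF assms(1)] \<phi>] integrable_mult_test[OF wgradD(3)[OF assms(2)] \<phi>]
  show "(LBINT x. (v x - w x) * dderiv \<phi> b x) = - (LBINT x. ((G x - H x) \<bullet> b) * \<phi> x)"
    using i b wgrad_test[OF assms(1) \<phi> b] wgrad_test[OF assms(2) \<phi> b]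
    by (simp add: left_diff_distrib inner_diff_left)
qed (use assms in \<open>auto simp: wgrad_def\<close>)

text \<open>The smooth factor is moved onto the test function: \<zeta> \<phi> is again a test
  function, and the classical product rule for it is rearranged.\<close>

lemma wgrad_mult:
  assumes "wgrad v G" and \<zeta>: "\<zeta> \<in> test_functions U"
  shows "wgrad (\<lambda>x. \<zeta> x * v x) (\<lambda>x. \<zeta> x *\<^sub>R G x + v x *\<^sub>R sgrad \<zeta> x)"
  unfolding wgrad_def
proof (intro conjI ballI)
  have sm: "smooth \<zeta>" using \<zeta> by (simp add: test_functions_iff)
  note v = wgradD[OF assms(1)]
  show "integrable lborel (\<lambda>x. \<zeta> x * v x)"
    using integrable_mult_test(1)[OF v(1) \<zeta>] by (simp add: mult.commute)
  have 1: "integrable lborel (\<lambda>x. \<zeta> x *\<^sub>R G x)"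
  proof -
    have "integrable lborel (\<lambda>x. \<Sum>b\<in>Basis. ((G x \<bullet> b) * \<zeta> x) *\<^sub>R b)"
      by (intro Bochner_Integration.integrable_sum integrable_scaleR_left integrable_mult_test[OF v(3) \<zeta>])
    also have "(\<lambda>x. \<Sum>b\<in>Basis. ((G x \<bullet> b) * \<zeta> x) *\<^sub>R b) = (\<lambda>x. \<zeta> x *\<^sub>R (\<Sum>b\<in>Basis. (G x \<bullet> b) *\<^sub>R b))"
      by (simp add: scaleR_sum_right mult.commute)
    finally show ?thesis by (simp add: euclidean_representation)
  qed
  have 2: "integrable lborel (\<lambda>x. v x *\<^sub>R sgrad \<zeta> x)"
  proof -
    have "integrable lborel (\<lambda>x. \<Sum>b\<in>Basis. (v x * dderiv \<zeta> b x) *\<^sub>R b)"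
      by (intro Bochner_Integration.integrable_sum integrable_scaleR_left integrable_mult_test(2)[OF v(1) \<zeta>])
    thus ?thesis by (simp add: sgrad_def scaleR_sum_right)
  qed
  show "integrable lborel (\<lambda>x. \<zeta> x *\<^sub>R G x + v x *\<^sub>R sgrad \<zeta> x)" using 1 2 by simp
  fix \<phi> :: "'a \<Rightarrow> real" and b :: 'a assume \<phi>: "\<phi> \<in> test_functions UNIV" and b: "b \<in> Basis"
  have sm\<phi>: "smooth \<phi>" using \<phi> by (simp add: test_functions_iff)
  have t: "(\<lambda>x. \<zeta> x * \<phi> x) \<in> test_functions UNIV" by (rule test_functions_mult[OF \<phi> sm])
  have i1: "integrable lborel (\<lambda>x. v x * dderiv (\<lambda>x. \<zeta> x * \<phi> x) b x)"
    by (rule integrable_mult_test(2)[OF v(1) t b])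
  have i2: "integrable lborel (\<lambda>x. v x * dderiv \<zeta> b x * \<phi> x)"
    by (rule integrable_mult_test(1)[OF integrable_mult_test(2)[OF v(1) \<zeta> b] \<phi>])
  have i3: "integrable lborel (\<lambda>x. (G x \<bullet> b) * (\<zeta> x * \<phi> x))"
    by (rule integrable_mult_test(1)[OF v(3) t])
  have "(LBINT x. \<zeta> x * v x * dderiv \<phi> b x)
     = (LBINT x. v x * dderiv (\<lambda>x. \<zeta> x * \<phi> x) b x - v x * dderiv \<zeta> b x * \<phi> x)"
    by (rule Bochner_Integration.integral_cong, simp, simp only: dderiv_mult[OF sm sm\<phi>], simp add: algebra_simps)
  also have "\<dots> = - (LBINT x. (G x \<bullet> b) * (\<zeta> x * \<phi> x)) - (LBINT x. v x * dderiv \<zeta> b x * \<phi> x)"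
    using i1 i2 wgrad_test[OF assms(1) t b] by simp
  also have "\<dots> = - (LBINT x. (G x \<bullet> b) * (\<zeta> x * \<phi> x) + v x * dderiv \<zeta> b x * \<phi> x)"
    using i2 i3 by simp
  also have "(\<lambda>x. (G x \<bullet> b) * (\<zeta> x * \<phi> x) + v x * dderiv \<zeta> b x * \<phi> x)
     = (\<lambda>x. ((\<zeta> x *\<^sub>R G x + v x *\<^sub>R sgrad \<zeta> x) \<bullet> b) * \<phi> x)"
    using b by (auto simp: inner_add_left sgrad_inner_Basis algebra_simps)
  finally show "(LBINT x. \<zeta> x * v x * dderiv \<phi> b x)
     = - (LBINT x. ((\<zeta> x *\<^sub>R G x + v x *\<^sub>R sgrad \<zeta> x) \<bullet> b) * \<phi> x)" .
qed

lemma wgrad_limit: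
  assumes w: "\<And>n. wgrad (v n) (G n)"
    and dom: "integrable lborel V" "integrable lborel W"
      "\<And>n x. \<bar>v n x\<bar> \<le> V x" "\<And>n x. norm (G n x) \<le> W x"
    and lim: "\<And>x. (\<lambda>n. v n x) \<longlonglongrightarrow> u x" "\<And>x. (\<lambda>n. G n x) \<longlonglongrightarrow> H x"
  shows "wgrad u H"
  unfolding wgrad_def
proof (intro conjI ballI)
  have [measurable]: "v n \<in> borel_measurable borel" "G n \<in> borel_measurable borel" for n using wgradD(4,5)[OF w] .
  have [measurable]: "u \<in> borel_measurable borel" "H \<in> borel_measurable borel"
    by (rule borel_measurable_LIMSEQ_metric[OF _ lim(1)], simp)
      (rule borel_measurable_LIMSEQ_metric[OF _ lim(2)], simp)
  show "integrable lborel u"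
    by (rule integrable_dominated_convergence[OF _ _ dom(1), of _ v]) (use dom lim in auto)
  show "integrable lborel H"
    by (rule integrable_dominated_convergence[OF _ _ dom(2), of _ G]) (use dom lim in auto)
  fix \<phi> :: "'a \<Rightarrow> real" and b :: 'a assume \<phi>: "\<phi> \<in> test_functions UNIV" and b: "b \<in> Basis"
  have [measurable]: "\<phi> \<in> borel_measurable borel" "(\<lambda>x. dderiv \<phi> b x) \<in> borel_measurable borel"
    using \<phi> b by (auto simp: test_functions_iff intro: smooth_measurable smooth_dderiv)
  obtain B where B: "B \<ge> 0" "\<And>x. \<bar>\<phi> x\<bar> \<le> B" "\<And>x. \<bar>dderiv \<phi> b x\<bar> \<le> B"
    using test_function_bounded[OF \<phi> b] by metis
  have V0: "V x \<ge> 0" and W0: "W x \<ge> 0" for x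
    using dom(3)[of 0 x] order_trans[OF norm_ge_zero dom(4)[of 0 x]] by auto
  have "(\<lambda>n. \<integral>x. v n x * dderiv \<phi> b x \<partial>lborel) \<longlonglongrightarrow> (LBINT x. u x * dderiv \<phi> b x)"
  proof (rule integral_dominated_convergence[where w="\<lambda>x. V x * B"])
    show "AE x in lborel. norm (v n x * dderiv \<phi> b x) \<le> V x * B" for n
      unfolding real_norm_def abs_mult using B dom(3) V0 by (intro AE_I2 mult_mono) auto
  qed (use dom in \<open>auto intro!: tendsto_intros lim\<close>)
  moreover have "(\<lambda>n. \<integral>x. (G n x \<bullet> b) * \<phi> x \<partial>lborel) \<longlonglongrightarrow> (LBINT x. (H x \<bullet> b) * \<phi> x)"
  proof (rule integral_dominated_convergence[where w="\<lambda>x. W x * B"])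
    show "AE x in lborel. norm ((G n x \<bullet> b) * \<phi> x) \<le> W x * B" for n
      unfolding real_norm_def abs_mult using B W0 order_trans[OF Basis_le_norm[OF b] dom(4)]
      by (intro AE_I2 mult_mono) auto
  qed (use dom in \<open>auto intro!: tendsto_intros lim\<close>)
  from tendsto_minus[OF this]
  have "(\<lambda>n. \<integral>x. v n x * dderiv \<phi> b x \<partial>lborel) \<longlonglongrightarrow> - (LBINT x. (H x \<bullet> b) * \<phi> x)"
    using wgrad_test[OF w \<phi> b] by simp
  ultimately show "(LBINT x. u x * dderiv \<phi> b x) = - (LBINT x. (H x \<bullet> b) * \<phi> x)"
    by (rule LIMSEQ_unique)
qed

subsection \<open>Difference quotients\<close>

lemma test_functions_translate:
  assumes "\<phi> \<in> test_functions UNIV" shows "(\<lambda>x. \<phi> (x + c)) \<in> test_functions UNIV"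
proof -
  obtain K where K: "compact K" "\<And>x. x \<notin> K \<Longrightarrow> \<phi> x = 0"
    using test_function_support[OF assms] by metis
  have "compact ((\<lambda>x. x - c) ` K)" using K(1) by (rule compact_translation_subtract)
  thus ?thesis
  proof (rule test_functionI[rotated])
    show "\<phi> (x + c) = 0" if "x \<notin> (\<lambda>x. x - c) ` K" for x
      using that by (intro K(2)) (metis add_diff_cancel imageI)
  qed (use assms in \<open>auto simp: test_functions_iff intro: smooth_translate\<close>)
qed

text \<open>The integrability on the product space that licenses exchanging the x-integral with the
  integral along the segment from x to x + t b.\<close>

lemma integrable_strip:
  fixes g :: "'a::euclidean_space \<Rightarrow> real"
  assumes g: "integrable lborel g" and [measurable]: "case_prod k \<in> borel_measurable (borel \<Otimes>\<^sub>M borel)"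
    and k: "\<And>\<tau> x. \<bar>k \<tau> x\<bar> \<le> B"
  shows "integrable (lborel \<Otimes>\<^sub>M lborel) (\<lambda>(\<tau>::real, x). indicator {0..t} \<tau> * (g (x + \<tau> *\<^sub>R b) * k \<tau> x))"
proof (rule integrableI_bounded)
  have [measurable]: "g \<in> borel_measurable borel" using g by (simp add: borel_measurable_integrable)
  show "(\<lambda>(\<tau>::real, x). indicator {0..t} \<tau> * (g (x + \<tau> *\<^sub>R b) * k \<tau> x)) \<in> borel_measurable (lborel \<Otimes>\<^sub>M lborel)"
    by measurable
  have B: "B \<ge> 0" using k[of 0 undefined] by linarith
  have "(\<integral>\<^sup>+z. ennreal (norm (case z of (\<tau>::real, x) \<Rightarrow> indicator {0..t} \<tau> * (g (x + \<tau> *\<^sub>R b) * k \<tau> x))) \<partial>(lborel \<Otimes>\<^sub>M lborel))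
    \<le> (\<integral>\<^sup>+z. (case z of (\<tau>::real, x) \<Rightarrow> indicator {0..t} \<tau> * (ennreal \<bar>g (x + \<tau> *\<^sub>R b)\<bar> * ennreal B)) \<partial>(lborel \<Otimes>\<^sub>M lborel))"
    using k B
    by (intro nn_integral_mono) (auto simp: abs_mult ennreal_mult' indicator_def intro!: mult_left_mono ennreal_leI)
  also have "\<dots> = (\<integral>\<^sup>+\<tau>. \<integral>\<^sup>+x. indicator {0..t} \<tau> * (ennreal \<bar>g (x + \<tau> *\<^sub>R b)\<bar> * ennreal B) \<partial>lborel \<partial>lborel)"
    by (subst lborel.nn_integral_fst[symmetric]) auto
  also have "\<dots> = (\<integral>\<^sup>+\<tau>. indicator {0..t} \<tau> * ((\<integral>\<^sub>+x. \<bar>g x\<bar>) * ennreal B) \<partial>lborel)"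
  proof (rule nn_integral_cong)
    fix \<tau> :: real
    have "(\<integral>\<^sup>+x. indicator {0..t} \<tau> * (ennreal \<bar>g (x + \<tau> *\<^sub>R b)\<bar> * ennreal B) \<partial>lborel)
      = indicator {0..t} \<tau> * ((\<integral>\<^sub>+x. \<bar>g (x + \<tau> *\<^sub>R b)\<bar>) * ennreal B)"
      by (simp add: nn_integral_cmult nn_integral_multc)
    thus "(\<integral>\<^sup>+x. indicator {0..t} \<tau> * (ennreal \<bar>g (x + \<tau> *\<^sub>R b)\<bar> * ennreal B) \<partial>lborel)
      = indicator {0..t} \<tau> * ((\<integral>\<^sub>+x. \<bar>g x\<bar>) * ennreal B)"
      using nn_integral_lborel_shift[of "\<lambda>x. ennreal \<bar>g x\<bar>" "\<tau> *\<^sub>R b"] by simp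
  qed
  also have "\<dots> = (\<integral>\<^sub>+x. \<bar>g x\<bar>) * ennreal B * emeasure lborel {0..t}"
    by (simp add: nn_integral_multc mult.commute)
  also have "\<dots> < \<infinity>"
    using g by (auto simp: integrable_iff_bounded ennreal_mult_less_top less_top[symmetric] emeasure_lborel_Icc_eq ennreal_mult_eq_top_iff)
  finally show "(\<integral>\<^sup>+z. ennreal (norm (case z of (\<tau>::real, x) \<Rightarrow> indicator {0..t} \<tau> * (g (x + \<tau> *\<^sub>R b) * k \<tau> x))) \<partial>(lborel \<Otimes>\<^sub>M lborel)) < \<infinity>" .
qed

text \<open>The fundamental theorem of calculus in a coordinate direction, verified weakly. Against
  a test function \<phi> the right side becomes, by Fubini, translation and the definition of the
  weak gradient, the integral of v times the derivative of \<phi> along the segment; that derivative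
  is integrated classically.\<close>

lemma wgrad_increment:
  assumes w: "wgrad v G" and b: "b \<in> Basis" and t: "t > 0"
  shows "AE x in lborel. v (x + t *\<^sub>R b) - v x = (LBINT \<tau>. indicator {0..t} \<tau> * (G (x + \<tau> *\<^sub>R b) \<bullet> b))"
proof -
  define g where "g = (\<lambda>x. G x \<bullet> b)"
  have g: "integrable lborel g" unfolding g_def by (rule wgradD(3)[OF w])
  note v = wgradD(1)[OF w]
  have [measurable]: "g \<in> borel_measurable borel" "v \<in> borel_measurable borel"
    using g v by (auto simp: borel_measurable_integrable)
  define A where "A = (\<lambda>x. \<integral>\<tau>. indicator {0..t} \<tau> * g (x + \<tau> *\<^sub>R b) \<partial>lborel)"
  have iA: "integrable lborel A"
  proof -
    have "integrable (lborel \<Otimes>\<^sub>M lborel) (\<lambda>(\<tau>::real, x). indicator {0..t} \<tau> * (g (x + \<tau> *\<^sub>R b) * 1))"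
      by (rule integrable_strip[OF g, of "\<lambda>_ _. 1" 1]) auto
    from lborel_pair.integrable_snd[OF this] show ?thesis by (simp add: A_def)
  qed
  define D where "D = (\<lambda>x. v (x + t *\<^sub>R b) - v x - A x)"
  have iD: "integrable lborel D"
    unfolding D_def using iA v integrable_lborel_shift[OF v] by simp
  have "AE x\<in>UNIV in lborel. D x = 0"
  proof (rule fundamental_lemma)
    fix K :: "'a set" assume "compact K"
    thus "integrable lborel (\<lambda>x. indicator K x * D x)"
      using integrable_mult_indicator[of K lborel D] iD by (auto simp: compact_imp_closed)
  next
    fix \<phi> :: "'a \<Rightarrow> real" assume \<phi>: "\<phi> \<in> test_functions UNIV"
    have sm: "smooth \<phi>" using \<phi> by (simp add: test_functions_iff)
    note smd = smooth_dderiv[OF sm b]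
    have [measurable]: "\<phi> \<in> borel_measurable borel" "(\<lambda>x. dderiv \<phi> b x) \<in> borel_measurable borel"
      using sm smd by (auto intro: smooth_measurable)
    obtain B where B: "B \<ge> 0" "\<And>x. \<bar>\<phi> x\<bar> \<le> B" "\<And>x. \<bar>dderiv \<phi> b x\<bar> \<le> B"
      using test_function_bounded[OF \<phi> b] by metis
    have FTC: "(LBINT \<tau>. indicator {0..t} \<tau> * dderiv \<phi> b (x - \<tau> *\<^sub>R b)) = \<phi> x - \<phi> (x - t *\<^sub>R b)" for x
    proof -
      have "(LBINT \<tau>. indicator {0..t} \<tau> *\<^sub>R dderiv \<phi> b (x - \<tau> *\<^sub>R b)) = - \<phi> (x - t *\<^sub>R b) - - \<phi> (x - 0 *\<^sub>R b)"
      proof (rule integral_FTC_atLeastAtMost)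
        show "continuous_on {0..t} (\<lambda>\<tau>. dderiv \<phi> b (x - \<tau> *\<^sub>R b))"
          by (intro continuous_on_compose2[OF smooth_continuous[OF smd]] continuous_intros) auto
        fix \<tau> :: real
        have lin: "linear (frechet_derivative \<phi> (at (x - \<tau> *\<^sub>R b)))"
          by (rule has_derivative_linear[OF smooth_has_derivative[OF sm]])
        have "((\<lambda>\<tau>. x - \<tau> *\<^sub>R b) has_derivative (\<lambda>h. - (h *\<^sub>R b))) (at \<tau> within {0..t})"
          by (auto intro!: derivative_eq_intros)
        from has_derivative_minus[OF has_derivative_compose[OF this smooth_has_derivative[OF sm]]]
        show "((\<lambda>\<tau>. - \<phi> (x - \<tau> *\<^sub>R b)) has_vector_derivative dderiv \<phi> b (x - \<tau> *\<^sub>R b)) (at \<tau> within {0..t})"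
          by (simp add: has_vector_derivative_def linear_neg[OF lin] linear_cmul[OF lin])
      qed (use t in auto)
      thus ?thesis by simp
    qed
    have "(LBINT x. A x * \<phi> x) = (LBINT x. (LBINT \<tau>. indicator {0..t} \<tau> * (g (x + \<tau> *\<^sub>R b) * \<phi> x)))"
      unfolding A_def by (simp add: mult.assoc[symmetric])
    also have "\<dots> = (LBINT \<tau>. (LBINT x. indicator {0..t} \<tau> * (g (x + \<tau> *\<^sub>R b) * \<phi> x)))"
    proof (rule lborel_pair.Fubini_integral)
      show "integrable (lborel \<Otimes>\<^sub>M lborel) (\<lambda>(\<tau>, x). indicator {0..t} \<tau> * (g (x + \<tau> *\<^sub>R b) * \<phi> x))"
        by (rule integrable_strip[OF g _ B(2)]) auto
    qed
    also have "\<dots> = (LBINT \<tau>. (LBINT x. - (indicator {0..t} \<tau> * (v x * dderiv \<phi> b (x - \<tau> *\<^sub>R b)))))"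
    proof (rule Bochner_Integration.integral_cong[OF refl])
      fix \<tau> :: real
      have t: "(\<lambda>x. \<phi> (x + - \<tau> *\<^sub>R b)) \<in> test_functions UNIV" by (rule test_functions_translate[OF \<phi>])
      have "(LBINT x. g (x + \<tau> *\<^sub>R b) * \<phi> x) = (LBINT x. g x * \<phi> (x + - \<tau> *\<^sub>R b))"
        using integral_lborel_shift[of "\<lambda>x. g x * \<phi> (x + - \<tau> *\<^sub>R b)" "\<tau> *\<^sub>R b"] by simp
      also have "\<dots> = - (LBINT x. v x * dderiv (\<lambda>x. \<phi> (x + - \<tau> *\<^sub>R b)) b x)"
        using wgrad_test[OF w t b] by (simp add: g_def)
      also have "\<dots> = - (LBINT x. v x * dderiv \<phi> b (x - \<tau> *\<^sub>R b))"
        by (simp only: dderiv_translate[OF sm]) simp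
      finally show "(LBINT x. indicator {0..t} \<tau> * (g (x + \<tau> *\<^sub>R b) * \<phi> x))
        = (LBINT x. - (indicator {0..t} \<tau> * (v x * dderiv \<phi> b (x - \<tau> *\<^sub>R b))))" by simp
    qed
    also have "\<dots> = (LBINT x. (LBINT \<tau>. - (indicator {0..t} \<tau> * (v x * dderiv \<phi> b (x - \<tau> *\<^sub>R b)))))"
    proof (rule lborel_pair.Fubini_integral[symmetric])
      have "integrable (lborel \<Otimes>\<^sub>M lborel) (\<lambda>(\<tau>, x). indicator {0..t} \<tau> * (v (x + \<tau> *\<^sub>R 0) * dderiv \<phi> b (x - \<tau> *\<^sub>R b)))"
        by (rule integrable_strip[OF v _ B(3)]) auto
      from integrable_minus[OF this]
      show "integrable (lborel \<Otimes>\<^sub>M lborel) (\<lambda>(\<tau>, x). - (indicator {0..t} \<tau> * (v x * dderiv \<phi> b (x - \<tau> *\<^sub>R b))))"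
        by (simp add: case_prod_unfold)
    qed
    also have "\<dots> = (LBINT x. v x * \<phi> (x + - t *\<^sub>R b) - v x * \<phi> x)"
    proof (rule Bochner_Integration.integral_cong[OF refl])
      fix x
      have "(LBINT \<tau>. - (indicator {0..t} \<tau> * (v x * dderiv \<phi> b (x - \<tau> *\<^sub>R b))))
        = (LBINT \<tau>. - v x * (indicator {0..t} \<tau> * dderiv \<phi> b (x - \<tau> *\<^sub>R b)))"
        by (rule Bochner_Integration.integral_cong) auto
      also have "\<dots> = - v x * (\<phi> x - \<phi> (x - t *\<^sub>R b))" unfolding integral_mult_right_zero FTC ..
      finally show "(LBINT \<tau>. - (indicator {0..t} \<tau> * (v x * dderiv \<phi> b (x - \<tau> *\<^sub>R b))))
        = v x * \<phi> (x + - t *\<^sub>R b) - v x * \<phi> x" by (simp add: algebra_simps)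
    qed
    also have "\<dots> = (LBINT x. v x * \<phi> (x + - t *\<^sub>R b)) - (LBINT x. v x * \<phi> x)"
      using integrable_mult_test(1)[OF v \<phi>] integrable_mult_test(1)[OF v test_functions_translate[OF \<phi>]]
      by (intro Bochner_Integration.integral_diff)
    also have "(LBINT x. v x * \<phi> (x + - t *\<^sub>R b)) = (LBINT x. v (x + t *\<^sub>R b) * \<phi> x)"
      using integral_lborel_shift[of "\<lambda>x. v x * \<phi> (x + - t *\<^sub>R b)" "t *\<^sub>R b"] by simp
    finally have e: "(LBINT x. A x * \<phi> x) = (LBINT x. v (x + t *\<^sub>R b) * \<phi> x) - (LBINT x. v x * \<phi> x)" .
    note i = integrable_mult_test(1)[OF v \<phi>] integrable_mult_test(1)[OF iA \<phi>]
      integrable_mult_test(1)[OF integrable_lborel_shift[OF v] \<phi>, of "t *\<^sub>R b"]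
    show "(LBINT x. D x * \<phi> x) = 0"
      unfolding D_def left_diff_distrib using i e by simp
  qed simp
  thus ?thesis by (rule eventually_mono) (simp add: D_def A_def g_def)
qed

text \<open>By \<open>wgrad_increment\<close> the error is at most the average over \<tau> in [0,t]
  of |g(x + \<tau> b) - g(x)|, so its L^1 norm is at most the largest translation error on that
  range.\<close>

lemma wgrad_difference_quotient:
  assumes w: "wgrad v G" and b: "b \<in> Basis"
  shows "((\<lambda>t. \<integral>x. \<bar>(v (x + t *\<^sub>R b) - v x) / t - G x \<bullet> b\<bar> \<partial>lborel) \<longlongrightarrow> 0) (at_right 0)"
proof (rule tendstoI)
  fix e :: real assume e: "e > 0"
  define g where "g = (\<lambda>x. G x \<bullet> b)"
  have g: "integrable lborel g" unfolding g_def by (rule wgradD(3)[OF w])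
  note v = wgradD(1)[OF w]
  have [measurable]: "g \<in> borel_measurable borel" "v \<in> borel_measurable borel"
    using g v by (auto simp: borel_measurable_integrable)
  have "\<forall>\<^sub>F h in at 0. dist (LBINT x. \<bar>g (x + h) - g x\<bar>) 0 < e / 2"
    using L1_translation_continuous[OF g] e by (intro tendstoD) auto
  then obtain d where d: "d > 0" "\<And>h. h \<noteq> 0 \<Longrightarrow> norm h < d \<Longrightarrow> (LBINT x. \<bar>g (x + h) - g x\<bar>) < e / 2"
    by (force simp: eventually_at dist_norm)
  have "(LBINT x. \<bar>(v (x + t *\<^sub>R b) - v x) / t - g x\<bar>) < e" if t: "0 < t" "t < d" for t
  proof -
    have bd: "(LBINT x. \<bar>g (x + \<tau> *\<^sub>R b) - g x\<bar>) \<le> e / 2" if "\<tau> \<in> {0..t}" for \<tau>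
      using d(2)[of "\<tau> *\<^sub>R b"] that t b e by (cases "\<tau> = 0") (auto simp: nonzero_Basis less_imp_le)
    have i1: "integrable lborel (\<lambda>x. \<bar>(v (x + t *\<^sub>R b) - v x) / t - g x\<bar>)"
      using g v integrable_lborel_shift[OF v] by auto
    have istrip: "integrable (lborel \<Otimes>\<^sub>M lborel) (\<lambda>(\<tau>::real, x). indicator {0..t} \<tau> * (g (x + \<tau> *\<^sub>R b) * 1))"
      by (rule integrable_strip[OF g, of "\<lambda>_ _. 1" 1]) auto
    have "AE x in lborel. integrable lborel (\<lambda>\<tau>. indicator {0..t} \<tau> * g (x + \<tau> *\<^sub>R b))"
      using lborel_pair.AE_integrable_snd[OF istrip] by simp
    with wgrad_increment[OF w b t(1)]
    have "AE x in lborel. ennreal \<bar>(v (x + t *\<^sub>R b) - v x) / t - g x\<bar>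
        \<le> (\<integral>\<^sub>+\<tau>. indicator {0..t} \<tau> / t * \<bar>g (x + \<tau> *\<^sub>R b) - g x\<bar>)"
    proof eventually_elim
      case (elim x)
      have ii: "integrable lborel (\<lambda>\<tau>. indicator {0..t} \<tau> * (1::real))"
        using integrable_indicator_cball[of "t / 2" "t / 2"] t by (simp add: cball_eq_atLeastAtMost)
      have c: "(LBINT \<tau>. indicator {0..t} \<tau> * g x) = t * g x" using t by simp
      have ii2: "integrable lborel (\<lambda>\<tau>. indicator {0..t} \<tau> * (g (x + \<tau> *\<^sub>R b) - g x))"
        using Bochner_Integration.integrable_diff[OF elim(2) integrable_mult_left[OF ii, of "g x"]]
        by (simp add: right_diff_distrib)
      have "(v (x + t *\<^sub>R b) - v x) / t - g x
        = ((LBINT \<tau>. indicator {0..t} \<tau> * g (x + \<tau> *\<^sub>R b)) - (LBINT \<tau>. indicator {0..t} \<tau> * g x)) / t"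
        using t elim(1) c unfolding g_def by (simp add: field_simps)
      also have "\<dots> = (LBINT \<tau>. indicator {0..t} \<tau> * (g (x + \<tau> *\<^sub>R b) - g x)) / t"
        using elim(2) integrable_mult_left[OF ii, of "g x"] by (simp add: right_diff_distrib)
      also have "\<dots> = (LBINT \<tau>. indicator {0..t} \<tau> / t * (g (x + \<tau> *\<^sub>R b) - g x))"
        by (simp add: mult.commute)
      finally have "ennreal \<bar>(v (x + t *\<^sub>R b) - v x) / t - g x\<bar>
        = ennreal (norm (LBINT \<tau>. indicator {0..t} \<tau> / t * (g (x + \<tau> *\<^sub>R b) - g x)))" by simp
      also have "\<dots> \<le> (\<integral>\<^sub>+\<tau>. norm (indicator {0..t} \<tau> / t * (g (x + \<tau> *\<^sub>R b) - g x)))"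
        using ii2 by (intro integral_norm_bound_ennreal) auto
      also have "\<dots> = (\<integral>\<^sub>+\<tau>. indicator {0..t} \<tau> / t * \<bar>g (x + \<tau> *\<^sub>R b) - g x\<bar>)"
        using t by (simp add: abs_mult)
      finally show ?case .
    qed
    hence "(\<integral>\<^sub>+x. \<bar>(v (x + t *\<^sub>R b) - v x) / t - g x\<bar>)
      \<le> (\<integral>\<^sup>+x. \<integral>\<^sup>+\<tau>. ennreal (indicator {0..t} \<tau> / t * \<bar>g (x + \<tau> *\<^sub>R b) - g x\<bar>) \<partial>lborel \<partial>lborel)"
      by (rule nn_integral_mono_AE)
    also have "\<dots> = (\<integral>\<^sup>+\<tau>. \<integral>\<^sup>+x. ennreal (indicator {0..t} \<tau> / t * \<bar>g (x + \<tau> *\<^sub>R b) - g x\<bar>) \<partial>lborel \<partial>lborel)"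
      by (rule lborel_pair.Fubini') measurable
    also have "\<dots> \<le> (\<integral>\<^sub>+\<tau>. indicator {0..t} \<tau> * (e / 2 / t))"
    proof (rule nn_integral_mono)
      fix \<tau> :: real
      show "(\<integral>\<^sub>+x. indicator {0..t} \<tau> / t * \<bar>g (x + \<tau> *\<^sub>R b) - g x\<bar>) \<le> ennreal (indicator {0..t} \<tau> * (e / 2 / t))"
      proof (cases "\<tau> \<in> {0..t}")
        case True
        have "(\<integral>\<^sub>+x. \<bar>g (x + \<tau> *\<^sub>R b) - g x\<bar>) = ennreal (LBINT x. \<bar>g (x + \<tau> *\<^sub>R b) - g x\<bar>)"
          using g integrable_lborel_shift[OF g] by (intro nn_integral_eq_integral) auto
        also have "\<dots> \<le> ennreal (e / 2)" using bd[OF True] by (rule ennreal_leI)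
        finally have *: "(\<integral>\<^sub>+x. \<bar>g (x + \<tau> *\<^sub>R b) - g x\<bar>) \<le> ennreal (e / 2)" .
        have "(\<integral>\<^sub>+x. indicator {0..t} \<tau> / t * \<bar>g (x + \<tau> *\<^sub>R b) - g x\<bar>)
          = ennreal (1 / t) * (\<integral>\<^sub>+x. \<bar>g (x + \<tau> *\<^sub>R b) - g x\<bar>)"
          using True t by (subst nn_integral_cmult[symmetric]) (auto simp: ennreal_mult'[symmetric])
        also have "\<dots> \<le> ennreal (1 / t) * ennreal (e / 2)" by (rule mult_left_mono[OF *]) simp
        also have "\<dots> = ennreal (indicator {0..t} \<tau> * (e / 2 / t))"
          using True t e by (simp add: ennreal_mult'[symmetric])
        finally show ?thesis .
      qed simp
    qed
    also have "\<dots> = (\<integral>\<^sup>+\<tau>. ennreal (e / 2 / t) * indicator {0..t} \<tau> \<partial>lborel)"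
      by (intro nn_integral_cong) (auto simp: indicator_def)
    also have "\<dots> = ennreal (e / 2)"
      using t e by (simp add: nn_integral_cmult_indicator ennreal_mult'[symmetric])
    finally have "ennreal (LBINT x. \<bar>(v (x + t *\<^sub>R b) - v x) / t - g x\<bar>) \<le> ennreal (e / 2)"
      using i1 by (subst (asm) nn_integral_eq_integral) auto
    thus ?thesis using e by (simp add: ennreal_le_iff)
  qed
  thus "\<forall>\<^sub>F t in at_right 0. dist (LBINT x. \<bar>(v (x + t *\<^sub>R b) - v x) / t - G x \<bullet> b\<bar>) 0 < e"
    unfolding eventually_at_right_field using d(1) by (auto intro!: exI[of _ d] simp: g_def)
qed

subsection \<open>Chain rule\<close>

lemma lipschitz_of_bounded_deriv:
  fixes \<phi> :: "real \<Rightarrow> real"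
  assumes "\<And>t. (\<phi> has_real_derivative \<phi>' t) (at t)" "\<And>t. \<bar>\<phi>' t\<bar> \<le> M"
  shows "\<bar>\<phi> s - \<phi> t\<bar> \<le> M * \<bar>s - t\<bar>"
  using field_differentiable_bound[OF convex_UNIV, of \<phi> \<phi>' M s t] assms
  by (auto intro: has_field_derivative_at_within)

text \<open>Difference quotients take the place of mollification. The quotient of \<phi> o v factors
  into a secant slope, bounded by M and convergent almost everywhere along a subsequence, and the
  quotient of v, which converges in L^1.\<close>

lemma wgrad_chain:
  assumes w: "wgrad v G"
    and d: "\<And>t. (\<phi> has_real_derivative \<phi>' t) (at t)" and cont: "continuous_on UNIV \<phi>'"
    and M: "\<And>t. \<bar>\<phi>' t\<bar> \<le> M" and \<phi>0: "\<phi> 0 = 0"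
  shows "wgrad (\<lambda>x. \<phi> (v x)) (\<lambda>x. \<phi>' (v x) *\<^sub>R G x)"
  unfolding wgrad_def
proof (intro conjI ballI)
  note v = wgradD(1)[OF w] and G = wgradD(2)[OF w]
  have M0: "M \<ge> 0" using M[of 0] by linarith
  note lip = lipschitz_of_bounded_deriv[OF d M]
  have cphi: "continuous_on UNIV \<phi>" using d by (auto simp: continuous_on_eq_continuous_at intro: DERIV_isCont)
  have [measurable]: "v \<in> borel_measurable borel" "G \<in> borel_measurable borel"
    "\<phi> \<in> borel_measurable borel" "\<phi>' \<in> borel_measurable borel"
    using wgradD(4,5)[OF w] cphi cont by (auto intro: borel_measurable_continuous_onI)
  show iv: "integrable lborel (\<lambda>x. \<phi> (v x))"
  proof (rule Bochner_Integration.integrable_bound)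
    show "integrable lborel (\<lambda>x. M * v x)" using v by simp
    show "AE x in lborel. norm (\<phi> (v x)) \<le> norm (M * v x)"
      using lip[of _ 0] M0 by (simp add: \<phi>0 abs_mult)
  qed simp
  show "integrable lborel (\<lambda>x. \<phi>' (v x) *\<^sub>R G x)"
  proof (rule Bochner_Integration.integrable_bound)
    show "integrable lborel (\<lambda>x. M *\<^sub>R G x)" using G by simp
    show "AE x in lborel. norm (\<phi>' (v x) *\<^sub>R G x) \<le> norm (M *\<^sub>R G x)"
      using M M0 by (auto intro!: mult_right_mono)
  qed simp
  fix \<psi> :: "'a \<Rightarrow> real" and b :: 'a assume \<psi>: "\<psi> \<in> test_functions UNIV" and b: "b \<in> Basis"
  have sm: "smooth \<psi>" using \<psi> by (simp add: test_functions_iff)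
  have [measurable]: "\<psi> \<in> borel_measurable borel" "(\<lambda>x. dderiv \<psi> b x) \<in> borel_measurable borel"
    using sm b by (auto intro: smooth_measurable smooth_dderiv)
  obtain B where B: "B \<ge> 0" "\<And>x. \<bar>\<psi> x\<bar> \<le> B" "\<And>x. \<bar>dderiv \<psi> b x\<bar> \<le> B"
    using test_function_bounded[OF \<psi> b] by metis
  define g where "g = (\<lambda>x. G x \<bullet> b)"
  have g: "integrable lborel g" unfolding g_def by (rule wgradD(3)[OF w])
  have [measurable]: "g \<in> borel_measurable borel" using g by (simp add: borel_measurable_integrable)
  have psider: "((\<lambda>t. \<psi> (x + t *\<^sub>R - b)) has_real_derivative - dderiv \<psi> b (x + t *\<^sub>R - b)) (at t)" for x t
  proof -
    have lin: "linear (frechet_derivative \<psi> (at (x + t *\<^sub>R - b)))"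
      by (rule has_derivative_linear[OF smooth_has_derivative[OF sm]])
    have "((\<lambda>t. x + t *\<^sub>R - b) has_derivative (\<lambda>h. h *\<^sub>R - b)) (at t)"
      by (auto intro!: derivative_eq_intros)
    from has_derivative_compose[OF this smooth_has_derivative[OF sm]]
    have "((\<lambda>t. \<psi> (x + t *\<^sub>R - b)) has_derivative (\<lambda>h. dderiv \<psi> (h *\<^sub>R - b) (x + t *\<^sub>R - b))) (at t)" .
    moreover have "dderiv \<psi> (h *\<^sub>R - b) (x + t *\<^sub>R - b) = - dderiv \<psi> b (x + t *\<^sub>R - b) * h" for h
      using linear_cmul[OF lin, of h "- b"] linear_neg[OF lin, of b] by simp
    ultimately show ?thesis unfolding has_field_derivative_def by (simp only:)
  qed
  define t where "t = (\<lambda>n. 1 / real (Suc n))"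
  have t: "t n > 0" for n by (simp add: t_def)
  have t0: "t \<longlonglongrightarrow> 0" unfolding t_def using LIMSEQ_inverse_real_of_nat by (simp add: inverse_eq_divide)
  have tr: "filterlim t (at_right 0) sequentially"
  proof -
    have "t n \<noteq> 0" for n using t[of n] by simp
    thus ?thesis using t0 t by (simp add: filterlim_at)
  qed
  define V where "V = (\<lambda>n x. v (x + t n *\<^sub>R b))"
  have [measurable]: "V n \<in> borel_measurable borel" for n unfolding V_def by measurable
  have iV: "integrable lborel (V n)" for n unfolding V_def by (rule integrable_lborel_shift[OF v])
  have "filterlim (\<lambda>n. t n *\<^sub>R b) (at 0) sequentially"
  proof -
    have "(\<lambda>n. t n *\<^sub>R b) \<longlonglongrightarrow> 0 *\<^sub>R b" by (intro tendsto_intros t0)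
    moreover have "t n *\<^sub>R b \<noteq> 0" for n using t[of n] b by (auto simp: nonzero_Basis)
    ultimately show ?thesis by (auto simp: filterlim_at intro: always_eventually)
  qed
  from filterlim_compose[OF L1_translation_continuous[OF v] this]
  have "(\<lambda>n. \<integral>x. norm (V n x - v x) \<partial>lborel) \<longlonglongrightarrow> 0" by (simp add: V_def)
  \<comment> \<open>Convergence of the translates in L^1 gives convergence almost everywhere only
    along a subsequence, which suffices because the other limit is known for the full
    sequence.\<close>
  then obtain r where r: "strict_mono r" "AE x in lborel. (\<lambda>n. V (r n) x - v x) \<longlonglongrightarrow> 0"
    using tendsto_L1_AE_subseq[of lborel "\<lambda>n x. V n x - v x"] iV v by auto
  define D where "D = (\<lambda>n x. (V n x - v x) / t n)"
  have [measurable]: "D n \<in> borel_measurable borel" for n unfolding D_def by measurable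
  have iD: "integrable lborel (D n)" for n unfolding D_def using iV v by simp
  have D: "(\<lambda>n. \<integral>x. \<bar>D n x - g x\<bar> \<partial>lborel) \<longlonglongrightarrow> 0"
    using filterlim_compose[OF wgrad_difference_quotient[OF w b] tr] by (simp add: D_def V_def g_def)
  \<comment> \<open>The value \<phi>' on the set where both arguments coincide makes the slope
    continuous in its first argument, while the factorisation \<open>Qe\<close> remains valid there
    trivially.\<close>
  define Q where "Q = (\<lambda>n x. if V n x = v x then \<phi>' (v x) else (\<phi> (V n x) - \<phi> (v x)) / (V n x - v x))"
  have [measurable]: "Q n \<in> borel_measurable borel" for n unfolding Q_def by measurable
  have Qb: "\<bar>Q n x\<bar> \<le> M" for n x
  proof (cases "V n x = v x")
    case True thus ?thesis using M by (simp add: Q_def)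
  next
    case False
    hence "\<bar>\<phi> (V n x) - \<phi> (v x)\<bar> / \<bar>V n x - v x\<bar> \<le> M"
      using lip[of "V n x" "v x"] by (subst pos_divide_le_eq) simp_all
    thus ?thesis using False by (simp add: Q_def)
  qed
  have Qe: "\<phi> (V n x) - \<phi> (v x) = Q n x * (V n x - v x)" for n x by (auto simp: Q_def)
  have Ql: "AE x in lborel. (\<lambda>n. Q (r n) x) \<longlonglongrightarrow> \<phi>' (v x)"
    using r(2)
  proof eventually_elim
    case (elim x)
    have Vl: "(\<lambda>n. V (r n) x) \<longlonglongrightarrow> v x" using elim by (simp add: LIM_zero_iff)
    define q where "q = (\<lambda>s. if s = v x then \<phi>' (v x) else (\<phi> s - \<phi> (v x)) / (s - v x))"
    have "((\<lambda>s. (\<phi> s - \<phi> (v x)) / (s - v x)) \<longlongrightarrow> \<phi>' (v x)) (at (v x))"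
      using d[of "v x"] by (simp add: has_field_derivative_iff)
    hence "(q \<longlongrightarrow> \<phi>' (v x)) (at (v x))"
      by (rule tendsto_cong[THEN iffD1, rotated]) (auto simp: q_def eventually_at_filter)
    hence "isCont q (v x)" by (simp add: isCont_def q_def)
    from isCont_tendsto_compose[OF this Vl] show ?case by (simp add: q_def Q_def)
  qed
  \<comment> \<open>Discrete integration by parts: a translation by t b moves the difference
    quotient from the test function to the composition.\<close>
  have id: "(LBINT x. \<phi> (v x) * ((\<psi> (x + t n *\<^sub>R - b) - \<psi> x) / t n)) = (LBINT x. Q n x * D n x * \<psi> x)" for n
  proof -
    have i1: "integrable lborel (\<lambda>x. \<phi> (v x) * \<psi> (x + t n *\<^sub>R - b))"
      using integrable_mult_test(1)[OF iv test_functions_translate[OF \<psi>]] .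
    have i2: "integrable lborel (\<lambda>x. \<phi> (v x) * \<psi> x)" using integrable_mult_test(1)[OF iv \<psi>] .
    have i3: "integrable lborel (\<lambda>x. \<phi> (V n x) * \<psi> x)"
      using integrable_mult_test(1)[OF integrable_lborel_shift[OF iv] \<psi>] by (simp add: V_def)
    have "(LBINT x. \<phi> (v x) * ((\<psi> (x + t n *\<^sub>R - b) - \<psi> x) / t n))
      = ((LBINT x. \<phi> (v x) * \<psi> (x + t n *\<^sub>R - b)) - (LBINT x. \<phi> (v x) * \<psi> x)) / t n"
      using i1 i2 by (simp add: right_diff_distrib)
    also have "(LBINT x. \<phi> (v x) * \<psi> (x + t n *\<^sub>R - b)) = (LBINT x. \<phi> (V n x) * \<psi> x)"
      using integral_lborel_shift[of "\<lambda>x. \<phi> (v x) * \<psi> (x + t n *\<^sub>R - b)" "t n *\<^sub>R b"] by (simp add: V_def)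
    also have "((LBINT x. \<phi> (V n x) * \<psi> x) - (LBINT x. \<phi> (v x) * \<psi> x)) / t n
      = (LBINT x. (\<phi> (V n x) - \<phi> (v x)) * \<psi> x / t n)"
      using i2 i3 by (simp add: left_diff_distrib)
    also have "\<dots> = (LBINT x. Q n x * D n x * \<psi> x)"
      by (rule Bochner_Integration.integral_cong) (auto simp: Qe D_def)
    finally show ?thesis .
  qed
  have L1: "(\<lambda>n. \<integral>x. \<phi> (v x) * ((\<psi> (x + t n *\<^sub>R - b) - \<psi> x) / t n) \<partial>lborel) \<longlonglongrightarrow> (LBINT x. \<phi> (v x) * (- dderiv \<psi> b x))"
  proof (rule integral_dominated_convergence[where w="\<lambda>x. \<bar>\<phi> (v x)\<bar> * B"])
    show "AE x in lborel. (\<lambda>n. \<phi> (v x) * ((\<psi> (x + t n *\<^sub>R - b) - \<psi> x) / t n)) \<longlonglongrightarrow> \<phi> (v x) * (- dderiv \<psi> b x)"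
    proof (intro AE_I2 tendsto_intros)
      fix x
      have "((\<lambda>h. (\<psi> (x + h *\<^sub>R - b) - \<psi> x) / h) \<longlongrightarrow> - dderiv \<psi> b x) (at 0)"
        using psider[of x 0] by (simp add: has_field_derivative_iff)
      moreover have "filterlim t (at 0) sequentially" using filterlim_mono[OF tr at_le[of "{0<..}" UNIV]] by simp
      ultimately show "(\<lambda>n. (\<psi> (x + t n *\<^sub>R - b) - \<psi> x) / t n) \<longlonglongrightarrow> - dderiv \<psi> b x"
        by (rule filterlim_compose)
    qed
    show "AE x in lborel. norm (\<phi> (v x) * ((\<psi> (x + t n *\<^sub>R - b) - \<psi> x) / t n)) \<le> \<bar>\<phi> (v x)\<bar> * B" for n
    proof (rule AE_I2)
      fix x
      have "\<bar>\<psi> (x + t n *\<^sub>R - b) - \<psi> (x + 0 *\<^sub>R - b)\<bar> \<le> B * \<bar>t n - 0\<bar>"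
        using B(3) by (intro lipschitz_of_bounded_deriv[OF psider]) auto
      hence "\<bar>(\<psi> (x + t n *\<^sub>R - b) - \<psi> x) / t n\<bar> \<le> B" using t[of n] by (simp add: divide_le_eq)
      thus "norm (\<phi> (v x) * ((\<psi> (x + t n *\<^sub>R - b) - \<psi> x) / t n)) \<le> \<bar>\<phi> (v x)\<bar> * B"
        unfolding real_norm_def abs_mult by (rule mult_left_mono) simp
    qed
  qed (use iv in auto)
  have L2: "(\<lambda>n. \<integral>x. Q (r n) x * D (r n) x * \<psi> x \<partial>lborel) \<longlonglongrightarrow> (LBINT x. \<phi>' (v x) * g x * \<psi> x)"
  proof -
    have iQ: "integrable lborel (\<lambda>x. h x * Q n x * \<psi> x)" if "integrable lborel h" for h n
      by (rule integrable_mult_test(1)[OF integrable_mult_bounded[OF that _ Qb] \<psi>]) simp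
    have A: "(\<lambda>n. \<integral>x. g x * Q (r n) x * \<psi> x \<partial>lborel) \<longlonglongrightarrow> (LBINT x. g x * \<phi>' (v x) * \<psi> x)"
    proof (rule integral_dominated_convergence[where w="\<lambda>x. \<bar>g x\<bar> * M * B"])
      show "AE x in lborel. (\<lambda>n. g x * Q (r n) x * \<psi> x) \<longlonglongrightarrow> g x * \<phi>' (v x) * \<psi> x"
        using Ql by eventually_elim (intro tendsto_intros)
      show "AE x in lborel. norm (g x * Q (r n) x * \<psi> x) \<le> \<bar>g x\<bar> * M * B" for n
        unfolding real_norm_def abs_mult using Qb B M0 by (intro AE_I2 mult_mono) auto
    qed (use g in auto)
    have "(\<lambda>n. \<integral>x. (D (r n) x - g x) * Q (r n) x * \<psi> x \<partial>lborel) \<longlonglongrightarrow> 0"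
    proof (rule Lim_null_comparison)
      show "\<forall>\<^sub>F n in sequentially. norm (LBINT x. (D (r n) x - g x) * Q (r n) x * \<psi> x) \<le> M * B * (LBINT x. \<bar>D (r n) x - g x\<bar>)"
      proof (intro always_eventually allI)
        fix n
        have "norm (LBINT x. (D (r n) x - g x) * Q (r n) x * \<psi> x) \<le> (LBINT x. norm ((D (r n) x - g x) * Q (r n) x * \<psi> x))"
          by (rule integral_norm_bound)
        also have "\<dots> \<le> (LBINT x. \<bar>D (r n) x - g x\<bar> * (M * B))"
          unfolding real_norm_def abs_mult mult.assoc
          using Qb B M0 iD g iQ[OF Bochner_Integration.integrable_diff[OF iD g], of "r n"]
          by (intro integral_mono mult_left_mono mult_mono) (auto simp: mult.assoc abs_mult[symmetric])
        finally show "norm (LBINT x. (D (r n) x - g x) * Q (r n) x * \<psi> x) \<le> M * B * (LBINT x. \<bar>D (r n) x - g x\<bar>)"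
          by (simp add: mult.commute)
      qed
      have "(\<lambda>n. \<integral>x. \<bar>D (r n) x - g x\<bar> \<partial>lborel) \<longlonglongrightarrow> 0"
        using LIMSEQ_subseq_LIMSEQ[OF D r(1)] by (simp add: o_def)
      from tendsto_mult_right_zero[OF this]
      show "(\<lambda>n. M * B * (LBINT x. \<bar>D (r n) x - g x\<bar>)) \<longlonglongrightarrow> 0" .
    qed
    from tendsto_add[OF this A]
    have "(\<lambda>n. (LBINT x. (D (r n) x - g x) * Q (r n) x * \<psi> x) + (LBINT x. g x * Q (r n) x * \<psi> x)) \<longlonglongrightarrow> (LBINT x. g x * \<phi>' (v x) * \<psi> x)"
      by simp
    moreover have "(LBINT x. (D n x - g x) * Q n x * \<psi> x) + (LBINT x. g x * Q n x * \<psi> x) = (LBINT x. Q n x * D n x * \<psi> x)" for n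
    proof -
      have "(LBINT x. (D n x - g x) * Q n x * \<psi> x) + (LBINT x. g x * Q n x * \<psi> x)
        = (LBINT x. (D n x - g x) * Q n x * \<psi> x + g x * Q n x * \<psi> x)"
        by (rule Bochner_Integration.integral_add[symmetric]) (intro iQ Bochner_Integration.integrable_diff iD g)+
      thus ?thesis by (simp add: algebra_simps)
    qed
    ultimately show ?thesis by (simp add: mult.commute)
  qed
  have "(\<lambda>n. \<integral>x. Q (r n) x * D (r n) x * \<psi> x \<partial>lborel) \<longlonglongrightarrow> (LBINT x. \<phi> (v x) * (- dderiv \<psi> b x))"
    using LIMSEQ_subseq_LIMSEQ[OF L1 r(1)] unfolding o_def id .
  from LIMSEQ_unique[OF this L2]
  show "(LBINT x. \<phi> (v x) * dderiv \<psi> b x) = - (LBINT x. (\<phi>' (v x) *\<^sub>R G x \<bullet> b) * \<psi> x)"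
    by (simp add: g_def)
qed

lemma has_derivative_pos_part_sq:
  "((\<lambda>s::real. (max 0 s)\<^sup>2) has_real_derivative 2 * max 0 s) (at s)"
proof -
  consider "s < 0" | "s > 0" | "s = 0" by linarith
  thus ?thesis
  proof cases
    case 1
    have "((\<lambda>s::real. 0) has_real_derivative 0) (at s)" by simp
    hence "((\<lambda>s::real. (max 0 s)\<^sup>2) has_real_derivative 0) (at s)"
      by (rule has_field_derivative_transform_within_open[where S="{..<0}"]) (use 1 in auto)
    thus ?thesis using 1 by simp
  next
    case 2
    have "((\<lambda>s::real. s\<^sup>2) has_real_derivative 2 * s) (at s)" by (auto intro!: derivative_eq_intros)
    hence "((\<lambda>s::real. (max 0 s)\<^sup>2) has_real_derivative 2 * s) (at s)"
      by (rule has_field_derivative_transform_within_open[where S="{0<..}"]) (use 2 in auto)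
    thus ?thesis using 2 by simp
  next
    case 3
    have "((\<lambda>h::real. max 0 h) \<longlongrightarrow> max 0 0) (at 0)" by (intro tendsto_intros)
    moreover have "((max 0 (0 + h))\<^sup>2 - (max 0 (0::real))\<^sup>2) / h = max 0 h" for h :: real
      by (cases "h > 0") (auto simp: max_def power2_eq_square)
    ultimately show ?thesis using 3 by (simp add: DERIV_def)
  qed
qed

text \<open>The approximations sqrt (((s-k)_+)^2 + d^2) - d are continuously differentiable, have
  slope at most one and slope 0 for s \<le> k; hence the limit gradient carries the strict
  superlevel set and vanishes on {v = k}. The sign of k ensures that 0 is mapped to 0, which keeps
  everything integrable.\<close>

lemma wgrad_pos_part:
  assumes w: "wgrad v G" and k: "k \<ge> 0"
  shows "wgrad (\<lambda>x. max 0 (v x - k)) (\<lambda>x. indicator {y. v y > k} x *\<^sub>R G x)"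
proof -
  note v = wgradD(1)[OF w] and G = wgradD(2)[OF w]
  define d where "d = (\<lambda>n. 1 / real (Suc n))"
  have d: "d n > 0" for n by (simp add: d_def)
  have d0: "d \<longlonglongrightarrow> 0" unfolding d_def using LIMSEQ_inverse_real_of_nat by (simp add: inverse_eq_divide)
  define P where "P = (\<lambda>n s. sqrt ((max 0 (s - k))\<^sup>2 + (d n)\<^sup>2) - d n)"
  define P' where "P' = (\<lambda>n s. max 0 (s - k) / sqrt ((max 0 (s - k))\<^sup>2 + (d n)\<^sup>2))"
  have pos: "(max 0 (s - k))\<^sup>2 + (d n)\<^sup>2 > 0" for n s using d[of n] by (intro add_nonneg_pos) auto
  have der: "(P n has_real_derivative P' n s) (at s)" for n s
  proof -
    have "((\<lambda>s. (max 0 (s - k))\<^sup>2) has_real_derivative 2 * max 0 (s - k)) (at s)"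
    proof -
      have "((\<lambda>s. s - k) has_real_derivative 1) (at s)" by (auto intro!: derivative_eq_intros)
      from DERIV_chain2[OF has_derivative_pos_part_sq this] show ?thesis by simp
    qed
    from DERIV_chain2[where g="\<lambda>s. (max 0 (s - k))\<^sup>2 + (d n)\<^sup>2", OF DERIV_real_sqrt[OF pos] DERIV_add[OF this DERIV_const]]
    have "((\<lambda>s. sqrt ((max 0 (s - k))\<^sup>2 + (d n)\<^sup>2)) has_real_derivative P' n s) (at s)"
      by (simp add: P'_def field_simps)
    from DERIV_diff[OF this DERIV_const] show ?thesis by (simp add: P_def)
  qed
  have c: "continuous_on UNIV (P' n)" for n
    unfolding P'_def using pos[of _ n] by (intro continuous_intros) (auto simp: less_imp_neq[symmetric])
  have b: "\<bar>P' n s\<bar> \<le> 1" for n s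
  proof -
    have "max 0 (s - k) \<le> sqrt ((max 0 (s - k))\<^sup>2 + (d n)\<^sup>2)" by (rule real_le_rsqrt) simp
    thus ?thesis using pos[of s n] by (simp add: P'_def divide_le_eq)
  qed
  have P0: "P n 0 = 0" for n using k d[of n] by (simp add: P_def)
  have wn: "wgrad (\<lambda>x. P n (v x)) (\<lambda>x. P' n (v x) *\<^sub>R G x)" for n
    by (rule wgrad_chain[OF w der c b P0])
  show ?thesis
  proof (rule wgrad_limit[OF wn])
    show "integrable lborel (\<lambda>x. \<bar>v x\<bar>)" "integrable lborel (\<lambda>x. norm (G x))" using v G by auto
    show "\<bar>P n (v x)\<bar> \<le> \<bar>v x\<bar>" for n x
      using lipschitz_of_bounded_deriv[OF der b, of n "v x" 0] by (simp add: P0)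
    show "norm (P' n (v x) *\<^sub>R G x) \<le> norm (G x)" for n x
      using b[of n "v x"] by (simp add: mult_left_le_one_le)
    show "(\<lambda>n. P n (v x)) \<longlonglongrightarrow> max 0 (v x - k)" for x
    proof -
      have "(\<lambda>n. P n (v x)) \<longlonglongrightarrow> sqrt ((max 0 (v x - k))\<^sup>2 + 0\<^sup>2) - 0"
        unfolding P_def by (intro tendsto_intros d0)
      thus ?thesis by simp
    qed
    show "(\<lambda>n. P' n (v x) *\<^sub>R G x) \<longlonglongrightarrow> indicator {y. k < v y} x *\<^sub>R G x" for x
    proof (cases "v x > k")
      case True
      have "(\<lambda>n. P' n (v x) *\<^sub>R G x) \<longlonglongrightarrow> (max 0 (v x - k) / sqrt ((max 0 (v x - k))\<^sup>2 + 0\<^sup>2)) *\<^sub>R G x"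
        unfolding P'_def using True by (intro tendsto_intros d0) auto
      thus ?thesis using True by simp
    next
      case False
      hence "P' n (v x) = 0" for n by (simp add: P'_def)
      thus ?thesis using False by simp
    qed
  qed
qed

section \<open>Sobolev inequalities\<close>

lemma cutoff_simple:
  fixes x0 :: "'a::euclidean_space"
  assumes "0 < \<rho>" "\<rho> < r"
  obtains \<kappa> where "smooth \<kappa>" "\<And>x. 0 \<le> \<kappa> x" "\<And>x. \<kappa> x \<le> 1" "\<And>x. x \<in> cball x0 \<rho> \<Longrightarrow> \<kappa> x = 1"
    "\<And>x. x \<notin> ball x0 r \<Longrightarrow> \<kappa> x = 0"
proof (rule cutoff_exists[where 'a='a])
  fix L :: real
  assume "\<And>(x0::'a) \<rho> r. 0 < \<rho> \<Longrightarrow> \<rho> < r \<Longrightarrow> \<exists>\<zeta>. cutoff L x0 \<rho> r \<zeta>"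
  from this[OF assms, of x0] show thesis using that unfolding cutoff_def by blast
qed

section \<open>An approximate identity and the pointwise Riesz potential bound\<close>

lemma integral_lborel_affine:
  fixes f :: "'a::euclidean_space \<Rightarrow> real"
  assumes [measurable]: "f \<in> borel_measurable borel" and "c \<noteq> 0"
  shows "(LBINT x. f x) = \<bar>c\<bar> ^ DIM('a) * (LBINT x. f (t + c *\<^sub>R x))"
  by (subst lborel_affine[OF assms(2), of t]) (simp add: integral_density integral_distr)

text \<open>For N \<ge> 3 this is a multiple of the Laplacian of the regularised Newtonian potential
  (\<epsilon>^2 + |z|^2)^(1-N/2). By \<open>poisson_scale\<close> it is a rescaled fixed profile,
  hence an approximate identity up to its total mass.\<close>

definition poisson :: "real \<Rightarrow> 'a::euclidean_space \<Rightarrow> real" where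
  "poisson \<epsilon> z = real DIM('a) * \<epsilon>\<^sup>2 * (\<epsilon>\<^sup>2 + (norm z)\<^sup>2) powr (- real DIM('a) / 2 - 1)"

lemma poisson_measurable [measurable]: "poisson \<epsilon> \<in> borel_measurable borel"
  unfolding poisson_def[abs_def] by measurable

lemma poisson_nonneg: "poisson \<epsilon> z \<ge> 0" by (simp add: poisson_def)

lemma poisson_pos: "\<epsilon> > 0 \<Longrightarrow> poisson \<epsilon> z > 0"
  by (auto simp: poisson_def intro!: mult_pos_pos)

lemma powr_of_square: "x > 0 \<Longrightarrow> (x\<^sup>2) powr a = x powr (2 * a)" for x :: real
  by (simp add: powr_powr[symmetric])

lemma poisson_le:
  fixes z :: "'a::euclidean_space"
  assumes "\<epsilon> > 0" shows "poisson \<epsilon> z \<le> real DIM('a) * \<epsilon>\<^sup>2 * (\<epsilon>\<^sup>2) powr (- real DIM('a) / 2 - 1)"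
  unfolding poisson_def using assms by (intro mult_left_mono powr_mono2') auto

lemma poisson_scale:
  fixes z :: "'a::euclidean_space"
  assumes "\<epsilon> > 0" shows "\<epsilon> ^ DIM('a) * poisson \<epsilon> (\<epsilon> *\<^sub>R z) = poisson 1 z"
proof -
  define n where "n = real DIM('a)"
  define c where "c = 1 + (norm z)\<^sup>2"
  have c: "c > 0" by (simp add: c_def add_pos_nonneg)
  have "\<epsilon>\<^sup>2 + (norm (\<epsilon> *\<^sub>R z))\<^sup>2 = \<epsilon>\<^sup>2 * c" by (simp add: c_def power_mult_distrib algebra_simps)
  moreover have "\<epsilon> ^ DIM('a) = \<epsilon> powr n" using assms by (simp add: n_def powr_realpow)
  moreover have "\<epsilon> powr n * (\<epsilon>\<^sup>2 * (\<epsilon>\<^sup>2 * c) powr (- n / 2 - 1)) = c powr (- n / 2 - 1)"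
  proof -
    have e: "\<epsilon>\<^sup>2 = \<epsilon> powr 2" using assms by simp
    have "(\<epsilon>\<^sup>2 * c) powr (- n / 2 - 1) = \<epsilon> powr (2 * (- n / 2 - 1)) * c powr (- n / 2 - 1)"
      using assms c by (simp only: powr_mult powr_of_square zero_le_power2 less_imp_le)
    hence "\<epsilon> powr n * (\<epsilon>\<^sup>2 * (\<epsilon>\<^sup>2 * c) powr (- n / 2 - 1)) = (\<epsilon> powr n * \<epsilon> powr 2 * \<epsilon> powr (2 * (- n / 2 - 1))) * c powr (- n / 2 - 1)"
      by (simp add: e)
    also have "\<epsilon> powr n * \<epsilon> powr 2 * \<epsilon> powr (2 * (- n / 2 - 1)) = 1"
      using assms by (simp only: powr_add[symmetric]) simp
    finally show ?thesis by simp
  qed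
  ultimately show ?thesis by (simp add: poisson_def n_def[symmetric] c_def mult.left_commute)
qed

lemma poisson_integrable: "integrable lborel (poisson 1 :: 'a::euclidean_space \<Rightarrow> real)"
proof (rule integrableI_bounded)
  obtain C where C: "\<And>\<delta>. \<delta> > 0 \<Longrightarrow>
    (\<integral>\<^sub>+x. indicator (- ball (0::'a) \<delta>) x * norm x powr (- (real DIM('a) + 2))) \<le> ennreal (C * \<delta> powr (DIM('a) - (real DIM('a) + 2)))"
    using norm_powr_far[where 'a='a, of "real DIM('a) + 2"] by auto
  have "(\<integral>\<^sub>+x. norm (poisson 1 (x::'a)))
    \<le> (\<integral>\<^sup>+x. ennreal DIM('a) * indicator (ball (0::'a) 1) x + ennreal DIM('a) * ennreal (indicator (- ball (0::'a) 1) x * norm x powr (- (real DIM('a) + 2))) \<partial>lborel)"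
  proof (rule nn_integral_mono)
    fix x :: 'a
    show "ennreal (norm (poisson 1 x)) \<le> ennreal DIM('a) * indicator (ball (0::'a) 1) x + ennreal DIM('a) * ennreal (indicator (- ball (0::'a) 1) x * norm x powr (- (real DIM('a) + 2)))"
    proof (cases "x \<in> ball 0 1")
      case True
      thus ?thesis using poisson_le[of 1 x] poisson_nonneg[of 1 x] by (auto intro!: ennreal_leI)
    next
      case False
      hence x: "norm x \<ge> 1" by auto
      have "(1 + (norm x)\<^sup>2) powr (- real DIM('a) / 2 - 1) \<le> ((norm x)\<^sup>2) powr (- real DIM('a) / 2 - 1)"
        using x by (intro powr_mono2') auto
      also have "((norm x)\<^sup>2) powr (- real DIM('a) / 2 - 1) = norm x powr (- (real DIM('a) + 2))"
      proof -
        have "norm x > 0" using x by linarith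
        from powr_of_square[OF this, of "- real DIM('a) / 2 - 1"] show ?thesis by (simp add: algebra_simps)
      qed
      finally have "poisson 1 x \<le> DIM('a) * norm x powr (- (real DIM('a) + 2))"
        by (simp add: poisson_def mult_left_mono)
      thus ?thesis using False poisson_nonneg[of 1 x] by (simp add: ennreal_mult'[symmetric] ennreal_leI)
    qed
  qed
  also have "\<dots> = ennreal DIM('a) * emeasure lborel (ball (0::'a) 1) + ennreal DIM('a) * (\<integral>\<^sub>+x. indicator (- ball (0::'a) 1) x * norm x powr (- (real DIM('a) + 2)))"
    by (subst nn_integral_add)
      (auto simp: nn_integral_cmult nn_integral_cmult_indicator intro!: borel_measurable_times_ennreal borel_measurable_indicator)
  also have "\<dots> < \<infinity>"
    using C[of 1] emeasure_lborel_ball_finite[of "0::'a" 1]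
    by (auto simp: ennreal_mult_less_top intro: le_less_trans)
  finally show "(\<integral>\<^sub>+x. norm (poisson 1 (x::'a))) < \<infinity>" .
qed simp

text \<open>The mass itself is never computed: its reciprocal becomes the constant in
  \<open>riesz_bound\<close>, so positivity is all that matters.\<close>

lemma poisson_integral_pos: "(LBINT x. poisson 1 (x::'a::euclidean_space)) > 0"
proof (rule ccontr)
  assume "\<not> ?thesis"
  moreover have "(LBINT x. poisson 1 (x::'a)) \<ge> 0" by (simp add: poisson_nonneg)
  ultimately have "(LBINT x. poisson 1 (x::'a)) = 0" by linarith
  hence "AE x in lborel. poisson 1 (x::'a) = 0"
    by (subst (asm) integral_nonneg_eq_0_iff_AE) (auto simp: poisson_integrable poisson_nonneg)
  hence "AE x in (lborel :: 'a measure). False"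
    by (rule eventually_mono) (use poisson_pos[of 1] in \<open>metis less_irrefl zero_less_one\<close>)
  thus False by (simp add: AE_iff_null null_sets_def)
qed

abbreviation riesz :: "('a::euclidean_space \<Rightarrow> 'a) \<Rightarrow> 'a \<Rightarrow> ennreal"
  where "riesz G x \<equiv> \<integral>\<^sub>+y. norm (G y) * norm (x - y) powr (1 - real DIM('a))"

text \<open>The kernel \<open>poisson \<epsilon>\<close> is the divergence of \<open>z (\<epsilon>\<^sup>2 + |z|\<^sup>2)\<^sup>-\<^sup>N\<^sup>/\<^sup>2\<close>, whose norm is at most \<open>|z|\<^sup>1\<^sup>-\<^sup>N\<close>.\<close>

lemma poisson_potential_bound:
  fixes v :: "'a::euclidean_space \<Rightarrow> real"
  assumes w: "wgrad v G" and M: "M > 0" "\<And>x. norm x > M \<Longrightarrow> v x = 0" and e: "\<epsilon> > 0"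
  shows "ennreal \<bar>\<integral>y. v y * poisson \<epsilon> (x - y) \<partial>lborel\<bar>
     \<le> riesz G x"
proof -
  define n where "n = real DIM('a)"
  define q where "q = (\<lambda>y. \<epsilon>\<^sup>2 + (norm (y - x))\<^sup>2)"
  have q: "q y > 0" for y using e by (simp add: q_def add_pos_nonneg)
  \<comment> \<open>The b-th component of the vector field (x-y) (\<epsilon>^2 + |x-y|^2)^(-N/2), as
    a function of y; its divergence in y is minus the kernel.\<close>
  define h where "h = (\<lambda>b y. (x \<bullet> b + (- 1) * (y \<bullet> b)) * q y powr (- n / 2))"
  have smq: "smooth q" unfolding q_def by (intro smooth_add smooth_const smooth_norm_sq)
  have smh: "smooth (h b)" for b
    unfolding h_def by (intro smooth_mult smooth_add smooth_const smooth_inner smooth_powr smq q)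
  have dh: "dderiv (h b) b y = - (q y powr (- n / 2)) + n * ((x - y) \<bullet> b)\<^sup>2 * q y powr (- n / 2 - 1)" if b: "b \<in> Basis" for b y
  proof -
    have "((\<lambda>y. (norm (y - x))\<^sup>2) has_derivative (\<lambda>k. 2 * ((y - x) \<bullet> k))) (at y)"
      unfolding power2_norm_eq_inner by (auto intro!: derivative_eq_intros simp: inner_commute)
    from has_derivative_add[OF has_derivative_const this]
    have dq: "(q has_derivative (\<lambda>k. 2 * ((y - x) \<bullet> k))) (at y)" unfolding q_def by simp
    have dp: "((\<lambda>y. q y powr (- n / 2)) has_derivative (\<lambda>k. (- n / 2) * (q y powr (- n / 2 - 1) * (2 * ((y - x) \<bullet> k))))) (at y)"
    proof (rule has_derivative_eq_rhs[OF has_derivative_powr[OF dq has_derivative_const, of "- n / 2"]])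
      have "q y powr (- n / 2) = q y powr (- n / 2 - 1) * q y" using q[of y] by (simp add: powr_diff)
      thus "(\<lambda>k. q y powr (- n / 2) * (0 * ln (q y) + 2 * ((y - x) \<bullet> k) * (- n / 2) / q y))
        = (\<lambda>k. - n / 2 * (q y powr (- n / 2 - 1) * (2 * ((y - x) \<bullet> k))))"
        using q[of y] by (intro ext) (simp only:, simp)
    qed (use q in auto)
    have dl: "((\<lambda>y. x \<bullet> b + (- 1) * (y \<bullet> b)) has_derivative (\<lambda>k. - (k \<bullet> b))) (at y)"
      by (auto intro!: derivative_eq_intros)
    have bb: "b \<bullet> b = 1" using b by simp
    have "dderiv (h b) b y = (x \<bullet> b + (- 1) * (y \<bullet> b)) * ((- n / 2) * (q y powr (- n / 2 - 1) * (2 * ((y - x) \<bullet> b)))) + - (b \<bullet> b) * q y powr (- n / 2)"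
      unfolding h_def by (rule dderiv_eqI[OF has_derivative_mult[OF dl dp]])
    thus ?thesis unfolding bb by (simp add: inner_diff_left power2_eq_square algebra_simps)
  qed
  have div: "(\<Sum>b\<in>Basis. dderiv (h b) b y) = - poisson \<epsilon> (x - y)" for y
  proof -
    have "(\<Sum>b\<in>Basis. dderiv (h b) b y) = - (n * (q y powr (- n / 2))) + n * (\<Sum>b\<in>Basis. ((x - y) \<bullet> b)\<^sup>2) * q y powr (- n / 2 - 1)"
      by (simp add: dh sum.distrib sum_subtractf sum_distrib_left sum_distrib_right sum_negf n_def mult.assoc)
    also have "(\<Sum>b\<in>Basis. ((x - y) \<bullet> b)\<^sup>2) = (norm (y - x))\<^sup>2"
    proof -
      have "(norm (y - x))\<^sup>2 = (x - y) \<bullet> (x - y)" by (simp add: norm_minus_commute[of y x] power2_norm_eq_inner)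
      also have "\<dots> = (\<Sum>b\<in>Basis. ((x - y) \<bullet> b)\<^sup>2)" by (subst euclidean_inner) (simp only: power2_eq_square)
      finally show ?thesis by simp
    qed
    also have "q y powr (- n / 2) = q y powr (- n / 2 - 1) * q y"
      using q[of y] by (simp add: powr_diff)
    finally show ?thesis by (simp add: poisson_def n_def q_def norm_minus_commute algebra_simps)
  qed
  \<comment> \<open>The field does not have compact support. Multiplying by a cut-off that is one
    near the support of v turns its components into test functions without changing the integrals
    against v.\<close>
  obtain \<kappa> where \<kappa>: "smooth \<kappa>" "\<And>x. 0 \<le> \<kappa> x" "\<And>x. \<kappa> x \<le> 1" "\<And>x. x \<in> cball (0::'a) (M + 1) \<Longrightarrow> \<kappa> x = 1"
    "\<And>x. x \<notin> ball 0 (M + 2) \<Longrightarrow> \<kappa> x = 0"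
    using cutoff_simple[of "M + 1" "M + 2" "0::'a"] M(1) by auto
  have [measurable]: "\<kappa> \<in> borel_measurable borel" by (rule smooth_measurable[OF \<kappa>(1)])
  have [measurable]: "q \<in> borel_measurable borel" by (rule smooth_measurable[OF smq])
  have t: "(\<lambda>y. \<kappa> y * h b y) \<in> test_functions UNIV" for b
    by (rule test_functionI[of _ "cball 0 (M + 2)"]) (use \<kappa> in \<open>auto intro!: smooth_mult smh\<close>)
  have d1: "v y * dderiv (\<lambda>y. \<kappa> y * h b y) b y = v y * dderiv (h b) b y" for b y
  proof (cases "norm y > M")
    case False
    have "(h b has_derivative frechet_derivative (h b) (at y)) (at y)" by (rule smooth_has_derivative[OF smh])
    hence "((\<lambda>y. \<kappa> y * h b y) has_derivative frechet_derivative (h b) (at y)) (at y)"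
      by (rule has_derivative_transform_within_open[of _ _ _ _ "ball 0 (M + 1)"]) (use False \<kappa>(4) in auto)
    thus ?thesis by (simp add: dderiv_eqI)
  qed (simp add: M(2))
  have i1: "integrable lborel (\<lambda>y. v y * dderiv (h b) b y)" if "b \<in> Basis" for b
    using integrable_mult_test(2)[OF wgradD(1)[OF w] t[of b] that] unfolding d1 .
  have i2: "integrable lborel (\<lambda>y. (G y \<bullet> b) * (\<kappa> y * h b y))" for b
    by (rule integrable_mult_test(1)[OF wgradD(3)[OF w] t])
  have "- (LBINT y. v y * poisson \<epsilon> (x - y)) = (LBINT y. (\<Sum>b\<in>Basis. v y * dderiv (h b) b y))"
    by (simp add: sum_distrib_left[symmetric] div)
  also have "\<dots> = (\<Sum>b\<in>Basis. (LBINT y. v y * dderiv (h b) b y))"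
    by (rule Bochner_Integration.integral_sum[OF i1])
  also have "\<dots> = (\<Sum>b\<in>Basis. - (LBINT y. (G y \<bullet> b) * (\<kappa> y * h b y)))"
  proof (rule sum.cong[OF refl])
    fix b :: 'a assume b: "b \<in> Basis"
    show "(LBINT y. v y * dderiv (h b) b y) = - (LBINT y. (G y \<bullet> b) * (\<kappa> y * h b y))"
      using wgrad_test[OF w t[of b] b] unfolding d1 .
  qed
  also have "\<dots> = - (LBINT y. (\<Sum>b\<in>Basis. (G y \<bullet> b) * (\<kappa> y * h b y)))"
    by (simp add: sum_negf Bochner_Integration.integral_sum[OF i2])
  finally have "ennreal \<bar>\<integral>y. v y * poisson \<epsilon> (x - y) \<partial>lborel\<bar> = ennreal (norm (LBINT y. (\<Sum>b\<in>Basis. (G y \<bullet> b) * (\<kappa> y * h b y))))"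
    by simp
  also have "\<dots> \<le> (\<integral>\<^sub>+y. norm (\<Sum>b\<in>Basis. (G y \<bullet> b) * (\<kappa> y * h b y)))"
    by (intro integral_norm_bound_ennreal Bochner_Integration.integrable_sum i2)
  also have "\<dots> \<le> (\<integral>\<^sub>+y. norm (G y) * norm (x - y) powr (1 - n))"
  proof (intro nn_integral_mono ennreal_leI)
    fix y
    have "(\<Sum>b\<in>Basis. (G y \<bullet> b) * (\<kappa> y * h b y)) = \<kappa> y * q y powr (- n / 2) * (\<Sum>b\<in>Basis. (G y \<bullet> b) * ((x - y) \<bullet> b))"
      by (simp add: h_def sum_distrib_left inner_diff_left algebra_simps)
    also have "\<dots> = \<kappa> y * q y powr (- n / 2) * (G y \<bullet> (x - y))" by (simp add: euclidean_inner[of "G y" "x - y"])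
    finally have "norm (\<Sum>b\<in>Basis. (G y \<bullet> b) * (\<kappa> y * h b y)) = \<kappa> y * q y powr (- n / 2) * \<bar>G y \<bullet> (x - y)\<bar>"
      using \<kappa>(2)[of y] by (simp add: abs_mult)
    also have "\<dots> \<le> 1 * q y powr (- n / 2) * (norm (G y) * norm (x - y))"
      using \<kappa> Cauchy_Schwarz_ineq2 by (intro mult_mono) auto
    also have "\<dots> = norm (G y) * (q y powr (- n / 2) * norm (x - y))" by simp
    also have "q y powr (- n / 2) * norm (x - y) \<le> norm (x - y) powr (1 - n)"
    proof (cases "x = y")
      case False
      hence z: "norm (y - x) > 0" by simp
      have "q y powr (- n / 2) \<le> ((norm (y - x))\<^sup>2) powr (- n / 2)"
        using z by (intro powr_mono2') (auto simp: q_def n_def)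
      also have "((norm (y - x))\<^sup>2) powr (- n / 2) = norm (y - x) powr (- n)"
        using powr_of_square[OF z, of "- n / 2"] by simp
      finally have "q y powr (- n / 2) \<le> norm (y - x) powr (- n)" .
      hence "q y powr (- n / 2) * norm (x - y) \<le> norm (y - x) powr (- n) * norm (y - x)"
        by (simp add: norm_minus_commute mult_right_mono)
      also have "\<dots> = norm (x - y) powr (1 - n)"
        using z by (simp add: norm_minus_commute[of x y] powr_diff powr_minus field_simps)
      finally show ?thesis .
    qed simp
    finally show "norm (\<Sum>b\<in>Basis. (G y \<bullet> b) * (\<kappa> y * h b y)) \<le> norm (G y) * norm (x - y) powr (1 - n)"
      by (simp add: mult_left_mono)
  qed
  finally show ?thesis by (simp add: n_def)
qed

text \<open>After rescaling, the convolution minus mass times v is an average of translation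
  differences of v. Its L^1 norm is at most the integral of the translation modulus \<omega>(-t z)
  against the profile, which tends to 0; a subsequence then converges almost everywhere.\<close>

lemma poisson_convolution_converges:
  fixes v :: "'a::euclidean_space \<Rightarrow> real"
  assumes v: "integrable lborel v"
  obtains \<epsilon> where "\<And>n. \<epsilon> n > (0::real)"
    "AE x in lborel. (\<lambda>n::nat. \<integral>y. v y * poisson (\<epsilon> n) (x - y) \<partial>lborel) \<longlonglongrightarrow> (LBINT z. poisson 1 (z::'a)) * v x"
proof -
  have [measurable]: "v \<in> borel_measurable borel" using v by (simp add: borel_measurable_integrable)
  define t where "t = (\<lambda>n. 1 / real (Suc n))"
  have t: "t n > 0" for n by (simp add: t_def)
  have t0: "t \<longlonglongrightarrow> 0" unfolding t_def using LIMSEQ_inverse_real_of_nat by (simp add: inverse_eq_divide)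
  let ?\<eta> = "poisson 1 :: 'a \<Rightarrow> real"
  define c where "c = (LBINT z. ?\<eta> z)"
  \<comment> \<open>The L^1 modulus of translation. The bound by twice the L^1 norm serves as the
    dominating constant, its continuity at 0 gives the limit.\<close>
  define \<omega> where "\<omega> = (\<lambda>h. \<integral>x. \<bar>v (x + h) - v x\<bar> \<partial>lborel)"
  have ish: "integrable lborel (\<lambda>x. v (x + h))" for h by (rule integrable_lborel_shift[OF v])
  have \<omega>0: "\<omega> h \<ge> 0" for h by (simp add: \<omega>_def)
  have \<omega>b: "\<omega> h \<le> 2 * (LBINT x. \<bar>v x\<bar>)" for h
  proof -
    have "\<omega> h \<le> (LBINT x. \<bar>v (x + h)\<bar> + \<bar>v x\<bar>)"
      unfolding \<omega>_def using v ish by (intro integral_mono) auto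
    also have "\<dots> = (LBINT x. \<bar>v (x + h)\<bar>) + (LBINT x. \<bar>v x\<bar>)" using v ish by simp
    also have "(LBINT x. \<bar>v (x + h)\<bar>) = (LBINT x. \<bar>v x\<bar>)"
      using integral_lborel_shift[of "\<lambda>x. \<bar>v x\<bar>" h] by simp
    finally show ?thesis by simp
  qed
  have [measurable]: "\<omega> \<in> borel_measurable borel"
    unfolding \<omega>_def by measurable
  define F where "F = (\<lambda>n z x. (v (x - t n *\<^sub>R z) - v x) * ?\<eta> z)"
  have [measurable]: "case_prod (F n) \<in> borel_measurable (borel \<Otimes>\<^sub>M borel)" for n
    unfolding F_def by measurable
  have nF: "(LBINT x. norm (F n z x)) = \<omega> (- t n *\<^sub>R z) * ?\<eta> z" for n z
    using poisson_nonneg[of 1 z] by (simp add: F_def \<omega>_def abs_mult)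
  have iw: "integrable lborel (\<lambda>z. \<omega> (- t n *\<^sub>R z) * ?\<eta> z)" for n
  proof (rule Bochner_Integration.integrable_bound)
    show "integrable lborel (\<lambda>z. 2 * (LBINT x. \<bar>v x\<bar>) * ?\<eta> z)" by (intro integrable_mult_right poisson_integrable)
    show "AE z in lborel. norm (\<omega> (- t n *\<^sub>R z) * ?\<eta> z) \<le> norm (2 * (LBINT x. \<bar>v x\<bar>) * ?\<eta> z)"
      using \<omega>b \<omega>0 by (intro AE_I2) (auto simp: abs_mult poisson_nonneg intro!: mult_right_mono)
  qed simp
  have iF: "integrable (lborel \<Otimes>\<^sub>M lborel) (\<lambda>(z, x). F n z x)" for n
  proof (rule lborel_pair.Fubini_integrable)
    show "integrable lborel (\<lambda>z. \<integral>x. norm (case (z, x) of (z, x) \<Rightarrow> F n z x) \<partial>lborel)"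
      using iw[of n] unfolding nF[symmetric] by simp
    show "AE z in lborel. integrable lborel (\<lambda>x. case (z, x) of (z, x) \<Rightarrow> F n z x)"
      using v ish[of "- t n *\<^sub>R _"] by (simp add: F_def)
  qed simp
  define E where "E = (\<lambda>n x. \<integral>z. F n z x \<partial>lborel)"
  have iE: "integrable lborel (E n)" for n
    using lborel_pair.integrable_snd[OF iF[of n]] by (simp add: E_def)
  have nE: "(LBINT x. norm (E n x)) \<le> (LBINT z. \<omega> (- t n *\<^sub>R z) * ?\<eta> z)" for n
  proof -
    have iN: "integrable (lborel \<Otimes>\<^sub>M lborel) (\<lambda>(z, x). norm (F n z x))"
      using integrable_norm[OF iF[of n]] by (simp add: case_prod_unfold)
    have "(LBINT x. norm (E n x)) \<le> (LBINT x. (LBINT z. norm (F n z x)))"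
      using iE lborel_pair.integrable_snd[OF iN]
      by (intro integral_mono) (auto simp: E_def intro: integral_norm_bound)
    also have "\<dots> = (LBINT z. (LBINT x. norm (F n z x)))"
      by (rule lborel_pair.Fubini_integral[OF iN])
    finally show ?thesis unfolding nF .
  qed
  have "(\<lambda>n. \<integral>z. \<omega> (- t n *\<^sub>R z) * ?\<eta> z \<partial>lborel) \<longlonglongrightarrow> (\<integral>z. 0 \<partial>(lborel :: 'a measure))"
  proof (rule integral_dominated_convergence[where w="\<lambda>z. 2 * (LBINT x. \<bar>v x\<bar>) * ?\<eta> z"])
    show "integrable lborel (\<lambda>z. 2 * (LBINT x. \<bar>v x\<bar>) * ?\<eta> z)" by (intro integrable_mult_right poisson_integrable)
    show "AE z in lborel. norm (\<omega> (- t n *\<^sub>R z) * ?\<eta> z) \<le> 2 * (LBINT x. \<bar>v x\<bar>) * ?\<eta> z" for n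
      using \<omega>b \<omega>0 by (intro AE_I2) (auto simp: abs_mult poisson_nonneg intro!: mult_right_mono)
    show "AE z in lborel. (\<lambda>n. \<omega> (- t n *\<^sub>R z) * ?\<eta> z) \<longlonglongrightarrow> 0"
    proof (rule AE_I2)
      fix z :: 'a
      have "isCont \<omega> 0"
        using L1_translation_continuous[OF v] by (simp add: isCont_def \<omega>_def)
      moreover have "(\<lambda>n. - t n *\<^sub>R z) \<longlonglongrightarrow> 0"
        using tendsto_scaleR[OF tendsto_minus[OF t0] tendsto_const[of z]] by simp
      ultimately have "(\<lambda>n. \<omega> (- t n *\<^sub>R z)) \<longlonglongrightarrow> \<omega> 0" by (rule isCont_tendsto_compose)
      hence "(\<lambda>n. \<omega> (- t n *\<^sub>R z)) \<longlonglongrightarrow> 0" by (simp add: \<omega>_def)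
      from tendsto_mult_left_zero[OF this] show "(\<lambda>n. \<omega> (- t n *\<^sub>R z) * ?\<eta> z) \<longlonglongrightarrow> 0" .
    qed
  qed auto
  hence "(\<lambda>n. \<integral>z. \<omega> (- t n *\<^sub>R z) * ?\<eta> z \<partial>lborel) \<longlonglongrightarrow> 0" by simp
  from tendsto_sandwich[OF _ _ tendsto_const this, of "\<lambda>n. \<integral>x. norm (E n x) \<partial>lborel"] nE
  have "(\<lambda>n. \<integral>x. norm (E n x) \<partial>lborel) \<longlonglongrightarrow> 0" by (simp add: always_eventually)
  then obtain r :: "nat \<Rightarrow> nat" where r: "strict_mono r" "AE x in lborel. (\<lambda>n. E (r n) x) \<longlonglongrightarrow> 0"
    using tendsto_L1_AE_subseq[of lborel E] iE by auto
  have A: "(LBINT y. v y * poisson (t n) (x - y)) = c * v x + E n x" for n x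
  proof -
    have "(LBINT y. v y * poisson (t n) (x - y)) = (t n) ^ DIM('a) * (LBINT z. v (x + (- t n) *\<^sub>R z) * poisson (t n) (x - (x + (- t n) *\<^sub>R z)))"
      using integral_lborel_affine[of "\<lambda>y. v y * poisson (t n) (x - y)" "- t n" x] t[of n] by simp
    also have "\<dots> = (LBINT z. v (x - t n *\<^sub>R z) * (t n ^ DIM('a) * poisson (t n) (t n *\<^sub>R z)))"
      by (simp add: mult.left_commute)
    also have "\<dots> = (LBINT z. v (x - t n *\<^sub>R z) * ?\<eta> z)" by (simp only: poisson_scale[OF t])
    finally have 1: "(LBINT y. v y * poisson (t n) (x - y)) = (LBINT z. v (x - t n *\<^sub>R z) * ?\<eta> z)" .
    have iv: "integrable lborel (\<lambda>z. v (x + (- t n) *\<^sub>R z))"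
    proof -
      have "integrable lborel (\<lambda>z. v (x + z))" using ish[of x] by (simp add: add.commute)
      hence "(\<integral>\<^sub>+z. \<bar>v (x + z)\<bar>) < \<infinity>" by (simp add: integrable_iff_bounded)
      moreover have "(\<integral>\<^sub>+z. \<bar>v (x + z)\<bar>) = ennreal (\<bar>- t n\<bar> ^ DIM('a)) * (\<integral>\<^sub>+z. \<bar>v (x + (0 + (- t n) *\<^sub>R z))\<bar>)"
        using t[of n] by (intro nn_integral_lborel_affine) auto
      ultimately show ?thesis using t[of n] zero_less_power[OF t[of n], of "DIM('a)"]
        by (auto simp: integrable_iff_bounded ennreal_mult_less_top ennreal_eq_0_iff not_le)
    qed
    have "\<bar>?\<eta> z\<bar> \<le> real DIM('a) * 1\<^sup>2 * (1\<^sup>2) powr (- real DIM('a) / 2 - 1)" for z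
      using poisson_le[of 1 z] poisson_nonneg[of 1 z] by simp
    from integrable_mult_bounded[OF iv _ this]
    have i: "integrable lborel (\<lambda>z. v (x - t n *\<^sub>R z) * ?\<eta> z)" by simp
    have "E n x = (LBINT z. v (x - t n *\<^sub>R z) * ?\<eta> z - v x * ?\<eta> z)"
      by (simp add: E_def F_def left_diff_distrib)
    also have "\<dots> = (LBINT z. v (x - t n *\<^sub>R z) * ?\<eta> z) - v x * c"
      using i by (simp add: c_def poisson_integrable)
    finally show ?thesis using 1 by simp
  qed
  show ?thesis
  proof (rule that[of "\<lambda>n. t (r n)"])
    show "AE x in lborel. (\<lambda>n. \<integral>y. v y * poisson (t (r n)) (x - y) \<partial>lborel) \<longlonglongrightarrow> (LBINT z. poisson 1 (z::'a)) * v x"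
      using r(2)
    proof eventually_elim
      case (elim x)
      from tendsto_add[OF tendsto_const this, of "c * v x"]
      show ?case by (simp add: A c_def)
    qed
  qed (rule t)
qed

text \<open>The estimate in \<open>poisson_potential_bound\<close> is independent of \<epsilon>, so
  it survives the limit of the convolutions.\<close>

lemma riesz_bound:
  obtains C where "C > 0" "\<And>(v :: 'a::euclidean_space \<Rightarrow> real) G M. \<lbrakk>wgrad v G; M > 0; \<And>x. norm x > M \<Longrightarrow> v x = 0\<rbrakk> \<Longrightarrow>
     AE x in lborel. ennreal \<bar>v x\<bar> \<le> ennreal C * riesz G x"
proof -
  define c where "c = (LBINT z. poisson 1 (z::'a))"
  have c: "c > 0" unfolding c_def by (rule poisson_integral_pos)
  show ?thesis
  proof (rule that[of "1 / c"])
    fix v :: "'a \<Rightarrow> real" and G M assume w: "wgrad v G" and M: "M > 0" "\<And>x. norm x > M \<Longrightarrow> v x = 0"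
    obtain \<epsilon> where \<epsilon>0: "\<And>n. \<epsilon> n > (0::real)" and \<epsilon>1:
      "AE x in lborel. (\<lambda>n::nat. \<integral>y. v y * poisson (\<epsilon> n) (x - y) \<partial>lborel) \<longlonglongrightarrow> (LBINT z. poisson 1 (z::'a)) * v x"
      by (rule poisson_convolution_converges[OF wgradD(1)[OF w]]) (rule that)
    note \<epsilon> = \<epsilon>0 \<epsilon>1[folded c_def]
    show "AE x in lborel. ennreal \<bar>v x\<bar> \<le> ennreal (1 / c) * riesz G x"
      using \<epsilon>(2)
    proof eventually_elim
      case (elim x)
      define I where "I = riesz G x"
      have "(\<lambda>n. ennreal \<bar>\<integral>y. v y * poisson (\<epsilon> n) (x - y) \<partial>lborel\<bar>) \<longlonglongrightarrow> ennreal \<bar>c * v x\<bar>"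
        by (intro tendsto_ennrealI tendsto_rabs elim)
      hence "ennreal \<bar>c * v x\<bar> \<le> I"
        unfolding I_def by (rule LIMSEQ_le_const2) (use poisson_potential_bound[OF w M \<epsilon>(1)] in blast)
      hence "ennreal (1 / c) * ennreal \<bar>c * v x\<bar> \<le> ennreal (1 / c) * I" by (rule mult_left_mono) simp
      thus ?case using c by (simp add: I_def ennreal_mult'[symmetric] abs_mult)
    qed
  qed (use c in simp)
qed

section \<open>The Sobolev inequality at the critical exponent\<close>

lemma ennreal_lincomb:
  "c \<ge> 0 \<Longrightarrow> u \<ge> 0 \<Longrightarrow> v \<ge> 0 \<Longrightarrow> ennreal c * (ennreal u + ennreal v) = ennreal (c * (u + v))"
  by (simp add: ennreal_mult' ennreal_plus[symmetric] del: ennreal_plus)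

lemma kernel_measurable:
  fixes B :: "'a::euclidean_space set"
  assumes "B \<in> sets borel"
  shows "(\<lambda>z. indicator B z * norm z powr c :: real) \<in> borel_measurable borel"
proof (rule borel_measurable_times)
  show "(\<lambda>z::'a. norm z powr c) \<in> borel_measurable borel"
    by (rule powr_real_measurable) auto
qed (use assms in auto)

text \<open>Splitting the Riesz kernel at the radius \<open>|E|\<^sup>1\<^sup>/\<^sup>N\<close> for the superlevel set \<open>E\<close> balances the two parts.\<close>

lemma sobolev_weak_type:
  fixes p :: real
  assumes p: "1 < p" "p < DIM('a::euclidean_space)"
  obtains C where "C > 0" "\<And>(v :: 'a \<Rightarrow> real) G M A t. \<lbrakk>wgrad v G; M > 0; \<And>x. norm x > M \<Longrightarrow> v x = 0;
      (\<integral>\<^sub>+x. norm (G x) powr p) \<le> ennreal A; A \<ge> 0; t > 0\<rbrakk> \<Longrightarrow>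
     t powr (DIM('a) * p / (DIM('a) - p)) * measure lborel {x. \<bar>v x\<bar> > t} \<le> C * A powr (DIM('a) / (DIM('a) - p))"
proof -
  define n where "n = real DIM('a)"
  have n: "p < n" "n > 1" using p by (auto simp: n_def)
  obtain p' where p': "p' > 1" "1 / p + 1 / p' = 1" "p' = p / (p - 1)" using conjugate_exponent[OF p(1)] .
  \<comment> \<open>Equivalent to p < N; it makes the p'-th power of the kernel |z|^(1-N) integrable
    at infinity.\<close>
  have np': "(n - 1) * p' > n" unfolding p'(3) using n p by (simp add: field_simps)
  obtain C0 where C0: "C0 > 0" "\<And>(v :: 'a \<Rightarrow> real) G M. \<lbrakk>wgrad v G; M > 0; \<And>x. norm x > M \<Longrightarrow> v x = 0\<rbrakk> \<Longrightarrow>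
     AE x in lborel. ennreal \<bar>v x\<bar> \<le> ennreal C0 * riesz G x"
    using riesz_bound[where 'a='a] by blast
  obtain C1 where C1: "C1 > 0" "\<And>\<delta>. \<delta> > 0 \<Longrightarrow>
    (\<integral>\<^sub>+x. indicator (ball (0::'a) \<delta>) x * norm x powr (- (n - 1))) \<le> ennreal (C1 * \<delta> powr (DIM('a) - (n - 1)))"
    using norm_powr_near[where 'a='a, of "n - 1"] by (auto simp: n_def)
  obtain C2 where C2: "C2 > 0" "\<And>\<delta>. \<delta> > 0 \<Longrightarrow>
    (\<integral>\<^sub>+x. indicator (- ball (0::'a) \<delta>) x * norm x powr (- ((n - 1) * p'))) \<le> ennreal (C2 * \<delta> powr (DIM('a) - (n - 1) * p'))"
    using norm_powr_far[where 'a='a, of "(n - 1) * p'"] np' by (auto simp: n_def)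
  define s where "s = n * p / (n - p)"
  have s: "s > 0" "s * (1 / p - 1 / n) = 1" "s / p = n / (n - p)" using n p by (auto simp: s_def field_simps)
  define C' where "C' = C0 * (C1 + C2 powr (1 / p'))"
  have C': "C' > 0" using C0(1) C1(1) C2(1) by (auto simp: C'_def intro!: mult_pos_pos add_pos_nonneg)
  show ?thesis
  proof (rule that[of "C' powr s"])
    fix v :: "'a \<Rightarrow> real" and G M A t
    assume w: "wgrad v G" and M: "M > 0" "\<And>x. norm x > M \<Longrightarrow> v x = 0"
      and A: "(\<integral>\<^sub>+x. norm (G x) powr p) \<le> ennreal A" "A \<ge> 0" and t: "t > (0::real)"
    have [measurable]: "v \<in> borel_measurable borel" "G \<in> borel_measurable borel" using wgradD(4,5)[OF w] .
    define E where "E = {x. \<bar>v x\<bar> > t}"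
    have [measurable]: "E \<in> sets borel" unfolding E_def by measurable
    have Esub: "E \<subseteq> cball 0 M"
    proof
      fix x assume "x \<in> E"
      thus "x \<in> cball 0 M" using M(2)[of x] t by (cases "norm x > M") (auto simp: E_def)
    qed
    define m where "m = measure lborel E"
    have "emeasure lborel E \<le> emeasure lborel (cball (0::'a) M)" by (rule emeasure_mono[OF Esub]) simp
    hence "emeasure lborel E < \<infinity>" using emeasure_lborel_cball_finite by (rule le_less_trans)
    hence em: "emeasure lborel E = ennreal m" by (simp add: m_def emeasure_eq_ennreal_measure)
    have "t powr s * m \<le> C' powr s * A powr (n / (n - p))"
    proof (cases "m > 0")
      case False
      hence "m = 0" by (simp add: m_def measure_nonneg antisym not_less)
      thus ?thesis by simp
    next
      case m: True
      define \<delta> where "\<delta> = m powr (1 / n)"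
      have d: "\<delta> > 0" using m by (simp add: \<delta>_def)
      define k1 where "k1 = (\<lambda>z::'a. indicator (ball (0::'a) \<delta>) z * norm z powr (1 - n))"
      define k2 where "k2 = (\<lambda>z::'a. indicator (- ball (0::'a) \<delta>) z * norm z powr (1 - n))"
      have k: "norm z powr (1 - n) = k1 z + k2 z" for z by (auto simp: k1_def k2_def indicator_def)
      have k0: "k1 z \<ge> 0" "k2 z \<ge> 0" for z by (auto simp: k1_def k2_def)
      have [measurable]: "k1 \<in> borel_measurable borel" "k2 \<in> borel_measurable borel" unfolding k1_def k2_def by (auto intro!: kernel_measurable)
      have ik1: "(\<integral>\<^sub>+z. k1 z) \<le> ennreal (C1 * \<delta>)"
        using C1(2)[OF d] d by (simp add: k1_def n_def)
      have ik2: "(\<integral>\<^sub>+z. k2 z powr p') \<le> ennreal (C2 * \<delta> powr (n - (n - 1) * p'))"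
      proof -
        have "k2 z powr p' = indicator (- ball 0 \<delta>) z * norm z powr (- ((n - 1) * p'))" for z
          by (auto simp: k2_def indicator_def powr_powr algebra_simps)
        thus ?thesis using C2(2)[OF d] by (simp add: n_def)
      qed
      define g where "g = (\<lambda>x. norm (G x))"
      have [measurable]: "g \<in> borel_measurable borel" unfolding g_def by measurable
      \<comment> \<open>The kernel is split as k1^(1/p) k1^(1/p') and Hoelder is used on the product
        space. Each factor then integrates in one variable to the mass of k1 and in the other to A
        or to the measure of E.\<close>
      have near: "(\<integral>\<^sup>+x. \<integral>\<^sup>+y. ennreal (indicator E x * g y * k1 (x - y)) \<partial>lborel \<partial>lborel) \<le> ennreal (C1 * \<delta> * A powr (1 / p) * m powr (1 / p'))"
      proof -
        define f where "f = (\<lambda>(x::'a, y). g y * k1 (x - y) powr (1 / p))"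
        define h where "h = (\<lambda>(x::'a, y::'a). indicator E x * k1 (x - y) powr (1 / p'))"
        have [measurable]: "f \<in> borel_measurable (lborel \<Otimes>\<^sub>M lborel)" "h \<in> borel_measurable (lborel \<Otimes>\<^sub>M lborel)"
          unfolding f_def h_def by measurable
        have "(\<integral>\<^sup>+z. ennreal (f z powr p) \<partial>(lborel \<Otimes>\<^sub>M lborel)) = (\<integral>\<^sup>+x. \<integral>\<^sup>+y. ennreal (g y powr p * k1 (x - y)) \<partial>lborel \<partial>lborel)"
          using p k0 by (subst lborel.nn_integral_fst[symmetric]) (auto simp: f_def g_def powr_mult powr_powr)
        also have "\<dots> = (\<integral>\<^sup>+y. \<integral>\<^sup>+x. ennreal (g y powr p * k1 (x - y)) \<partial>lborel \<partial>lborel)"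
          by (rule lborel_pair.Fubini') measurable
        also have "\<dots> = (\<integral>\<^sup>+y. ennreal (g y powr p) * (\<integral>\<^sub>+x. k1 x) \<partial>lborel)"
        proof (rule nn_integral_cong)
          fix y
          have "(\<integral>\<^sub>+x. g y powr p * k1 (x - y)) = ennreal (g y powr p) * (\<integral>\<^sub>+x. k1 (x + - y))"
            using k0 by (simp add: ennreal_mult nn_integral_cmult)
          thus "(\<integral>\<^sub>+x. g y powr p * k1 (x - y)) = ennreal (g y powr p) * (\<integral>\<^sub>+x. k1 x)"
            by (simp add: nn_integral_lborel_shift[of "\<lambda>x. ennreal (k1 x)" "- y", simplified])
        qed
        also have "\<dots> = (\<integral>\<^sub>+y. g y powr p) * (\<integral>\<^sub>+x. k1 x)"
          by (rule nn_integral_multc) measurable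
        also have "\<dots> \<le> ennreal A * ennreal (C1 * \<delta>)"
          using A(1) ik1 by (intro mult_mono) (auto simp: g_def)
        finally have fp: "(\<integral>\<^sup>+z. ennreal (f z powr p) \<partial>(lborel \<Otimes>\<^sub>M lborel)) \<le> ennreal (A * (C1 * \<delta>))"
          using A C1 d by (simp add: ennreal_mult)
        have "(\<integral>\<^sup>+z. ennreal (h z powr p') \<partial>(lborel \<Otimes>\<^sub>M lborel)) = (\<integral>\<^sup>+x. \<integral>\<^sup>+y. ennreal (indicator E x * k1 (x - y)) \<partial>lborel \<partial>lborel)"
        proof -
          have "h (x, y) powr p' = indicator E x * k1 (x - y)" for x y
            using p' k0[of "x - y"] by (auto simp: h_def indicator_def powr_powr)
          thus ?thesis by (subst lborel.nn_integral_fst[symmetric]) auto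
        qed
        also have "\<dots> = (\<integral>\<^sup>+x. indicator E x * (\<integral>\<^sub>+y. k1 y) \<partial>lborel)"
        proof (rule nn_integral_cong)
          fix x
          have "(\<integral>\<^sub>+y. indicator E x * k1 (x - y)) = indicator E x * (\<integral>\<^sub>+y. k1 (x - y))"
            by (auto simp: indicator_def)
          thus "(\<integral>\<^sub>+y. indicator E x * k1 (x - y)) = indicator E x * (\<integral>\<^sub>+y. k1 y)"
            by (simp add: nn_integral_lborel_reflect[of "\<lambda>x. ennreal (k1 x)" x])
        qed
        also have "\<dots> = ennreal m * (\<integral>\<^sub>+y. k1 y)"
          by (simp add: nn_integral_multc em)
        also have "\<dots> \<le> ennreal m * ennreal (C1 * \<delta>)" by (rule mult_left_mono[OF ik1]) simp
        finally have hp: "(\<integral>\<^sup>+z. ennreal (h z powr p') \<partial>(lborel \<Otimes>\<^sub>M lborel)) \<le> ennreal (m * (C1 * \<delta>))"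
          using m C1 d by (simp add: ennreal_mult)
        have fh: "f (x, y) * h (x, y) = indicator E x * g y * k1 (x - y)" for x y
        proof -
          have "k1 (x - y) powr (1 / p) * k1 (x - y) powr (1 / p') = k1 (x - y)"
            using k0(1)[of "x - y"] p'(2) by (simp add: powr_add[symmetric])
          thus ?thesis by (simp add: f_def h_def)
        qed
        have "(\<integral>\<^sup>+x. \<integral>\<^sup>+y. ennreal (indicator E x * g y * k1 (x - y)) \<partial>lborel \<partial>lborel) = (\<integral>\<^sup>+z. ennreal (f z * h z) \<partial>(lborel \<Otimes>\<^sub>M lborel))"
          by (subst lborel.nn_integral_fst[symmetric]) (auto simp: fh)
        also have "\<dots> \<le> ennreal ((A * (C1 * \<delta>)) powr (1 / p) * (m * (C1 * \<delta>)) powr (1 / p'))"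
          using A m C1 d k0 p p' fp hp
          by (intro nn_integral_Holder) (auto simp: f_def h_def g_def)
        also have "(A * (C1 * \<delta>)) powr (1 / p) * (m * (C1 * \<delta>)) powr (1 / p') = A powr (1 / p) * m powr (1 / p') * ((C1 * \<delta>) powr (1 / p) * (C1 * \<delta>) powr (1 / p'))"
          using A m C1 d by (simp add: powr_mult)
        also have "(C1 * \<delta>) powr (1 / p) * (C1 * \<delta>) powr (1 / p') = C1 * \<delta>"
          using C1(1) d p'(2) by (simp add: powr_add[symmetric])
        finally show ?thesis by (simp add: mult_ac)
      qed
      \<comment> \<open>Here Hoelder is applied in y alone, for each x in E, since the far kernel
        need not be integrable but its p'-th power is.\<close>
      have far: "(\<integral>\<^sup>+x. \<integral>\<^sup>+y. ennreal (indicator E x * g y * k2 (x - y)) \<partial>lborel \<partial>lborel)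
         \<le> ennreal (m * (A powr (1 / p) * (C2 * \<delta> powr (n - (n - 1) * p')) powr (1 / p')))"
      proof -
        have "(\<integral>\<^sub>+y. indicator E x * g y * k2 (x - y))
          \<le> ennreal (A powr (1 / p) * (C2 * \<delta> powr (n - (n - 1) * p')) powr (1 / p')) * indicator E x" for x
        proof (cases "x \<in> E")
          case True
          have "(\<integral>\<^sub>+y. g y * k2 (x - y)) \<le> ennreal (A powr (1 / p) * (C2 * \<delta> powr (n - (n - 1) * p')) powr (1 / p'))"
          proof (rule nn_integral_Holder)
            show "(\<integral>\<^sub>+y. k2 (x - y) powr p') \<le> ennreal (C2 * \<delta> powr (n - (n - 1) * p'))"
              using ik2 by (simp add: nn_integral_lborel_reflect[of "\<lambda>x. ennreal (k2 x powr p')" x])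
          qed (use p p' A C2 k0 in \<open>auto simp: g_def\<close>)
          thus ?thesis using True by simp
        qed simp
        hence "(\<integral>\<^sup>+x. \<integral>\<^sup>+y. ennreal (indicator E x * g y * k2 (x - y)) \<partial>lborel \<partial>lborel)
          \<le> (\<integral>\<^sup>+x. ennreal (A powr (1 / p) * (C2 * \<delta> powr (n - (n - 1) * p')) powr (1 / p')) * indicator E x \<partial>lborel)"
          by (rule nn_integral_mono)
        also have "\<dots> = ennreal (m * (A powr (1 / p) * (C2 * \<delta> powr (n - (n - 1) * p')) powr (1 / p')))"
          using m by (subst nn_integral_cmult_indicator, simp, subst em, subst ennreal_mult''[symmetric], simp, simp add: mult.commute)
        finally show ?thesis .
      qed
      have rb: "AE x in lborel. ennreal \<bar>v x\<bar> \<le> ennreal C0 * riesz G x"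
        by (rule C0(2)[OF w M(1)]) (rule M(2))
      have "ennreal (t * m) = (\<integral>\<^sup>+x. ennreal t * indicator E x \<partial>lborel)"
        using t m by (simp add: nn_integral_cmult_indicator em ennreal_mult)
      also have "\<dots> \<le> (\<integral>\<^sup>+x. ennreal C0 * (\<integral>\<^sup>+y. ennreal (indicator E x * g y * k1 (x - y)) + ennreal (indicator E x * g y * k2 (x - y)) \<partial>lborel) \<partial>lborel)"
      proof (rule nn_integral_mono_AE)
        show "AE x in lborel. ennreal t * indicator E x \<le> ennreal C0 * (\<integral>\<^sup>+y. ennreal (indicator E x * g y * k1 (x - y)) + ennreal (indicator E x * g y * k2 (x - y)) \<partial>lborel)"
          using rb
        proof eventually_elim
          case (elim x)
          show ?case
          proof (cases "x \<in> E")
            case True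
            have "ennreal t \<le> ennreal \<bar>v x\<bar>" using True by (intro ennreal_leI) (simp add: E_def)
            also note elim
            also have "riesz G x
              = (\<integral>\<^sup>+y. ennreal (indicator E x * g y * k1 (x - y)) + ennreal (indicator E x * g y * k2 (x - y)) \<partial>lborel)"
              using True k k0 by (intro nn_integral_cong) (simp add: g_def n_def[symmetric] ennreal_plus[symmetric] distrib_left del: ennreal_plus)
            finally show ?thesis using True by simp
          qed simp
        qed
      qed
      also have "\<dots> = ennreal C0 * ((\<integral>\<^sup>+x. \<integral>\<^sup>+y. ennreal (indicator E x * g y * k1 (x - y)) \<partial>lborel \<partial>lborel) + (\<integral>\<^sup>+x. \<integral>\<^sup>+y. ennreal (indicator E x * g y * k2 (x - y)) \<partial>lborel \<partial>lborel))"
        by (simp add: nn_integral_cmult nn_integral_add)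
      also have "\<dots> \<le> ennreal C0 * (ennreal (C1 * \<delta> * A powr (1 / p) * m powr (1 / p')) + ennreal (m * (A powr (1 / p) * (C2 * \<delta> powr (n - (n - 1) * p')) powr (1 / p'))))"
        by (intro mult_left_mono add_mono near far) simp
      also have "\<dots> = ennreal (C0 * (C1 * \<delta> * A powr (1 / p) * m powr (1 / p') + m * (A powr (1 / p) * (C2 * \<delta> powr (n - (n - 1) * p')) powr (1 / p'))))"
        using C0(1) C1(1) d m by (intro ennreal_lincomb) auto
      finally have 1: "t * m \<le> C0 * (C1 * \<delta> * A powr (1 / p) * m powr (1 / p') + m * (A powr (1 / p) * (C2 * \<delta> powr (n - (n - 1) * p')) powr (1 / p')))"
        using C0(1) C1(1) d m by (subst (asm) ennreal_le_iff) auto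
      \<comment> \<open>With \<delta> = m^(1/N) both parts scale as m^\<beta>. Dividing by this
        leaves the exponent 1 - \<beta> = 1/p - 1/N, the reciprocal of the Sobolev exponent.\<close>
      define \<beta> where "\<beta> = 1 / n - 1 / p + 1"
      have e1: "\<delta> * m powr (1 / p') = m powr \<beta>"
      proof -
        have "1 / n + 1 / p' = \<beta>" using p'(2) by (simp add: \<beta>_def)
        thus ?thesis by (simp add: \<delta>_def powr_add[symmetric])
      qed
      have e2: "m * (C2 * \<delta> powr (n - (n - 1) * p')) powr (1 / p') = C2 powr (1 / p') * m powr \<beta>"
      proof -
        have "1 / n * (n - (n - 1) * p') * (1 / p') = 1 / p' - 1 + 1 / n" using n p'(1) by (simp add: field_simps)
        also have "\<dots> = \<beta> - 1" using p'(2) by (simp add: \<beta>_def)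
        finally have h: "(\<delta> powr (n - (n - 1) * p')) powr (1 / p') = m powr (\<beta> - 1)" by (simp add: \<delta>_def powr_powr)
        have "(C2 * \<delta> powr (n - (n - 1) * p')) powr (1 / p') = C2 powr (1 / p') * (\<delta> powr (n - (n - 1) * p')) powr (1 / p')"
          by (rule powr_mult)
        also note h
        finally have "m * (C2 * \<delta> powr (n - (n - 1) * p')) powr (1 / p') = C2 powr (1 / p') * (m * m powr (\<beta> - 1))" by simp
        also have "m * m powr (\<beta> - 1) = m powr \<beta>" using m by (simp add: powr_diff)
        finally show ?thesis .
      qed
      have "t * m \<le> C0 * (C1 * A powr (1 / p) * (\<delta> * m powr (1 / p')) + A powr (1 / p) * (m * (C2 * \<delta> powr (n - (n - 1) * p')) powr (1 / p')))"
        using 1 by (simp add: mult_ac)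
      also have "\<dots> = C' * A powr (1 / p) * m powr \<beta>"
        unfolding e1 e2 by (simp add: C'_def algebra_simps)
      finally have "t * m * m powr (- \<beta>) \<le> C' * A powr (1 / p) * m powr \<beta> * m powr (- \<beta>)"
        by (rule mult_right_mono) simp
      moreover have "m * m powr (- \<beta>) = m powr (1 / p - 1 / n)"
      proof -
        have "m * m powr (- \<beta>) = m powr (1 + - \<beta>)" using m by (simp only: powr_add) simp
        thus ?thesis by (simp add: \<beta>_def)
      qed
      ultimately have "t * m powr (1 / p - 1 / n) \<le> C' * A powr (1 / p)"
        using m by (simp add: mult.assoc powr_add[symmetric])
      hence "(t * m powr (1 / p - 1 / n)) powr s \<le> (C' * A powr (1 / p)) powr s"
        using t s by (intro powr_mono2) auto
      moreover have "(t * m powr (1 / p - 1 / n)) powr s = t powr s * m"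
        using t m s(2) by (simp add: powr_mult powr_powr mult.commute[of _ s])
      moreover have "(C' * A powr (1 / p)) powr s = C' powr s * A powr (n / (n - p))"
        using C' s(3) by (simp add: powr_mult powr_powr)
      ultimately show ?thesis by simp
    qed
    thus "t powr (DIM('a) * p / (DIM('a) - p)) * measure lborel {x. \<bar>v x\<bar> > t} \<le> C' powr s * A powr (DIM('a) / (DIM('a) - p))"
      by (simp add: s_def n_def m_def E_def)
  qed (use C' in simp)
qed

text \<open>Maz'ya's truncation: the weak type estimate is applied on each dyadic slab of values.\<close>

lemma sobolev_critical_pos:
  fixes p :: real
  assumes p: "1 < p" "p < DIM('a::euclidean_space)"
  obtains C where "C > 0" "\<And>(v :: 'a \<Rightarrow> real) G M A. \<lbrakk>wgrad v G; M > 0; \<And>x. norm x > M \<Longrightarrow> v x = 0;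
      (\<integral>\<^sub>+x. norm (G x) powr p) \<le> ennreal A; A \<ge> 0\<rbrakk> \<Longrightarrow>
     (\<integral>\<^sub>+x. max 0 (v x) powr (DIM('a) * p / (DIM('a) - p))) \<le> ennreal (C * A powr (DIM('a) / (DIM('a) - p)))"
proof -
  define n where "n = real DIM('a)"
  define s where "s = n * p / (n - p)"
  define r where "r = n / (n - p)"
  have s: "s > 0" and r: "r > 1" using p by (auto simp: s_def r_def n_def field_simps)
  obtain C where C: "C > 0" "\<And>(v :: 'a \<Rightarrow> real) G M A t. \<lbrakk>wgrad v G; M > 0; \<And>x. norm x > M \<Longrightarrow> v x = 0;
      (\<integral>\<^sub>+x. norm (G x) powr p) \<le> ennreal A; A \<ge> 0; t > 0\<rbrakk> \<Longrightarrow>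
     t powr s * measure lborel {x. \<bar>v x\<bar> > t} \<le> C * A powr r"
    using sobolev_weak_type[OF p] unfolding s_def r_def n_def by blast
  show ?thesis
  proof (rule that[of "8 powr s * C"])
    fix v :: "'a \<Rightarrow> real" and G M A
    assume w: "wgrad v G" and M: "M > 0" "\<And>x. norm x > M \<Longrightarrow> v x = 0"
      and A: "(\<integral>\<^sub>+x. norm (G x) powr p) \<le> ennreal A" "A \<ge> 0"
    have [measurable]: "v \<in> borel_measurable borel" "G \<in> borel_measurable borel" using wgradD(4,5)[OF w] .
    \<comment> \<open>\<open>\<sigma>\<close> is the lowest dyadic level. Values below 2 \<sigma>
      contribute at most (2 \<sigma>)^s times the volume of the ball that contains the support, and
      this is sent to 0 at the end.\<close>
    have step: "(\<integral>\<^sub>+x. max 0 (v x) powr s) \<le> ennreal ((2 * \<sigma>) powr s * measure lborel (cball (0::'a) M)) + ennreal (8 powr s * C * A powr r)"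
      if \<sigma>: "\<sigma> > 0" for \<sigma>
    proof -
      define L where "L = (\<lambda>j::nat. \<sigma> * 2 ^ j)"
      have L: "L j > 0" "L (Suc j) = 2 * L j" for j using \<sigma> by (auto simp: L_def)
      have Lmono: "i \<le> j \<Longrightarrow> L i \<le> L j" for i j using \<sigma> by (simp add: L_def)
      define S where "S = (\<lambda>j. {x. L j < v x \<and> v x \<le> L (Suc j)})"
      have [measurable]: "S j \<in> sets borel" for j unfolding S_def by measurable
      have disj: "disjoint_family S"
        unfolding disjoint_family_on_def
      proof (intro ballI impI)
        fix i j :: nat assume "i \<noteq> j"
        thus "S i \<inter> S j = {}"
          using Lmono[of "Suc i" j] Lmono[of "Suc j" i] by (cases "i < j") (force simp: S_def)+
      qed
      define \<alpha> where "\<alpha> = (\<lambda>j. \<integral>\<^sup>+x. indicator (S j) x * ennreal (norm (G x) powr p) \<partial>lborel)"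
      have sum\<alpha>: "(\<Sum>j. \<alpha> j) \<le> ennreal A"
      proof -
        have "(\<Sum>j. \<alpha> j) = (\<integral>\<^sup>+x. (\<Sum>j. indicator (S j) x * ennreal (norm (G x) powr p)) \<partial>lborel)"
          unfolding \<alpha>_def by (rule nn_integral_suminf[symmetric]) measurable
        also have "\<dots> = (\<integral>\<^sup>+x. indicator (\<Union>j. S j) x * ennreal (norm (G x) powr p) \<partial>lborel)"
          by (intro nn_integral_cong) (simp add: ennreal_suminf_multc suminf_indicator[OF disj])
        also have "\<dots> \<le> (\<integral>\<^sub>+x. norm (G x) powr p)"
          by (intro nn_integral_mono) (auto simp: indicator_def)
        finally show ?thesis using A(1) by simp
      qed
      have \<alpha>A: "\<alpha> j \<le> ennreal A" for j
      proof -
        have "\<alpha> j \<le> (\<integral>\<^sub>+x. norm (G x) powr p)"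
          unfolding \<alpha>_def by (intro nn_integral_mono) (auto simp: indicator_def)
        thus ?thesis using A(1) by simp
      qed
      define a where "a = (\<lambda>j. enn2real (\<alpha> j))"
      have a: "\<alpha> j = ennreal (a j)" "a j \<ge> 0" "a j \<le> A" for j
      proof -
        have "\<alpha> j < top" using \<alpha>A[of j] by (rule le_less_trans) simp
        thus "\<alpha> j = ennreal (a j)" by (simp add: a_def)
        thus "a j \<le> A" using \<alpha>A[of j] A(2) by (simp add: ennreal_le_iff)
      qed (simp add: a_def)
      \<comment> \<open>The weak type estimate is used for the slab truncation at the height L_j /
        2; wherever v exceeds the next level the truncation has its full height L_j.\<close>
      have meas: "(4 * L j) powr s * measure lborel {x. v x > L (Suc j)} \<le> 8 powr s * C * A powr (r - 1) * a j" for j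
      proof -
        define vj where "vj = (\<lambda>x. max 0 (v x - L j) - max 0 (v x - L (Suc j)))"
        define Gj where "Gj = (\<lambda>x. indicator {y. v y > L j} x *\<^sub>R G x - indicator {y. v y > L (Suc j)} x *\<^sub>R G x)"
        have wj: "wgrad vj Gj" unfolding vj_def Gj_def
          using L(1)[of j] L(1)[of "Suc j"] by (intro wgrad_diff wgrad_pos_part[OF w]) auto
        have vj0: "vj x = 0" if "norm x > M" for x using M(2)[OF that] L(1)[of j] L(1)[of "Suc j"] by (simp add: vj_def)
        have "norm (Gj x) powr p = indicator (S j) x * (norm (G x) powr p)" for x
          using L(1)[of j] L(2)[of j] p by (auto simp: Gj_def S_def indicator_def)
        hence "(\<integral>\<^sub>+x. norm (Gj x) powr p) = \<alpha> j"
          unfolding \<alpha>_def by (intro nn_integral_cong) (auto simp: indicator_def)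
        hence ij: "(\<integral>\<^sub>+x. norm (Gj x) powr p) \<le> ennreal (a j)" using a(1) by simp
        have [measurable]: "vj \<in> borel_measurable borel" using wgradD(4)[OF wj] .
        have sub: "{x. v x > L (Suc j)} \<subseteq> {x. \<bar>vj x\<bar> > L j / 2}"
          using L(1)[of j] L(2)[of j] by (auto simp: vj_def)
        have sub2: "{x. \<bar>vj x\<bar> > L j / 2} \<subseteq> cball 0 M"
        proof
          fix x assume "x \<in> {x. \<bar>vj x\<bar> > L j / 2}"
          thus "x \<in> cball 0 M" using vj0[of x] L(1)[of j] by (cases "norm x > M") auto
        qed
        have "measure lborel {x. v x > L (Suc j)} \<le> measure lborel {x. \<bar>vj x\<bar> > L j / 2}"
        proof (rule measure_mono_fmeasurable[OF sub])
          show "{x. \<bar>vj x\<bar> > L j / 2} \<in> fmeasurable lborel"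
            by (rule fmeasurableI2[OF fmeasurable_compact[OF compact_cball[of 0 M]] sub2]) measurable
        qed measurable
        hence "(L j / 2) powr s * measure lborel {x. v x > L (Suc j)} \<le> (L j / 2) powr s * measure lborel {x. \<bar>vj x\<bar> > L j / 2}"
          by (rule mult_left_mono) simp
        also have "\<dots> \<le> C * a j powr r"
          using C(2)[OF wj M(1) vj0 ij a(2), of "L j / 2"] L(1)[of j] by simp
        \<comment> \<open>The exponent r = N/(N-p) exceeds one. All but one power of the slab energy
          is therefore replaced by the total A, and the remaining linear terms can be summed over
          the disjoint slabs.\<close>
        also have "a j powr r \<le> A powr (r - 1) * a j"
        proof -
          have "a j powr r = a j powr (r - 1) * a j" using a(2)[of j] by (cases "a j = 0") (auto simp: powr_diff)
          also have "\<dots> \<le> A powr (r - 1) * a j" using a r by (intro mult_right_mono powr_mono2) auto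
          finally show ?thesis .
        qed
        finally have "(L j / 2) powr s * measure lborel {x. v x > L (Suc j)} \<le> C * (A powr (r - 1) * a j)" using C(1) by simp
        hence "8 powr s * ((L j / 2) powr s * measure lborel {x. v x > L (Suc j)}) \<le> 8 powr s * (C * (A powr (r - 1) * a j))"
          by (rule mult_left_mono) simp
        moreover have "8 powr s * (L j / 2) powr s = (4 * L j) powr s" using L(1)[of j] by (simp add: powr_mult[symmetric])
        ultimately show ?thesis by (simp add: mult.assoc[symmetric])
      qed
      have Tm: "{x. v x > L (Suc j)} \<in> sets borel" for j by measurable
      have m1: "(\<lambda>x. ennreal ((2 * \<sigma>) powr s) * indicator (cball (0::'a) M) x) \<in> borel_measurable lborel"
        by (intro borel_measurable_times_ennreal borel_measurable_const borel_measurable_indicator) simp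
      have m2: "(\<lambda>x. ennreal ((4 * L j) powr s) * indicator {x. v x > L (Suc j)} x) \<in> borel_measurable lborel" for j
        by (intro borel_measurable_times_ennreal borel_measurable_const borel_measurable_indicator) (simp add: Tm)
      have fin: "emeasure lborel {x. v x > L (Suc j)} = ennreal (measure lborel {x. v x > L (Suc j)})" for j
      proof -
        have "{x. v x > L (Suc j)} \<subseteq> cball 0 M"
        proof
          fix x assume "x \<in> {x. v x > L (Suc j)}"
          thus "x \<in> cball 0 M" using M(2)[of x] L(1)[of "Suc j"] by (cases "norm x > M") auto
        qed
        hence "{x. v x > L (Suc j)} \<in> fmeasurable lborel"
          by (rule fmeasurableI2[OF fmeasurable_compact[OF compact_cball[of 0 M]]]) measurable
        thus ?thesis by (simp add: emeasure_eq_measure2 fmeasurableD2 emeasure_eq_ennreal_measure)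
      qed
      have "(\<integral>\<^sub>+x. max 0 (v x) powr s)
        \<le> (\<integral>\<^sup>+x. ennreal ((2 * \<sigma>) powr s) * indicator (cball 0 M) x + (\<Sum>j. ennreal ((4 * L j) powr s) * indicator {x. v x > L (Suc j)} x) \<partial>lborel)"
      proof (rule nn_integral_mono)
        fix x
        show "ennreal (max 0 (v x) powr s) \<le> ennreal ((2 * \<sigma>) powr s) * indicator (cball 0 M) x + (\<Sum>j. ennreal ((4 * L j) powr s) * indicator {x. v x > L (Suc j)} x)"
        proof (cases "v x \<le> 2 * \<sigma>")
          case True
          have "ennreal (max 0 (v x) powr s) \<le> ennreal ((2 * \<sigma>) powr s) * indicator (cball 0 M) x"
          proof (cases "v x \<le> 0")
            case False
            hence "x \<in> cball 0 M" using M(2)[of x] by (cases "norm x > M") auto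
            thus ?thesis using True False s by (simp add: ennreal_leI powr_mono2)
          qed simp
          thus ?thesis by (simp add: add_increasing2)
        next
          case False
          obtain k where "v x / \<sigma> < 2 ^ k" using real_arch_pow[of 2 "v x / \<sigma>"] by auto
          hence ex: "v x \<le> L k" using \<sigma> by (simp add: L_def field_simps)
          define l where "l = (LEAST k. v x \<le> L k)"
          have l: "v x \<le> L l" unfolding l_def by (rule LeastI[of "\<lambda>k. v x \<le> L k", OF ex])
          have "l \<noteq> 0" "l \<noteq> 1" using l False \<sigma> by (auto simp: L_def intro: ccontr)
          then obtain j where j: "l = Suc (Suc j)" by (metis One_nat_def not0_implies_Suc)
          have lt: "v x > L (Suc j)" using not_less_Least[of "Suc j" "\<lambda>k. v x \<le> L k"] j by (force simp: l_def)
          have "v x \<le> 4 * L j" using l unfolding j L(2) by simp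
          hence "ennreal (max 0 (v x) powr s) \<le> ennreal ((4 * L j) powr s) * indicator {x. v x > L (Suc j)} x"
            using lt L(1)[of "Suc j"] s by (simp add: ennreal_leI powr_mono2)
          also have "\<dots> \<le> (\<Sum>j. ennreal ((4 * L j) powr s) * indicator {x. v x > L (Suc j)} x)"
            using sum_le_suminf[of "\<lambda>j. ennreal ((4 * L j) powr s) * indicator {x. v x > L (Suc j)} x" "{j}"]
            by (simp del: sum_mult_indicator)
          finally show ?thesis by (simp add: add_increasing)
        qed
      qed
      also have "\<dots> = (\<integral>\<^sup>+x. ennreal ((2 * \<sigma>) powr s) * indicator (cball (0::'a) M) x \<partial>lborel)
          + (\<integral>\<^sup>+x. (\<Sum>j. ennreal ((4 * L j) powr s) * indicator {x. v x > L (Suc j)} x) \<partial>lborel)"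
        by (rule nn_integral_add[OF m1 borel_measurable_suminf_order[OF m2]])
      also have "(\<integral>\<^sup>+x. ennreal ((2 * \<sigma>) powr s) * indicator (cball (0::'a) M) x \<partial>lborel) = ennreal ((2 * \<sigma>) powr s * measure lborel (cball (0::'a) M))"
        using emeasure_lborel_cball_finite[of "0::'a" M] by (simp add: nn_integral_cmult_indicator emeasure_eq_ennreal_measure ennreal_mult)
      also have "(\<integral>\<^sup>+x. (\<Sum>j. ennreal ((4 * L j) powr s) * indicator {x. v x > L (Suc j)} x) \<partial>lborel)
          = (\<Sum>j. ennreal ((4 * L j) powr s) * emeasure lborel {x. v x > L (Suc j)})"
        by (subst nn_integral_suminf[OF m2]) (simp add: nn_integral_cmult_indicator Tm)
      finally have 1: "(\<integral>\<^sub>+x. max 0 (v x) powr s)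
        \<le> ennreal ((2 * \<sigma>) powr s * measure lborel (cball (0::'a) M)) + (\<Sum>j. ennreal ((4 * L j) powr s) * emeasure lborel {x. v x > L (Suc j)})" .
      have "(\<Sum>j. ennreal ((4 * L j) powr s) * emeasure lborel {x. v x > L (Suc j)}) \<le> (\<Sum>j. ennreal (8 powr s * C * A powr (r - 1)) * \<alpha> j)"
      proof (rule suminf_le)
        fix j
        have "ennreal ((4 * L j) powr s) * emeasure lborel {x. v x > L (Suc j)} = ennreal ((4 * L j) powr s * measure lborel {x. v x > L (Suc j)})"
          unfolding fin by (simp add: ennreal_mult)
        also have "\<dots> \<le> ennreal (8 powr s * C * A powr (r - 1) * a j)" by (rule ennreal_leI[OF meas])
        also have "\<dots> = ennreal (8 powr s * C * A powr (r - 1)) * \<alpha> j"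
          unfolding a(1) using C(1) a(2) by (intro ennreal_mult) auto
        finally show "ennreal ((4 * L j) powr s) * emeasure lborel {x. v x > L (Suc j)} \<le> ennreal (8 powr s * C * A powr (r - 1)) * \<alpha> j" .
      qed auto
      also have "\<dots> = ennreal (8 powr s * C * A powr (r - 1)) * (\<Sum>j. \<alpha> j)" by simp
      also have "\<dots> \<le> ennreal (8 powr s * C * A powr (r - 1)) * ennreal A" by (rule mult_left_mono[OF sum\<alpha>]) simp
      also have "\<dots> = ennreal (8 powr s * C * A powr (r - 1) * A)"
        using A(2) C(1) by (intro ennreal_mult[symmetric]) auto
      also have "8 powr s * C * A powr (r - 1) * A = 8 powr s * C * A powr r"
        using A(2) by (cases "A = 0") (auto simp: powr_diff)
      finally have 2: "(\<Sum>j. ennreal ((4 * L j) powr s) * emeasure lborel {x. v x > L (Suc j)}) \<le> ennreal (8 powr s * C * A powr r)" .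
      show ?thesis using 1 add_left_mono[OF 2] by (rule order_trans)
    qed
    show "(\<integral>\<^sub>+x. max 0 (v x) powr (DIM('a) * p / (DIM('a) - p))) \<le> ennreal (8 powr s * C * A powr (DIM('a) / (DIM('a) - p)))"
      unfolding s_def[unfolded n_def, symmetric] r_def[unfolded n_def, symmetric]
    proof (rule ennreal_le_epsilon)
      fix e :: real assume e: "e > 0"
      define \<mu> where "\<mu> = measure lborel (cball (0::'a) M) + 1"
      have \<mu>: "\<mu> > 0" by (simp add: \<mu>_def add_nonneg_pos)
      define \<sigma> where "\<sigma> = (e / \<mu>) powr (1 / s) / 2"
      have \<sigma>: "\<sigma> > 0" using e \<mu> by (simp add: \<sigma>_def)
      have "(2 * \<sigma>) powr s = e / \<mu>" using e \<mu> s by (simp add: \<sigma>_def powr_powr)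
      moreover have "e / \<mu> * measure lborel (cball (0::'a) M) \<le> e / \<mu> * \<mu>"
        using e \<mu> by (intro mult_left_mono) (auto simp: \<mu>_def)
      ultimately have "(2 * \<sigma>) powr s * measure lborel (cball (0::'a) M) \<le> e" using \<mu> by simp
      hence "ennreal ((2 * \<sigma>) powr s * measure lborel (cball (0::'a) M)) + ennreal (8 powr s * C * A powr r) \<le> ennreal e + ennreal (8 powr s * C * A powr r)"
        by (intro add_right_mono ennreal_leI)
      thus "(\<integral>\<^sub>+x. max 0 (v x) powr s) \<le> ennreal (8 powr s * C * A powr r) + ennreal e"
        using step[OF \<sigma>] by (simp add: add.commute order_trans)
    qed
  qed (use C in simp)
qed

lemma sobolev_critical:
  fixes p :: real
  assumes p: "1 < p" "p < DIM('a::euclidean_space)"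
  obtains C where "C > 0" "\<And>(v :: 'a \<Rightarrow> real) G M A. \<lbrakk>wgrad v G; M > 0; \<And>x. norm x > M \<Longrightarrow> v x = 0;
      (\<integral>\<^sub>+x. norm (G x) powr p) \<le> ennreal A; A \<ge> 0\<rbrakk> \<Longrightarrow>
     (\<integral>\<^sub>+x. \<bar>v x\<bar> powr (DIM('a) * p / (DIM('a) - p))) \<le> ennreal (C * A powr (DIM('a) / (DIM('a) - p)))"
proof -
  define s where "s = DIM('a) * p / (DIM('a) - p)"
  define r where "r = DIM('a) / (DIM('a) - p)"
  obtain C where C: "C > 0" "\<And>(v :: 'a \<Rightarrow> real) G M A. \<lbrakk>wgrad v G; M > 0; \<And>x. norm x > M \<Longrightarrow> v x = 0;
      (\<integral>\<^sub>+x. norm (G x) powr p) \<le> ennreal A; A \<ge> 0\<rbrakk> \<Longrightarrow>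
     (\<integral>\<^sub>+x. max 0 (v x) powr s) \<le> ennreal (C * A powr r)"
    using sobolev_critical_pos[OF p] unfolding s_def r_def by blast
  show ?thesis
  proof (rule that[of "2 * C"], goal_cases)
    case 1 thus ?case using C by simp
  next
    case (2 v G M A)
    have [measurable]: "v \<in> borel_measurable borel" using wgradD(4)[OF 2(1)] .
    have w: "wgrad (\<lambda>x. - 1 * v x) (\<lambda>x. (- 1) *\<^sub>R G x)" by (rule wgrad_scale[OF 2(1)])
    have "(\<integral>\<^sub>+x. \<bar>v x\<bar> powr s) \<le> (\<integral>\<^sup>+x. ennreal (max 0 (v x) powr s) + ennreal (max 0 (- 1 * v x) powr s) \<partial>lborel)"
    proof (rule nn_integral_mono)
      fix x show "ennreal (\<bar>v x\<bar> powr s) \<le> ennreal (max 0 (v x) powr s) + ennreal (max 0 (- 1 * v x) powr s)"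
        by (cases "v x \<ge> 0") (auto simp: max_def)
    qed
    also have "\<dots> = (\<integral>\<^sub>+x. max 0 (v x) powr s) + (\<integral>\<^sub>+x. max 0 (- 1 * v x) powr s)"
      by (rule nn_integral_add) measurable
    also have "\<dots> \<le> ennreal (C * A powr r) + ennreal (C * A powr r)"
      using 2 by (intro add_mono C(2)[OF 2(1,2)] C(2)[OF w 2(2)]) auto
    also have "\<dots> = ennreal (2 * C * A powr r)"
      using C(1) by (simp add: ennreal_plus[symmetric] del: ennreal_plus)
    finally show ?case by (simp add: s_def r_def)
  qed
qed

section \<open>Embeddings below the critical exponent, at p = N, and for p > N\<close>

text \<open>Hoelder against the indicator of the support, in the form needed to descend from one
  exponent to a smaller one.\<close>

lemma nn_Lp_mono:
  fixes h :: "'b \<Rightarrow> real"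
  assumes ab: "0 < a" "a \<le> b" and [measurable]: "h \<in> borel_measurable M" "B \<in> sets M"
    and h: "\<And>x. h x \<ge> 0" "\<And>x. x \<notin> B \<Longrightarrow> h x = 0"
    and X: "(\<integral>\<^sup>+x. ennreal (h x powr b) \<partial>M) \<le> ennreal X" "X \<ge> 0"
    and \<beta>: "emeasure M B \<le> ennreal \<beta>" "\<beta> > 0"
  shows "(\<integral>\<^sup>+x. ennreal (h x powr a) \<partial>M) \<le> ennreal (\<beta> powr (1 - a / b) * X powr (a / b))"
proof (cases "a = b")
  case True thus ?thesis using X ab \<beta> by simp
next
  case False
  hence r: "b / a > 1" using ab by simp
  obtain r' where r': "r' > 1" "1 / (b / a) + 1 / r' = 1" "r' = (b / a) / (b / a - 1)" using conjugate_exponent[OF r] .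
  have "(\<integral>\<^sup>+x. ennreal (h x powr a * indicator B x) \<partial>M) \<le> ennreal (X powr (1 / (b / a)) * \<beta> powr (1 / r'))"
  proof (rule nn_integral_Holder[OF r r'(1,2)])
    show "(\<integral>\<^sup>+x. ennreal ((h x powr a) powr (b / a)) \<partial>M) \<le> ennreal X"
      using X ab by (simp add: powr_powr)
    have "(\<integral>\<^sup>+x. ennreal (indicator B x powr r') \<partial>M) = (\<integral>\<^sup>+x. indicator B x \<partial>M)"
      by (intro nn_integral_cong) (auto simp: indicator_def)
    thus "(\<integral>\<^sup>+x. ennreal (indicator B x powr r') \<partial>M) \<le> ennreal \<beta>" using \<beta> by simp
  qed (use X \<beta> in auto)
  moreover have "(\<lambda>x. ennreal (h x powr a * indicator B x)) = (\<lambda>x. ennreal (h x powr a))"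
    using h(2) by (intro ext) (auto simp: indicator_def)
  moreover have "1 / r' = 1 - a / b" using r'(2) ab by (simp add: field_simps)
  ultimately show ?thesis by (simp only: mult.commute[of "\<beta> powr _"]) simp
qed

text \<open>For p < N the exponent is lowered from the critical one on the bounded support of v; for
  p = N the exponent of the gradient is lowered instead. The radius M is fixed in advance because
  the constant depends on it.\<close>

lemma sobolev:
  fixes p q M :: real
  assumes p: "1 < p" "p \<le> DIM('a::euclidean_space)" "p < q" and N: "DIM('a) \<ge> 2"
    and q: "p < DIM('a) \<Longrightarrow> q \<le> DIM('a) * p / (DIM('a) - p)" and M: "M > 0"
  obtains C where "C > 0" "\<And>(v :: 'a \<Rightarrow> real) G A. \<lbrakk>wgrad v G; \<And>x. norm x > M \<Longrightarrow> v x = 0; \<And>x. norm x > M \<Longrightarrow> G x = 0;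
      (\<integral>\<^sub>+x. norm (G x) powr p) \<le> ennreal A; A \<ge> 0\<rbrakk> \<Longrightarrow>
     (\<integral>\<^sub>+x. \<bar>v x\<bar> powr q) \<le> ennreal (C * A powr (q / p))"
proof -
  define n where "n = real DIM('a)"
  define \<beta> where "\<beta> = measure lborel (cball (0::'a) M) + 1"
  have \<beta>: "\<beta> > 0" "emeasure lborel (cball (0::'a) M) \<le> ennreal \<beta>"
    using emeasure_lborel_cball_finite[of "0::'a" M]
    by (auto simp: \<beta>_def emeasure_eq_ennreal_measure intro!: add_nonneg_pos ennreal_leI)
  show ?thesis
  proof (cases "p < n")
    case True
    define s where "s = n * p / (n - p)"
    define r where "r = n / (n - p)"
    have s: "q \<le> s" "s > 0" "r * (q / s) = q / p" "0 < q" using True p q by (auto simp: s_def r_def n_def field_simps)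
    obtain C where C: "C > 0" "\<And>(v :: 'a \<Rightarrow> real) G M A. \<lbrakk>wgrad v G; M > 0; \<And>x. norm x > M \<Longrightarrow> v x = 0;
      (\<integral>\<^sub>+x. norm (G x) powr p) \<le> ennreal A; A \<ge> 0\<rbrakk> \<Longrightarrow>
      (\<integral>\<^sub>+x. \<bar>v x\<bar> powr s) \<le> ennreal (C * A powr r)"
      using sobolev_critical[of p] p True unfolding s_def r_def n_def by blast
    show ?thesis
    proof (rule that[of "\<beta> powr (1 - q / s) * C powr (q / s)"], goal_cases)
      case 1 thus ?case using \<beta> C by simp
    next
      case (2 v G A)
      have [measurable]: "v \<in> borel_measurable borel" using wgradD(4)[OF 2(1)] .
      have v0: "v x = 0" if "x \<notin> cball 0 M" for x using 2(2)[of x] that by auto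
      have "(\<integral>\<^sub>+x. \<bar>v x\<bar> powr q) \<le> ennreal (\<beta> powr (1 - q / s) * (C * A powr r) powr (q / s))"
        using s \<beta> C(1) v0
        by (intro nn_Lp_mono[OF _ _ _ _ _ _ C(2)[OF 2(1) M 2(2,4,5)]]) auto
      also have "(C * A powr r) powr (q / s) = C powr (q / s) * A powr (q / p)"
        using C(1) 2(5) s(3) by (simp add: powr_mult powr_powr)
      finally show ?case by (simp add: mult.assoc)
    qed
  next
    case False
    hence pn: "p = n" using p by (simp add: n_def)
    \<comment> \<open>The exponent whose Sobolev conjugate N t / (N - t) equals q. That t exceeds
      one uses N \<ge> 2 and q > 2.\<close>
    define t where "t = n * q / (n + q)"
    have n2: "n \<ge> 2" using N by (simp add: n_def)
    have q2: "q > 2" using p n2 pn by simp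
    have "(n - 1) * (q - 1) > 1 * 1" using n2 q2 by (intro mult_le_less_imp_less) auto
    hence "n * q > n + q" by (simp add: algebra_simps)
    hence t1: "1 < t" using n2 q2 by (simp add: t_def field_simps)
    have tn: "t < n" using n2 q2 by (simp add: t_def field_simps)
    have nt: "n - t = n * n / (n + q)" using n2 q2 by (simp add: t_def field_simps)
    have ts: "n * t / (n - t) = q" unfolding nt using n2 q2 by (simp add: t_def)
    have tr: "n / (n - t) = q / t" unfolding nt using n2 q2 by (simp add: t_def)
    obtain C where C: "C > 0" "\<And>(v :: 'a \<Rightarrow> real) G M A. \<lbrakk>wgrad v G; M > 0; \<And>x. norm x > M \<Longrightarrow> v x = 0;
      (\<integral>\<^sub>+x. norm (G x) powr t) \<le> ennreal A; A \<ge> 0\<rbrakk> \<Longrightarrow>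
      (\<integral>\<^sub>+x. \<bar>v x\<bar> powr q) \<le> ennreal (C * A powr (q / t))"
      using sobolev_critical[of t] t1 tn ts tr unfolding n_def by metis
    show ?thesis
    proof (rule that[of "C * (\<beta> powr (1 - t / p)) powr (q / t)"], goal_cases)
      case 1 thus ?case using \<beta> C by simp
    next
      case (2 v G A)
      have [measurable]: "G \<in> borel_measurable borel" using wgradD(5)[OF 2(1)] .
      have G0: "G x = 0" if "x \<notin> cball 0 M" for x using 2(3)[of x] that by auto
      have *: "(\<integral>\<^sub>+x. norm (G x) powr t) \<le> ennreal (\<beta> powr (1 - t / p) * A powr (t / p))"
        using \<beta> 2(4,5) G0 t1 tn pn by (intro nn_Lp_mono[where B="cball 0 M"]) auto
      have "(\<integral>\<^sub>+x. \<bar>v x\<bar> powr q) \<le> ennreal (C * (\<beta> powr (1 - t / p) * A powr (t / p)) powr (q / t))"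
        by (rule C(2)[OF 2(1) M 2(2) *]) auto
      also have "(\<beta> powr (1 - t / p) * A powr (t / p)) powr (q / t) = (\<beta> powr (1 - t / p)) powr (q / t) * A powr (q / p)"
        using t1 by (simp add: powr_mult powr_powr)
      finally show ?case by (simp add: mult.assoc)
    qed
  qed
qed

text \<open>For p > N the kernel |z|^(1-N) belongs locally to L^p', and the bounded supports confine
  x - y to a fixed ball, so Hoelder bounds the Riesz potential uniformly.\<close>

lemma morrey_bounded:
  fixes v :: "'a::euclidean_space \<Rightarrow> real" and p :: real
  assumes p: "1 < p" "p > DIM('a)" and w: "wgrad v G" and M: "M > 0"
    and supp: "\<And>x. norm x > M \<Longrightarrow> v x = 0" "\<And>x. norm x > M \<Longrightarrow> G x = 0"
    and A: "(\<integral>\<^sub>+x. norm (G x) powr p) < \<infinity>"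
  obtains C where "AE x in lborel. \<bar>v x\<bar> \<le> C"
proof -
  define n where "n = real DIM('a)"
  obtain p' where p': "p' > 1" "1 / p + 1 / p' = 1" "p' = p / (p - 1)" using conjugate_exponent[OF p(1)] .
  \<comment> \<open>Equivalent to p > N; this is integrability of the p'-th power of the kernel at
    the origin.\<close>
  have np': "(n - 1) * p' < n" unfolding p'(3) using p by (simp add: n_def field_simps)
  obtain C0 where C0: "C0 > 0" "\<And>(v :: 'a \<Rightarrow> real) G M. \<lbrakk>wgrad v G; M > 0; \<And>x. norm x > M \<Longrightarrow> v x = 0\<rbrakk> \<Longrightarrow>
     AE x in lborel. ennreal \<bar>v x\<bar> \<le> ennreal C0 * riesz G x"
    using riesz_bound[where 'a='a] by blast
  obtain C1 where C1: "C1 > 0" "\<And>\<delta>. \<delta> > 0 \<Longrightarrow>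
    (\<integral>\<^sub>+x. indicator (ball (0::'a) \<delta>) x * norm x powr (- ((n - 1) * p'))) \<le> ennreal (C1 * \<delta> powr (DIM('a) - (n - 1) * p'))"
    using norm_powr_near[where 'a='a, of "(n - 1) * p'"] np' by (auto simp: n_def)
  have [measurable]: "G \<in> borel_measurable borel" using wgradD(5)[OF w] .
  define X where "X = enn2real (\<integral>\<^sub>+x. norm (G x) powr p)"
  have X: "(\<integral>\<^sub>+x. norm (G x) powr p) \<le> ennreal X" "X \<ge> 0" using A by (auto simp: X_def)
  define \<delta> where "\<delta> = 2 * M + 1"
  have d: "\<delta> > 0" using M by (simp add: \<delta>_def)
  define k where "k = (\<lambda>z::'a. indicator (ball (0::'a) \<delta>) z * norm z powr (1 - n))"
  have [measurable]: "k \<in> borel_measurable borel" unfolding k_def by (auto intro!: kernel_measurable)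
  have ik: "(\<integral>\<^sub>+z. k z powr p') \<le> ennreal (C1 * \<delta> powr (n - (n - 1) * p'))"
  proof -
    have "k z powr p' = indicator (ball 0 \<delta>) z * norm z powr (- ((n - 1) * p'))" for z
      by (auto simp: k_def indicator_def powr_powr algebra_simps)
    thus ?thesis using C1(2)[OF d] by (simp add: n_def)
  qed
  define Y where "Y = X powr (1 / p) * (C1 * \<delta> powr (n - (n - 1) * p')) powr (1 / p')"
  have "AE x in lborel. ennreal \<bar>v x\<bar> \<le> ennreal C0 * riesz G x"
    by (rule C0(2)[OF w M]) (rule supp(1))
  hence "AE x in lborel. \<bar>v x\<bar> \<le> C0 * Y"
  proof eventually_elim
    case (elim x)
    show ?case
    proof (cases "norm x > M")
      case True thus ?thesis using supp(1) C0(1) by (simp add: Y_def)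
    next
      case False
      have "riesz G x = (\<integral>\<^sub>+y. norm (G y) * k (x - y))"
      proof (rule nn_integral_cong)
        fix y
        show "ennreal (norm (G y) * norm (x - y) powr (1 - real DIM('a))) = ennreal (norm (G y) * k (x - y))"
        proof (cases "norm y > M")
          case False
          hence "norm (x - y) < \<delta>" using \<open>\<not> norm x > M\<close> norm_triangle_ineq4[of x y] by (simp add: \<delta>_def)
          thus ?thesis by (simp add: k_def n_def)
        qed (simp add: supp(2))
      qed
      also have "\<dots> \<le> ennreal Y"
        unfolding Y_def
      proof (rule nn_integral_Holder[OF p(1) p'(1,2)])
        show "(\<integral>\<^sub>+y. k (x - y) powr p') \<le> ennreal (C1 * \<delta> powr (n - (n - 1) * p'))"
          using ik by (simp add: nn_integral_lborel_reflect[of "\<lambda>x. ennreal (k x powr p')" x])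
        show "k (x - y) \<ge> 0" for y by (simp add: k_def)
      qed (use X C1(1) in auto)
      finally have "ennreal C0 * riesz G x \<le> ennreal C0 * ennreal Y"
        by (rule mult_left_mono) simp
      with elim have "ennreal \<bar>v x\<bar> \<le> ennreal (C0 * Y)" using C0(1) by (simp add: ennreal_mult' order_trans)
      thus ?thesis using C0(1) by (subst (asm) ennreal_le_iff) (auto simp: Y_def)
    qed
  qed
  thus ?thesis by (rule that)
qed

section \<open>Borel representatives and local weak gradients\<close>

lemma AE_lebesgue_iff: "(AE x in lebesgue. P x) \<longleftrightarrow> (AE x in lborel. P x)"
  by (simp add: AE_completion_iff)

lemma AE_lebesgue_on_iff:
  assumes "U \<in> sets borel"
  shows "(AE x in lebesgue_on U. P x) \<longleftrightarrow> (AE x\<in>U in lborel. P x)"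
  using assms by (subst AE_restrict_space_iff) (auto simp: AE_lebesgue_iff)

lemma borel_measurable_lebesgue_onI:
  "h \<in> borel_measurable borel \<Longrightarrow> h \<in> borel_measurable (lebesgue_on U)"
  by (intro measurable_restrict_space1 measurable_completion) simp

text \<open>The dictionary between the Lebesgue integrals in which the problem is stated and the
  Borel setting in which Fubini and the whole-space theory are carried out.\<close>

lemma lebesgue_on_borel:
  fixes h h0 :: "'a::euclidean_space \<Rightarrow> 'b::euclidean_space"
  assumes U: "U \<in> sets borel" and h: "h \<in> borel_measurable (lebesgue_on U)"
    and h0: "h0 \<in> borel_measurable borel" and AE: "AE x\<in>U in lborel. h x = h0 x"
  shows "integrable (lebesgue_on U) h \<longleftrightarrow> integrable lborel (\<lambda>x. indicator U x *\<^sub>R h0 x)"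
    and "(\<integral>x. h x \<partial>lebesgue_on U) = (LBINT x. indicator U x *\<^sub>R h0 x)"
proof -
  have h0': "h0 \<in> borel_measurable (lebesgue_on U)" by (rule borel_measurable_lebesgue_onI[OF h0])
  have AE': "AE x in lebesgue_on U. h x = h0 x" using AE by (simp add: AE_lebesgue_on_iff[OF U])
  have U': "U \<inter> space lebesgue \<in> sets lebesgue" using U by simp
  have m: "(\<lambda>x. indicator U x *\<^sub>R h0 x) \<in> borel_measurable lborel" using U h0 by simp
  have "integrable (lebesgue_on U) h \<longleftrightarrow> integrable (lebesgue_on U) h0" by (rule integrable_cong_AE[OF h h0' AE'])
  also have "\<dots> \<longleftrightarrow> integrable lebesgue (\<lambda>x. indicator U x *\<^sub>R h0 x)" by (rule integrable_restrict_space[OF U'])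
  also have "\<dots> \<longleftrightarrow> integrable lborel (\<lambda>x. indicator U x *\<^sub>R h0 x)" by (rule integrable_completion[OF m])
  finally show "integrable (lebesgue_on U) h \<longleftrightarrow> integrable lborel (\<lambda>x. indicator U x *\<^sub>R h0 x)" .
  have "(\<integral>x. h x \<partial>lebesgue_on U) = (\<integral>x. h0 x \<partial>lebesgue_on U)" by (rule integral_cong_AE[OF h h0' AE'])
  also have "\<dots> = (\<integral>x. indicator U x *\<^sub>R h0 x \<partial>lebesgue)" by (rule integral_restrict_space[OF U'])
  also have "\<dots> = (LBINT x. indicator U x *\<^sub>R h0 x)" by (rule integral_completion[OF m])
  finally show "(\<integral>x. h x \<partial>lebesgue_on U) = (LBINT x. indicator U x *\<^sub>R h0 x)" .
qed

lemma borel_representative: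
  fixes h :: "'a::euclidean_space \<Rightarrow> real"
  assumes U: "U \<in> sets borel" and h: "h \<in> borel_measurable (lebesgue_on U)"
  obtains h0 where "h0 \<in> borel_measurable borel" "AE x\<in>U in lborel. h x = h0 x"
proof -
  have U': "U \<inter> space lebesgue \<in> sets lebesgue" using U by simp
  have "(\<lambda>x. indicator U x *\<^sub>R h x) \<in> borel_measurable lebesgue"
    using h unfolding borel_measurable_restrict_space_iff[OF U'] .
  then obtain h0 where h0: "h0 \<in> borel_measurable lborel" "AE x in lborel. indicator U x *\<^sub>R h x = h0 x"
    using completion_ex_borel_measurable_real[of "\<lambda>x. indicator U x *\<^sub>R h x" lborel] by auto
  show ?thesis
  proof (rule that)
    show "h0 \<in> borel_measurable borel" using h0(1) by simp
    show "AE x\<in>U in lborel. h x = h0 x" using h0(2) by eventually_elim auto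
  qed
qed

lemma borel_representative_vector:
  fixes h :: "'a::euclidean_space \<Rightarrow> 'b::euclidean_space"
  assumes U: "U \<in> sets borel" and h: "h \<in> borel_measurable (lebesgue_on U)"
  obtains h0 where "h0 \<in> borel_measurable borel" "AE x\<in>U in lborel. h x = h0 x"
proof -
  have "\<forall>b\<in>Basis. \<exists>g. g \<in> borel_measurable borel \<and> (AE x\<in>U in lborel. h x \<bullet> b = g x)"
  proof
    fix b :: 'b
    have "(\<lambda>x. h x \<bullet> b) \<in> borel_measurable (lebesgue_on U)" using h by simp
    from borel_representative[OF U this]
    show "\<exists>g. g \<in> borel_measurable borel \<and> (AE x\<in>U in lborel. h x \<bullet> b = g x)" by blast
  qed
  then obtain g where g: "\<And>b. b \<in> Basis \<Longrightarrow> g b \<in> borel_measurable borel"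
    "\<And>b. b \<in> Basis \<Longrightarrow> AE x\<in>U in lborel. h x \<bullet> b = g b x" by metis
  show ?thesis
  proof (rule that[of "\<lambda>x. \<Sum>b\<in>Basis. g b x *\<^sub>R b"])
    show "(\<lambda>x. \<Sum>b\<in>Basis. g b x *\<^sub>R b) \<in> borel_measurable borel"
      by (intro borel_measurable_sum borel_measurable_scaleR g) auto
    have "AE x in lborel. \<forall>b\<in>Basis. x \<in> U \<longrightarrow> h x \<bullet> b = g b x"
      using g(2) by (subst AE_ball_countable) (auto intro: countable_finite)
    thus "AE x\<in>U in lborel. h x = (\<Sum>b\<in>Basis. g b x *\<^sub>R b)"
    proof eventually_elim
      case (elim x)
      show ?case
      proof
        assume "x \<in> U"
        hence "(\<Sum>b\<in>Basis. g b x *\<^sub>R b) = (\<Sum>b\<in>Basis. (h x \<bullet> b) *\<^sub>R b)" using elim by simp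
        thus "h x = (\<Sum>b\<in>Basis. g b x *\<^sub>R b)" by (simp add: euclidean_representation)
      qed
    qed
  qed
qed

lemma Lspace_integrable:
  fixes h h0 :: "'a::euclidean_space \<Rightarrow> 'b::euclidean_space"
  assumes "h \<in> Lspace r K" "K \<in> sets borel" "h0 \<in> borel_measurable borel" "AE x\<in>K in lborel. h x = h0 x"
  shows "integrable lborel (\<lambda>x. indicator K x * norm (h0 x) powr r)"
proof -
  have i: "integrable (lebesgue_on K) (\<lambda>x. norm (h x) powr r)" and [measurable]: "h \<in> borel_measurable (lebesgue_on K)"
    using assms(1) by (auto simp: Lspace_def)
  have "integrable (lebesgue_on K) (\<lambda>x. norm (h x) powr r) \<longleftrightarrow> integrable lborel (\<lambda>x. indicator K x *\<^sub>R (norm (h0 x) powr r))"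
    using assms(2-4) by (intro lebesgue_on_borel(1)) (auto elim: eventually_mono)
  thus ?thesis using i by simp
qed

section \<open>Local weak gradients of Borel functions\<close>

text \<open>The counterpart of \<open>is_weak_gradient\<close> for Borel functions and
  \<open>lborel\<close>; \<open>lwgrad_of_is_weak_gradient\<close> and
  \<open>is_weak_gradient_of_lwgrad\<close> translate in the two directions.\<close>

definition lwgrad :: "'a::euclidean_space set \<Rightarrow> ('a \<Rightarrow> real) \<Rightarrow> ('a \<Rightarrow> 'a) \<Rightarrow> bool" where
  "lwgrad U v G \<longleftrightarrow> v \<in> borel_measurable borel \<and> G \<in> borel_measurable borel \<and>
     (\<forall>K. compact K \<longrightarrow> K \<subseteq> U \<longrightarrow> integrable lborel (\<lambda>x. indicator K x * v x) \<and> integrable lborel (\<lambda>x. indicator K x *\<^sub>R G x)) \<and>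
     (\<forall>\<phi>\<in>test_functions U. \<forall>b\<in>Basis. (LBINT x. v x * dderiv \<phi> b x) = - (LBINT x. (G x \<bullet> b) * \<phi> x))"

lemma lwgradD:
  assumes "lwgrad U v G"
  shows "v \<in> borel_measurable borel" "G \<in> borel_measurable borel"
    "compact K \<Longrightarrow> K \<subseteq> U \<Longrightarrow> integrable lborel (\<lambda>x. indicator K x * v x)"
    "compact K \<Longrightarrow> K \<subseteq> U \<Longrightarrow> integrable lborel (\<lambda>x. indicator K x *\<^sub>R G x)"
    "\<phi> \<in> test_functions U \<Longrightarrow> b \<in> Basis \<Longrightarrow> (LBINT x. v x * dderiv \<phi> b x) = - (LBINT x. (G x \<bullet> b) * \<phi> x)"
  using assms by (auto simp: lwgrad_def)

lemma test_integrals_lebesgue_on: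
  fixes v v' :: "'a::euclidean_space \<Rightarrow> real"
  assumes U: "U \<in> sets borel" and v: "v \<in> borel_measurable (lebesgue_on U)" and v': "v' \<in> borel_measurable borel"
    and AE: "AE x\<in>U in lborel. v x = v' x"
    and k: "k \<in> borel_measurable borel" "\<And>x. x \<notin> U \<Longrightarrow> k x = 0"
  shows "(\<integral>x. v x * k x \<partial>lebesgue_on U) = (LBINT x. v' x * k x)"
proof -
  have "(\<integral>x. v x * k x \<partial>lebesgue_on U) = (LBINT x. indicator U x *\<^sub>R (v' x * k x))"
    using v v' k AE borel_measurable_lebesgue_onI[OF k(1), of U]
    by (intro lebesgue_on_borel(2)[OF U]) (auto elim: eventually_mono)
  also have "\<dots> = (LBINT x. v' x * k x)"
    using k(2) by (intro Bochner_Integration.integral_cong) (auto simp: indicator_def)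
  finally show ?thesis .
qed

lemma lwgrad_of_is_weak_gradient:
  assumes U: "open U" and w: "is_weak_gradient U v G"
    and v': "v' \<in> borel_measurable borel" "AE x\<in>U in lborel. v x = v' x"
    and G': "G' \<in> borel_measurable borel" "AE x\<in>U in lborel. G x = G' x"
  shows "lwgrad U v' G'"
  unfolding lwgrad_def
proof (intro conjI allI impI ballI)
  have Ub: "U \<in> sets borel" using U by simp
  have vl: "v \<in> Lspace_loc 1 U" and Gl: "G \<in> Lspace_loc 1 U" using w by (auto simp: is_weak_gradient_def)
  hence vm: "v \<in> borel_measurable (lebesgue_on U)" and Gm: "G \<in> borel_measurable (lebesgue_on U)"
    by (auto simp: Lspace_loc_def)
  show "v' \<in> borel_measurable borel" "G' \<in> borel_measurable borel" by fact+
  note [measurable] = v'(1) G'(1)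
  fix K :: "'a set" assume K: "compact K" "K \<subseteq> U"
  have Kb: "K \<in> sets borel" using K(1) by (simp add: borel_closed compact_imp_closed)
  have AEv: "AE x\<in>K in lborel. v x = v' x" using v'(2) by eventually_elim (use K in auto)
  have AEG: "AE x\<in>K in lborel. G x = G' x" using G'(2) by eventually_elim (use K in auto)
  have "v \<in> Lspace 1 K" "G \<in> Lspace 1 K" using vl Gl K by (auto simp: Lspace_loc_def)
  note i = Lspace_integrable[OF this(1) Kb v'(1) AEv] Lspace_integrable[OF this(2) Kb G'(1) AEG]
  show "integrable lborel (\<lambda>x. indicator K x * v' x)"
    by (rule Bochner_Integration.integrable_bound[OF i(1)]) (use Kb in \<open>auto simp: indicator_def\<close>)
  show "integrable lborel (\<lambda>x. indicator K x *\<^sub>R G' x)"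
    by (rule Bochner_Integration.integrable_bound[OF i(2)]) (use Kb in \<open>auto simp: indicator_def\<close>)
next
  have Ub: "U \<in> sets borel" using U by simp
  have vm: "v \<in> borel_measurable (lebesgue_on U)" and Gm: "G \<in> borel_measurable (lebesgue_on U)"
    using w by (auto simp: is_weak_gradient_def Lspace_loc_def)
  fix \<phi> :: "'a \<Rightarrow> real" and b :: 'a assume \<phi>: "\<phi> \<in> test_functions U" and b: "b \<in> Basis"
  have sm: "smooth \<phi>" using \<phi> by (simp add: test_functions_iff)
  obtain K where K: "compact K" "K \<subseteq> U" "\<And>x. x \<notin> K \<Longrightarrow> \<phi> x = 0" "\<And>x b. x \<notin> K \<Longrightarrow> dderiv \<phi> b x = 0"
    using test_function_support[OF \<phi>] by blast
  have z: "\<phi> x = 0" "dderiv \<phi> b x = 0" if "x \<notin> U" for x using that K by auto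
  have "(LBINT x. v' x * dderiv \<phi> b x) = (\<integral>x. v x * dderiv \<phi> b x \<partial>lebesgue_on U)"
    by (rule test_integrals_lebesgue_on[OF Ub vm v' smooth_measurable[OF smooth_dderiv[OF sm b]] z(2), symmetric])
  also have "\<dots> = - (\<integral>x. (G x \<bullet> b) * \<phi> x \<partial>lebesgue_on U)"
    using w \<phi> b by (auto simp: is_weak_gradient_def)
  also have "(\<integral>x. (G x \<bullet> b) * \<phi> x \<partial>lebesgue_on U) = (LBINT x. (G' x \<bullet> b) * \<phi> x)"
    using Gm G' by (intro test_integrals_lebesgue_on[OF Ub _ _ _ smooth_measurable[OF sm] z(1)]) (auto elim: eventually_mono)
  finally show "(LBINT x. v' x * dderiv \<phi> b x) = - (LBINT x. (G' x \<bullet> b) * \<phi> x)" .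
qed

lemma is_weak_gradient_of_lwgrad:
  assumes U: "open U" and w: "lwgrad U v G"
  shows "is_weak_gradient U v G"
proof -
  have Ub: "U \<in> sets borel" using U by simp
  note vm = lwgradD(1)[OF w] and Gm = lwgradD(2)[OF w]
  have v1: "v \<in> Lspace_loc 1 U"
    unfolding Lspace_loc_def Lspace_def
  proof (intro CollectI conjI allI impI)
    fix K assume K: "compact K \<and> K \<subseteq> U"
    hence Kb: "K \<in> sets borel" by (simp add: borel_closed compact_imp_closed)
    have "integrable lborel (\<lambda>x. norm (indicator K x * v x))" using lwgradD(3)[OF w] K by (intro integrable_norm) auto
    thus "integrable (lebesgue_on K) (\<lambda>x. norm (v x) powr 1)"
      using Kb vm borel_measurable_lebesgue_onI[OF vm, of K]
      by (subst lebesgue_on_borel(1)[where h0="\<lambda>x. norm (v x) powr 1"]) (auto simp: abs_mult)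
  qed (rule borel_measurable_lebesgue_onI[OF vm])+
  have G1: "G \<in> Lspace_loc 1 U"
    unfolding Lspace_loc_def Lspace_def
  proof (intro CollectI conjI allI impI)
    fix K assume K: "compact K \<and> K \<subseteq> U"
    hence Kb: "K \<in> sets borel" by (simp add: borel_closed compact_imp_closed)
    have "integrable lborel (\<lambda>x. norm (indicator K x *\<^sub>R G x))" using lwgradD(4)[OF w] K by (intro integrable_norm) auto
    thus "integrable (lebesgue_on K) (\<lambda>x. norm (G x) powr 1)"
      using Kb Gm borel_measurable_lebesgue_onI[OF Gm, of K]
      by (subst lebesgue_on_borel(1)[where h0="\<lambda>x. norm (G x) powr 1"]) auto
  qed (rule borel_measurable_lebesgue_onI[OF Gm])+
  show ?thesis unfolding is_weak_gradient_def
  proof (intro conjI v1 G1 ballI)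
    fix \<phi> :: "'a \<Rightarrow> real" and b :: 'a assume \<phi>: "\<phi> \<in> test_functions U" and b: "b \<in> Basis"
    have sm: "smooth \<phi>" using \<phi> by (simp add: test_functions_iff)
    obtain K where K: "compact K" "K \<subseteq> U" "\<And>x. x \<notin> K \<Longrightarrow> \<phi> x = 0" "\<And>x b. x \<notin> K \<Longrightarrow> dderiv \<phi> b x = 0"
      using test_function_support[OF \<phi>] by blast
    have z: "\<phi> x = 0" "dderiv \<phi> b x = 0" if "x \<notin> U" for x using that K by auto
    have "(\<integral>x. v x * dderiv \<phi> b x \<partial>lebesgue_on U) = (LBINT x. v x * dderiv \<phi> b x)"
      by (rule test_integrals_lebesgue_on[OF Ub borel_measurable_lebesgue_onI[OF vm] vm _ smooth_measurable[OF smooth_dderiv[OF sm b]] z(2)]) simp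
    moreover have "(\<integral>x. (G x \<bullet> b) * \<phi> x \<partial>lebesgue_on U) = (LBINT x. (G x \<bullet> b) * \<phi> x)"
      using Gm by (intro test_integrals_lebesgue_on[OF Ub borel_measurable_lebesgue_onI _ _ smooth_measurable[OF sm] z(1)]) auto
    ultimately show "(\<integral>x. v x * dderiv \<phi> b x \<partial>lebesgue_on U) = - (\<integral>x. (G x \<bullet> b) * \<phi> x \<partial>lebesgue_on U)"
      using lwgradD(5)[OF w \<phi> b] by simp
  qed
qed

lemma integrable_local_mult:
  fixes v k :: "'a::euclidean_space \<Rightarrow> real"
  assumes v: "\<And>K. compact K \<Longrightarrow> K \<subseteq> U \<Longrightarrow> integrable lborel (\<lambda>x. indicator K x * v x)"
    and \<phi>: "\<phi> \<in> test_functions U"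
  shows "integrable lborel (\<lambda>x. v x * \<phi> x)" "b \<in> Basis \<Longrightarrow> integrable lborel (\<lambda>x. v x * dderiv \<phi> b x)"
proof -
  obtain K where K: "compact K" "K \<subseteq> U" "\<And>x. x \<notin> K \<Longrightarrow> \<phi> x = 0" "\<And>x b. x \<notin> K \<Longrightarrow> dderiv \<phi> b x = 0"
    using test_function_support[OF \<phi>] by blast
  have "indicator K x * v x * \<phi> x = v x * \<phi> x" "indicator K x * v x * dderiv \<phi> b x = v x * dderiv \<phi> b x" for x b
    using K(3,4)[of x] by (cases "x \<in> K"; simp)+
  hence e1: "(\<lambda>x. indicator K x * v x * \<phi> x) = (\<lambda>x. v x * \<phi> x)"
    and e2: "(\<lambda>x. indicator K x * v x * dderiv \<phi> b x) = (\<lambda>x. v x * dderiv \<phi> b x)" for b by auto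
  show "integrable lborel (\<lambda>x. v x * \<phi> x)"
    using integrable_mult_test(1)[OF v[OF K(1,2)] \<phi>] unfolding e1 .
  show "b \<in> Basis \<Longrightarrow> integrable lborel (\<lambda>x. v x * dderiv \<phi> b x)"
    using integrable_mult_test(2)[OF v[OF K(1,2)] \<phi>] unfolding e2 .
qed

lemma lwgrad_component:
  assumes "lwgrad U v G" "compact K" "K \<subseteq> U"
  shows "integrable lborel (\<lambda>x. indicator K x * (G x \<bullet> b))"
  using integrable_inner_left[OF lwgradD(4)[OF assms], of b] by simp

text \<open>Makes the arbitrary choice inside \<open>weak_gradient\<close> harmless. The components
  of the difference have vanishing integrals against all test functions.\<close>

lemma lwgrad_unique:
  assumes U: "open U" and "lwgrad U v G" "lwgrad U v H"
  shows "AE x\<in>U in lborel. G x = H x"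
proof -
  have "AE x\<in>U in lborel. (G x - H x) \<bullet> b = 0" if b: "b \<in> Basis" for b
  proof (rule fundamental_lemma[OF U])
    fix K assume K: "compact K" "K \<subseteq> U"
    show "integrable lborel (\<lambda>x. indicator K x * ((G x - H x) \<bullet> b))"
      using lwgrad_component[OF assms(2) K] lwgrad_component[OF assms(3) K]
      by (simp add: inner_diff_left right_diff_distrib)
  next
    fix \<phi> assume \<phi>: "\<phi> \<in> test_functions U"
    have "integrable lborel (\<lambda>x. (G x \<bullet> b) * \<phi> x)" "integrable lborel (\<lambda>x. (H x \<bullet> b) * \<phi> x)"
      using integrable_local_mult(1)[of U "\<lambda>x. G x \<bullet> b" \<phi>, OF lwgrad_component[OF assms(2)] \<phi>]
        integrable_local_mult(1)[of U "\<lambda>x. H x \<bullet> b" \<phi>, OF lwgrad_component[OF assms(3)] \<phi>] by auto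
    thus "(LBINT x. (G x - H x) \<bullet> b * \<phi> x) = 0"
      using lwgradD(5)[OF assms(2) \<phi> b] lwgradD(5)[OF assms(3) \<phi> b]
      by (simp add: inner_diff_left left_diff_distrib)
  qed
  hence "AE x in lborel. \<forall>b\<in>Basis. x \<in> U \<longrightarrow> (G x - H x) \<bullet> b = 0"
    by (intro AE_finite_allI finite_Basis)
  thus ?thesis
  proof eventually_elim
    case (elim x)
    show ?case
    proof
      assume "x \<in> U"
      thus "G x = H x" using elim by - (rule euclidean_eqI, simp add: inner_diff_left)
    qed
  qed
qed

lemma test_cutoff:
  fixes x0 :: "'a::euclidean_space"
  assumes r: "0 < \<rho>" "\<rho> < r" and U: "cball x0 r \<subseteq> U"
  obtains \<kappa> c where "\<kappa> \<in> test_functions U" "\<And>x. 0 \<le> \<kappa> x" "\<And>x. \<kappa> x \<le> 1" "\<And>x. x \<in> cball x0 \<rho> \<Longrightarrow> \<kappa> x = 1"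
    "\<And>x. x \<notin> cball x0 r \<Longrightarrow> \<kappa> x = 0" "\<And>x. x \<notin> cball x0 r \<Longrightarrow> sgrad \<kappa> x = 0" "c \<ge> 0" "\<And>x. norm (sgrad \<kappa> x) \<le> c"
proof -
  obtain \<kappa> where \<kappa>: "smooth \<kappa>" "\<And>x. 0 \<le> \<kappa> x" "\<And>x. \<kappa> x \<le> 1" "\<And>x. x \<in> cball x0 \<rho> \<Longrightarrow> \<kappa> x = 1" "\<And>x. x \<notin> ball x0 r \<Longrightarrow> \<kappa> x = 0"
    using cutoff_simple[OF r, of x0] by metis
  have z: "\<kappa> x = 0" if "x \<notin> cball x0 r" for x using that \<kappa>(5)[of x] by auto
  have s: "sgrad \<kappa> x = 0" if "x \<notin> cball x0 r" for x
  proof -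
    have "dderiv \<kappa> b x = 0" for b by (rule dderiv_zero_outside[of "cball x0 r"]) (use z that in auto)
    thus ?thesis by (simp add: sgrad_def)
  qed
  have "continuous_on UNIV (\<lambda>x. norm (sgrad \<kappa> x))"
    unfolding sgrad_def by (intro continuous_intros smooth_continuous smooth_dderiv \<kappa>(1))
  then obtain c where "c \<ge> 0" "\<And>x. \<bar>norm (sgrad \<kappa> x)\<bar> \<le> c"
    using continuous_compact_support_bounded[of "\<lambda>x. norm (sgrad \<kappa> x)" "cball x0 r"] s by auto
  moreover have "\<kappa> \<in> test_functions U"
    by (rule test_functionI[OF \<kappa>(1) compact_cball U]) (use \<kappa>(5) in auto)
  ultimately show thesis using that[of \<kappa> c] \<kappa> z s by auto
qed

text \<open>The passage from local to global: the cut-off function has a weak gradient on the whole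
  space, so truncation, chain rule and Sobolev inequality become available.\<close>

lemma lwgrad_cutoff:
  assumes w: "lwgrad U v G" and \<zeta>: "\<zeta> \<in> test_functions U"
  shows "wgrad (\<lambda>x. \<zeta> x * v x) (\<lambda>x. \<zeta> x *\<^sub>R G x + v x *\<^sub>R sgrad \<zeta> x)"
  unfolding wgrad_def
proof (intro conjI ballI)
  have sm: "smooth \<zeta>" using \<zeta> by (simp add: test_functions_iff)
  have iv: "integrable lborel (\<lambda>x. v x * \<phi> x)" "b \<in> Basis \<Longrightarrow> integrable lborel (\<lambda>x. v x * dderiv \<phi> b x)"
    if "\<phi> \<in> test_functions U" for \<phi> b
    using integrable_local_mult[of U v \<phi>, OF lwgradD(3)[OF w] that] by auto
  have iG: "integrable lborel (\<lambda>x. (G x \<bullet> b) * \<phi> x)" if "\<phi> \<in> test_functions U" for \<phi> b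
    using integrable_local_mult(1)[of U "\<lambda>x. G x \<bullet> b" \<phi>, OF lwgrad_component[OF w] that] by auto
  show "integrable lborel (\<lambda>x. \<zeta> x * v x)"
    using iv(1)[OF \<zeta>] by (simp add: mult.commute)
  have 1: "integrable lborel (\<lambda>x. \<zeta> x *\<^sub>R G x)"
  proof -
    have "integrable lborel (\<lambda>x. \<Sum>b\<in>Basis. ((G x \<bullet> b) * \<zeta> x) *\<^sub>R b)"
      by (intro Bochner_Integration.integrable_sum integrable_scaleR_left iG \<zeta>)
    also have "(\<lambda>x. \<Sum>b\<in>Basis. ((G x \<bullet> b) * \<zeta> x) *\<^sub>R b) = (\<lambda>x. \<zeta> x *\<^sub>R (\<Sum>b\<in>Basis. (G x \<bullet> b) *\<^sub>R b))"
      by (simp add: scaleR_sum_right mult.commute)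
    finally show ?thesis by (simp add: euclidean_representation)
  qed
  have 2: "integrable lborel (\<lambda>x. v x *\<^sub>R sgrad \<zeta> x)"
  proof -
    have "integrable lborel (\<lambda>x. \<Sum>b\<in>Basis. (v x * dderiv \<zeta> b x) *\<^sub>R b)"
      by (intro Bochner_Integration.integrable_sum integrable_scaleR_left iv(2) \<zeta>)
    thus ?thesis by (simp add: sgrad_def scaleR_sum_right)
  qed
  show "integrable lborel (\<lambda>x. \<zeta> x *\<^sub>R G x + v x *\<^sub>R sgrad \<zeta> x)" using 1 2 by simp
  fix \<phi> :: "'a \<Rightarrow> real" and b :: 'a assume \<phi>: "\<phi> \<in> test_functions UNIV" and b: "b \<in> Basis"
  have sm\<phi>: "smooth \<phi>" using \<phi> by (simp add: test_functions_iff)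
  have t: "(\<lambda>x. \<zeta> x * \<phi> x) \<in> test_functions U"
    using test_functions_mult[OF \<zeta> sm\<phi>] by (simp add: mult.commute)
  have i1: "integrable lborel (\<lambda>x. v x * dderiv (\<lambda>x. \<zeta> x * \<phi> x) b x)"
    by (rule iv(2)[OF t b])
  have i2: "integrable lborel (\<lambda>x. v x * dderiv \<zeta> b x * \<phi> x)"
    by (rule integrable_mult_test(1)[OF iv(2)[OF \<zeta> b] \<phi>])
  have i3: "integrable lborel (\<lambda>x. (G x \<bullet> b) * (\<zeta> x * \<phi> x))"
    by (rule iG[OF t])
  have "(LBINT x. \<zeta> x * v x * dderiv \<phi> b x)
     = (LBINT x. v x * dderiv (\<lambda>x. \<zeta> x * \<phi> x) b x - v x * dderiv \<zeta> b x * \<phi> x)"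
    by (rule Bochner_Integration.integral_cong, simp, simp only: dderiv_mult[OF sm sm\<phi>], simp add: algebra_simps)
  also have "\<dots> = - (LBINT x. (G x \<bullet> b) * (\<zeta> x * \<phi> x)) - (LBINT x. v x * dderiv \<zeta> b x * \<phi> x)"
    using i1 i2 lwgradD(5)[OF w t b] by simp
  also have "\<dots> = - (LBINT x. (G x \<bullet> b) * (\<zeta> x * \<phi> x) + v x * dderiv \<zeta> b x * \<phi> x)"
    using i2 i3 by simp
  also have "(\<lambda>x. (G x \<bullet> b) * (\<zeta> x * \<phi> x) + v x * dderiv \<zeta> b x * \<phi> x)
     = (\<lambda>x. ((\<zeta> x *\<^sub>R G x + v x *\<^sub>R sgrad \<zeta> x) \<bullet> b) * \<phi> x)"
    using b by (auto simp: inner_add_left sgrad_inner_Basis algebra_simps)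
  finally show "(LBINT x. \<zeta> x * v x * dderiv \<phi> b x)
     = - (LBINT x. ((\<zeta> x *\<^sub>R G x + v x *\<^sub>R sgrad \<zeta> x) \<bullet> b) * \<phi> x)" .
qed

lemma lwgrad_diff:
  assumes w: "lwgrad U v G" and h: "wgrad h H"
  shows "lwgrad U (\<lambda>x. v x - h x) (\<lambda>x. G x - H x)"
  unfolding lwgrad_def
proof (intro conjI allI impI ballI)
  show "(\<lambda>x. v x - h x) \<in> borel_measurable borel" "(\<lambda>x. G x - H x) \<in> borel_measurable borel"
    using lwgradD(1,2)[OF w] wgradD(4,5)[OF h] by simp_all
  fix K assume K: "compact K" "K \<subseteq> U"
  hence Kb: "K \<in> sets lborel" by (simp add: borel_closed compact_imp_closed)
  show "integrable lborel (\<lambda>x. indicator K x * (v x - h x))"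
    using lwgradD(3)[OF w K] integrable_mult_indicator[OF Kb wgradD(1)[OF h]] by (simp add: right_diff_distrib)
  show "integrable lborel (\<lambda>x. indicator K x *\<^sub>R (G x - H x))"
    using lwgradD(4)[OF w K] integrable_mult_indicator[OF Kb wgradD(2)[OF h]] by (simp add: scaleR_diff_right)
next
  fix \<phi> :: "'a \<Rightarrow> real" and b :: 'a assume \<phi>: "\<phi> \<in> test_functions U" and b: "b \<in> Basis"
  have "integrable lborel (\<lambda>x. v x * dderiv \<phi> b x)" "integrable lborel (\<lambda>x. (G x \<bullet> b) * \<phi> x)"
    using integrable_local_mult(2)[of U v \<phi>, OF lwgradD(3)[OF w] \<phi> b]
      integrable_local_mult(1)[of U "\<lambda>x. G x \<bullet> b" \<phi>, OF lwgrad_component[OF w] \<phi>] by auto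
  moreover have "integrable lborel (\<lambda>x. h x * dderiv \<phi> b x)" "integrable lborel (\<lambda>x. (H x \<bullet> b) * \<phi> x)"
    using integrable_mult_test(2)[OF wgradD(1)[OF h] \<phi> b] integrable_mult_test(1)[OF wgradD(3)[OF h] \<phi>] by auto
  ultimately show "(LBINT x. (v x - h x) * dderiv \<phi> b x) = - (LBINT x. (G x - H x) \<bullet> b * \<phi> x)"
    using lwgradD(5)[OF w \<phi> b] wgrad_test[OF h \<phi> b] by (simp add: left_diff_distrib inner_diff_left)
qed

lemma weak_gradient_AE:
  assumes U: "open U" and w: "lwgrad U v G"
  shows "AE x\<in>U in lborel. weak_gradient U v x = G x"
proof -
  have "is_weak_gradient U v (weak_gradient U v)"
    unfolding weak_gradient_def by (rule someI[of "is_weak_gradient U v"]) (rule is_weak_gradient_of_lwgrad[OF U w])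
  note wg = this
  have Ub: "U \<in> sets borel" using U by simp
  have "weak_gradient U v \<in> borel_measurable (lebesgue_on U)"
    using wg by (auto simp: is_weak_gradient_def Lspace_loc_def)
  then obtain G' where G': "G' \<in> borel_measurable borel" "AE x\<in>U in lborel. weak_gradient U v x = G' x"
    using borel_representative_vector[OF Ub] by blast
  have "lwgrad U v G'" by (rule lwgrad_of_is_weak_gradient[OF U wg lwgradD(1)[OF w] _ G']) simp
  from lwgrad_unique[OF U this w] G'(2) show ?thesis by eventually_elim auto
qed

text \<open>For a simple function the composition is measurable piece by piece; the general case is
  a limit, by continuity of \<open>F x\<close> for almost every x.\<close>

lemma caratheodory_measurable:
  assumes U: "U \<in> sets borel" and F: "caratheodory U F" and g: "g \<in> borel_measurable borel"
  shows "(\<lambda>x. F x (g x)) \<in> borel_measurable (lebesgue_on U)"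
proof -
  let ?M = "lebesgue_on U"
  have gm: "g \<in> borel_measurable ?M" by (rule borel_measurable_lebesgue_onI[OF g])
  obtain s where s: "\<And>i. simple_function ?M (s i)" "\<And>x. x \<in> space ?M \<Longrightarrow> (\<lambda>i. s i x) \<longlonglongrightarrow> g x"
    using borel_measurable_implies_sequence_metric[OF gm, of 0] by auto
  have sm: "(\<lambda>x. F x (s i x)) \<in> borel_measurable ?M" for i
  proof (rule measurable_compose_countable'[where f="\<lambda>\<xi> x. F x \<xi>" and g="s i" and I="s i ` space ?M"])
    show "s i \<in> measurable ?M (count_space (s i ` space ?M))"
      by (rule measurable_count_space_extend[OF _ _ measurable_simple_function[OF s(1)]]) auto
    show "countable (s i ` space ?M)" using s(1)[of i] by (auto simp: simple_function_def intro: countable_finite)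
    show "(\<lambda>x. F x \<xi>) \<in> borel_measurable ?M" for \<xi> using F by (simp add: caratheodory_def)
  qed
  \<comment> \<open>\<open>lim\<close> yields a measurable function even where the sequence
    diverges, and it agrees with the composition wherever \<open>F x\<close> is continuous;
    completeness of the measure does the rest.\<close>
  have lm: "(\<lambda>x. lim (\<lambda>i. F x (s i x))) \<in> borel_measurable ?M" using sm by measurable
  have U': "U \<inter> space lebesgue \<in> sets lebesgue" using U by simp
  have "AE x in ?M. continuous_on UNIV (F x)" using F by (simp add: caratheodory_def)
  hence "AE x\<in>U in lborel. continuous_on UNIV (F x)" by (simp add: AE_lebesgue_on_iff[OF U])
  hence "AE x in lebesgue. indicator U x *\<^sub>R lim (\<lambda>i. F x (s i x)) = indicator U x *\<^sub>R F x (g x)"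
    unfolding AE_lebesgue_iff
  proof eventually_elim
    case (elim x)
    show ?case
    proof (cases "x \<in> U")
      case True
      hence "isCont (F x) (g x)" using elim by (simp add: continuous_on_eq_continuous_at)
      moreover have "(\<lambda>i. s i x) \<longlonglongrightarrow> g x" using s(2) True by simp
      ultimately have "(\<lambda>i. F x (s i x)) \<longlonglongrightarrow> F x (g x)" by (rule isCont_tendsto_compose)
      thus ?thesis by (simp add: limI)
    qed simp
  qed
  from borel_measurable_AE[OF lm[unfolded borel_measurable_restrict_space_iff[OF U']] this]
  show ?thesis unfolding borel_measurable_restrict_space_iff[OF U'] .
qed

section \<open>Elementary inequalities\<close>

text \<open>The power function lies above its tangent at y, that is q y^(q-1) (x - y) \<le> x^q -
  y^q, obtained from Young's inequality.\<close>

lemma powr_tangent: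
  fixes x y q :: real
  assumes "q > 1" "x \<ge> 0" "y \<ge> 0"
  shows "q * y powr (q - 1) * x \<le> x powr q + (q - 1) * y powr q"
proof -
  obtain q' where q': "q' > 1" "1 / q + 1 / q' = 1" "q' = q / (q - 1)" using conjugate_exponent[OF assms(1)] .
  have "x * y powr (q - 1) \<le> x powr q / q + (y powr (q - 1)) powr q' / q'"
    using assms q' by (intro Youngs_inequality) auto
  also have "(y powr (q - 1)) powr q' = y powr q" using assms by (simp add: q'(3) powr_powr)
  finally have "x * y powr (q - 1) \<le> x powr q / q + y powr q / q'" .
  hence "q * (x * y powr (q - 1)) \<le> q * (x powr q / q + y powr q / q')" using assms by (intro mult_left_mono) auto
  also have "\<dots> = x powr q + q / q' * y powr q" using assms by (simp add: distrib_left)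
  also have "q / q' = q - 1" using assms by (simp add: q'(3))
  finally show ?thesis by (simp add: mult_ac)
qed

text \<open>The tangent inequalities at the mean are added with the two weights; the linear terms
  cancel.\<close>

lemma powr_convex:
  fixes x y q \<theta> :: real
  assumes "q > 1" "x \<ge> 0" "y \<ge> 0" "0 \<le> \<theta>" "\<theta> \<le> 1"
  shows "((1 - \<theta>) * x + \<theta> * y) powr q \<le> (1 - \<theta>) * x powr q + \<theta> * y powr q"
proof -
  define z where "z = (1 - \<theta>) * x + \<theta> * y"
  have z: "z \<ge> 0" using assms by (simp add: z_def)
  have "q * z powr (q - 1) * z \<le> (1 - \<theta>) * (x powr q + (q - 1) * z powr q) + \<theta> * (y powr q + (q - 1) * z powr q)"
  proof -
    have "q * z powr (q - 1) * z = (1 - \<theta>) * (q * z powr (q - 1) * x) + \<theta> * (q * z powr (q - 1) * y)"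
      by (simp add: z_def algebra_simps)
    also have "\<dots> \<le> (1 - \<theta>) * (x powr q + (q - 1) * z powr q) + \<theta> * (y powr q + (q - 1) * z powr q)"
      using assms z by (intro add_mono mult_left_mono powr_tangent) auto
    finally show ?thesis .
  qed
  moreover have "z powr (q - 1) * z = z powr q" using z by (cases "z = 0") (auto simp: powr_diff)
  ultimately have "q * z powr q \<le> (1 - \<theta>) * (x powr q + (q - 1) * z powr q) + \<theta> * (y powr q + (q - 1) * z powr q)"
    by (simp add: mult.assoc)
  thus ?thesis unfolding z_def[symmetric] by (simp add: algebra_simps)
qed

lemma powr_add_le:
  fixes x y p :: real
  assumes "p > 0" "x \<ge> 0" "y \<ge> 0"
  shows "(x + y) powr p \<le> 2 powr p * (x powr p + y powr p)"
proof -
  have "(x + y) powr p \<le> (2 * max x y) powr p" using assms by (intro powr_mono2) auto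
  also have "\<dots> = 2 powr p * (max x y) powr p" by (simp add: powr_mult)
  also have "(max x y) powr p \<le> x powr p + y powr p" by (auto simp: max_def)
  finally show ?thesis by simp
qed

lemma power_diff_le:
  fixes e h :: real
  assumes "0 \<le> e" "0 \<le> h" "h \<le> B" "e \<le> B"
  shows "\<bar>h ^ m - e ^ m\<bar> \<le> m * B ^ (m - 1) * \<bar>h - e\<bar>"
proof -
  have "norm (h ^ m - e ^ m) \<le> (m * B ^ (m - 1)) * norm (h - e)"
  proof (rule field_differentiable_bound[of "{0..B}" "\<lambda>x. x ^ m" "\<lambda>x. m * x ^ (m - 1)"])
    show "((\<lambda>x. x ^ m) has_field_derivative m * x ^ (m - 1)) (at x within {0..B})" for x :: real
      by (auto intro!: derivative_eq_intros)
    show "norm (m * x ^ (m - 1)) \<le> m * B ^ (m - 1)" if "x \<in> {0..B}" for x :: real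
      using that by (auto intro!: mult_left_mono power_mono)
  qed (use assms in auto)
  thus ?thesis by simp
qed

text \<open>Comparison of the nonlocal energy densities of \<open>u\<close> and of \<open>u - \<eta>\<^sup>m (u - k)\<^sub>+\<close>. Taking
  \<open>m \<ge> q\<close> makes the first term on the right appear with the constant one, so that no coercivity of
  the nonlocal part is needed.\<close>

lemma truncation_pointwise_ordered:
  fixes X Y k e h q :: real and m :: nat
  assumes q: "q > 1" "q \<le> m" and e: "0 \<le> e" "e \<le> 1" and h: "0 \<le> h" "h \<le> 1" and XY: "Y \<le> X"
  defines "W \<equiv> max 0 (X - k)" and "w \<equiv> max 0 (Y - k)"
  defines "C \<equiv> (m * 2 ^ m) powr q + q * 2 powr q"
  defines "\<Delta> \<equiv> \<bar>(X - e ^ m * W) - (Y - h ^ m * w)\<bar> powr q - \<bar>X - Y\<bar> powr q"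
  shows "h \<le> 2 * e \<Longrightarrow> \<Delta> \<le> C * \<bar>e - h\<bar> powr q * w powr q"
    and "2 * e < h \<Longrightarrow> \<Delta> \<le> C * \<bar>e - h\<bar> powr q * (W powr (q - 1) * w)"
proof -
  have C1: "(m * 2 ^ m) powr q \<le> C" "q * 2 powr q \<le> C" "C \<ge> 0" using q by (auto simp: C_def)
  have m: "m \<ge> 1" using q by linarith
  have Ww: "W \<ge> w" "w \<ge> 0" using XY by (auto simp: W_def w_def)
  have em: "0 \<le> e ^ m" "e ^ m \<le> 1" and hm: "0 \<le> h ^ m" "h ^ m \<le> 1" using e h by (auto simp: power_le_one)
  \<comment> \<open>If Y is at most k, the modified value of X still lies between Y and X, so the
    difference cannot grow.\<close>
  have D0: "\<Delta> \<le> 0" if "w = 0"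
  proof -
    have WX: "W \<le> X - Y" using that XY by (auto simp: W_def w_def max_def split: if_splits)
    have "e ^ m * W \<le> 1 * W" using em Ww by (intro mult_right_mono) auto
    moreover have "e ^ m * W \<ge> 0" using em Ww by simp
    ultimately have "\<bar>(X - e ^ m * W) - (Y - h ^ m * w)\<bar> \<le> \<bar>X - Y\<bar>" using that WX by auto
    hence "\<bar>(X - e ^ m * W) - (Y - h ^ m * w)\<bar> powr q \<le> \<bar>X - Y\<bar> powr q" using q by (intro powr_mono2) auto
    thus ?thesis by (simp add: \<Delta>_def)
  qed
  \<comment> \<open>As soon as w is positive both X and Y lie above k, hence X - Y = W - w, and the
    modified difference depends only on b and w.\<close>
  define b where "b = W - w"
  have b: "b \<ge> 0" using Ww by (simp add: b_def)
  have Dw: "\<Delta> = \<bar>(1 - e ^ m) * b + (h ^ m - e ^ m) * w\<bar> powr q - b powr q" if "w > 0"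
  proof -
    have "X - Y = b" using that XY by (auto simp: b_def W_def w_def)
    moreover have "(X - e ^ m * W) - (Y - h ^ m * w) = (1 - e ^ m) * b + (h ^ m - e ^ m) * w"
      using \<open>X - Y = b\<close> by (simp add: b_def algebra_simps)
    ultimately show ?thesis using b by (simp add: \<Delta>_def)
  qed
  show "\<Delta> \<le> C * \<bar>e - h\<bar> powr q * w powr q" if he: "h \<le> 2 * e"
  proof (cases "w = 0 \<or> e = 0")
    case True
    thus ?thesis
    proof
      assume "w = 0" thus ?thesis using D0 C1 by simp
    next
      assume "e = 0"
      hence "h = 0" using he h by simp
      with \<open>e = 0\<close> show ?thesis using m by (simp add: \<Delta>_def power_0_left)
    qed
  next
    case False
    hence w: "w > 0" and e0: "e > 0" using Ww e by auto
    \<comment> \<open>Convexity with weight \<theta> = e^m leaves at most b^q plus \<theta>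
      (g/\<theta>)^q. For h \<le> 2 e the difference of the m-th powers is of order e^(m-1) |e - h|,
      so g/\<theta> is of order |e - h| w / e, and the remaining factor e^(m-q) is at most one
      because m \<ge> q.\<close>
    define \<theta> where "\<theta> = e ^ m"
    have \<theta>: "0 < \<theta>" "\<theta> \<le> 1" using e0 em by (auto simp: \<theta>_def)
    define g where "g = \<bar>h ^ m - e ^ m\<bar> * w"
    have g: "g \<ge> 0" using w by (simp add: g_def)
    have "\<bar>(1 - e ^ m) * b + (h ^ m - e ^ m) * w\<bar> \<le> (1 - \<theta>) * b + \<theta> * (g / \<theta>)"
    proof -
      have "\<bar>(1 - e ^ m) * b + (h ^ m - e ^ m) * w\<bar> \<le> \<bar>(1 - e ^ m) * b\<bar> + \<bar>(h ^ m - e ^ m) * w\<bar>" by (rule abs_triangle_ineq)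
      also have "\<dots> = (1 - \<theta>) * b + \<theta> * (g / \<theta>)" using \<theta> b w e0 by (simp add: abs_mult g_def \<theta>_def)
      finally show ?thesis .
    qed
    hence "\<bar>(1 - e ^ m) * b + (h ^ m - e ^ m) * w\<bar> powr q \<le> ((1 - \<theta>) * b + \<theta> * (g / \<theta>)) powr q"
      using q by (intro powr_mono2) auto
    also have "\<dots> \<le> (1 - \<theta>) * b powr q + \<theta> * (g / \<theta>) powr q"
      using q b g \<theta> by (intro powr_convex) auto
    also have "(1 - \<theta>) * b powr q \<le> 1 * b powr q" using \<theta> by (intro mult_right_mono) auto
    finally have 1: "\<Delta> \<le> \<theta> * (g / \<theta>) powr q" using Dw[OF w] by simp
    have "g / \<theta> \<le> (m * 2 ^ m) * (\<bar>e - h\<bar> * w) / e"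
    proof -
      have "\<bar>h ^ m - e ^ m\<bar> \<le> m * (2 * e) ^ (m - 1) * \<bar>h - e\<bar>" using e h he by (intro power_diff_le) auto
      also have "\<dots> \<le> m * (2 ^ m * e ^ (m - 1)) * \<bar>h - e\<bar>"
        using e by (intro mult_right_mono mult_left_mono) (auto simp: power_mult_distrib intro!: mult_right_mono power_increasing)
      finally have "g \<le> m * (2 ^ m * e ^ (m - 1)) * \<bar>h - e\<bar> * w" unfolding g_def using w by (intro mult_right_mono) auto
      hence "g / \<theta> \<le> (m * (2 ^ m * e ^ (m - 1)) * \<bar>h - e\<bar> * w) / \<theta>" using \<theta> by (intro divide_right_mono) auto
      also have "\<dots> = (m * 2 ^ m) * (\<bar>e - h\<bar> * w) / e"
      proof -
        have "\<theta> = e * e ^ (m - 1)" using m by (cases m) (auto simp: \<theta>_def)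
        thus ?thesis using e0 by (simp add: abs_minus_commute)
      qed
      finally show ?thesis .
    qed
    hence "(g / \<theta>) powr q \<le> ((m * 2 ^ m) * (\<bar>e - h\<bar> * w) / e) powr q" using q g \<theta> by (intro powr_mono2) auto
    also have "\<dots> = (m * 2 ^ m) powr q * (\<bar>e - h\<bar> powr q * w powr q) / e powr q"
      by (simp add: powr_mult powr_divide)
    finally have "\<theta> * (g / \<theta>) powr q \<le> \<theta> * ((m * 2 ^ m) powr q * (\<bar>e - h\<bar> powr q * w powr q) / e powr q)"
      using \<theta> by (intro mult_left_mono) auto
    also have "\<dots> = (m * 2 ^ m) powr q * (\<bar>e - h\<bar> powr q * w powr q) * (\<theta> / e powr q)" by simp
    also have "\<theta> / e powr q = e powr (m - q)" using e0 by (simp add: \<theta>_def powr_diff powr_realpow)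
    also have "(m * 2 ^ m) powr q * (\<bar>e - h\<bar> powr q * w powr q) * e powr (m - q) \<le> (m * 2 ^ m) powr q * (\<bar>e - h\<bar> powr q * w powr q) * 1"
      using e e0 q by (intro mult_left_mono powr_le1) auto
    also have "\<dots> \<le> C * (\<bar>e - h\<bar> powr q * w powr q)" using C1 by (simp add: mult_right_mono)
    finally show ?thesis using 1 by (simp add: mult.assoc)
  qed
  \<comment> \<open>Here e may be too small to divide by, but h < 2 |e - h|. The tangent inequality
    bounds the increase by q W^(q-1) g, and g \<le> h^m w \<le> (2 |e - h|)^q w, again by m \<ge>
    q.\<close>
  show "\<Delta> \<le> C * \<bar>e - h\<bar> powr q * (W powr (q - 1) * w)" if he: "2 * e < h"
  proof (cases "w = 0")
    case True thus ?thesis using D0 by simp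
  next
    case False
    hence w: "w > 0" using Ww by auto
    define g where "g = (h ^ m - e ^ m) * w"
    have "e ^ m \<le> h ^ m" using e he by (intro power_mono) auto
    hence g0: "g \<ge> 0" using w by (simp add: g_def)
    have gw: "g \<le> h ^ m * w" using w em by (simp add: g_def)
    have gw2: "g \<le> w" using gw hm w by (meson mult_left_le_one_le order_trans less_imp_le)
    have "(1 - e ^ m) * b \<le> 1 * b" using em b by (intro mult_right_mono) auto
    hence "\<bar>(1 - e ^ m) * b + (h ^ m - e ^ m) * w\<bar> \<le> b + g" using g0 em b by (simp add: g_def[symmetric])
    hence "\<bar>(1 - e ^ m) * b + (h ^ m - e ^ m) * w\<bar> powr q \<le> (b + g) powr q" using q by (intro powr_mono2) auto
    moreover have "q * (b + g) powr (q - 1) * b \<le> b powr q + (q - 1) * (b + g) powr q"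
      using q b g0 by (intro powr_tangent) auto
    moreover have "(b + g) powr q = (b + g) powr (q - 1) * (b + g)"
      using b g0 by (cases "b + g = 0") (auto simp: powr_diff)
    ultimately have "\<Delta> \<le> q * ((b + g) powr (q - 1) * g)" using Dw[OF w] by (simp add: algebra_simps)
    also have "\<dots> \<le> q * (W powr (q - 1) * ((2 * \<bar>e - h\<bar>) powr q * w))"
    proof (intro mult_left_mono mult_mono)
      show "(b + g) powr (q - 1) \<le> W powr (q - 1)" using q b g0 gw2 by (intro powr_mono2) (auto simp: b_def)
      have h0: "h > 0" using he e by simp
      have "h ^ m = h powr m" using h0 by (simp add: powr_realpow)
      also have "\<dots> \<le> h powr q" using h h0 q by (intro powr_mono') auto
      also have "\<dots> \<le> (2 * \<bar>e - h\<bar>) powr q" using he h0 q e by (intro powr_mono2) auto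
      finally have "h ^ m * w \<le> (2 * \<bar>e - h\<bar>) powr q * w" using w by (intro mult_right_mono) auto
      thus "g \<le> (2 * \<bar>e - h\<bar>) powr q * w" using gw by linarith
    qed (use q g0 in auto)
    also have "\<dots> = (q * 2 powr q) * (\<bar>e - h\<bar> powr q * (W powr (q - 1) * w))" by (simp add: powr_mult)
    also have "\<dots> \<le> C * (\<bar>e - h\<bar> powr q * (W powr (q - 1) * w))" using C1 Ww by (intro mult_right_mono) auto
    finally show ?thesis by (simp add: mult.assoc)
  qed
qed

text \<open>The ordering of X and Y is removed by symmetry. The second estimate is for a point Y
  outside the support of the cut-off: it is linear in W, so that the distant factor appears with
  exactly the power q - 1 that the tail space controls.\<close>

lemma truncation_pointwise:
  fixes X Y k e h q :: real and m :: nat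
  assumes q: "q > 1" "q \<le> m" and e: "0 \<le> e" "e \<le> 1" and h: "0 \<le> h" "h \<le> 1"
  defines "W \<equiv> max 0 (X - k)" and "w \<equiv> max 0 (Y - k)"
  defines "C \<equiv> (m * 2 ^ m) powr q + q * 2 powr q"
  shows "\<bar>(X - e ^ m * W) - (Y - h ^ m * w)\<bar> powr q \<le> \<bar>X - Y\<bar> powr q + C * \<bar>e - h\<bar> powr q * (W powr q + w powr q)"
    and "h = 0 \<Longrightarrow> \<bar>(X - e ^ m * W) - (Y - h ^ m * w)\<bar> powr q \<le> \<bar>X - Y\<bar> powr q + C * (W * w powr (q - 1))"
proof -
  have C: "C \<ge> 0" using q by (simp add: C_def)
  have W0: "W \<ge> 0" "w \<ge> 0" by (auto simp: W_def w_def)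
  have pw: "x powr q = x powr (q - 1) * x" if "x \<ge> 0" for x :: real using that by (cases "x = 0") (auto simp: powr_diff)
  have m1: "x powr (q - 1) * y \<le> x powr q" if "0 \<le> y" "y \<le> x" for x y :: real
    using that by (subst pw) (auto intro!: mult_left_mono)
  consider "Y \<le> X" | "X \<le> Y" by linarith
  note cs = this
  note o1 = truncation_pointwise_ordered[OF q e h, of Y X k, folded W_def w_def C_def]
  note o2 = truncation_pointwise_ordered[OF q h e, of X Y k, folded W_def w_def C_def]
  show "\<bar>(X - e ^ m * W) - (Y - h ^ m * w)\<bar> powr q \<le> \<bar>X - Y\<bar> powr q + C * \<bar>e - h\<bar> powr q * (W powr q + w powr q)"
    using cs
  proof cases
    case 1
    have wW: "w \<le> W" using 1 by (auto simp: W_def w_def)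
    have "C * \<bar>e - h\<bar> powr q * w powr q \<le> C * \<bar>e - h\<bar> powr q * (W powr q + w powr q)"
      "C * \<bar>e - h\<bar> powr q * (W powr (q - 1) * w) \<le> C * \<bar>e - h\<bar> powr q * (W powr q + w powr q)"
      using C m1[OF W0(2) wW] by (intro mult_left_mono; simp add: add_increasing2)+
    thus ?thesis using o1[OF 1] by (cases "h \<le> 2 * e") force+
  next
    case 2
    have wW: "W \<le> w" using 2 by (auto simp: W_def w_def)
    have "C * \<bar>h - e\<bar> powr q * W powr q \<le> C * \<bar>h - e\<bar> powr q * (W powr q + w powr q)"
      "C * \<bar>h - e\<bar> powr q * (w powr (q - 1) * W) \<le> C * \<bar>h - e\<bar> powr q * (W powr q + w powr q)"
      using C m1[OF W0(1) wW] by (intro mult_left_mono; simp add: add_increasing)+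
    hence "\<bar>(Y - h ^ m * w) - (X - e ^ m * W)\<bar> powr q \<le> \<bar>Y - X\<bar> powr q + C * \<bar>h - e\<bar> powr q * (W powr q + w powr q)"
      using o2[OF 2] by (cases "e \<le> 2 * h") force+
    thus ?thesis by (simp add: abs_minus_commute)
  qed
  show "\<bar>(X - e ^ m * W) - (Y - h ^ m * w)\<bar> powr q \<le> \<bar>X - Y\<bar> powr q + C * (W * w powr (q - 1))" if h0: "h = 0"
    using cs
  proof cases
    case 1
    have wW: "w \<le> W" using 1 by (auto simp: W_def w_def)
    have "w powr q \<le> W * w powr (q - 1)" using wW W0 by (subst pw) (auto simp: mult.commute intro!: mult_right_mono)
    moreover have "\<bar>e - h\<bar> powr q \<le> 1" using e h0 q by (intro powr_le1) auto
    ultimately have "\<bar>e - h\<bar> powr q * w powr q \<le> 1 * (W * w powr (q - 1))" using W0 by (intro mult_mono) auto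
    hence "C * (\<bar>e - h\<bar> powr q * w powr q) \<le> C * (W * w powr (q - 1))" using C by (intro mult_left_mono) auto
    thus ?thesis using o1(1)[OF 1] e h0 by (simp add: mult.assoc)
  next
    case 2
    show ?thesis
    proof (cases "e = 0")
      case True
      thus ?thesis using h0 C W0 q by (cases m) (auto intro!: mult_nonneg_nonneg)
    next
      case False
      hence "e > 2 * h" using e h0 by simp
      have "\<bar>h - e\<bar> powr q \<le> 1" using e h0 q by (intro powr_le1) auto
      hence "\<bar>h - e\<bar> powr q * (w powr (q - 1) * W) \<le> 1 * (w powr (q - 1) * W)" using W0 by (intro mult_right_mono) auto
      hence "C * (\<bar>h - e\<bar> powr q * (w powr (q - 1) * W)) \<le> C * (W * w powr (q - 1))" using C by (intro mult_left_mono) (auto simp: mult.commute)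
      hence "\<bar>(Y - h ^ m * w) - (X - e ^ m * W)\<bar> powr q \<le> \<bar>Y - X\<bar> powr q + C * (W * w powr (q - 1))"
        using o2(2)[OF 2 \<open>e > 2 * h\<close>] by (simp add: mult.assoc)
      thus ?thesis by (simp add: abs_minus_commute)
    qed
  qed
qed

subsection \<open>Iteration lemmas\<close>

text \<open>Iterating over geometrically accumulating radii, the contraction factor \<theta> must
  beat the growth of the gap term. The bound B only makes the remainder \<theta>^n \<Phi> vanish in
  the limit and does not enter the constant.\<close>

lemma hole_filling_iteration:
  fixes \<theta> b :: real
  assumes \<theta>: "0 < \<theta>" "\<theta> < 1" and b: "b > 0"
  obtains C where "C > 0" "\<And>\<Phi> S B r0 r1. \<lbrakk>r0 < r1; S \<ge> 0; \<And>t. r0 \<le> t \<Longrightarrow> t \<le> r1 \<Longrightarrow> \<Phi> t \<le> B;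
     \<And>\<rho> r. r0 \<le> \<rho> \<Longrightarrow> \<rho> < r \<Longrightarrow> r \<le> r1 \<Longrightarrow> \<Phi> \<rho> \<le> \<theta> * \<Phi> r + S * (r - \<rho>) powr (- b)\<rbrakk> \<Longrightarrow>
     \<Phi> r0 \<le> C * S * (r1 - r0) powr (- b)"
proof -
  \<comment> \<open>Chosen so that \<theta> \<tau>^(-b) = 2 \<theta> / (1 + \<theta>) < 1, hence the
    errors of the successive steps are summable.\<close>
  define \<tau> where "\<tau> = ((1 + \<theta>) / 2) powr (1 / b)"
  have \<tau>: "0 < \<tau>" "\<tau> < 1"
    using \<theta> b powr_less_mono2[of "1 / b" "(1 + \<theta>) / 2" 1] by (auto simp: \<tau>_def)
  define \<kappa> where "\<kappa> = \<theta> * \<tau> powr (- b)"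
  have "\<tau> powr (- b) = 2 / (1 + \<theta>)" using \<theta> b by (simp add: \<tau>_def powr_powr powr_minus field_simps)
  hence "\<kappa> = 2 * \<theta> / (1 + \<theta>)" by (simp add: \<kappa>_def)
  moreover have "0 < 2 * \<theta> / (1 + \<theta>)" "2 * \<theta> / (1 + \<theta>) < 1" using \<theta> by (simp_all add: divide_less_eq)
  ultimately have \<kappa>: "0 < \<kappa>" "\<kappa> < 1" by simp_all
  define C where "C = (1 - \<tau>) powr (- b) / (1 - \<kappa>)"
  show ?thesis
  proof (rule that[of C])
    show "C > 0" using \<tau> \<kappa> by (simp add: C_def)
    fix \<Phi> :: "real \<Rightarrow> real" and S B r0 r1 :: real
    assume r: "r0 < r1" and S: "S \<ge> 0" and B: "\<And>t. r0 \<le> t \<Longrightarrow> t \<le> r1 \<Longrightarrow> \<Phi> t \<le> B"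
      and step: "\<And>\<rho> r. r0 \<le> \<rho> \<Longrightarrow> \<rho> < r \<Longrightarrow> r \<le> r1 \<Longrightarrow> \<Phi> \<rho> \<le> \<theta> * \<Phi> r + S * (r - \<rho>) powr (- b)"
    define d where "d = r1 - r0"
    define t where "t = (\<lambda>i::nat. r0 + (1 - \<tau> ^ i) * d)"
    have d: "d > 0" using r by (simp add: d_def)
    have ti: "\<tau> ^ i \<le> 1" "\<tau> ^ i > 0" for i using \<tau> by (auto simp: power_le_one)
    have t01: "r0 \<le> t i" "t i \<le> r1" for i
    proof -
      show "r0 \<le> t i" using ti[of i] d by (simp add: t_def)
      have "(1 - \<tau> ^ i) * d \<le> 1 * d" using ti[of i] d by (intro mult_right_mono) auto
      thus "t i \<le> r1" by (simp add: t_def d_def)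
    qed
    have td: "t (Suc i) - t i = \<tau> ^ i * ((1 - \<tau>) * d)" for i by (simp add: t_def algebra_simps)
    define A where "A = S * ((1 - \<tau>) * d) powr (- b)"
    have A: "A \<ge> 0" using S by (simp add: A_def)
    have st: "\<Phi> (t i) \<le> \<theta> * \<Phi> (t (Suc i)) + A * (\<tau> powr (- b)) ^ i" for i
    proof -
      have "t i < t (Suc i)" using td[of i] ti[of i] \<tau> d by (smt (verit) mult_pos_pos)
      from step[OF t01(1) this t01(2)]
      have "\<Phi> (t i) \<le> \<theta> * \<Phi> (t (Suc i)) + S * (\<tau> ^ i * ((1 - \<tau>) * d)) powr (- b)" by (simp add: td)
      also have "(\<tau> ^ i * ((1 - \<tau>) * d)) powr (- b) = (\<tau> ^ i) powr (- b) * ((1 - \<tau>) * d) powr (- b)"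
        by (rule powr_mult)
      also have "(\<tau> ^ i) powr (- b) = (\<tau> powr (- b)) ^ i"
        using \<tau> by (simp add: powr_realpow[symmetric] powr_powr powr_power mult.commute)
      finally show ?thesis by (simp add: A_def mult_ac)
    qed
    have ind: "\<Phi> (t 0) \<le> \<theta> ^ n * \<Phi> (t n) + A * (\<Sum>i<n. \<kappa> ^ i)" for n
    proof (induction n)
      case (Suc n)
      have "\<theta> ^ n * \<Phi> (t n) \<le> \<theta> ^ n * (\<theta> * \<Phi> (t (Suc n)) + A * (\<tau> powr (- b)) ^ n)"
        using st \<theta> by (intro mult_left_mono) auto
      also have "\<dots> = \<theta> ^ Suc n * \<Phi> (t (Suc n)) + A * \<kappa> ^ n"
        by (simp add: \<kappa>_def power_mult_distrib algebra_simps)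
      finally show ?case using Suc by (simp add: distrib_left)
    qed simp
    have bound: "\<Phi> r0 \<le> \<theta> ^ n * \<bar>B\<bar> + A / (1 - \<kappa>)" for n
    proof -
      have "(\<Sum>i<n. \<kappa> ^ i) = (1 - \<kappa> ^ n) / (1 - \<kappa>)" using \<kappa> by (simp add: sum_gp_strict)
      also have "\<dots> \<le> 1 / (1 - \<kappa>)" using \<kappa> by (intro divide_right_mono) auto
      finally have "A * (\<Sum>i<n. \<kappa> ^ i) \<le> A * (1 / (1 - \<kappa>))" using A by (rule mult_left_mono)
      moreover have "\<theta> ^ n * \<Phi> (t n) \<le> \<theta> ^ n * \<bar>B\<bar>"
        using B[OF t01, of n] \<theta> by (intro mult_left_mono) auto
      moreover have "t 0 = r0" by (simp add: t_def)
      ultimately show ?thesis using ind[of n] by simp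
    qed
    have "(\<lambda>n. \<theta> ^ n * \<bar>B\<bar> + A / (1 - \<kappa>)) \<longlonglongrightarrow> 0 * \<bar>B\<bar> + A / (1 - \<kappa>)"
      using \<theta> by (intro tendsto_intros LIMSEQ_power_zero) auto
    hence "\<Phi> r0 \<le> 0 * \<bar>B\<bar> + A / (1 - \<kappa>)"
      by (rule LIMSEQ_le_const) (use bound in auto)
    also have "\<dots> = C * S * (r1 - r0) powr (- b)"
      unfolding A_def C_def d_def[symmetric] by (simp add: powr_mult)
    finally show "\<Phi> r0 \<le> C * S * (r1 - r0) powr (- b)" .
  qed
qed

text \<open>One shows Y n \<le> \<epsilon> l^n. Because \<epsilon> \<le> 1 this keeps every Y n
  below one, so the recursion need only be assumed under that restriction, which is how
  \<open>de_giorgi_step\<close> provides it.\<close>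

lemma fast_geometric_convergence:
  fixes c b \<delta> :: real
  assumes c: "c > 0" and b: "b > 1" and \<delta>: "\<delta> > 0"
  obtains \<epsilon> where "\<epsilon> > 0" "\<epsilon> \<le> 1" "\<And>Y. \<lbrakk>\<And>n. Y n \<ge> 0; Y 0 \<le> \<epsilon>; \<And>n. Y n \<le> 1 \<Longrightarrow> Y (Suc n) \<le> c * b ^ n * Y n powr (1 + \<delta>)\<rbrakk> \<Longrightarrow> Y \<longlonglongrightarrow> 0"
proof -
  \<comment> \<open>The ratio satisfies l^\<delta> = 1/b, so the superlinear gain (l^n)^\<delta>
    cancels b^n exactly; \<epsilon> is then small enough that c \<epsilon>^\<delta> \<le> l.\<close>
  define l where "l = b powr (- 1 / \<delta>)"
  have l: "0 < l" "l < 1" using b \<delta> by (auto simp: l_def powr_less_one)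
  define \<epsilon> where "\<epsilon> = min 1 ((l / c) powr (1 / \<delta>))"
  have \<epsilon>: "\<epsilon> > 0" "\<epsilon> \<le> 1" using l c by (auto simp: \<epsilon>_def)
  have \<epsilon>2: "c * \<epsilon> powr \<delta> \<le> l"
  proof -
    have "\<epsilon> powr \<delta> \<le> ((l / c) powr (1 / \<delta>)) powr \<delta>" using \<epsilon> \<delta> by (intro powr_mono2) (auto simp: \<epsilon>_def)
    also have "\<dots> = l / c" using l c \<delta> by (simp add: powr_powr)
    finally show ?thesis using c by (simp add: field_simps)
  qed
  show ?thesis
  proof (rule that[OF \<epsilon>])
    fix Y :: "nat \<Rightarrow> real" assume Y: "\<And>n. Y n \<ge> 0" "Y 0 \<le> \<epsilon>"
      and step: "\<And>n. Y n \<le> 1 \<Longrightarrow> Y (Suc n) \<le> c * b ^ n * Y n powr (1 + \<delta>)"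
    have ind: "Y n \<le> \<epsilon> * l ^ n" for n
    proof (induction n)
      case 0 thus ?case using Y by simp
    next
      case (Suc n)
      have "\<epsilon> * l ^ n \<le> 1 * 1" using \<epsilon> l by (intro mult_mono power_le_one) auto
      hence "Y n \<le> 1" using Suc by linarith
      from step[OF this] have "Y (Suc n) \<le> c * b ^ n * Y n powr (1 + \<delta>)" .
      also have "\<dots> \<le> c * b ^ n * (\<epsilon> * l ^ n) powr (1 + \<delta>)"
        using Suc Y(1) c b \<delta> by (intro mult_left_mono powr_mono2) auto
      also have "(\<epsilon> * l ^ n) powr (1 + \<delta>) = \<epsilon> * l ^ n * (\<epsilon> powr \<delta> * (l powr \<delta>) ^ n)"
      proof -
        have "(\<epsilon> * l ^ n) powr (1 + \<delta>) = (\<epsilon> * l ^ n) * (\<epsilon> * l ^ n) powr \<delta>"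
          using \<epsilon> l by (simp add: powr_add)
        also have "(\<epsilon> * l ^ n) powr \<delta> = \<epsilon> powr \<delta> * (l ^ n) powr \<delta>" by (rule powr_mult)
        also have "(l ^ n) powr \<delta> = (l powr \<delta>) ^ n"
          using l by (simp add: powr_realpow[symmetric] powr_powr powr_power mult.commute)
        finally show ?thesis .
      qed
      also have "l powr \<delta> = 1 / b"
      proof -
        have "l powr \<delta> = b powr (- 1 / \<delta> * \<delta>)" by (simp only: l_def powr_powr)
        thus ?thesis using b \<delta> by (simp add: powr_minus_divide)
      qed
      also have "c * b ^ n * (\<epsilon> * l ^ n * (\<epsilon> powr \<delta> * (1 / b) ^ n)) = \<epsilon> * l ^ n * (c * \<epsilon> powr \<delta>)"
        using b by (simp add: power_divide)
      also have "\<dots> \<le> \<epsilon> * l ^ n * l" using \<epsilon>2 \<epsilon> l by (intro mult_left_mono) auto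
      finally show ?case by (simp add: mult_ac)
    qed
    have "(\<lambda>n. \<epsilon> * l ^ n) \<longlonglongrightarrow> \<epsilon> * 0" using l by (intro tendsto_intros LIMSEQ_power_zero) auto
    hence "(\<lambda>n. \<epsilon> * l ^ n) \<longlonglongrightarrow> 0" by simp
    thus "Y \<longlonglongrightarrow> 0"
      by (rule tendsto_sandwich[OF _ _ tendsto_const, rotated 2]) (use Y ind in auto)
  qed
qed

section \<open>Caccioppoli inequality for minimizers\<close>

lemma AE_lborel_fst:
  assumes "AE x in (lborel :: 'a::euclidean_space measure). P x"
  shows "AE z in (lborel :: ('a \<times> 'b::euclidean_space) measure). P (fst z)"
proof -
  obtain N where N: "N \<in> null_sets lborel" "{x. \<not> P x} \<subseteq> N"
    using assms by (auto elim!: AE_E simp: null_sets_def)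
  have [measurable]: "N \<in> sets borel" using N(1) by (auto simp: null_sets_def)
  have "AE x in lborel. x \<notin> N" by (rule AE_not_in[OF N(1)])
  hence "AE x in (lborel :: 'a measure). AE y in (lborel :: 'b measure). fst (x, y) \<notin> N"
    by eventually_elim simp
  moreover have "{z \<in> space (lborel \<Otimes>\<^sub>M (lborel :: 'b measure)). fst z \<notin> N} \<in> sets (lborel \<Otimes>\<^sub>M lborel)"
    by measurable
  ultimately have "AE z in lborel \<Otimes>\<^sub>M (lborel :: 'b measure). fst z \<notin> N"
    by (intro lborel_pair.AE_pair_measure)
  thus ?thesis unfolding lborel_prod by (rule eventually_mono) (use N(2) in auto)
qed

lemma lborel_swap: "distr lborel lborel (\<lambda>(x, y). (y, x)) = (lborel :: ('a::euclidean_space \<times> 'a) measure)"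
  unfolding lborel_prod[symmetric] by (rule lborel_pair.distr_pair_swap[symmetric])

lemma measurable_swap: "(\<lambda>(x, y). (y, x)) \<in> measurable lborel (lborel :: ('a::euclidean_space \<times> 'a) measure)"
  unfolding lborel_prod[symmetric] by (rule measurable_pair_swap')

lemma AE_lborel_swap:
  assumes "AE z in (lborel :: ('a::euclidean_space \<times> 'a) measure). P z"
  shows "AE z in (lborel :: ('a \<times> 'a) measure). P (snd z, fst z)"
proof -
  have "AE z in distr lborel lborel (\<lambda>(x, y). (y, x)). P (z :: 'a \<times> 'a)" unfolding lborel_swap by (rule assms)
  from AE_distrD[OF measurable_swap this] show ?thesis by (simp add: case_prod_unfold)
qed

lemma AE_lborel_snd:
  assumes "AE x in (lborel :: 'a::euclidean_space measure). P x"
  shows "AE z in (lborel :: ('a \<times> 'a) measure). P (snd z)"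
  using AE_lborel_swap[OF AE_lborel_fst[OF assms]] by simp

lemma nn_integral_lborel_swap:
  assumes "f \<in> borel_measurable (borel :: ('a::euclidean_space \<times> 'a) measure)"
  shows "(\<integral>\<^sup>+z. f (snd z, fst z) \<partial>lborel) = (\<integral>\<^sup>+z. f z \<partial>(lborel :: ('a \<times> 'a) measure))"
proof -
  have "(\<integral>\<^sup>+z. f z \<partial>lborel) = (\<integral>\<^sup>+z. f z \<partial>distr lborel lborel (\<lambda>(x, y). (y, x)))"
    unfolding lborel_swap ..
  also have "\<dots> = (\<integral>\<^sup>+z. f (case z of (x, y) \<Rightarrow> (y, x)) \<partial>lborel)"
    using assms by (intro nn_integral_distr measurable_swap) simp
  finally show ?thesis by (simp add: case_prod_unfold)
qed

lemma nn_integral_lborel_pair: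
  assumes "f \<in> borel_measurable (borel :: ('a::euclidean_space \<times> 'b::euclidean_space) measure)"
  shows "(\<integral>\<^sup>+z. f z \<partial>lborel) = (\<integral>\<^sup>+x. \<integral>\<^sup>+y. f (x, y) \<partial>lborel \<partial>lborel)"
proof -
  have "f \<in> borel_measurable (lborel \<Otimes>\<^sub>M lborel)" using assms by (simp add: lborel_prod)
  from lborel.nn_integral_fst[OF this] show ?thesis by (simp add: lborel_prod)
qed

lemma fst_borel: "(fst :: 'a::euclidean_space \<times> 'b::euclidean_space \<Rightarrow> 'a) \<in> borel_measurable borel"
  and snd_borel: "(snd :: 'a::euclidean_space \<times> 'b::euclidean_space \<Rightarrow> 'b) \<in> borel_measurable borel"
  by (intro borel_measurable_continuous_onI continuous_intros)+

lemma borel_fst_comp: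
  fixes v :: "'a::euclidean_space \<Rightarrow> 'c::topological_space"
  assumes "v \<in> borel_measurable borel"
  shows "(\<lambda>z. v (fst z)) \<in> borel_measurable (borel :: ('a \<times> 'b::euclidean_space) measure)"
  using measurable_compose[OF fst_borel assms] .

lemma borel_snd_comp:
  fixes v :: "'b::euclidean_space \<Rightarrow> 'c::topological_space"
  assumes "v \<in> borel_measurable borel"
  shows "(\<lambda>z. v (snd z)) \<in> borel_measurable (borel :: ('a::euclidean_space \<times> 'b) measure)"
  using measurable_compose[OF snd_borel assms] .

lemma kernel_pair_measurable:
  "(\<lambda>z. norm (fst z - snd z) powr c) \<in> borel_measurable (borel :: ('a::euclidean_space \<times> 'a) measure)"
proof (rule powr_real_measurable)
  show "(\<lambda>z. norm (fst z - snd z)) \<in> borel_measurable (borel :: ('a \<times> 'a) measure)"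
    by (intro borel_measurable_continuous_onI continuous_intros)
qed simp

section \<open>The variational problem for p \<le> N and its Borel representatives\<close>

locale nonlocal_problem =
  fixes \<Omega> :: "'a::euclidean_space set"
    and F :: "'a \<Rightarrow> 'a \<Rightarrow> real" and a :: "'a \<Rightarrow> 'a \<Rightarrow> real" and f u :: "'a \<Rightarrow> real"
    and s p q \<gamma> \<Lambda> :: real
  assumes dim: "DIM('a) \<ge> 2" and open_\<Omega>: "open \<Omega>"
    and s: "0 < s" "s < 1" and p: "1 < p" "p \<le> s * q" and pN: "p \<le> DIM('a)"
    and caratheodory: "caratheodory \<Omega> F" and \<Lambda>: "\<Lambda> > 1"
    and growth: "AE x in lebesgue_on \<Omega>. \<forall>\<xi>. inverse \<Lambda> * norm \<xi> powr p \<le> F x \<xi> \<and> F x \<xi> \<le> \<Lambda> * norm \<xi> powr p"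
    and a_measurable: "case_prod a \<in> borel_measurable lebesgue"
    and a_nonneg: "\<And>x y. a x y \<ge> 0" and a_sym: "\<And>x y. a x y = a y x"
    and a_loc: "case_prod a \<in> Linf_loc (\<Omega> \<times> \<Omega>)"
    and qp: "p < DIM('a) \<Longrightarrow> q / p \<le> 1 + p / (DIM('a) - p)"
    and f_loc: "f \<in> Lspace_loc \<gamma> \<Omega>" and \<gamma>1: "\<gamma> > q / (q - p)" and \<gamma>2: "\<gamma> > p / (p - 1)"
    and min: "minimizer F f (nonlocal_kernel a s q) p q \<Omega> u"
    and tail: "u \<in> weighted_tail_space a s q \<Omega>"

text \<open>Representatives are fixed once. Those of the kernel weight are required to be
  nonnegative and symmetric at every point, so that exchanging the two variables is an identity and
  not merely one almost everywhere.\<close>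

locale nonlocal_problem_rep = nonlocal_problem \<Omega> F a f u s p q \<gamma> \<Lambda>
  for \<Omega> :: "'a::euclidean_space set" and F a f u s p q \<gamma> \<Lambda> +
  fixes u0 :: "'a \<Rightarrow> real" and G0 :: "'a \<Rightarrow> 'a" and f0 :: "'a \<Rightarrow> real" and a0 :: "'a \<times> 'a \<Rightarrow> real"
  assumes u0_AE: "AE x in lborel. u x = u0 x"
    and lw: "lwgrad \<Omega> u0 G0" and G0_AE: "AE x\<in>\<Omega> in lborel. weak_gradient \<Omega> u x = G0 x"
    and f0_borel [measurable]: "f0 \<in> borel_measurable borel" and f0_AE: "AE x\<in>\<Omega> in lborel. f x = f0 x"
    and a0_borel [measurable]: "a0 \<in> borel_measurable borel" and a0_AE: "AE z in lborel. case_prod a z = a0 z"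
    and a0_nonneg: "\<And>z. a0 z \<ge> 0" and a0_sym: "\<And>x y. a0 (x, y) = a0 (y, x)"
begin

lemma u0_borel [measurable]: "u0 \<in> borel_measurable borel" and G0_borel [measurable]: "G0 \<in> borel_measurable borel"
  using lwgradD(1,2)[OF lw] .

lemma \<Omega>_borel [measurable]: "\<Omega> \<in> sets borel" using open_\<Omega> by simp

lemma q: "p < q" "q > 1"
proof -
  have "q > 0" using p s by (smt (verit) mult_pos_pos zero_less_mult_iff)
  hence "s * q < 1 * q" using s by (intro mult_strict_right_mono) auto
  thus "p < q" "q > 1" using p by auto
qed

definition K0 :: "'a \<times> 'a \<Rightarrow> real" where
  "K0 z = a0 z * norm (fst z - snd z) powr (- real DIM('a) - s * q)"

definition NI :: "('a \<Rightarrow> real) \<Rightarrow> 'a \<times> 'a \<Rightarrow> real" where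
  "NI v z = \<bar>v (fst z) - v (snd z)\<bar> powr q * K0 z"

definition LI :: "('a \<Rightarrow> real) \<Rightarrow> ('a \<Rightarrow> 'a) \<Rightarrow> 'a \<Rightarrow> real" where
  "LI v G x = F x (G x) - f0 x * v x"

lemma K0_nonneg: "K0 z \<ge> 0" by (simp add: K0_def a0_nonneg)

lemma K0_borel [measurable]: "K0 \<in> borel_measurable borel"
  unfolding K0_def[abs_def] by (intro borel_measurable_times kernel_pair_measurable a0_borel)

lemma NI_borel [measurable]:
  assumes "v \<in> borel_measurable borel" shows "NI v \<in> borel_measurable borel"
  unfolding NI_def[abs_def]
  by (intro borel_measurable_times powr_real_measurable borel_measurable_abs borel_measurable_diff
      borel_fst_comp borel_snd_comp assms K0_borel borel_measurable_const)

lemma NI_nonneg: "NI v z \<ge> 0" by (simp add: NI_def K0_nonneg)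

lemma cross_borel [measurable]: "cross_region \<Omega> \<in> sets borel"
proof -
  have "closed ((- \<Omega>) \<times> (- \<Omega>))" using open_\<Omega> by (intro closed_Times) auto
  thus ?thesis unfolding cross_region_def by (intro sets.Diff) auto
qed

lemma nonlocal_integrand_rep:
  assumes g: "AE x in lborel. g x = v x" and v [measurable]: "v \<in> borel_measurable borel"
  defines "h \<equiv> nonlocal_integrand (nonlocal_kernel a s q) q g"
  shows "integrable (lebesgue_on (cross_region \<Omega>)) h \<longleftrightarrow> integrable lborel (\<lambda>z. indicator (cross_region \<Omega>) z * NI v z)"
    and "(\<integral>z. h z \<partial>lebesgue_on (cross_region \<Omega>)) = (LBINT z. indicator (cross_region \<Omega>) z * NI v z)"
proof -
  have AE: "AE z in lborel. h z = NI v z"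
    using AE_lborel_fst[OF g] AE_lborel_snd[OF g] a0_AE
    by eventually_elim (simp add: h_def nonlocal_integrand_def nonlocal_kernel_def NI_def K0_def case_prod_unfold)
  have "NI v \<in> borel_measurable lebesgue" by (rule measurable_completion) simp
  hence "h \<in> borel_measurable lebesgue"
    by (rule borel_measurable_AE) (use AE in \<open>auto simp: AE_lebesgue_iff elim: eventually_mono\<close>)
  hence m: "h \<in> borel_measurable (lebesgue_on (cross_region \<Omega>))" by (rule measurable_restrict_space1)
  have AE': "AE z in lborel. z \<in> cross_region \<Omega> \<longrightarrow> h z = NI v z" using AE by eventually_elim simp
  show "integrable (lebesgue_on (cross_region \<Omega>)) h \<longleftrightarrow> integrable lborel (\<lambda>z. indicator (cross_region \<Omega>) z * NI v z)"
    using lebesgue_on_borel(1)[OF cross_borel m NI_borel[OF v] AE'] by simp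
  show "(\<integral>z. h z \<partial>lebesgue_on (cross_region \<Omega>)) = (LBINT z. indicator (cross_region \<Omega>) z * NI v z)"
    using lebesgue_on_borel(2)[OF cross_borel m NI_borel[OF v] AE'] by simp
qed

lemma LI_measurable:
  assumes "v \<in> borel_measurable borel" "G \<in> borel_measurable borel"
  shows "LI v G \<in> borel_measurable (lebesgue_on \<Omega>)"
  unfolding LI_def[abs_def]
  using assms by (intro borel_measurable_diff borel_measurable_times caratheodory_measurable[OF \<Omega>_borel caratheodory] borel_measurable_lebesgue_onI) auto

lemma local_integrand_AE:
  assumes "AE x\<in>\<Omega> in lborel. g x = v x" "AE x\<in>\<Omega> in lborel. weak_gradient \<Omega> g x = G x"
  shows "AE x in lebesgue_on \<Omega>. local_integrand F f \<Omega> g x = LI v G x"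
  unfolding AE_lebesgue_on_iff[OF \<Omega>_borel]
  using assms f0_AE by eventually_elim (simp add: local_integrand_def LI_def)

lemma local_integrand_rep:
  assumes wd: "weakly_differentiable_on g \<Omega>"
    and v: "AE x\<in>\<Omega> in lborel. g x = v x" "v \<in> borel_measurable borel"
    and G: "AE x\<in>\<Omega> in lborel. weak_gradient \<Omega> g x = G x" "G \<in> borel_measurable borel"
  shows "integrable (lebesgue_on \<Omega>) (local_integrand F f \<Omega> g) \<longleftrightarrow> integrable (lebesgue_on \<Omega>) (LI v G)"
    and "(\<integral>x. local_integrand F f \<Omega> g x \<partial>lebesgue_on \<Omega>) = (\<integral>x. LI v G x \<partial>lebesgue_on \<Omega>)"
proof -
  have U': "\<Omega> \<inter> space lebesgue \<in> sets lebesgue" by simp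
  note AE = local_integrand_AE[OF v(1) G(1)]
  have "AE x in lebesgue. indicator \<Omega> x *\<^sub>R LI v G x = indicator \<Omega> x *\<^sub>R local_integrand F f \<Omega> g x"
    using AE unfolding AE_lebesgue_on_iff[OF \<Omega>_borel] AE_lebesgue_iff
    by eventually_elim (auto simp: indicator_def)
  from borel_measurable_AE[OF _ this]
  have m: "local_integrand F f \<Omega> g \<in> borel_measurable (lebesgue_on \<Omega>)"
    using LI_measurable[OF v(2) G(2)] unfolding borel_measurable_restrict_space_iff[OF U'] by blast
  show "integrable (lebesgue_on \<Omega>) (local_integrand F f \<Omega> g) \<longleftrightarrow> integrable (lebesgue_on \<Omega>) (LI v G)"
    by (rule integrable_cong_AE[OF m LI_measurable[OF v(2) G(2)] AE])
  show "(\<integral>x. local_integrand F f \<Omega> g x \<partial>lebesgue_on \<Omega>) = (\<integral>x. LI v G x \<partial>lebesgue_on \<Omega>)"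
    by (rule integral_cong_AE[OF m LI_measurable[OF v(2) G(2)] AE])
qed

lemma u_energy:
  shows "integrable (lebesgue_on \<Omega>) (LI u0 G0)" "integrable lborel (\<lambda>z. indicator (cross_region \<Omega>) z * NI u0 z)"
    "energy F f (nonlocal_kernel a s q) q \<Omega> u = ereal ((\<integral>x. LI u0 G0 x \<partial>lebesgue_on \<Omega>) + (LBINT z. indicator (cross_region \<Omega>) z * NI u0 z))"
    "u \<in> Lspace p \<Omega>"
proof -
  have fin: "energy F f (nonlocal_kernel a s q) q \<Omega> u < \<infinity>" and up: "u \<in> Lspace p \<Omega>"
    using min by (auto simp: minimizer_def admissible_def)
  show "u \<in> Lspace p \<Omega>" by fact
  have A: "weakly_differentiable_on u \<Omega>" "integrable (lebesgue_on \<Omega>) (local_integrand F f \<Omega> u)"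
    "integrable (lebesgue_on (cross_region \<Omega>)) (nonlocal_integrand (nonlocal_kernel a s q) q u)"
    using fin by (auto simp: energy_def split: if_splits)
  have uA: "AE x\<in>\<Omega> in lborel. u x = u0 x" using u0_AE by eventually_elim simp
  note l = local_integrand_rep[OF A(1) uA u0_borel G0_AE G0_borel] and n = nonlocal_integrand_rep[OF u0_AE u0_borel]
  show "integrable (lebesgue_on \<Omega>) (LI u0 G0)" "integrable lborel (\<lambda>z. indicator (cross_region \<Omega>) z * NI u0 z)"
    using A l n by auto
  show "energy F f (nonlocal_kernel a s q) q \<Omega> u = ereal ((\<integral>x. LI u0 G0 x \<partial>lebesgue_on \<Omega>) + (LBINT z. indicator (cross_region \<Omega>) z * NI u0 z))"
    using A l n by (simp add: energy_def)
qed

text \<open>Minimality in terms of Borel data. The competitor comes with its gradient and with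
  convergent integrals, so both energies are finite and may be compared as real numbers.\<close>

lemma min_ineq:
  assumes v: "lwgrad \<Omega> v G" "\<And>x. x \<notin> \<Omega> \<Longrightarrow> v x = u0 x"
    and i: "integrable (lebesgue_on \<Omega>) (LI v G)" "integrable lborel (\<lambda>z. indicator (cross_region \<Omega>) z * NI v z)"
  shows "(\<integral>x. LI u0 G0 x \<partial>lebesgue_on \<Omega>) + (LBINT z. indicator (cross_region \<Omega>) z * NI u0 z)
    \<le> (\<integral>x. LI v G x \<partial>lebesgue_on \<Omega>) + (LBINT z. indicator (cross_region \<Omega>) z * NI v z)"
proof -
  note vb = lwgradD(1)[OF v(1)] and Gb = lwgradD(2)[OF v(1)]
  have wd: "weakly_differentiable_on v \<Omega>"
    using is_weak_gradient_of_lwgrad[OF open_\<Omega> v(1)] by (auto simp: weakly_differentiable_on_def)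
  have vv: "AE x in lborel. v x = v x" "AE x\<in>\<Omega> in lborel. v x = v x" by auto
  note l = local_integrand_rep[OF wd vv(2) vb weak_gradient_AE[OF open_\<Omega> v(1)] Gb] and n = nonlocal_integrand_rep[OF vv(1) vb]
  have ev: "energy F f (nonlocal_kernel a s q) q \<Omega> v = ereal ((\<integral>x. LI v G x \<partial>lebesgue_on \<Omega>) + (LBINT z. indicator (cross_region \<Omega>) z * NI v z))"
    using wd i l n by (simp add: energy_def)
  have "AE x in lborel. x \<in> - \<Omega> \<longrightarrow> v x = u x" using u0_AE by eventually_elim (use v(2) in auto)
  hence "AE x in lebesgue_on (- \<Omega>). v x = u x" by (subst AE_lebesgue_on_iff) auto
  moreover have "v \<in> borel_measurable lebesgue" using vb by (intro measurable_completion) simp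
  ultimately have "energy F f (nonlocal_kernel a s q) q \<Omega> u \<le> energy F f (nonlocal_kernel a s q) q \<Omega> v"
    using min by (auto simp: minimizer_def)
  thus ?thesis by (simp add: ev u_energy(3))
qed

subsection \<open>Local integrability\<close>

lemma growth_AE: "AE x\<in>\<Omega> in lborel. (\<forall>\<xi>. inverse \<Lambda> * norm \<xi> powr p \<le> F x \<xi> \<and> F x \<xi> \<le> \<Lambda> * norm \<xi> powr p)"
  using growth by (simp add: AE_lebesgue_on_iff)

lemma compact_borel: "compact K \<Longrightarrow> K \<in> sets borel" for K :: "'b::euclidean_space set"
  by (simp add: borel_closed compact_imp_closed)

lemma integrable_indicator_compact: "compact K \<Longrightarrow> integrable lborel (indicator K :: 'a \<Rightarrow> real)"
  using emeasure_compact_finite[of K] compact_borel[of K] by (intro integrable_real_indicator) auto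

lemma u0_Lp: "integrable lborel (\<lambda>x. indicator \<Omega> x * \<bar>u0 x\<bar> powr p)"
  using Lspace_integrable[OF u_energy(4) \<Omega>_borel u0_borel] u0_AE by (simp add: eventually_mono)

lemma f0_L\<gamma>:
  assumes "compact K" "K \<subseteq> \<Omega>"
  shows "integrable lborel (\<lambda>x. indicator K x * \<bar>f0 x\<bar> powr \<gamma>)"
proof -
  have "f \<in> Lspace \<gamma> K" using f_loc assms by (auto simp: Lspace_loc_def)
  moreover have "AE x\<in>K in lborel. f x = f0 x" using f0_AE by eventually_elim (use assms in auto)
  ultimately show ?thesis using Lspace_integrable[of f \<gamma> K f0] compact_borel[OF assms(1)] by simp
qed

text \<open>Young's inequality with exponents p and p'. Locally f lies in L^p' because \<gamma> >
  p/(p-1), and u lies in L^p.\<close>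

lemma fu_local:
  assumes K: "compact K" "K \<subseteq> \<Omega>"
  shows "integrable lborel (\<lambda>x. indicator K x * (\<bar>f0 x\<bar> * \<bar>u0 x\<bar>))"
proof (rule Bochner_Integration.integrable_bound)
  have [measurable]: "K \<in> sets borel" by (rule compact_borel[OF K(1)])
  obtain p' where p': "p' > 1" "1 / p + 1 / p' = 1" "p' = p / (p - 1)" using conjugate_exponent[OF p(1)] .
  show "integrable lborel (\<lambda>x. indicator \<Omega> x * \<bar>u0 x\<bar> powr p + (indicator K x + indicator K x * \<bar>f0 x\<bar> powr \<gamma>))"
    by (intro Bochner_Integration.integrable_add u0_Lp integrable_indicator_compact[OF K(1)] f0_L\<gamma>[OF K])
  show "AE x in lborel. norm (indicator K x * (\<bar>f0 x\<bar> * \<bar>u0 x\<bar>)) \<le> norm (indicator \<Omega> x * \<bar>u0 x\<bar> powr p + (indicator K x + indicator K x * \<bar>f0 x\<bar> powr \<gamma>))"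
  proof (rule AE_I2)
    fix x
    show "norm (indicator K x * (\<bar>f0 x\<bar> * \<bar>u0 x\<bar>)) \<le> norm (indicator \<Omega> x * \<bar>u0 x\<bar> powr p + (indicator K x + indicator K x * \<bar>f0 x\<bar> powr \<gamma>))"
    proof (cases "x \<in> K")
      case True
      have "\<bar>u0 x\<bar> * \<bar>f0 x\<bar> \<le> \<bar>u0 x\<bar> powr p / p + \<bar>f0 x\<bar> powr p' / p'"
        using p(1) p' by (intro Youngs_inequality) auto
      also have "\<dots> \<le> \<bar>u0 x\<bar> powr p / 1 + \<bar>f0 x\<bar> powr p' / 1"
        using p(1) p' by (intro add_mono divide_left_mono) auto
      also have "\<bar>f0 x\<bar> powr p' \<le> 1 + \<bar>f0 x\<bar> powr \<gamma>"
      proof (cases "\<bar>f0 x\<bar> \<le> 1")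
        case True
        hence "\<bar>f0 x\<bar> powr p' \<le> 1" using p' by (intro powr_le1) auto
        thus ?thesis by (simp add: add_increasing2)
      next
        case False
        hence "\<bar>f0 x\<bar> powr p' \<le> \<bar>f0 x\<bar> powr \<gamma>" using \<gamma>2 p'(3) by (intro powr_mono) auto
        thus ?thesis by simp
      qed
      finally show ?thesis using True K by (auto simp: mult.commute)
    qed simp
  qed
qed (use compact_borel[OF K(1)] in measurable)

text \<open>Finite energy controls only the sum of F(x,Du) and -f u; since the second part is
  locally integrable by itself, the lower growth bound gives the gradient in L^p.\<close>

lemma G0_local:
  assumes K: "compact K" "K \<subseteq> \<Omega>"
  shows "integrable lborel (\<lambda>x. indicator K x * norm (G0 x) powr p)"
proof -
  have [measurable]: "K \<in> sets borel" by (rule compact_borel[OF K(1)])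
  obtain L where L: "L \<in> borel_measurable borel" "AE x\<in>\<Omega> in lborel. LI u0 G0 x = L x"
    using borel_representative[OF \<Omega>_borel LI_measurable[OF u0_borel G0_borel]] by blast
  have iL: "integrable lborel (\<lambda>x. indicator \<Omega> x *\<^sub>R L x)"
    using lebesgue_on_borel(1)[OF \<Omega>_borel LI_measurable[OF u0_borel G0_borel] L] u_energy(1) by simp
  show ?thesis
  proof (rule Bochner_Integration.integrable_bound)
    show "integrable lborel (\<lambda>x. \<Lambda> * (\<bar>indicator \<Omega> x *\<^sub>R L x\<bar> + indicator K x * (\<bar>f0 x\<bar> * \<bar>u0 x\<bar>)))"
      by (intro integrable_mult_right Bochner_Integration.integrable_add integrable_abs iL fu_local[OF K])
    show "AE x in lborel. norm (indicator K x * norm (G0 x) powr p) \<le> norm (\<Lambda> * (\<bar>indicator \<Omega> x *\<^sub>R L x\<bar> + indicator K x * (\<bar>f0 x\<bar> * \<bar>u0 x\<bar>)))"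
      using L(2) growth_AE
    proof eventually_elim
      case (elim x)
      show ?case
      proof (cases "x \<in> K")
        case True
        hence x\<Omega>: "x \<in> \<Omega>" using K by auto
        have "inverse \<Lambda> * norm (G0 x) powr p \<le> F x (G0 x)" using elim(2) x\<Omega> by blast
        also have "\<dots> = L x + f0 x * u0 x" using elim(1) x\<Omega> by (simp add: LI_def)
        also have "\<dots> \<le> \<bar>L x\<bar> + \<bar>f0 x\<bar> * \<bar>u0 x\<bar>" by (simp add: abs_mult[symmetric] add_mono)
        finally have "\<Lambda> * (inverse \<Lambda> * norm (G0 x) powr p) \<le> \<Lambda> * (\<bar>L x\<bar> + \<bar>f0 x\<bar> * \<bar>u0 x\<bar>)"
          using \<Lambda> by (intro mult_left_mono) auto
        thus ?thesis using True x\<Omega> \<Lambda> by (simp add: mult.assoc[symmetric])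
      qed simp
    qed
  qed measurable
qed

text \<open>For p < N the hypothesis on q/p states precisely that q is at most the Sobolev exponent
  N p / (N - p).\<close>

lemma sobolev_q:
  assumes M: "M > 0"
  obtains C where "C > 0" "\<And>(v :: 'a \<Rightarrow> real) G A. \<lbrakk>wgrad v G; \<And>x. norm x > M \<Longrightarrow> v x = 0; \<And>x. norm x > M \<Longrightarrow> G x = 0;
      (\<integral>\<^sub>+x. norm (G x) powr p) \<le> ennreal A; A \<ge> 0\<rbrakk> \<Longrightarrow>
     (\<integral>\<^sub>+x. \<bar>v x\<bar> powr q) \<le> ennreal (C * A powr (q / p))"
proof -
  have qc: "q \<le> DIM('a) * p / (DIM('a) - p)" if "p < DIM('a)"
  proof -
    have "q / p * p \<le> (1 + p / (DIM('a) - p)) * p" using qp[OF that] p by (intro mult_right_mono) auto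
    also have "\<dots> = DIM('a) * p / (DIM('a) - p)" using that by (simp add: field_simps)
    finally show ?thesis using p by simp
  qed
  show thesis using that sobolev[where 'a='a, OF p(1) pN q(1) dim qc M] by blast
qed

text \<open>The Sobolev inequality for a cut-off of u. This makes the quantities of the iteration
  finite and later provides the dominating function in \<open>Y_tendsto_0\<close>.\<close>

lemma u0_Lq:
  assumes R: "0 < R" "cball x0 (2 * R) \<subseteq> \<Omega>"
  shows "integrable lborel (\<lambda>x. indicator (cball x0 R) x * \<bar>u0 x\<bar> powr q)"
proof -
  let ?K = "cball x0 (2 * R)"
  obtain \<kappa> c where \<kappa>t: "\<kappa> \<in> test_functions \<Omega>" and \<kappa>: "\<And>x. 0 \<le> \<kappa> x" "\<And>x. \<kappa> x \<le> 1" "\<And>x. x \<in> cball x0 R \<Longrightarrow> \<kappa> x = 1"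
    and \<kappa>z: "\<And>x. x \<notin> ?K \<Longrightarrow> \<kappa> x = 0" "\<And>x. x \<notin> ?K \<Longrightarrow> sgrad \<kappa> x = 0" and c: "c \<ge> 0" "\<And>x. norm (sgrad \<kappa> x) \<le> c"
    using test_cutoff[of R "2 * R" x0 \<Omega>] R by auto
  define Z where "Z = (\<lambda>x. \<kappa> x *\<^sub>R G0 x + u0 x *\<^sub>R sgrad \<kappa> x)"
  have wz: "wgrad (\<lambda>x. \<kappa> x * u0 x) Z" unfolding Z_def by (rule lwgrad_cutoff[OF lw \<kappa>t])
  have [measurable]: "(\<lambda>x. \<kappa> x * u0 x) \<in> borel_measurable borel" "Z \<in> borel_measurable borel" using wgradD(4,5)[OF wz] .
  have iZ: "integrable lborel (\<lambda>x. norm (Z x) powr p)"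
  proof (rule Bochner_Integration.integrable_bound)
    show "integrable lborel (\<lambda>x. 2 powr p * (indicator ?K x * norm (G0 x) powr p + c powr p * (indicator \<Omega> x * \<bar>u0 x\<bar> powr p)))"
      by (intro integrable_mult_right Bochner_Integration.integrable_add G0_local[OF compact_cball R(2)] u0_Lp)
    show "AE x in lborel. norm (norm (Z x) powr p) \<le> norm (2 powr p * (indicator ?K x * norm (G0 x) powr p + c powr p * (indicator \<Omega> x * \<bar>u0 x\<bar> powr p)))"
    proof (rule AE_I2)
      fix x
      show "norm (norm (Z x) powr p) \<le> norm (2 powr p * (indicator ?K x * norm (G0 x) powr p + c powr p * (indicator \<Omega> x * \<bar>u0 x\<bar> powr p)))"
      proof (cases "x \<in> ?K")
        case True
        have "norm (Z x) \<le> norm (G0 x) + c * \<bar>u0 x\<bar>"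
          unfolding Z_def using \<kappa>(1,2)[of x] c(1) mult_left_mono[OF c(2)[of x], of "\<bar>u0 x\<bar>"]
          by (intro order_trans[OF norm_triangle_ineq] add_mono) (auto simp: mult_left_le_one_le mult.commute)
        hence "norm (Z x) powr p \<le> (norm (G0 x) + c * \<bar>u0 x\<bar>) powr p" using p by (intro powr_mono2) auto
        also have "\<dots> \<le> 2 powr p * (norm (G0 x) powr p + (c * \<bar>u0 x\<bar>) powr p)" using p c by (intro powr_add_le) auto
        also have "(c * \<bar>u0 x\<bar>) powr p = c powr p * \<bar>u0 x\<bar> powr p" by (rule powr_mult)
        finally show ?thesis using True R(2) by (auto simp: subset_iff)
      qed (simp add: Z_def \<kappa>z)
    qed
  qed measurable
  define M where "M = norm x0 + 2 * R + 1"
  have M: "M > 0" using R by (simp add: M_def add_nonneg_pos)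
  have out: "x \<notin> ?K" if "norm x > M" for x
    using that R norm_triangle_ineq2[of x x0] by (auto simp: M_def dist_norm norm_minus_commute)
  obtain C where C: "C > 0" "\<And>(v :: 'a \<Rightarrow> real) G A. \<lbrakk>wgrad v G; \<And>x. norm x > M \<Longrightarrow> v x = 0; \<And>x. norm x > M \<Longrightarrow> G x = 0;
      (\<integral>\<^sub>+x. norm (G x) powr p) \<le> ennreal A; A \<ge> 0\<rbrakk> \<Longrightarrow>
     (\<integral>\<^sub>+x. \<bar>v x\<bar> powr q) \<le> ennreal (C * A powr (q / p))"
    using sobolev_q[OF M] by blast
  have "(\<integral>\<^sub>+x. \<bar>\<kappa> x * u0 x\<bar> powr q) \<le> ennreal (C * (LBINT x. norm (Z x) powr p) powr (q / p))"
  proof (rule C(2)[OF wz])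
    show "(\<integral>\<^sub>+x. norm (Z x) powr p) \<le> ennreal (LBINT x. norm (Z x) powr p)"
      using iZ by (subst nn_integral_eq_integral) auto
    show "\<kappa> x * u0 x = 0" "Z x = 0" if "norm x > M" for x using \<kappa>z[OF out[OF that]] by (auto simp: Z_def)
  qed simp
  also have "\<dots> < \<infinity>" by simp
  finally have "integrable lborel (\<lambda>x. \<bar>\<kappa> x * u0 x\<bar> powr q)"
    by (intro integrableI_bounded) auto
  from integrable_mult_indicator[OF _ this, of "cball x0 R"]
  have "integrable lborel (\<lambda>x. indicator (cball x0 R) x *\<^sub>R \<bar>\<kappa> x * u0 x\<bar> powr q)" by simp
  also have "(\<lambda>x. indicator (cball x0 R) x *\<^sub>R \<bar>\<kappa> x * u0 x\<bar> powr q) = (\<lambda>x. indicator (cball x0 R) x * \<bar>u0 x\<bar> powr q)"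
  proof
    fix x show "indicator (cball x0 R) x *\<^sub>R \<bar>\<kappa> x * u0 x\<bar> powr q = indicator (cball x0 R) x * \<bar>u0 x\<bar> powr q"
      using \<kappa>(3)[of x] by (cases "x \<in> cball x0 R") auto
  qed
  finally show ?thesis .
qed

lemma tail_bound:
  obtains T where "T \<ge> 0" "AE x in lborel. x \<in> \<Omega> \<longrightarrow>
     (\<integral>\<^sub>+y. a0 (x, y) * \<bar>u0 y\<bar> powr (q - 1) / (1 + norm y) powr (real DIM('a) + s * q)) \<le> ennreal T"
proof -
  let ?t = "\<lambda>x. \<integral>\<^sup>+ y. ennreal (a x y * \<bar>u y\<bar> powr (q - 1) / (1 + norm y) powr (real DIM('a) + s * q)) \<partial>lebesgue"
  define T where "T = enn2real (esssup (lebesgue_on \<Omega>) ?t)"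
  have fin: "esssup (lebesgue_on \<Omega>) ?t < \<infinity>" using tail by (simp add: weighted_tail_space_def)
  hence T: "esssup (lebesgue_on \<Omega>) ?t = ennreal T" by (simp add: T_def)
  have 1: "AE x\<in>\<Omega> in lborel. ?t x \<le> ennreal T"
    using esssup_AE[of ?t "lebesgue_on \<Omega>"] unfolding T AE_lebesgue_on_iff[OF \<Omega>_borel] .
  have "AE z in lborel \<Otimes>\<^sub>M lborel. case_prod a z = a0 z" unfolding lborel_prod by (rule a0_AE)
  hence 2: "AE x in lborel. AE y in lborel. a x y = a0 (x, y)"
    using lborel_pair.AE_pair[of "\<lambda>z. case_prod a z = a0 z"] by simp
  show ?thesis
  proof (rule that[of T])
    show "AE x in lborel. x \<in> \<Omega> \<longrightarrow>
     (\<integral>\<^sub>+y. a0 (x, y) * \<bar>u0 y\<bar> powr (q - 1) / (1 + norm y) powr (real DIM('a) + s * q)) \<le> ennreal T"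
      using 1 2
    proof eventually_elim
      case (elim x)
      have "?t x = (\<integral>\<^sub>+y. a0 (x, y) * \<bar>u0 y\<bar> powr (q - 1) / (1 + norm y) powr (real DIM('a) + s * q))"
        unfolding nn_integral_completion
        by (rule nn_integral_cong_AE) (use elim(2) u0_AE in eventually_elim, simp)
      thus ?case using elim(1) by simp
    qed
  qed (simp add: T_def)
qed

lemma a0_bounded:
  assumes "compact K" "K \<subseteq> \<Omega>"
  obtains A where "A \<ge> 0" "AE z in lborel. z \<in> K \<times> K \<longrightarrow> a0 z \<le> A"
proof -
  have c: "compact (K \<times> K)" using assms(1) by (intro compact_Times)
  then obtain C where "AE z in lebesgue_on (K \<times> K). norm (case_prod a z) \<le> C"
    using a_loc assms(2) unfolding Linf_loc_def by blast
  hence "AE z in lborel. z \<in> K \<times> K \<longrightarrow> norm (case_prod a z) \<le> C"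
    unfolding AE_lebesgue_on_iff[OF compact_borel[OF c]] .
  hence "AE z in lborel. z \<in> K \<times> K \<longrightarrow> a0 z \<le> \<bar>C\<bar>"
    using a0_AE by eventually_elim (auto simp: abs_le_iff)
  thus ?thesis by (intro that[of "\<bar>C\<bar>"]) auto
qed

end

section \<open>Truncations above a level on a fixed ball\<close>

text \<open>Gaps between radii are at most R \<le> 1, so their negative powers increase with the
  exponent and can all be replaced by the largest one. The doubled ball leaves room for a cut-off
  that equals one on the ball of radius R.\<close>

locale nonlocal_problem_ball = nonlocal_problem_rep \<Omega> F a f u s p q \<gamma> \<Lambda> u0 G0 f0 a0
  for \<Omega> :: "'a::euclidean_space set" and F a f u s p q \<gamma> \<Lambda> u0 G0 f0 a0 +
  fixes x0 :: 'a and R :: real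
  assumes R: "0 < R" "R \<le> 1" and ball_\<Omega>: "cball x0 (2 * R) \<subseteq> \<Omega>"
begin

definition w :: "real \<Rightarrow> 'a \<Rightarrow> real" where "w k x = max 0 (u0 x - k)"

definition \<Phi> :: "real \<Rightarrow> real \<Rightarrow> real" where
  "\<Phi> k r = (LBINT x. indicator (ball x0 r) x * (indicator {x. u0 x > k} x * norm (G0 x) powr p))"

text \<open>The lower order terms of the Caccioppoli inequality: w^p comes from the gradient of the
  cut-off, w^q from the nonlocal interaction near the diagonal, w from the tail, and |f| w from the
  source.\<close>

definition S :: "real \<Rightarrow> real \<Rightarrow> real" where
  "S k r = (LBINT x. indicator (ball x0 r) x * (w k x powr p + w k x powr q + w k x + \<bar>f0 x\<bar> * w k x))"

lemma w_borel [measurable]: "w k \<in> borel_measurable borel" unfolding w_def[abs_def] by measurable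

lemma w_nonneg: "w k x \<ge> 0" by (simp add: w_def)

lemma w_le: "k \<ge> 0 \<Longrightarrow> w k x \<le> \<bar>u0 x\<bar>" by (auto simp: w_def)

lemma superlevel_borel [measurable]: "{x. u0 x > k} \<in> sets borel" by measurable

lemma cball_\<Omega>: "cball x0 R \<subseteq> \<Omega>" using ball_\<Omega> R by (auto simp: subset_iff)

lemma integrable_ball:
  fixes g h :: "'a \<Rightarrow> real"
  assumes g: "integrable lborel (\<lambda>x. indicator (cball x0 R) x * g x)" and r: "r \<le> R"
    and h: "h \<in> borel_measurable borel" "\<And>x. 0 \<le> h x" "\<And>x. h x \<le> g x"
  shows "integrable lborel (\<lambda>x. indicator (ball x0 r) x * h x)"
proof (rule Bochner_Integration.integrable_bound[OF g])
  show "(\<lambda>x. indicator (ball x0 r) x * h x) \<in> borel_measurable lborel"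
    using h(1) by (intro borel_measurable_times borel_measurable_indicator) auto
  show "AE x in lborel. norm (indicator (ball x0 r) x * h x) \<le> norm (indicator (cball x0 R) x * g x)"
    using h(2,3) r by (intro AE_I2) (auto simp: indicator_def intro: order_trans[OF _ abs_ge_self])
qed

lemma integrable_w:
  assumes r: "r \<le> R" and k: "k \<ge> 0"
  shows "integrable lborel (\<lambda>x. indicator (ball x0 r) x * w k x powr p)"
    and "integrable lborel (\<lambda>x. indicator (ball x0 r) x * w k x powr q)"
    and "integrable lborel (\<lambda>x. indicator (ball x0 r) x * w k x)"
    and "integrable lborel (\<lambda>x. indicator (ball x0 r) x * (\<bar>f0 x\<bar> * w k x))"
    and "integrable lborel (\<lambda>x. indicator (ball x0 r) x * (indicator {x. u0 x > k} x * norm (G0 x) powr p))"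
proof -
  have up: "integrable lborel (\<lambda>x. indicator (cball x0 R) x * \<bar>u0 x\<bar> powr p)"
  proof (rule Bochner_Integration.integrable_bound[OF u0_Lp])
    show "AE x in lborel. norm (indicator (cball x0 R) x * \<bar>u0 x\<bar> powr p) \<le> norm (indicator \<Omega> x * \<bar>u0 x\<bar> powr p)"
      using cball_\<Omega> by (intro AE_I2) (auto simp: indicator_def)
    show "(\<lambda>x. indicator (cball x0 R) x * \<bar>u0 x\<bar> powr p) \<in> borel_measurable lborel"
      by (intro borel_measurable_times borel_measurable_indicator powr_real_measurable borel_measurable_abs borel_measurable_const) auto
  qed
  show "integrable lborel (\<lambda>x. indicator (ball x0 r) x * w k x powr p)"
    using w_nonneg w_le[OF k] p by (intro integrable_ball[OF up r]) (auto intro!: powr_mono2)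
  show "integrable lborel (\<lambda>x. indicator (ball x0 r) x * w k x powr q)"
    using w_nonneg w_le[OF k] q p by (intro integrable_ball[OF u0_Lq[OF R(1) ball_\<Omega>] r]) (auto intro!: powr_mono2)
  have u1: "integrable lborel (\<lambda>x. indicator (cball x0 R) x * (1 + \<bar>u0 x\<bar> powr p))"
    using up integrable_indicator_compact[of "cball x0 R"] by (simp add: distrib_left)
  have le1: "t \<le> 1 + t powr p" if "t \<ge> 0" for t :: real
  proof (cases "t \<le> 1")
    case False
    hence "t powr 1 \<le> t powr p" using p by (intro powr_mono) auto
    thus ?thesis using False by simp
  qed (simp add: add_increasing2)
  show "integrable lborel (\<lambda>x. indicator (ball x0 r) x * w k x)"
    using w_nonneg by (intro integrable_ball[OF u1 r]) (auto intro: order_trans[OF w_le[OF k] le1])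
  show "integrable lborel (\<lambda>x. indicator (ball x0 r) x * (\<bar>f0 x\<bar> * w k x))"
    using w_nonneg w_le[OF k] by (intro integrable_ball[OF fu_local[OF compact_cball cball_\<Omega>] r]) (auto intro!: mult_left_mono)
  show "integrable lborel (\<lambda>x. indicator (ball x0 r) x * (indicator {x. u0 x > k} x * norm (G0 x) powr p))"
    by (intro integrable_ball[OF G0_local[OF compact_cball cball_\<Omega>] r]) (auto simp: indicator_def)
qed

lemma S_split:
  assumes r: "r \<le> R" and k: "k \<ge> 0"
  shows "S k r = (LBINT x. indicator (ball x0 r) x * w k x powr p) + (LBINT x. indicator (ball x0 r) x * w k x powr q)
    + (LBINT x. indicator (ball x0 r) x * w k x) + (LBINT x. indicator (ball x0 r) x * (\<bar>f0 x\<bar> * w k x))"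
    and "0 \<le> (LBINT x. indicator (ball x0 r) x * w k x powr p)" "0 \<le> (LBINT x. indicator (ball x0 r) x * w k x powr q)"
    "0 \<le> (LBINT x. indicator (ball x0 r) x * w k x)" "0 \<le> (LBINT x. indicator (ball x0 r) x * (\<bar>f0 x\<bar> * w k x))"
proof -
  show "S k r = (LBINT x. indicator (ball x0 r) x * w k x powr p) + (LBINT x. indicator (ball x0 r) x * w k x powr q)
    + (LBINT x. indicator (ball x0 r) x * w k x) + (LBINT x. indicator (ball x0 r) x * (\<bar>f0 x\<bar> * w k x))"
    unfolding S_def distrib_left using integrable_w[OF r k] by simp
qed (auto intro!: integral_nonneg_AE AE_I2 mult_nonneg_nonneg simp: w_nonneg)

lemma S_nonneg: "S k r \<ge> 0"
  unfolding S_def by (intro integral_nonneg_AE AE_I2) (simp add: w_nonneg)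

lemma \<Phi>_mono: assumes "\<rho> \<le> r" "r \<le> R" "k \<ge> 0" shows "\<Phi> k \<rho> \<le> \<Phi> k r"
  unfolding \<Phi>_def using assms
  by (intro integral_mono integrable_w) (auto simp: indicator_def)

lemma S_mono: assumes "\<rho> \<le> r" "r \<le> R" "k \<ge> 0" shows "S k \<rho> \<le> S k r"
  unfolding S_def
proof (rule integral_mono)
  have "integrable lborel (\<lambda>x. indicator (ball x0 r) x * (w k x powr p + w k x powr q + w k x + \<bar>f0 x\<bar> * w k x))" if "r \<le> R" for r
    unfolding distrib_left using integrable_w[OF that assms(3)] by simp
  thus "integrable lborel (\<lambda>x. indicator (ball x0 \<rho>) x * (w k x powr p + w k x powr q + w k x + \<bar>f0 x\<bar> * w k x))"
    "integrable lborel (\<lambda>x. indicator (ball x0 r) x * (w k x powr p + w k x powr q + w k x + \<bar>f0 x\<bar> * w k x))"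
    using assms by auto
  show "indicator (ball x0 \<rho>) x * (w k x powr p + w k x powr q + w k x + \<bar>f0 x\<bar> * w k x)
    \<le> indicator (ball x0 r) x * (w k x powr p + w k x powr q + w k x + \<bar>f0 x\<bar> * w k x)" for x
    using assms w_nonneg[of k x] by (intro mult_right_mono) (auto simp: indicator_def)
qed

text \<open>The modification of u used for the comparison. The strict inequality \<rho>' < R
  separates the support of the cut-off from the region where u itself has to be cut off.\<close>

lemma competitor:
  assumes k: "k \<ge> 0" and \<eta>: "smooth \<eta>" "\<And>x. 0 \<le> \<eta> x" "\<And>x. \<eta> x \<le> 1" and \<rho>: "\<rho>' < R"
    and out: "\<forall>x. x \<notin> ball x0 \<rho>' \<longrightarrow> \<eta> x = 0" and c: "\<And>x h. \<bar>dderiv \<eta> h x\<bar> \<le> c * norm h" and m: "m \<ge> 1"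
  defines "\<zeta> \<equiv> \<lambda>x. \<eta> x ^ m"
  shows "wgrad (\<lambda>x. \<zeta> x * w k x) (\<lambda>x. \<zeta> x *\<^sub>R (indicator {x. u0 x > k} x *\<^sub>R G0 x) + w k x *\<^sub>R sgrad \<zeta> x)"
    and "\<And>x. norm (sgrad \<zeta> x) \<le> m * c" and "\<And>x r. \<rho>' < r \<Longrightarrow> x \<notin> ball x0 r \<Longrightarrow> sgrad \<zeta> x = 0"
proof -
  have sm: "smooth \<zeta>" unfolding \<zeta>_def by (rule smooth_power[OF \<eta>(1)])
  have \<zeta>0: "\<zeta> x = 0" if "x \<notin> cball x0 \<rho>'" for x using out that m by (auto simp: \<zeta>_def)
  show s0: "sgrad \<zeta> x = 0" if "\<rho>' < r" "x \<notin> ball x0 r" for x r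
  proof -
    have "x \<notin> cball x0 \<rho>'" using that by auto
    hence "dderiv \<zeta> b x = 0" for b by (intro dderiv_zero_outside[of "cball x0 \<rho>'"] \<zeta>0) auto
    thus ?thesis by (simp add: sgrad_def)
  qed
  show "norm (sgrad \<zeta> x) \<le> m * c" for x
  proof (rule norm_sgrad_le[OF sm])
    fix h
    have "(\<zeta> has_derivative (\<lambda>h. dderiv \<eta> h x * (m * \<eta> x ^ (m - 1)))) (at x)"
      unfolding \<zeta>_def
      by (rule has_derivative_eq_rhs[OF has_derivative_power[OF smooth_has_derivative[OF \<eta>(1)]]]) (simp add: fun_eq_iff mult_ac)
    hence "dderiv \<zeta> h x = dderiv \<eta> h x * (m * \<eta> x ^ (m - 1))" by (rule dderiv_eqI)
    hence "\<bar>dderiv \<zeta> h x\<bar> = \<bar>dderiv \<eta> h x\<bar> * (m * \<eta> x ^ (m - 1))" using \<eta>(2)[of x] by (simp add: abs_mult)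
    also have "\<dots> \<le> (c * norm h) * (m * 1)"
    proof (rule mult_mono)
      show "real m * \<eta> x ^ (m - 1) \<le> real (m * 1)" using \<eta>(2,3)[of x] by (simp add: mult_left_le power_le_one)
      show "0 \<le> c * norm h" using order_trans[OF abs_ge_zero c[of x h]] .
    qed (use c[of x h] \<eta>(2)[of x] in auto)
    finally show "\<bar>dderiv \<zeta> h x\<bar> \<le> m * c * norm h" by (simp add: mult_ac)
  qed
  \<comment> \<open>u is not globally weakly differentiable. A second cut-off, equal to one on the
    ball of radius R, makes \<open>wgrad_pos_part\<close> applicable and disappears from the formula
    on the support of \<zeta>.\<close>
  obtain \<kappa> where \<kappa>: "smooth \<kappa>" "\<And>x. 0 \<le> \<kappa> x" "\<And>x. \<kappa> x \<le> 1" "\<And>x. x \<in> cball x0 R \<Longrightarrow> \<kappa> x = 1" "\<And>x. x \<notin> ball x0 (2 * R) \<Longrightarrow> \<kappa> x = 0"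
    using cutoff_simple[of R "2 * R" x0] R(1) by auto
  have \<kappa>t: "\<kappa> \<in> test_functions \<Omega>"
    by (rule test_functionI[OF \<kappa>(1) compact_cball ball_\<Omega>]) (use \<kappa>(5) in auto)
  have \<kappa>s: "sgrad \<kappa> x = 0" if "x \<in> ball x0 R" for x
  proof -
    have "((\<lambda>x. 1::real) has_derivative (\<lambda>_. 0)) (at x)" by simp
    hence "(\<kappa> has_derivative (\<lambda>_. 0)) (at x)"
      by (rule has_derivative_transform_within_open[of _ _ _ _ "ball x0 R"]) (use that \<kappa>(4) in auto)
    hence "dderiv \<kappa> b x = 0" for b by (rule dderiv_eqI)
    thus ?thesis by (simp add: sgrad_def)
  qed
  have \<zeta>t: "\<zeta> \<in> test_functions UNIV"
    by (rule test_functionI[OF sm compact_cball[of x0 \<rho>']]) (use \<zeta>0 in auto)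
  have "wgrad (\<lambda>x. \<zeta> x * max 0 (\<kappa> x * u0 x - k)) (\<lambda>x. \<zeta> x *\<^sub>R (indicator {y. \<kappa> y * u0 y > k} x *\<^sub>R (\<kappa> x *\<^sub>R G0 x + u0 x *\<^sub>R sgrad \<kappa> x)) + max 0 (\<kappa> x * u0 x - k) *\<^sub>R sgrad \<zeta> x)"
    by (rule wgrad_mult[OF wgrad_pos_part[OF lwgrad_cutoff[OF lw \<kappa>t] k] \<zeta>t])
  also have "(\<lambda>x. \<zeta> x * max 0 (\<kappa> x * u0 x - k)) = (\<lambda>x. \<zeta> x * w k x)"
  proof
    fix x show "\<zeta> x * max 0 (\<kappa> x * u0 x - k) = \<zeta> x * w k x"
      using \<zeta>0[of x] \<kappa>(4)[of x] \<rho> by (cases "x \<in> cball x0 \<rho>'") (auto simp: w_def)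
  qed
  also have "(\<lambda>x. \<zeta> x *\<^sub>R (indicator {y. \<kappa> y * u0 y > k} x *\<^sub>R (\<kappa> x *\<^sub>R G0 x + u0 x *\<^sub>R sgrad \<kappa> x)) + max 0 (\<kappa> x * u0 x - k) *\<^sub>R sgrad \<zeta> x)
     = (\<lambda>x. \<zeta> x *\<^sub>R (indicator {x. u0 x > k} x *\<^sub>R G0 x) + w k x *\<^sub>R sgrad \<zeta> x)"
  proof
    fix x
    show "\<zeta> x *\<^sub>R (indicator {y. \<kappa> y * u0 y > k} x *\<^sub>R (\<kappa> x *\<^sub>R G0 x + u0 x *\<^sub>R sgrad \<kappa> x)) + max 0 (\<kappa> x * u0 x - k) *\<^sub>R sgrad \<zeta> x
     = \<zeta> x *\<^sub>R (indicator {x. u0 x > k} x *\<^sub>R G0 x) + w k x *\<^sub>R sgrad \<zeta> x"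
    proof (cases "x \<in> ball x0 R")
      case True
      thus ?thesis using \<kappa>(4)[of x] \<kappa>s[OF True] by (auto simp: w_def indicator_def)
    next
      case False
      thus ?thesis using \<zeta>0[of x] s0[OF \<rho> False] \<rho> by auto
    qed
  qed
  finally show "wgrad (\<lambda>x. \<zeta> x * w k x) (\<lambda>x. \<zeta> x *\<^sub>R (indicator {x. u0 x > k} x *\<^sub>R G0 x) + w k x *\<^sub>R sgrad \<zeta> x)" .
qed

section \<open>Change of the nonlocal energy under truncation\<close>

text \<open>The factor |x-y|^q gained from the Lipschitz bound of the cut-off lowers the singularity
  to |x-y|^(-\<alpha>) with \<alpha> = N - (1-s) q < N; its integral over y is therefore bounded
  uniformly in x.\<close>

lemma near_error:
  obtains J where "J \<ge> 0" "\<And>k r. k \<ge> 0 \<Longrightarrow> r \<le> R \<Longrightarrow>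
    (\<integral>\<^sub>+z. indicator (ball x0 r) (fst z) * indicator (ball x0 r) (snd z) * norm (fst z - snd z) powr (q - real DIM('a) - s * q) * w k (fst z) powr q)
    \<le> ennreal (J * (LBINT x. indicator (ball x0 r) x * w k x powr q))"
proof -
  define \<alpha> where "\<alpha> = real DIM('a) - (q - s * q)"
  have "s * q < 1 * q" using s q by (intro mult_strict_right_mono) auto
  hence \<alpha>: "\<alpha> < DIM('a)" by (simp add: \<alpha>_def)
  obtain C where C: "C > 0" "\<And>\<delta>. \<delta> > 0 \<Longrightarrow>
    (\<integral>\<^sub>+x. indicator (ball (0::'a) \<delta>) x * norm x powr (- \<alpha>)) \<le> ennreal (C * \<delta> powr (DIM('a) - \<alpha>))"
    using norm_powr_near[where 'a='a, OF \<alpha>] by blast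
  define J where "J = C * (2 * R) powr (DIM('a) - \<alpha>)"
  have J: "J \<ge> 0" using C by (simp add: J_def)
  define \<kappa> where "\<kappa> = (\<lambda>x::'a. indicator (ball (0::'a) (2 * R)) x * norm x powr (- \<alpha>))"
  have \<kappa>m: "\<kappa> \<in> borel_measurable borel" unfolding \<kappa>_def by (rule kernel_measurable) simp
  show ?thesis
  proof (rule that[OF J])
    fix k r :: real assume k: "k \<ge> 0" and r: "r \<le> R"
    have m: "(\<lambda>z::'a \<times> 'a. ennreal (indicator (ball x0 r) (fst z) * indicator (ball x0 r) (snd z) * norm (fst z - snd z) powr (q - real DIM('a) - s * q) * w k (fst z) powr q)) \<in> borel_measurable borel"
      by (intro measurable_compose[OF _ measurable_ennreal] borel_measurable_times kernel_pair_measurable powr_real_measurable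
          borel_fst_comp borel_snd_comp w_borel borel_measurable_const borel_measurable_indicator) auto
    have "(\<integral>\<^sub>+z. indicator (ball x0 r) (fst z) * indicator (ball x0 r) (snd z) * norm (fst z - snd z) powr (q - real DIM('a) - s * q) * w k (fst z) powr q)
      = (\<integral>\<^sup>+x. \<integral>\<^sup>+y. ennreal (indicator (ball x0 r) x * indicator (ball x0 r) y * norm (x - y) powr (q - real DIM('a) - s * q) * w k x powr q) \<partial>lborel \<partial>lborel)"
      by (subst nn_integral_lborel_pair[OF m]) simp
    also have "\<dots> \<le> (\<integral>\<^sup>+x. ennreal (indicator (ball x0 r) x * w k x powr q) * ennreal J \<partial>lborel)"
    proof (rule nn_integral_mono)
      fix x
      have "(\<integral>\<^sub>+y. indicator (ball x0 r) x * indicator (ball x0 r) y * norm (x - y) powr (q - real DIM('a) - s * q) * w k x powr q)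
        \<le> (\<integral>\<^sup>+y. ennreal (indicator (ball x0 r) x * w k x powr q) * ennreal (\<kappa> (x - y)) \<partial>lborel)"
      proof (rule nn_integral_mono)
        fix y
        have e: "q - real DIM('a) - s * q = - \<alpha>" by (simp add: \<alpha>_def)
        have nn: "norm (x - y) < 2 * R" if "x \<in> ball x0 r" "y \<in> ball x0 r"
        proof -
          have "dist x y \<le> dist x0 x + dist x0 y" by (metis dist_commute dist_triangle)
          thus ?thesis using that r by (simp add: dist_norm)
        qed
        have "indicator (ball x0 r) x * indicator (ball x0 r) y * norm (x - y) powr (q - real DIM('a) - s * q) * w k x powr q
          \<le> (indicator (ball x0 r) x * w k x powr q) * \<kappa> (x - y)"
          unfolding e using nn by (auto simp: \<kappa>_def indicator_def)
        thus "ennreal (indicator (ball x0 r) x * indicator (ball x0 r) y * norm (x - y) powr (q - real DIM('a) - s * q) * w k x powr q)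
          \<le> ennreal (indicator (ball x0 r) x * w k x powr q) * ennreal (\<kappa> (x - y))"
          by (subst ennreal_mult'[symmetric]) (auto intro: ennreal_leI)
      qed
      also have "\<dots> = ennreal (indicator (ball x0 r) x * w k x powr q) * (\<integral>\<^sub>+y. \<kappa> (x - y))"
        using \<kappa>m by (intro nn_integral_cmult) simp
      also have "(\<integral>\<^sub>+y. \<kappa> (x - y)) = (\<integral>\<^sub>+y. \<kappa> y)"
        using \<kappa>m by (intro nn_integral_lborel_reflect[of "\<lambda>y. ennreal (\<kappa> y)" x]) simp
      also have "ennreal (indicator (ball x0 r) x * w k x powr q) * (\<integral>\<^sub>+y. \<kappa> y) \<le> ennreal (indicator (ball x0 r) x * w k x powr q) * ennreal J"
        using C(2)[of "2 * R"] R by (intro mult_left_mono) (auto simp: \<kappa>_def J_def)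
      finally show "(\<integral>\<^sub>+y. indicator (ball x0 r) x * indicator (ball x0 r) y * norm (x - y) powr (q - real DIM('a) - s * q) * w k x powr q)
        \<le> ennreal (indicator (ball x0 r) x * w k x powr q) * ennreal J" .
    qed
    also have "\<dots> = (\<integral>\<^sub>+x. indicator (ball x0 r) x * w k x powr q) * ennreal J"
      by (intro nn_integral_multc measurable_compose[OF _ measurable_ennreal] borel_measurable_times borel_measurable_indicator powr_real_measurable borel_measurable_const) auto
    also have "(\<integral>\<^sub>+x. indicator (ball x0 r) x * w k x powr q) = ennreal (LBINT x. indicator (ball x0 r) x * w k x powr q)"
      by (rule nn_integral_eq_integral[OF integrable_w(2)[OF r k]]) auto
    also have "\<dots> * ennreal J = ennreal (J * (LBINT x. indicator (ball x0 r) x * w k x powr q))"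
      using J S_split(3)[OF r k] by (simp add: ennreal_mult'' mult.commute)
    finally show "(\<integral>\<^sub>+z. indicator (ball x0 r) (fst z) * indicator (ball x0 r) (snd z) * norm (fst z - snd z) powr (q - real DIM('a) - s * q) * w k (fst z) powr q)
    \<le> ennreal (J * (LBINT x. indicator (ball x0 r) x * w k x powr q))" .
  qed
qed

text \<open>The interaction of the support of the cut-off with the complement of the larger ball, in
  the form given by the second part of \<open>truncation_pointwise\<close>.\<close>

definition \<tau> :: "real \<Rightarrow> real \<Rightarrow> real \<Rightarrow> 'a \<times> 'a \<Rightarrow> real" where
  "\<tau> k \<rho>' r z = indicator (ball x0 \<rho>') (fst z) * indicator (- ball x0 r) (snd z) * K0 z * (w k (fst z) * w k (snd z) powr (q - 1))"

lemma \<tau>_borel: "\<tau> k \<rho>' r \<in> borel_measurable borel"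
  unfolding \<tau>_def[abs_def]
  by (intro borel_measurable_times powr_real_measurable K0_borel
          borel_fst_comp borel_snd_comp w_borel borel_measurable_const borel_measurable_indicator) auto

lemma \<tau>_nonneg: "\<tau> k \<rho>' r z \<ge> 0" by (simp add: \<tau>_def K0_nonneg w_nonneg)

text \<open>For separated points the kernel |x-y|^(-N-sq) is comparable with (1+|y|)^(-N-sq), at the
  price of a power of the gap; the essential supremum in the tail space then bounds the y-integral
  uniformly in x.\<close>

lemma tail_error:
  obtains D where "D \<ge> 0" "\<And>k \<rho>' r. k \<ge> 0 \<Longrightarrow> 0 < \<rho>' \<Longrightarrow> \<rho>' < r \<Longrightarrow> r \<le> R \<Longrightarrow>
    (\<integral>\<^sub>+z. \<tau> k \<rho>' r z) \<le> ennreal (D * (r - \<rho>') powr (- (real DIM('a) + s * q)) * (LBINT x. indicator (ball x0 r) x * w k x))"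
proof -
  define \<beta> where "\<beta> = real DIM('a) + s * q"
  have \<beta>: "\<beta> > 0" using p s by (auto simp: \<beta>_def intro!: add_pos_pos)
  obtain T where T: "T \<ge> 0" "AE x in lborel. x \<in> \<Omega> \<longrightarrow>
     (\<integral>\<^sub>+y. a0 (x, y) * \<bar>u0 y\<bar> powr (q - 1) / (1 + norm y) powr (real DIM('a) + s * q)) \<le> ennreal T"
    using tail_bound by blast
  define D0 where "D0 = 1 + norm x0 + 2 * R"
  have D0: "D0 > 0" using R by (auto simp: D0_def intro!: add_pos_nonneg)
  show ?thesis
  proof (rule that[of "D0 powr \<beta> * T"])
    show "D0 powr \<beta> * T \<ge> 0" using T by simp
    fix k \<rho>' r :: real assume k: "k \<ge> 0" and r: "0 < \<rho>'" "\<rho>' < r" "r \<le> R"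
    define d where "d = r - \<rho>'"
    have d: "0 < d" "d \<le> R" using r by (auto simp: d_def)
    \<comment> \<open>Since |x-y| \<ge> d and d \<le> R, both 1 + |x| and |x-y| are at most
      multiples of |x-y| / d, which gives 1 + |y| \<le> D0 |x-y| / d.\<close>
    have dist: "(norm (x - y)) powr (- \<beta>) \<le> (D0 / d) powr \<beta> * (1 / (1 + norm y) powr \<beta>)"
      if "x \<in> ball x0 \<rho>'" "y \<notin> ball x0 r" for x y
    proof -
      have "r \<le> dist x0 y" using that by simp
      also have "\<dots> \<le> dist x0 x + dist x y" by (rule dist_triangle)
      finally have xy: "d \<le> norm (x - y)" using that(1) by (simp add: d_def dist_norm)
      have nx: "norm x \<le> norm x0 + R" using that(1) r norm_triangle_ineq2[of x x0] by (simp add: dist_norm norm_minus_commute)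
      have "1 + norm y \<le> 1 + norm x + norm (x - y)" using norm_triangle_ineq4[of x "x - y"] by simp
      also have "\<dots> \<le> (1 + norm x0 + R) * 1 + norm (x - y) * 1" using nx by simp
      also have "\<dots> \<le> (1 + norm x0 + R) * (norm (x - y) / d) + norm (x - y) * (R / d)"
      proof (intro add_mono mult_left_mono)
        show "1 \<le> norm (x - y) / d" "1 \<le> R / d" using xy d by (auto simp: le_divide_eq)
        show "0 \<le> 1 + norm x0 + R" using R norm_ge_zero[of x0] by linarith
      qed simp
      also have "\<dots> = D0 * norm (x - y) / d" by (simp add: D0_def add_divide_distrib algebra_simps)
      finally have "1 + norm y \<le> D0 / d * norm (x - y)" by simp
      hence "(1 + norm y) powr \<beta> \<le> (D0 / d * norm (x - y)) powr \<beta>" using \<beta> by (intro powr_mono2) auto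
      also have "\<dots> = (D0 / d) powr \<beta> * norm (x - y) powr \<beta>" by (rule powr_mult)
      finally have "(1 + norm y) powr \<beta> * norm (x - y) powr (- \<beta>) \<le> (D0 / d) powr \<beta> * norm (x - y) powr \<beta> * norm (x - y) powr (- \<beta>)"
        by (intro mult_right_mono) auto
      also have "\<dots> = (D0 / d) powr \<beta>" using order.strict_trans2[OF d(1) xy] by (simp add: mult.assoc powr_add[symmetric])
      finally have le: "(1 + norm y) powr \<beta> * norm (x - y) powr (- \<beta>) \<le> (D0 / d) powr \<beta>" .
      have "1 + norm y > 0" using norm_ge_zero[of y] by linarith
      hence "(1 + norm y) powr \<beta> > 0" by simp
      thus ?thesis using le by (simp add: pos_le_divide_eq mult.commute)
    qed
    have "(\<integral>\<^sub>+z. \<tau> k \<rho>' r z) = (\<integral>\<^sup>+x. \<integral>\<^sup>+y. ennreal (\<tau> k \<rho>' r (x, y)) \<partial>lborel \<partial>lborel)"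
      using \<tau>_borel by (intro nn_integral_lborel_pair) simp
    also have "\<dots> \<le> (\<integral>\<^sup>+x. ennreal (indicator (ball x0 r) x * w k x) * ennreal ((D0 / d) powr \<beta> * T) \<partial>lborel)"
    proof (rule nn_integral_mono_AE)
      show "AE x in lborel. (\<integral>\<^sub>+y. \<tau> k \<rho>' r (x, y)) \<le> ennreal (indicator (ball x0 r) x * w k x) * ennreal ((D0 / d) powr \<beta> * T)"
        using T(2)
      proof eventually_elim
        case (elim x)
        show ?case
        proof (cases "x \<in> ball x0 \<rho>'")
          case True
          hence xb: "x \<in> ball x0 r" and x\<Omega>: "x \<in> \<Omega>" using r cball_\<Omega> by auto
          have "(\<integral>\<^sub>+y. \<tau> k \<rho>' r (x, y))
            \<le> (\<integral>\<^sup>+y. ennreal (w k x * (D0 / d) powr \<beta>) * ennreal (a0 (x, y) * \<bar>u0 y\<bar> powr (q - 1) / (1 + norm y) powr \<beta>) \<partial>lborel)"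
          proof (rule nn_integral_mono)
            fix y
            have "\<tau> k \<rho>' r (x, y) \<le> (w k x * (D0 / d) powr \<beta>) * (a0 (x, y) * \<bar>u0 y\<bar> powr (q - 1) / (1 + norm y) powr \<beta>)"
            proof (cases "y \<in> ball x0 r")
              case False
              have "- real DIM('a) - s * q = - \<beta>" by (simp add: \<beta>_def)
              hence "\<tau> k \<rho>' r (x, y) = a0 (x, y) * norm (x - y) powr (- \<beta>) * (w k x * w k y powr (q - 1))"
                using True False by (simp add: \<tau>_def K0_def)
              also have "\<dots> \<le> a0 (x, y) * ((D0 / d) powr \<beta> * (1 / (1 + norm y) powr \<beta>)) * (w k x * \<bar>u0 y\<bar> powr (q - 1))"
                using dist[OF True False] w_nonneg w_le[OF k] q a0_nonneg
                by (intro mult_mono mult_left_mono powr_mono2) auto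
              finally show ?thesis by (simp add: mult_ac)
            qed (use w_nonneg a0_nonneg in \<open>simp add: \<tau>_def\<close>)
            hence "ennreal (\<tau> k \<rho>' r (x, y)) \<le> ennreal ((w k x * (D0 / d) powr \<beta>) * (a0 (x, y) * \<bar>u0 y\<bar> powr (q - 1) / (1 + norm y) powr \<beta>))"
              by (rule ennreal_leI)
            thus "ennreal (\<tau> k \<rho>' r (x, y)) \<le> ennreal (w k x * (D0 / d) powr \<beta>) * ennreal (a0 (x, y) * \<bar>u0 y\<bar> powr (q - 1) / (1 + norm y) powr \<beta>)"
              by (subst ennreal_mult'[symmetric]) (auto simp: w_nonneg)
          qed
          also have "\<dots> = ennreal (w k x * (D0 / d) powr \<beta>) * (\<integral>\<^sub>+y. a0 (x, y) * \<bar>u0 y\<bar> powr (q - 1) / (1 + norm y) powr \<beta>)"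
          proof (rule nn_integral_cmult)
            have "(\<lambda>y. a0 (x, y)) \<in> borel_measurable borel"
              by (rule measurable_compose[OF _ a0_borel]) (intro borel_measurable_continuous_onI continuous_intros)
            thus "(\<lambda>y. ennreal (a0 (x, y) * \<bar>u0 y\<bar> powr (q - 1) / (1 + norm y) powr \<beta>)) \<in> borel_measurable lborel"
              by measurable
          qed
          also have "\<dots> \<le> ennreal (w k x * (D0 / d) powr \<beta>) * ennreal T"
            using elim x\<Omega> by (intro mult_left_mono) (auto simp: \<beta>_def)
          also have "\<dots> = ennreal (indicator (ball x0 r) x * w k x) * ennreal ((D0 / d) powr \<beta> * T)"
            using xb T(1) w_nonneg by (simp add: ennreal_mult'[symmetric] mult.assoc)
          finally show ?thesis .
        qed (simp add: \<tau>_def)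
      qed
    qed
    also have "\<dots> = (\<integral>\<^sub>+x. indicator (ball x0 r) x * w k x) * ennreal ((D0 / d) powr \<beta> * T)"
      by (intro nn_integral_multc measurable_compose[OF _ measurable_ennreal] borel_measurable_times borel_measurable_indicator) auto
    also have "(\<integral>\<^sub>+x. indicator (ball x0 r) x * w k x) = ennreal (LBINT x. indicator (ball x0 r) x * w k x)"
      by (rule nn_integral_eq_integral[OF integrable_w(3)[OF r(3) k]]) (auto simp: w_nonneg)
    also have "\<dots> * ennreal ((D0 / d) powr \<beta> * T) = ennreal ((D0 / d) powr \<beta> * T * (LBINT x. indicator (ball x0 r) x * w k x))"
      using T S_split(4)[OF r(3) k] by (simp add: ennreal_mult'' mult.commute)
    also have "(D0 / d) powr \<beta> * T = D0 powr \<beta> * T * d powr (- \<beta>)"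
      using powr_divide[of D0 d \<beta>] d D0 by (simp add: powr_minus divide_inverse)
    finally show "(\<integral>\<^sub>+z. \<tau> k \<rho>' r z) \<le> ennreal (D0 powr \<beta> * T * (r - \<rho>') powr (- (real DIM('a) + s * q)) * (LBINT x. indicator (ball x0 r) x * w k x))"
      by (simp add: \<beta>_def d_def)
  qed
qed

text \<open>An exponent that dominates the three losses N + s q from the tail, q from the near
  interaction and p from the gradient of the cut-off.\<close>

definition bexp :: real where "bexp = real DIM('a) + s * q + q"

lemma bexp: "bexp > 0" "real DIM('a) + s * q \<le> bexp" "q \<le> bexp" "p \<le> bexp"
proof -
  have "s * q > 0" using s q by simp
  moreover have "real DIM('a) \<ge> 0" by simp
  ultimately show "bexp > 0" "real DIM('a) + s * q \<le> bexp" "q \<le> bexp" "p \<le> bexp"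
    using q p unfolding bexp_def by linarith+
qed

text \<open>The cut-off is supported in the ball of the intermediate radius (\<rho>+r)/2, so that
  half of the gap remains between its support and the complement of the larger ball;
  \<open>tail_error\<close> needs this distance. Nothing is used about the kernel from
  below.\<close>

lemma nonlocal_error:
  fixes m :: nat and L :: real
  assumes m: "q \<le> m" and L: "L > 0"
  obtains C where "C \<ge> 0" "\<And>k \<rho> r \<eta>. \<lbrakk>k \<ge> 0; 0 < \<rho>; \<rho> < r; r \<le> R; \<eta> \<in> borel_measurable borel; \<And>x. 0 \<le> \<eta> x; \<And>x. \<eta> x \<le> 1;
     \<And>x. x \<notin> ball x0 ((\<rho> + r) / 2) \<Longrightarrow> \<eta> x = 0; \<And>x y. \<bar>\<eta> x - \<eta> y\<bar> \<le> L / (r - \<rho>) * norm (x - y)\<rbrakk> \<Longrightarrow>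
     integrable lborel (\<lambda>z. indicator (cross_region \<Omega>) z * NI (\<lambda>x. u0 x - \<eta> x ^ m * w k x) z) \<and>
     (LBINT z. indicator (cross_region \<Omega>) z * NI (\<lambda>x. u0 x - \<eta> x ^ m * w k x) z)
     \<le> (LBINT z. indicator (cross_region \<Omega>) z * NI u0 z) + C * (r - \<rho>) powr (- bexp) * S k r"
proof -
  define \<beta> where "\<beta> = real DIM('a) + s * q"
  obtain J where J: "J \<ge> 0" "\<And>k r. k \<ge> 0 \<Longrightarrow> r \<le> R \<Longrightarrow>
    (\<integral>\<^sub>+z. indicator (ball x0 r) (fst z) * indicator (ball x0 r) (snd z) * norm (fst z - snd z) powr (q - real DIM('a) - s * q) * w k (fst z) powr q)
    \<le> ennreal (J * (LBINT x. indicator (ball x0 r) x * w k x powr q))" using near_error by blast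
  obtain D where D: "D \<ge> 0" "\<And>k \<rho>' r. k \<ge> 0 \<Longrightarrow> 0 < \<rho>' \<Longrightarrow> \<rho>' < r \<Longrightarrow> r \<le> R \<Longrightarrow>
    (\<integral>\<^sub>+z. \<tau> k \<rho>' r z) \<le> ennreal (D * (r - \<rho>') powr (- (real DIM('a) + s * q)) * (LBINT x. indicator (ball x0 r) x * w k x))"
    using tail_error by blast
  obtain A where A: "A \<ge> 0" "AE z in lborel. z \<in> cball x0 R \<times> cball x0 R \<longrightarrow> a0 z \<le> A"
    using a0_bounded[OF compact_cball cball_\<Omega>] by blast
  define C0 where "C0 = (m * 2 ^ m) powr q + q * 2 powr q"
  have C0: "C0 \<ge> 0" using q by (simp add: C0_def)
  \<comment> \<open>Each error occurs twice, once for each order of the two points; the factor 2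
    powr \<beta> is the cost of the halved gap.\<close>
  define C where "C = C0 * (A * L powr q * (2 * J) + 2 * D * 2 powr \<beta>)"
  have C: "C \<ge> 0" using C0 A(1) J(1) D(1) by (simp add: C_def)
  show ?thesis
  proof (rule that[OF C])
    fix k \<rho> r :: real and \<eta> :: "'a \<Rightarrow> real"
    assume k: "k \<ge> 0" and r: "0 < \<rho>" "\<rho> < r" "r \<le> R" and \<eta>m[measurable]: "\<eta> \<in> borel_measurable borel" and \<eta>: "\<And>x. 0 \<le> \<eta> x" "\<And>x. \<eta> x \<le> 1"
      and out: "\<And>x. x \<notin> ball x0 ((\<rho> + r) / 2) \<Longrightarrow> \<eta> x = 0" and lip: "\<And>x y. \<bar>\<eta> x - \<eta> y\<bar> \<le> L / (r - \<rho>) * norm (x - y)"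
    define \<rho>' where "\<rho>' = (\<rho> + r) / 2"
    have \<rho>': "0 < \<rho>'" "\<rho>' < r" "r - \<rho>' = (r - \<rho>) / 2" using r by (auto simp: \<rho>'_def field_simps)
    define t where "t = r - \<rho>"
    have t: "0 < t" "t \<le> 1" using r R by (auto simp: t_def)
    define v where "v = (\<lambda>x. u0 x - \<eta> x ^ m * w k x)"
    have vm: "v \<in> borel_measurable borel" unfolding v_def by measurable
    define n1 where "n1 = (\<lambda>z::'a \<times> 'a. indicator (ball x0 r) (fst z) * indicator (ball x0 r) (snd z) * norm (fst z - snd z) powr (q - real DIM('a) - s * q) * w k (fst z) powr q)"
    have n1m: "n1 \<in> borel_measurable borel" unfolding n1_def
      by (intro borel_measurable_times kernel_pair_measurable powr_real_measurable
          borel_fst_comp borel_snd_comp w_borel borel_measurable_const borel_measurable_indicator) auto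
    have n10: "n1 z \<ge> 0" for z by (simp add: n1_def)
    define \<sigma> where "\<sigma> = (\<lambda>z::'a \<times> 'a. (snd z, fst z))"
    have \<sigma>m: "\<sigma> \<in> borel_measurable borel" unfolding \<sigma>_def by (intro borel_measurable_continuous_onI continuous_intros)
    define c1 where "c1 = C0 * (A * (L / t) powr q)"
    have c1: "c1 \<ge> 0" using C0 A by (simp add: c1_def)
    define E where "E = (\<lambda>z. c1 * (n1 z + n1 (\<sigma> z)) + C0 * (\<tau> k \<rho>' r z + \<tau> k \<rho>' r (\<sigma> z)))"
    have n1s: "(\<lambda>z. n1 (\<sigma> z)) \<in> borel_measurable borel" and \<tau>s: "(\<lambda>z. \<tau> k \<rho>' r (\<sigma> z)) \<in> borel_measurable borel"
      using measurable_compose[OF \<sigma>m n1m] measurable_compose[OF \<sigma>m \<tau>_borel] .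
    have Em: "E \<in> borel_measurable borel" unfolding E_def
      by (intro borel_measurable_add borel_measurable_times borel_measurable_const n1m n1s \<tau>_borel \<tau>s)
    have E0: "E z \<ge> 0" for z unfolding E_def using c1 C0 n10 \<tau>_nonneg by (intro add_nonneg_nonneg mult_nonneg_nonneg) auto
    have K0s: "K0 (\<sigma> z) = K0 z" for z by (cases z) (simp add: K0_def \<sigma>_def a0_sym norm_minus_commute)
    have key: "NI v z \<le> NI u0 z + E z" if Az: "z \<in> cball x0 R \<times> cball x0 R \<longrightarrow> a0 z \<le> A" for z
    proof -
      obtain x y where z: "z = (x, y)" by (cases z)
      have b1: "NI v z \<le> NI u0 z + C0 * \<bar>\<eta> x - \<eta> y\<bar> powr q * (w k x powr q + w k y powr q) * K0 z"
      proof -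
        have "\<bar>v x - v y\<bar> powr q \<le> \<bar>u0 x - u0 y\<bar> powr q + C0 * \<bar>\<eta> x - \<eta> y\<bar> powr q * (w k x powr q + w k y powr q)"
          unfolding v_def using truncation_pointwise(1)[OF q(2) m \<eta>(1)[of x] \<eta>(2)[of x] \<eta>(1)[of y] \<eta>(2)[of y], of "u0 x" k "u0 y"]
          by (simp add: w_def C0_def)
        from mult_right_mono[OF this K0_nonneg[of z]] show ?thesis by (simp add: NI_def z distrib_right)
      qed
      \<comment> \<open>Both points in the larger ball: the Lipschitz bound and the local bound of a
        apply. One point in the inner ball and the other outside the larger one: the tail term, in
        either order. Both points outside the inner ball: the cut-off vanishes and nothing
        changes.\<close>
      consider "x \<in> ball x0 r \<and> y \<in> ball x0 r" | "x \<in> ball x0 \<rho>' \<and> y \<notin> ball x0 r" | "y \<in> ball x0 \<rho>' \<and> x \<notin> ball x0 r"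
        | "x \<notin> ball x0 \<rho>' \<and> y \<notin> ball x0 \<rho>'" using \<rho>'(2) by fastforce
      thus ?thesis
      proof cases
        case 1
        have "a0 z \<le> A" using Az 1 r(3) by (auto simp: z)
        have "\<bar>\<eta> x - \<eta> y\<bar> powr q * K0 z \<le> (L / t * norm (x - y)) powr q * (A * norm (x - y) powr (- real DIM('a) - s * q))"
        proof (rule mult_mono)
          show "\<bar>\<eta> x - \<eta> y\<bar> powr q \<le> (L / t * norm (x - y)) powr q"
            using lip[of x y] q unfolding t_def by (intro powr_mono2) auto
          show "K0 z \<le> A * norm (x - y) powr (- real DIM('a) - s * q)"
            using \<open>a0 z \<le> A\<close> by (auto simp: K0_def z intro: mult_right_mono)
        qed (auto simp: K0_nonneg)
        also have "\<dots> = A * (L / t) powr q * norm (x - y) powr (q - real DIM('a) - s * q)"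
        proof -
          have "norm (x - y) powr q * norm (x - y) powr (- real DIM('a) - s * q) = norm (x - y) powr (q - real DIM('a) - s * q)"
            by (simp add: powr_add[symmetric] algebra_simps)
          thus ?thesis by (metis (no_types, lifting) powr_mult mult.assoc mult.left_commute)
        qed
        finally have "C0 * (\<bar>\<eta> x - \<eta> y\<bar> powr q * K0 z) * (w k x powr q + w k y powr q)
          \<le> C0 * (A * (L / t) powr q * norm (x - y) powr (q - real DIM('a) - s * q)) * (w k x powr q + w k y powr q)"
          using C0 by (intro mult_right_mono mult_left_mono) auto
        also have "\<dots> = c1 * (n1 z + n1 (\<sigma> z))"
          using 1 by (simp add: c1_def n1_def \<sigma>_def z norm_minus_commute[of y x] algebra_simps)
        finally have "C0 * \<bar>\<eta> x - \<eta> y\<bar> powr q * (w k x powr q + w k y powr q) * K0 z \<le> c1 * (n1 z + n1 (\<sigma> z))"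
          by (simp add: mult_ac)
        also have "\<dots> \<le> E z" unfolding E_def using C0 \<tau>_nonneg by simp
        finally show ?thesis using b1 by linarith
      next
        case 2
        have \<eta>y: "\<eta> y = 0" using 2 \<rho>'(2) by (intro out) (auto simp: \<rho>'_def)
        have "\<bar>v x - v y\<bar> powr q \<le> \<bar>u0 x - u0 y\<bar> powr q + C0 * (w k x * w k y powr (q - 1))"
          unfolding v_def using truncation_pointwise(2)[OF q(2) m \<eta>(1)[of x] \<eta>(2)[of x] \<eta>(1)[of y] \<eta>(2)[of y] \<eta>y, of "u0 x" k "u0 y"]
          by (simp add: w_def C0_def)
        from mult_right_mono[OF this K0_nonneg[of z]]
        have "NI v z \<le> (\<bar>u0 x - u0 y\<bar> powr q + C0 * (w k x * w k y powr (q - 1))) * K0 z" by (simp add: NI_def z)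
        also have "\<dots> = NI u0 z + C0 * \<tau> k \<rho>' r z" using 2 unfolding distrib_right by (simp add: NI_def z \<tau>_def)
        also have "NI u0 z + C0 * \<tau> k \<rho>' r z \<le> NI u0 z + E z" unfolding E_def using c1 C0 n10 \<tau>_nonneg
          by (simp add: distrib_left add_increasing)
        finally show ?thesis .
      next
        case 3
        have \<eta>x: "\<eta> x = 0" using 3 \<rho>'(2) by (intro out) (auto simp: \<rho>'_def)
        have "\<bar>v y - v x\<bar> powr q \<le> \<bar>u0 y - u0 x\<bar> powr q + C0 * (w k y * w k x powr (q - 1))"
          unfolding v_def using truncation_pointwise(2)[OF q(2) m \<eta>(1)[of y] \<eta>(2)[of y] \<eta>(1)[of x] \<eta>(2)[of x] \<eta>x, of "u0 y" k "u0 x"]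
          by (simp add: w_def C0_def)
        hence "\<bar>v x - v y\<bar> powr q \<le> \<bar>u0 x - u0 y\<bar> powr q + C0 * (w k y * w k x powr (q - 1))" by (simp add: abs_minus_commute)
        from mult_right_mono[OF this K0_nonneg[of z]]
        have "NI v z \<le> (\<bar>u0 x - u0 y\<bar> powr q + C0 * (w k y * w k x powr (q - 1))) * K0 z" by (simp add: NI_def z)
        also have "\<dots> = NI u0 z + C0 * \<tau> k \<rho>' r (\<sigma> z)" using 3 K0s[of z] unfolding distrib_right by (simp add: NI_def z \<tau>_def \<sigma>_def)
        also have "NI u0 z + C0 * \<tau> k \<rho>' r (\<sigma> z) \<le> NI u0 z + E z" unfolding E_def using c1 C0 n10 \<tau>_nonneg
          by (simp add: distrib_left add_increasing)
        finally show ?thesis .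
      next
        case 4
        have "\<eta> x = 0" "\<eta> y = 0" using 4 by (auto intro!: out simp: \<rho>'_def)
        hence "NI v z \<le> NI u0 z" using b1 q by simp
        thus ?thesis using E0[of z] by linarith
      qed
    qed
    define W1 where "W1 = (LBINT x. indicator (ball x0 r) x * w k x)"
    define Wq where "Wq = (LBINT x. indicator (ball x0 r) x * w k x powr q)"
    have W: "W1 \<ge> 0" "Wq \<ge> 0" "W1 + Wq \<le> S k r"
      using S_split[OF r(3) k] by (auto simp: W1_def Wq_def)
    have nE: "(\<integral>\<^sub>+z. E z) \<le> ennreal (C * t powr (- bexp) * S k r)"
    proof -
      define X where "X = (\<integral>\<^sub>+z. n1 z)"
      define Y where "Y = (\<integral>\<^sub>+z. \<tau> k \<rho>' r z)"
      have X: "X \<le> ennreal (J * Wq)" unfolding X_def n1_def Wq_def by (rule J(2)[OF k r(3)])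
      have Y: "Y \<le> ennreal (D * (t / 2) powr (- \<beta>) * W1)"
        using D(2)[OF k \<rho>'(1,2) r(3)] unfolding Y_def W1_def \<beta>_def \<rho>'(3) t_def .
      have Xs: "(\<integral>\<^sub>+z. n1 (\<sigma> z)) = X"
        unfolding X_def \<sigma>_def using n1m by (intro nn_integral_lborel_swap[of "\<lambda>z. ennreal (n1 z)"]) simp
      have Ys: "(\<integral>\<^sub>+z. \<tau> k \<rho>' r (\<sigma> z)) = Y"
        unfolding Y_def \<sigma>_def using \<tau>_borel by (intro nn_integral_lborel_swap[of "\<lambda>z. ennreal (\<tau> k \<rho>' r z)"]) simp
      have "(\<integral>\<^sub>+z. E z) = (\<integral>\<^sup>+z. ennreal c1 * (ennreal (n1 z) + ennreal (n1 (\<sigma> z))) + ennreal C0 * (ennreal (\<tau> k \<rho>' r z) + ennreal (\<tau> k \<rho>' r (\<sigma> z))) \<partial>lborel)"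
        unfolding E_def using c1 C0 n10 \<tau>_nonneg
        by (intro nn_integral_cong) (simp add: ennreal_lincomb[symmetric])
      also have "\<dots> = ennreal c1 * (X + X) + ennreal C0 * (Y + Y)"
        using n1m n1s \<tau>_borel[of k \<rho>' r] \<tau>s unfolding X_def[symmetric]
        by (simp add: nn_integral_add nn_integral_cmult Xs Ys X_def[symmetric] Y_def[symmetric])
      also have "\<dots> \<le> ennreal c1 * (ennreal (J * Wq) + ennreal (J * Wq)) + ennreal C0 * (ennreal (D * (t / 2) powr (- \<beta>) * W1) + ennreal (D * (t / 2) powr (- \<beta>) * W1))"
        by (intro add_mono mult_left_mono X Y) auto
      also have "\<dots> = ennreal (c1 * (2 * J * Wq) + C0 * (2 * D * (t / 2) powr (- \<beta>) * W1))"
      proof -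
        have "ennreal c1 * (ennreal a + ennreal a) + ennreal C0 * (ennreal b + ennreal b) = ennreal (c1 * (2 * a) + C0 * (2 * b))" if "a \<ge> 0" "b \<ge> 0" for a b
          unfolding ennreal_lincomb[OF c1 that(1) that(1)] ennreal_lincomb[OF C0 that(2) that(2)] mult_2
          using that c1 C0 by (subst ennreal_plus[symmetric]) auto
        from this[of "J * Wq" "D * (t / 2) powr (- \<beta>) * W1"] show ?thesis using J(1) D(1) W by (simp add: mult.assoc)
      qed
      also have "\<dots> \<le> ennreal (C * t powr (- bexp) * S k r)"
      proof (rule ennreal_leI)
        have tq: "t powr (- q) \<le> t powr (- bexp)" and t\<beta>: "t powr (- \<beta>) \<le> t powr (- bexp)"
          using t bexp by (auto intro!: powr_mono' simp: \<beta>_def)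
        have "c1 * (2 * J * Wq) = C0 * (A * L powr q * (2 * J)) * (t powr (- q) * Wq)"
          using powr_divide[of L t q] t L by (simp add: c1_def powr_minus divide_inverse mult_ac)
        also have "\<dots> \<le> C0 * (A * L powr q * (2 * J)) * (t powr (- bexp) * S k r)"
          using tq W C0 A(1) J(1) by (intro mult_left_mono mult_mono mult_nonneg_nonneg) auto
        finally have 1: "c1 * (2 * J * Wq) \<le> C0 * (A * L powr q * (2 * J)) * (t powr (- bexp) * S k r)" .
        have "(t / 2) powr (- \<beta>) = 2 powr \<beta> * t powr (- \<beta>)"
          using powr_divide[of t 2 "- \<beta>"] powr_minus_divide[of 2 \<beta>] t by (simp only: divide_divide_eq_right mult_1_right mult.commute)
        hence "C0 * (2 * D * (t / 2) powr (- \<beta>) * W1) = C0 * (2 * D * 2 powr \<beta>) * (t powr (- \<beta>) * W1)"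
          by (simp only: mult_ac)
        also have "\<dots> \<le> C0 * (2 * D * 2 powr \<beta>) * (t powr (- bexp) * S k r)"
          using t\<beta> W C0 D(1) by (intro mult_left_mono mult_mono mult_nonneg_nonneg) auto
        finally have 2: "C0 * (2 * D * (t / 2) powr (- \<beta>) * W1) \<le> C0 * (2 * D * 2 powr \<beta>) * (t powr (- bexp) * S k r)" .
        have "c1 * (2 * J * Wq) + C0 * (2 * D * (t / 2) powr (- \<beta>) * W1) \<le> C0 * (A * L powr q * (2 * J)) * (t powr (- bexp) * S k r) + C0 * (2 * D * 2 powr \<beta>) * (t powr (- bexp) * S k r)"
          by (rule add_mono[OF 1 2])
        also have "\<dots> = C * t powr (- bexp) * S k r" by (simp add: C_def algebra_simps)
        finally show "c1 * (2 * J * Wq) + C0 * (2 * D * (t / 2) powr (- \<beta>) * W1) \<le> C * t powr (- bexp) * S k r" .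
      qed
      finally show ?thesis .
    qed
    have iE: "integrable lborel E"
    proof (rule integrableI_bounded)
      have "(\<integral>\<^sub>+z. norm (E z)) = (\<integral>\<^sub>+z. E z)" using E0 by simp
      also have "\<dots> < \<infinity>" using nE by (rule le_less_trans) simp
      finally show "(\<integral>\<^sub>+z. norm (E z)) < \<infinity>" .
    qed (use Em in simp)
    have intE: "(LBINT z. E z) \<le> C * t powr (- bexp) * S k r"
    proof -
      have "ennreal (LBINT z. E z) \<le> ennreal (C * t powr (- bexp) * S k r)"
        using nE iE E0 by (simp add: nn_integral_eq_integral)
      thus ?thesis using C S_nonneg[of k r] by (subst (asm) ennreal_le_iff) auto
    qed
    have iu: "integrable lborel (\<lambda>z. indicator (cross_region \<Omega>) z * NI u0 z + E z)"
      by (intro Bochner_Integration.integrable_add u_energy(2) iE)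
    have AEk: "AE z in lborel. indicator (cross_region \<Omega>) z * NI v z \<le> indicator (cross_region \<Omega>) z * NI u0 z + E z"
      using A(2)
    proof eventually_elim
      case (elim z)
      show ?case using key[OF elim] E0[of z] by (auto simp: indicator_def)
    qed
    have iv: "integrable lborel (\<lambda>z. indicator (cross_region \<Omega>) z * NI v z)"
    proof (rule Bochner_Integration.integrable_bound[OF iu])
      show "AE z in lborel. norm (indicator (cross_region \<Omega>) z * NI v z) \<le> norm (indicator (cross_region \<Omega>) z * NI u0 z + E z)"
        using AEk
      proof eventually_elim
        case (elim z)
        thus ?case using NI_nonneg[of v z] by (simp add: abs_mult)
      qed
    qed (use NI_borel[OF vm] in simp)
    have "(LBINT z. indicator (cross_region \<Omega>) z * NI v z) \<le> (LBINT z. indicator (cross_region \<Omega>) z * NI u0 z + E z)"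
      by (rule integral_mono_AE[OF iv iu AEk])
    also have "\<dots> = (LBINT z. indicator (cross_region \<Omega>) z * NI u0 z) + (LBINT z. E z)"
      by (intro Bochner_Integration.integral_add u_energy(2) iE)
    finally show "integrable lborel (\<lambda>z. indicator (cross_region \<Omega>) z * NI (\<lambda>x. u0 x - \<eta> x ^ m * w k x) z) \<and>
     (LBINT z. indicator (cross_region \<Omega>) z * NI (\<lambda>x. u0 x - \<eta> x ^ m * w k x) z)
     \<le> (LBINT z. indicator (cross_region \<Omega>) z * NI u0 z) + C * (r - \<rho>) powr (- bexp) * S k r"
      using iv intE unfolding v_def t_def by auto
  qed
qed

text \<open>Since \<open>F\<close> need not be convex, the gradient on the annulus is absorbed by hole filling.\<close>

lemma caccioppoli_step:
  obtains C1 C2 where "C1 > 0" "C2 \<ge> 0" "\<And>k \<rho> r. k \<ge> 0 \<Longrightarrow> 0 < \<rho> \<Longrightarrow> \<rho> < r \<Longrightarrow> r \<le> R \<Longrightarrow>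
    \<Phi> k \<rho> \<le> C1 * (\<Phi> k r - \<Phi> k \<rho>) + C2 * (r - \<rho>) powr (- bexp) * S k r"
proof -
  obtain L :: real where L: "L > 0"
    "\<And>(x0::'a) \<rho> r. 0 < \<rho> \<Longrightarrow> \<rho> < r \<Longrightarrow> \<exists>\<zeta>. cutoff L x0 \<rho> r \<zeta>"
    using cutoff_exists[where 'a='a] by blast
  define m where "m = nat \<lceil>q\<rceil>"
  have m: "q \<le> m" unfolding m_def by linarith
  hence m1: "m \<ge> 1" using q by linarith
  have L2: "2 * L > 0" using L(1) by simp
  obtain C where C: "C \<ge> 0" "\<And>k \<rho> r \<eta>. \<lbrakk>k \<ge> 0; 0 < \<rho>; \<rho> < r; r \<le> R; \<eta> \<in> borel_measurable borel; \<And>x. 0 \<le> \<eta> x; \<And>x. \<eta> x \<le> 1;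
     \<And>x. x \<notin> ball x0 ((\<rho> + r) / 2) \<Longrightarrow> \<eta> x = 0; \<And>x y. \<bar>\<eta> x - \<eta> y\<bar> \<le> (2 * L) / (r - \<rho>) * norm (x - y)\<rbrakk> \<Longrightarrow>
     integrable lborel (\<lambda>z. indicator (cross_region \<Omega>) z * NI (\<lambda>x. u0 x - \<eta> x ^ m * w k x) z) \<and>
     (LBINT z. indicator (cross_region \<Omega>) z * NI (\<lambda>x. u0 x - \<eta> x ^ m * w k x) z)
     \<le> (LBINT z. indicator (cross_region \<Omega>) z * NI u0 z) + C * (r - \<rho>) powr (- bexp) * S k r"
    using nonlocal_error[OF m L2] by blast
  define c0 where "c0 = m * (2 * L)"
  have c0: "c0 \<ge> 0" using L by (simp add: c0_def)
  define C1 where "C1 = \<Lambda> * (\<Lambda> * 2 powr p)"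
  define C2 where "C2 = \<Lambda> * (\<Lambda> * 2 powr p * c0 powr p + 1 + C)"
  show ?thesis
  proof (rule that[of C1 C2])
    show "C1 > 0" "C2 \<ge> 0" using \<Lambda> C c0 by (auto simp: C1_def C2_def)
    fix k \<rho> r :: real assume k: "k \<ge> 0" and r: "0 < \<rho>" "\<rho> < r" "r \<le> R"
    define \<rho>' where "\<rho>' = (\<rho> + r) / 2"
    have \<rho>': "\<rho> < \<rho>'" "\<rho>' < r" "\<rho>' < R" "0 < \<rho>'" using r by (auto simp: \<rho>'_def)
    define t where "t = r - \<rho>"
    have t: "0 < t" "t \<le> 1" using r R by (auto simp: t_def)
    have Lt: "L / (\<rho>' - \<rho>) = 2 * L / t" by (simp add: \<rho>'_def t_def field_simps)
    obtain \<eta> where \<eta>: "smooth \<eta>" "\<And>x. 0 \<le> \<eta> x" "\<And>x. \<eta> x \<le> 1" "\<And>x. x \<in> cball x0 \<rho> \<Longrightarrow> \<eta> x = 1" "\<And>x. x \<notin> ball x0 \<rho>' \<Longrightarrow> \<eta> x = 0"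
      "\<And>x h. \<bar>dderiv \<eta> h x\<bar> \<le> 2 * L / t * norm h" "\<And>x y. \<bar>\<eta> x - \<eta> y\<bar> \<le> 2 * L / t * norm (x - y)"
      using L(2)[OF r(1) \<rho>'(1), of x0] unfolding Lt cutoff_def by blast
    note [measurable] = smooth_measurable[OF \<eta>(1)]
    define \<zeta> where "\<zeta> = (\<lambda>x. \<eta> x ^ m)"
    have \<zeta>: "0 \<le> \<zeta> x" "\<zeta> x \<le> 1" for x using \<eta>(2,3)[of x] by (auto simp: \<zeta>_def power_le_one)
    have \<zeta>1: "\<zeta> x = 1" if "x \<in> ball x0 \<rho>" for x using \<eta>(4)[of x] that by (simp add: \<zeta>_def)
    have \<zeta>0: "\<zeta> x = 0" if "x \<notin> ball x0 r" for x
    proof -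
      have "\<eta> x = 0" using that \<rho>'(2) by (intro \<eta>(5)) auto
      thus ?thesis using m1 by (simp add: \<zeta>_def)
    qed
    define A where "A = {x. u0 x > k}"
    have [measurable]: "A \<in> sets borel" unfolding A_def by measurable
    define B where "B = ball x0 r"
    have [measurable]: "B \<in> sets borel" by (simp add: B_def)
    have B\<Omega>: "B \<subseteq> \<Omega>" using r cball_\<Omega> by (auto simp: B_def)
    define h where "h = (\<lambda>x. \<zeta> x * w k x)"
    define H where "H = (\<lambda>x. \<zeta> x *\<^sub>R (indicator A x *\<^sub>R G0 x) + w k x *\<^sub>R sgrad \<zeta> x)"
    have out: "\<forall>x. x \<notin> ball x0 \<rho>' \<longrightarrow> \<eta> x = 0" using \<eta>(5) by blast
    have comp: "wgrad (\<lambda>x. \<eta> x ^ m * w k x) (\<lambda>x. \<eta> x ^ m *\<^sub>R (indicator {x. u0 x > k} x *\<^sub>R G0 x) + w k x *\<^sub>R sgrad (\<lambda>x. \<eta> x ^ m) x)"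
      "norm (sgrad (\<lambda>x. \<eta> x ^ m) x) \<le> m * (2 * L / t)" "x \<notin> ball x0 r \<Longrightarrow> sgrad (\<lambda>x. \<eta> x ^ m) x = 0" for x
      using competitor[where k=k and \<eta>=\<eta> and \<rho>'=\<rho>' and c="2 * L / t" and m=m, OF k \<eta>(1) _ _ \<rho>'(3) out _ m1] \<eta>(2,3,6) \<rho>'(2) by auto
    have wh: "wgrad h H" unfolding h_def H_def \<zeta>_def A_def by (rule comp(1))
    have [measurable]: "h \<in> borel_measurable borel" "H \<in> borel_measurable borel" using wgradD(4,5)[OF wh] .
    have sg: "norm (sgrad \<zeta> x) \<le> c0 / t" for x using comp(2)[of x] by (simp add: c0_def \<zeta>_def)
    have sg0: "sgrad \<zeta> x = 0" if "x \<notin> B" for x using comp(3)[of x] that by (simp add: B_def \<zeta>_def)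
    have h0: "h x = 0" "H x = 0" if "x \<notin> B \<inter> A" for x
    proof -
      have "w k x = 0" if "x \<notin> A" using that by (simp add: A_def w_def)
      thus "h x = 0" "H x = 0" using that \<zeta>0[of x] sg0[of x] by (auto simp: h_def H_def B_def)
    qed
    have hw: "0 \<le> h x" "h x \<le> w k x" for x using \<zeta>[of x] w_nonneg[of k x] by (auto simp: h_def mult_left_le_one_le)
    define v where "v = (\<lambda>x. u0 x - h x)"
    define V where "V = (\<lambda>x. G0 x - H x)"
    have lv: "lwgrad \<Omega> v V" unfolding v_def V_def by (rule lwgrad_diff[OF lw wh])
    note [measurable] = lwgradD(1,2)[OF lv]
    \<comment> \<open>Where u exceeds k, the new gradient is (1-\<zeta>) Du - w D\<zeta>. The full
      gradient survives only outside the smaller ball, which creates the hole.\<close>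
    have Vb: "norm (V x) powr p \<le> 2 powr p * (indicator (- ball x0 \<rho>) x * norm (G0 x) powr p + (c0 / t) powr p * w k x powr p)"
      if "x \<in> A" for x
    proof -
      have "V x = (1 - \<zeta> x) *\<^sub>R G0 x - w k x *\<^sub>R sgrad \<zeta> x" using that by (simp add: V_def H_def algebra_simps)
      hence "norm (V x) \<le> (1 - \<zeta> x) * norm (G0 x) + w k x * norm (sgrad \<zeta> x)"
        using \<zeta>[of x] w_nonneg[of k x] norm_triangle_ineq4[of "(1 - \<zeta> x) *\<^sub>R G0 x" "w k x *\<^sub>R sgrad \<zeta> x"] by simp
      also have "\<dots> \<le> indicator (- ball x0 \<rho>) x * norm (G0 x) + w k x * (c0 / t)"
      proof (intro add_mono mult_right_mono mult_left_mono sg w_nonneg)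
        show "1 - \<zeta> x \<le> indicator (- ball x0 \<rho>) x" using \<zeta>1[of x] \<zeta>[of x] by (auto simp: indicator_def)
      qed simp
      finally have "norm (V x) powr p \<le> (indicator (- ball x0 \<rho>) x * norm (G0 x) + w k x * (c0 / t)) powr p"
        using p by (intro powr_mono2) auto
      also have "\<dots> \<le> 2 powr p * ((indicator (- ball x0 \<rho>) x * norm (G0 x)) powr p + (w k x * (c0 / t)) powr p)"
        using p w_nonneg[of k x] c0 t by (intro powr_add_le) auto
      also have "(w k x * (c0 / t)) powr p = (c0 / t) powr p * w k x powr p" by (metis powr_mult mult.commute)
      also have "(indicator (- ball x0 \<rho>) x * norm (G0 x)) powr p = indicator (- ball x0 \<rho>) x * norm (G0 x) powr p"
        by (auto simp: indicator_def)
      finally show ?thesis .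
    qed
    let ?M = "lebesgue_on \<Omega>"
    define Q where "Q = (\<lambda>x. indicator B x * (indicator A x * norm (G0 x) powr p))"
    define Q1 where "Q1 = (\<lambda>x. indicator (ball x0 \<rho>) x * (indicator A x * norm (G0 x) powr p))"
    define P where "P = (\<lambda>x. indicator B x * w k x powr p)"
    define f1 where "f1 = (\<lambda>x. indicator B x * (\<bar>f0 x\<bar> * w k x))"
    have iQ: "integrable lborel Q" and iQ1: "integrable lborel Q1" and iP: "integrable lborel P" and if1: "integrable lborel f1"
      unfolding Q_def Q1_def P_def f1_def A_def B_def using integrable_w[OF r(3) k] integrable_w(5)[of \<rho> k] r k by auto
    have [measurable]: "Q \<in> borel_measurable borel" "Q1 \<in> borel_measurable borel" "P \<in> borel_measurable borel" "f1 \<in> borel_measurable borel"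
      using iQ iQ1 iP if1 by (auto dest: borel_measurable_integrable)
    have QB: "Q x = 0" "Q1 x = 0" "P x = 0" "f1 x = 0" if "x \<notin> \<Omega>" for x
    proof -
      have "x \<notin> B" "x \<notin> ball x0 \<rho>" using that B\<Omega> r by (auto simp: B_def subset_iff)
      thus "Q x = 0" "Q1 x = 0" "P x = 0" "f1 x = 0" by (auto simp: Q_def Q1_def P_def f1_def)
    qed
    define cc where "cc = (c0 / t) powr p"
    \<comment> \<open>The change of the local density is estimated twice: |d| \<le> U yields
      integrability, hence finite energy of the competitor, and the lower bound E carries the
      inequality that follows from minimality.\<close>
    define E where "E = (\<lambda>x. inverse \<Lambda> * Q x - \<Lambda> * (2 powr p * (Q x - Q1 x + cc * P x)) - f1 x)"
    define U where "U = (\<lambda>x. \<Lambda> * Q x + \<Lambda> * (2 powr p * (Q x - Q1 x + cc * P x)) + f1 x)"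
    have iE: "integrable lborel E" and iU: "integrable lborel U"
      unfolding E_def U_def
      by (intro Bochner_Integration.integrable_diff Bochner_Integration.integrable_add integrable_mult_right iQ iQ1 iP if1)+
    have onM: "integrable ?M X \<and> (\<integral>x. X x \<partial>?M) = (LBINT x. X x)"
      if "integrable lborel X" "\<And>x. x \<notin> \<Omega> \<Longrightarrow> X x = 0" for X :: "'a \<Rightarrow> real"
    proof -
      have Xm: "X \<in> borel_measurable borel" using that(1) by (simp add: borel_measurable_integrable)
      have e: "(\<lambda>x. indicator \<Omega> x *\<^sub>R X x) = X" using that(2) by (auto simp: indicator_def fun_eq_iff)
      show ?thesis
        using lebesgue_on_borel[OF \<Omega>_borel borel_measurable_lebesgue_onI[OF Xm] Xm] that(1) unfolding e by simp
    qed
    have EM: "integrable ?M E" "(\<integral>x. E x \<partial>?M) = (LBINT x. E x)" and UM: "integrable ?M U"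
      using onM[OF iE] onM[OF iU] QB by (auto simp: E_def U_def)
    define d where "d = (\<lambda>x. LI u0 G0 x - LI v V x)"
    have dm: "d \<in> borel_measurable ?M" unfolding d_def
      by (intro borel_measurable_diff LI_measurable) auto
    have "AE x\<in>\<Omega> in lborel. E x \<le> d x \<and> \<bar>d x\<bar> \<le> U x"
      using growth_AE
    proof eventually_elim
      case (elim x)
      show ?case
      proof
        assume x\<Omega>: "x \<in> \<Omega>"
        show "E x \<le> d x \<and> \<bar>d x\<bar> \<le> U x"
        proof (cases "x \<in> B \<inter> A")
          case True
          have de: "d x = F x (G0 x) - F x (V x) - f0 x * h x" by (simp add: d_def LI_def v_def algebra_simps)
          have g: "inverse \<Lambda> * norm (G0 x) powr p \<le> F x (G0 x)" "F x (G0 x) \<le> \<Lambda> * norm (G0 x) powr p"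
            "inverse \<Lambda> * norm (V x) powr p \<le> F x (V x)" "F x (V x) \<le> \<Lambda> * norm (V x) powr p" using elim x\<Omega> by auto
          have il: "0 \<le> inverse \<Lambda> * norm (G0 x) powr p" "0 \<le> inverse \<Lambda> * norm (V x) powr p" using \<Lambda> by auto
          have fh: "\<bar>f0 x * h x\<bar> \<le> f1 x"
            using True hw[of x] by (auto simp: f1_def abs_mult intro!: mult_left_mono)
          have "Q x - Q1 x = indicator (- ball x0 \<rho>) x * norm (G0 x) powr p" using True r
            by (auto simp: Q_def Q1_def B_def indicator_def)
          moreover have "P x = w k x powr p" using True by (simp add: P_def)
          ultimately have "norm (V x) powr p \<le> 2 powr p * (Q x - Q1 x + cc * P x)" using Vb[of x] True by (simp add: cc_def)
          hence FV: "\<Lambda> * norm (V x) powr p \<le> \<Lambda> * (2 powr p * (Q x - Q1 x + cc * P x))" using \<Lambda> by (intro mult_left_mono) auto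
          have Qx: "Q x = norm (G0 x) powr p" using True by (simp add: Q_def)
          show ?thesis using de g il fh FV unfolding E_def U_def Qx by (auto simp: abs_le_iff)
        next
          case False
          have "d x = 0" using h0[OF False] by (simp add: d_def LI_def v_def V_def)
          moreover have "Q x = 0" "Q1 x = 0" using False r by (auto simp: Q_def Q1_def B_def indicator_def)
          moreover have "P x \<ge> 0" "f1 x \<ge> 0" "cc \<ge> 0" by (auto simp: P_def f1_def cc_def w_nonneg)
          moreover have "0 \<le> \<Lambda> * (2 powr p * (cc * P x))"
            using \<Lambda> \<open>P x \<ge> 0\<close> \<open>cc \<ge> 0\<close> by (intro mult_nonneg_nonneg) auto
          ultimately show ?thesis by (simp add: E_def U_def)
        qed
      qed
    qed
    hence dAE: "AE x in ?M. E x \<le> d x \<and> \<bar>d x\<bar> \<le> U x" unfolding AE_lebesgue_on_iff[OF \<Omega>_borel] .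
    have id: "integrable ?M d"
    proof (rule Bochner_Integration.integrable_bound[OF UM dm])
      show "AE x in ?M. norm (d x) \<le> norm (U x)" using dAE by eventually_elim auto
    qed
    have "(\<lambda>x. LI u0 G0 x - d x) = LI v V" by (auto simp: d_def)
    hence iv: "integrable ?M (LI v V)"
      using Bochner_Integration.integrable_diff[OF u_energy(1) id] by simp
    have vx: "v x = u0 x" if "x \<notin> \<Omega>" for x using h0(1)[of x] that B\<Omega> by (auto simp: v_def)
    have nl: "integrable lborel (\<lambda>z. indicator (cross_region \<Omega>) z * NI v z) \<and>
     (LBINT z. indicator (cross_region \<Omega>) z * NI v z) \<le> (LBINT z. indicator (cross_region \<Omega>) z * NI u0 z) + C * (r - \<rho>) powr (- bexp) * S k r"
      unfolding v_def h_def \<zeta>_def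
      by (rule C(2)[OF k r]) (use \<eta> in \<open>auto simp: \<rho>'_def t_def\<close>)
    have "(\<integral>x. d x \<partial>?M) = (\<integral>x. LI u0 G0 x \<partial>?M) - (\<integral>x. LI v V x \<partial>?M)"
      unfolding d_def by (rule Bochner_Integration.integral_diff[OF u_energy(1) iv])
    also have "\<dots> \<le> C * t powr (- bexp) * S k r"
      using min_ineq[OF lv vx iv] nl by (simp add: t_def)
    finally have d1: "(\<integral>x. d x \<partial>?M) \<le> C * t powr (- bexp) * S k r" .
    have "(LBINT x. E x) \<le> (\<integral>x. d x \<partial>?M)"
      unfolding EM(2)[symmetric] using dAE by (intro integral_mono_AE[OF EM(1) id]) (auto elim: eventually_mono)
    also note d1
    also have "(LBINT x. E x) = inverse \<Lambda> * \<Phi> k r - \<Lambda> * (2 powr p * (\<Phi> k r - \<Phi> k \<rho> + cc * (LBINT x. P x))) - (LBINT x. f1 x)"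
    proof -
      have "(LBINT x. Q x) = \<Phi> k r" "(LBINT x. Q1 x) = \<Phi> k \<rho>"
        by (auto simp: Q_def Q1_def \<Phi>_def A_def B_def)
      thus ?thesis unfolding E_def using iQ iQ1 iP if1 by simp
    qed
    finally have "inverse \<Lambda> * \<Phi> k r \<le> \<Lambda> * (2 powr p * (\<Phi> k r - \<Phi> k \<rho> + cc * (LBINT x. P x))) + (LBINT x. f1 x) + C * t powr (- bexp) * S k r"
      by linarith
    hence *: "\<Lambda> * (inverse \<Lambda> * \<Phi> k r) \<le> \<Lambda> * (\<Lambda> * (2 powr p * (\<Phi> k r - \<Phi> k \<rho> + cc * (LBINT x. P x))) + (LBINT x. f1 x) + C * t powr (- bexp) * S k r)"
      using \<Lambda> by (intro mult_left_mono) auto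
    hence 1: "\<Phi> k r \<le> C1 * (\<Phi> k r - \<Phi> k \<rho>) + \<Lambda> * (\<Lambda> * 2 powr p * (cc * (LBINT x. P x)) + (LBINT x. f1 x) + C * t powr (- bexp) * S k r)"
    proof -
      have "\<Lambda> * (inverse \<Lambda> * \<Phi> k r) = \<Phi> k r" using \<Lambda> by simp
      moreover have "l * (l * (b * (X + Y)) + g + T) = l * (l * b) * X + l * (l * b * Y + g + T)" for l b X Y g T :: real
        by (simp add: algebra_simps)
      ultimately show ?thesis using * by (simp only: C1_def)
    qed
    have PS: "(LBINT x. P x) \<le> S k r" "(LBINT x. f1 x) \<le> S k r" "0 \<le> (LBINT x. P x)"
      using S_split[OF r(3) k] by (auto simp: P_def f1_def B_def)
    have tp: "t powr (- p) \<le> t powr (- bexp)" "1 \<le> t powr (- bexp)"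
      using t bexp powr_mono'[of "- bexp" "- p" t] powr_mono'[of "- bexp" 0 t] by auto
    have "cc * (LBINT x. P x) = c0 powr p * (t powr (- p) * (LBINT x. P x))"
      using powr_divide[of c0 t p] t c0 by (simp add: cc_def powr_minus divide_inverse)
    also have "\<dots> \<le> c0 powr p * (t powr (- bexp) * S k r)"
      using tp PS by (intro mult_left_mono mult_mono) auto
    finally have 2: "cc * (LBINT x. P x) \<le> c0 powr p * (t powr (- bexp) * S k r)" .
    have "1 * S k r \<le> t powr (- bexp) * S k r" using tp S_nonneg by (intro mult_right_mono) auto
    hence 3: "(LBINT x. f1 x) \<le> t powr (- bexp) * S k r" using PS by simp
    have "\<Lambda> * (\<Lambda> * 2 powr p * (cc * (LBINT x. P x)) + (LBINT x. f1 x) + C * t powr (- bexp) * S k r)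
      \<le> \<Lambda> * (\<Lambda> * 2 powr p * (c0 powr p * (t powr (- bexp) * S k r)) + t powr (- bexp) * S k r + C * t powr (- bexp) * S k r)"
      using \<Lambda> 2 3 by (intro order_refl mult_left_mono add_mono) auto
    also have "\<dots> = C2 * t powr (- bexp) * S k r" by (simp add: C2_def algebra_simps)
    finally have "\<Phi> k r \<le> C1 * (\<Phi> k r - \<Phi> k \<rho>) + C2 * t powr (- bexp) * S k r" using 1 by linarith
    \<comment> \<open>The left side may be lowered to the smaller ball, which puts the estimate into
      hole-filling form.\<close>
    moreover have "\<Phi> k \<rho> \<le> \<Phi> k r" using r k by (intro \<Phi>_mono) auto
    ultimately show "\<Phi> k \<rho> \<le> C1 * (\<Phi> k r - \<Phi> k \<rho>) + C2 * (r - \<rho>) powr (- bexp) * S k r" by (simp add: t_def)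
  qed
qed

text \<open>Adding C1 \<Phi>(\<rho>) to both sides of \<open>caccioppoli_step\<close> produces the
  factor \<theta> = C1/(1+C1) < 1, as \<open>hole_filling_iteration\<close> requires. S is frozen at
  the outer radius by monotonicity.\<close>

lemma caccioppoli:
  obtains C where "C > 0" "\<And>k \<rho> r. k \<ge> 0 \<Longrightarrow> 0 < \<rho> \<Longrightarrow> \<rho> < r \<Longrightarrow> r \<le> R \<Longrightarrow> \<Phi> k \<rho> \<le> C * S k r * (r - \<rho>) powr (- bexp)"
proof -
  obtain C1 C2 where C: "C1 > 0" "C2 \<ge> 0" "\<And>k \<rho> r. k \<ge> 0 \<Longrightarrow> 0 < \<rho> \<Longrightarrow> \<rho> < r \<Longrightarrow> r \<le> R \<Longrightarrow>
    \<Phi> k \<rho> \<le> C1 * (\<Phi> k r - \<Phi> k \<rho>) + C2 * (r - \<rho>) powr (- bexp) * S k r"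
    using caccioppoli_step by blast
  define \<theta> where "\<theta> = C1 / (1 + C1)"
  have \<theta>: "0 < \<theta>" "\<theta> < 1" using C by (auto simp: \<theta>_def)
  obtain c where c: "c > 0" "\<And>\<Phi> S B r0 r1. \<lbrakk>r0 < r1; S \<ge> 0; \<And>t. r0 \<le> t \<Longrightarrow> t \<le> r1 \<Longrightarrow> \<Phi> t \<le> B;
     \<And>\<rho> r. r0 \<le> \<rho> \<Longrightarrow> \<rho> < r \<Longrightarrow> r \<le> r1 \<Longrightarrow> \<Phi> \<rho> \<le> \<theta> * \<Phi> r + S * (r - \<rho>) powr (- bexp)\<rbrakk> \<Longrightarrow>
     \<Phi> r0 \<le> c * S * (r1 - r0) powr (- bexp)"
    using hole_filling_iteration[OF \<theta> bexp(1)] by blast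
  show ?thesis
  proof (rule that[of "c * (C2 / (1 + C1) + 1)"])
    have "C2 / (1 + C1) + 1 > 0" using C(1,2) by (intro add_nonneg_pos divide_nonneg_pos) auto
    thus "c * (C2 / (1 + C1) + 1) > 0" using c(1) by simp
    fix k \<rho> r :: real assume k: "k \<ge> 0" and r: "0 < \<rho>" "\<rho> < r" "r \<le> R"
    define S' where "S' = C2 / (1 + C1) * S k r"
    have S': "S' \<ge> 0" using C S_nonneg[of k r] by (simp add: S'_def)
    have "\<Phi> k \<rho> \<le> c * S' * (r - \<rho>) powr (- bexp)"
    proof (rule c(2)[where B="\<Phi> k r"])
      show "\<Phi> k t \<le> \<Phi> k r" if "\<rho> \<le> t" "t \<le> r" for t using that r k by (intro \<Phi>_mono) auto
      fix \<rho>1 r1 assume h: "\<rho> \<le> \<rho>1" "\<rho>1 < r1" "r1 \<le> r"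
      have "\<Phi> k \<rho>1 \<le> C1 * (\<Phi> k r1 - \<Phi> k \<rho>1) + C2 * (r1 - \<rho>1) powr (- bexp) * S k r1"
        using h r k by (intro C(3)) auto
      also have "\<dots> \<le> C1 * (\<Phi> k r1 - \<Phi> k \<rho>1) + C2 * (r1 - \<rho>1) powr (- bexp) * S k r"
        using h r k C by (intro add_left_mono mult_left_mono S_mono) auto
      finally have "(1 + C1) * \<Phi> k \<rho>1 \<le> C1 * \<Phi> k r1 + C2 * (r1 - \<rho>1) powr (- bexp) * S k r" by (simp add: algebra_simps)
      hence "\<Phi> k \<rho>1 \<le> (C1 * \<Phi> k r1 + C2 * (r1 - \<rho>1) powr (- bexp) * S k r) / (1 + C1)"
        using C(1) by (simp add: pos_le_divide_eq mult.commute)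
      also have "\<dots> = \<theta> * \<Phi> k r1 + S' * (r1 - \<rho>1) powr (- bexp)"
        by (simp add: \<theta>_def S'_def add_divide_distrib mult_ac)
      finally show "\<Phi> k \<rho>1 \<le> \<theta> * \<Phi> k r1 + S' * (r1 - \<rho>1) powr (- bexp)" .
    qed (use r S' in auto)
    also have "\<dots> \<le> c * (C2 / (1 + C1) + 1) * S k r * (r - \<rho>) powr (- bexp)"
    proof -
      have "S' \<le> (C2 / (1 + C1) + 1) * S k r" using S_nonneg[of k r] by (simp add: S'_def distrib_right)
      hence "c * S' * (r - \<rho>) powr (- bexp) \<le> c * ((C2 / (1 + C1) + 1) * S k r) * (r - \<rho>) powr (- bexp)"
        using c(1) by (intro mult_right_mono mult_left_mono) auto
      thus ?thesis by (simp add: mult.assoc)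
    qed
    finally show "\<Phi> k \<rho> \<le> c * (C2 / (1 + C1) + 1) * S k r * (r - \<rho>) powr (- bexp)" .
  qed
qed

end

section \<open>De Giorgi iteration\<close>

lemma power_powr: "(x ^ j) powr c = (x powr c) ^ j" for x c :: real
  by (induction j) (simp_all add: powr_mult)

context nonlocal_problem_ball
begin

definition Y :: "real \<Rightarrow> real \<Rightarrow> real" where
  "Y k r = (LBINT x. indicator (ball x0 r) x * w k x powr q)"

lemma Y_nonneg: "Y k r \<ge> 0"
  unfolding Y_def by (intro integral_nonneg_AE AE_I2) simp

lemma nn_integral_eq_Y: "r \<le> R \<Longrightarrow> k \<ge> 0 \<Longrightarrow> (\<integral>\<^sub>+x. indicator (ball x0 r) x * w k x powr q) = ennreal (Y k r)"
  unfolding Y_def by (intro nn_integral_eq_integral integrable_w AE_I2) auto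

definition \<gamma>' where "\<gamma>' = \<gamma> / (\<gamma> - 1)"

text \<open>The hypotheses on \<gamma> in conjugate form. The bound by p makes \<gamma>' an
  admissible exponent in \<open>w_powr_le\<close>; the bound by q/p is what makes the recursion
  superlinear.\<close>

lemma \<gamma>': "\<gamma> > 1" "\<gamma>' > 1" "1 / \<gamma> + 1 / \<gamma>' = 1" "\<gamma>' < p" "\<gamma>' < q / p"
proof -
  have "p / (p - 1) > 1" using p by (simp add: field_simps)
  thus g: "\<gamma> > 1" using \<gamma>2 by linarith
  obtain g' where "g' > 1" "1 / \<gamma> + 1 / g' = 1" "g' = \<gamma> / (\<gamma> - 1)" using conjugate_exponent[OF g] .
  thus "\<gamma>' > 1" "1 / \<gamma> + 1 / \<gamma>' = 1" by (auto simp: \<gamma>'_def)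
  have "p < \<gamma> * (p - 1)" using \<gamma>2 p by (simp add: pos_divide_less_eq)
  hence "\<gamma> < p * (\<gamma> - 1)" by (simp add: algebra_simps)
  thus "\<gamma>' < p" using g by (simp add: \<gamma>'_def pos_divide_less_eq)
  have "q < \<gamma> * (q - p)" using \<gamma>1 q by (simp add: pos_divide_less_eq)
  hence "\<gamma> * p < q * (\<gamma> - 1)" by (simp add: algebra_simps)
  thus "\<gamma>' < q / p" using g p by (simp add: \<gamma>'_def pos_divide_less_eq pos_less_divide_eq mult.commute)
qed

text \<open>On \<open>{u0 > k}\<close> the lower truncation satisfies \<open>w h > k - h\<close>, so every smaller power of \<open>w k\<close> is controlled by \<open>w h powr q\<close>.\<close>

lemma w_powr_le:
  assumes "h < k" "k - h \<le> 1" "0 < e" "e \<le> q"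
  shows "w k x powr e \<le> (k - h) powr (- q) * w h x powr q"
proof (cases "u0 x > k")
  case True
  have wh: "w h x > k - h" "w k x \<le> w h x" using True assms by (auto simp: w_def)
  have "w h x powr (e - q) \<le> (k - h) powr (e - q)" using wh assms by (intro powr_mono2') auto
  also have "\<dots> \<le> (k - h) powr (- q)" using assms by (intro powr_mono') auto
  finally have le: "w h x powr (e - q) \<le> (k - h) powr (- q)" .
  have "w k x powr e \<le> w h x powr e" using wh w_nonneg assms by (intro powr_mono2) auto
  also have "\<dots> = w h x powr q * w h x powr (e - q)" by (simp add: powr_add[symmetric])
  also have "\<dots> \<le> w h x powr q * (k - h) powr (- q)" by (intro mult_left_mono le) auto
  finally show ?thesis by (simp add: mult.commute)
next
  case False
  hence "w k x = 0" by (simp add: w_def)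
  thus ?thesis by simp
qed

lemma integral_w_powr_le:
  assumes hk: "0 \<le> h" "h < k" "k - h \<le> 1" and e: "0 < e" "e \<le> q" and r: "r \<le> R"
    and i: "integrable lborel (\<lambda>x. indicator (ball x0 r) x * w k x powr e)"
  shows "(LBINT x. indicator (ball x0 r) x * w k x powr e) \<le> (k - h) powr (- q) * Y h r"
proof -
  have "(LBINT x. indicator (ball x0 r) x * w k x powr e) \<le> (LBINT x. (k - h) powr (- q) * (indicator (ball x0 r) x * w h x powr q))"
  proof (rule integral_mono[OF i])
    show "integrable lborel (\<lambda>x. (k - h) powr (- q) * (indicator (ball x0 r) x * w h x powr q))"
      by (intro integrable_mult_right integrable_w(2) r hk)
    show "indicator (ball x0 r) x * w k x powr e \<le> (k - h) powr (- q) * (indicator (ball x0 r) x * w h x powr q)" for x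
      using w_powr_le[OF hk(2,3) e, of x] by (auto simp: indicator_def)
  qed
  also have "\<dots> = (k - h) powr (- q) * Y h r" by (simp add: Y_def)
  finally show ?thesis .
qed

text \<open>Hoelder with \<gamma> and \<gamma>', followed by replacing the power \<gamma>' of the
  truncation by the power q at the lower level h.\<close>

lemma f0_w_bound:
  obtains B where "B \<ge> 0" "\<And>h k r. \<lbrakk>0 \<le> h; h < k; k - h \<le> 1; r \<le> R\<rbrakk> \<Longrightarrow>
    (LBINT x. indicator (ball x0 r) x * (\<bar>f0 x\<bar> * w k x)) \<le> B * ((k - h) powr (- q) * Y h r) powr (1 / \<gamma>')"
proof -
  define B0 where "B0 = (LBINT x. indicator (cball x0 R) x * \<bar>f0 x\<bar> powr \<gamma>)"
  have B0: "B0 \<ge> 0" unfolding B0_def by (intro integral_nonneg_AE AE_I2) simp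
  show ?thesis
  proof (rule that[of "B0 powr (1 / \<gamma>)"])
    fix h k r :: real assume hk: "0 \<le> h" "h < k" "k - h \<le> 1" and r: "r \<le> R"
    have kk: "0 \<le> k" using hk by simp
    define X where "X = (k - h) powr (- q) * Y h r"
    have X: "X \<ge> 0" by (simp add: X_def Y_nonneg)
    let ?f = "\<lambda>x. indicator (ball x0 r) x * \<bar>f0 x\<bar>" and ?g = "\<lambda>x. indicator (ball x0 r) x * w k x"
    have "(\<integral>\<^sub>+x. ?f x * ?g x) \<le> ennreal (B0 powr (1 / \<gamma>) * X powr (1 / \<gamma>'))"
    proof (rule nn_integral_Holder[OF \<gamma>'(1-3) _ _ _ _ _ B0 _ X])
      have [measurable]: "ball x0 r \<in> sets borel" by simp
      show "?f \<in> borel_measurable lborel" "?g \<in> borel_measurable lborel" by (auto intro!: borel_measurable_times)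
      show "?f x \<ge> 0" "?g x \<ge> 0" for x by (auto simp: w_nonneg)
      have "(\<integral>\<^sub>+x. ?f x powr \<gamma>) \<le> (\<integral>\<^sub>+x. indicator (cball x0 R) x * \<bar>f0 x\<bar> powr \<gamma>)"
        using r by (intro nn_integral_mono ennreal_leI) (auto simp: indicator_def)
      also have "\<dots> = ennreal B0" unfolding B0_def
        by (intro nn_integral_eq_integral f0_L\<gamma>[OF compact_cball cball_\<Omega>] AE_I2) simp
      finally show "(\<integral>\<^sub>+x. ?f x powr \<gamma>) \<le> ennreal B0" .
      have "(\<integral>\<^sub>+x. ?g x powr \<gamma>') \<le> (\<integral>\<^sup>+x. ennreal ((k - h) powr (- q)) * ennreal (indicator (ball x0 r) x * w h x powr q) \<partial>lborel)"
      proof (rule nn_integral_mono)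
        fix x
        have "?g x powr \<gamma>' \<le> (k - h) powr (- q) * (indicator (ball x0 r) x * w h x powr q)"
          using w_powr_le[OF hk(2,3), of \<gamma>' x] \<gamma>' q by (auto simp: indicator_def)
        thus "ennreal (?g x powr \<gamma>') \<le> ennreal ((k - h) powr (- q)) * ennreal (indicator (ball x0 r) x * w h x powr q)"
          by (subst ennreal_mult'[symmetric]) (auto intro: ennreal_leI)
      qed
      also have "\<dots> = ennreal ((k - h) powr (- q)) * ennreal (Y h r)"
        unfolding nn_integral_eq_Y[OF r hk(1), symmetric]
        by (intro nn_integral_cmult measurable_compose[OF _ measurable_ennreal] borel_measurable_times powr_real_measurable borel_measurable_indicator borel_measurable_const) auto
      also have "\<dots> = ennreal X" by (simp add: X_def ennreal_mult')
      finally show "(\<integral>\<^sub>+x. ?g x powr \<gamma>') \<le> ennreal X" .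
    qed
    also have "(\<lambda>x. ?f x * ?g x) = (\<lambda>x. indicator (ball x0 r) x * (\<bar>f0 x\<bar> * w k x))" by (auto simp: indicator_def)
    also have "(\<integral>\<^sub>+x. indicator (ball x0 r) x * (\<bar>f0 x\<bar> * w k x)) = ennreal (LBINT x. indicator (ball x0 r) x * (\<bar>f0 x\<bar> * w k x))"
      using integrable_w(4)[OF r kk] by (intro nn_integral_eq_integral) (auto simp: w_nonneg)
    finally show "(LBINT x. indicator (ball x0 r) x * (\<bar>f0 x\<bar> * w k x)) \<le> B0 powr (1 / \<gamma>) * ((k - h) powr (- q) * Y h r) powr (1 / \<gamma>')"
      by (subst (asm) ennreal_le_iff) (auto simp: X_def)
  qed simp
qed

text \<open>The source term carries the smallest power 1/\<gamma>' of Y. Since Y \<le> 1 and the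
  factor (k-h)^(-q) is at least one, the other three terms are bounded by the same
  expression.\<close>

lemma S_bound:
  obtains B where "B > 0" "\<And>h k r. \<lbrakk>0 \<le> h; h < k; k - h \<le> 1; r \<le> R; Y h r \<le> 1\<rbrakk> \<Longrightarrow>
    S k r \<le> B * ((k - h) powr (- q) * Y h r powr (1 / \<gamma>'))"
proof -
  obtain B where B: "B \<ge> 0" "\<And>h k r. \<lbrakk>0 \<le> h; h < k; k - h \<le> 1; r \<le> R\<rbrakk> \<Longrightarrow>
    (LBINT x. indicator (ball x0 r) x * (\<bar>f0 x\<bar> * w k x)) \<le> B * ((k - h) powr (- q) * Y h r) powr (1 / \<gamma>')"
    using f0_w_bound by blast
  show ?thesis
  proof (rule that[of "3 + B"])
    fix h k r :: real assume hk: "0 \<le> h" "h < k" "k - h \<le> 1" and r: "r \<le> R" and Y1: "Y h r \<le> 1"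
    have kk: "0 \<le> k" using hk by simp
    define X where "X = (k - h) powr (- q) * Y h r powr (1 / \<gamma>')"
    have \<theta>: "1 \<le> (k - h) powr (- q)" using powr_mono'[of "- q" 0 "k - h"] hk q by auto
    have g: "0 < 1 / \<gamma>'" "1 / \<gamma>' \<le> 1" using \<gamma>'(2) by auto
    have Yg: "Y h r \<le> Y h r powr (1 / \<gamma>')"
    proof -
      have "Y h r powr 1 \<le> Y h r powr (1 / \<gamma>')" using g Y1 Y_nonneg[of h r] by (intro powr_mono') auto
      thus ?thesis using Y_nonneg[of h r] by simp
    qed
    have 0: "(k - h) powr (- q) * Y h r \<le> X" unfolding X_def using Yg by (intro mult_left_mono) auto
    have "((k - h) powr (- q)) powr (1 / \<gamma>') \<le> ((k - h) powr (- q)) powr 1"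
      using \<theta> g by (intro powr_mono) auto
    hence "((k - h) powr (- q) * Y h r) powr (1 / \<gamma>') \<le> X"
      unfolding X_def powr_mult using \<theta> by (intro mult_right_mono) auto
    hence 4: "(LBINT x. indicator (ball x0 r) x * (\<bar>f0 x\<bar> * w k x)) \<le> B * X"
      using B(1) by (intro order_trans[OF B(2)[OF hk r]] mult_left_mono) auto
    have 1: "(LBINT x. indicator (ball x0 r) x * w k x powr p) \<le> X"
      using p q by (intro order_trans[OF integral_w_powr_le[OF hk _ _ r integrable_w(1)[OF r kk]] 0]) auto
    have 2: "(LBINT x. indicator (ball x0 r) x * w k x powr q) \<le> X"
      using p q by (intro order_trans[OF integral_w_powr_le[OF hk _ _ r integrable_w(2)[OF r kk]] 0]) auto
    have w1: "(\<lambda>x. indicator (ball x0 r) x * w k x powr 1) = (\<lambda>x. indicator (ball x0 r) x * w k x)" by (simp add: w_nonneg)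
    have 3: "(LBINT x. indicator (ball x0 r) x * w k x) \<le> X"
      using integral_w_powr_le[OF hk _ _ r, of 1] integrable_w(3)[OF r kk] q 0 unfolding w1 by auto
    show "S k r \<le> (3 + B) * ((k - h) powr (- q) * Y h r powr (1 / \<gamma>'))"
      unfolding X_def[symmetric] S_split(1)[OF r kk] distrib_right using 1 2 3 4 by linarith
  qed (use B(1) in simp)
qed

text \<open>The Sobolev inequality for \<eta> w_k with a cut-off between \<rho> and the midpoint,
  and the Caccioppoli inequality between the midpoint and r. The outer exponent q/p comes from
  Sobolev, the inner 1/\<gamma>' from the source.\<close>

lemma de_giorgi_step:
  obtains C where "C > 0" "\<And>h k \<rho> r. \<lbrakk>0 \<le> h; h < k; k - h \<le> 1; 0 < \<rho>; \<rho> < r; r \<le> R; Y h r \<le> 1\<rbrakk> \<Longrightarrow>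
    Y k \<rho> \<le> C * ((r - \<rho>) powr (- bexp) * ((k - h) powr (- q) * Y h r powr (1 / \<gamma>'))) powr (q / p)"
proof -
  obtain L :: real where L: "L > 0"
    "\<And>(x0::'a) \<rho> r. 0 < \<rho> \<Longrightarrow> \<rho> < r \<Longrightarrow> \<exists>\<zeta>. cutoff L x0 \<rho> r \<zeta>"
    using cutoff_exists[where 'a='a] by blast
  obtain Cc where Cc: "Cc > 0" "\<And>k \<rho> r. k \<ge> 0 \<Longrightarrow> 0 < \<rho> \<Longrightarrow> \<rho> < r \<Longrightarrow> r \<le> R \<Longrightarrow> \<Phi> k \<rho> \<le> Cc * S k r * (r - \<rho>) powr (- bexp)"
    using caccioppoli by blast
  obtain B where B: "B > 0" "\<And>h k r. \<lbrakk>0 \<le> h; h < k; k - h \<le> 1; r \<le> R; Y h r \<le> 1\<rbrakk> \<Longrightarrow>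
    S k r \<le> B * ((k - h) powr (- q) * Y h r powr (1 / \<gamma>'))"
    using S_bound by blast
  define M where "M = norm x0 + 2 * R + 1"
  have M: "M > 0" using R by (simp add: M_def add_nonneg_pos)
  have out: "x \<notin> ball x0 R" if "norm x > M" for x
    using that R norm_triangle_ineq2[of x x0] by (auto simp: M_def dist_norm norm_minus_commute)
  obtain Cs where Cs: "Cs > 0" "\<And>(v :: 'a \<Rightarrow> real) G A. \<lbrakk>wgrad v G; \<And>x. norm x > M \<Longrightarrow> v x = 0; \<And>x. norm x > M \<Longrightarrow> G x = 0;
      (\<integral>\<^sub>+x. norm (G x) powr p) \<le> ennreal A; A \<ge> 0\<rbrakk> \<Longrightarrow>
     (\<integral>\<^sub>+x. \<bar>v x\<bar> powr q) \<le> ennreal (Cs * A powr (q / p))"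
    using sobolev_q[OF M] by blast
  define C1 where "C1 = 2 powr p * (Cc * 2 powr bexp + (2 * L) powr p) * B"
  have C1: "C1 > 0" using L(1) Cc(1) B(1) by (auto simp: C1_def intro!: mult_pos_pos add_pos_pos)
  show ?thesis
  proof (rule that[of "Cs * C1 powr (q / p)"])
    show "Cs * C1 powr (q / p) > 0" using Cs(1) C1 by simp
    fix h k \<rho> r :: real assume hk: "0 \<le> h" "h < k" "k - h \<le> 1" and r: "0 < \<rho>" "\<rho> < r" "r \<le> R" and Y1: "Y h r \<le> 1"
    have kk: "0 \<le> k" using hk by simp
    define t where "t = r - \<rho>"
    have t: "0 < t" "t \<le> 1" using r R by (auto simp: t_def)
    define \<rho>' where "\<rho>' = (\<rho> + r) / 2"
    have \<rho>': "\<rho> < \<rho>'" "\<rho>' < r" "\<rho>' < R" "0 < \<rho>'" "r - \<rho>' = t / 2" "\<rho>' - \<rho> = t / 2" using r by (auto simp: \<rho>'_def t_def field_simps)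
    have Lt: "L / (\<rho>' - \<rho>) = 2 * L / t" by (simp add: \<rho>'(6))
    obtain \<eta> where \<eta>: "smooth \<eta>" "\<And>x. 0 \<le> \<eta> x" "\<And>x. \<eta> x \<le> 1" "\<And>x. x \<in> cball x0 \<rho> \<Longrightarrow> \<eta> x = 1" "\<And>x. x \<notin> ball x0 \<rho>' \<Longrightarrow> \<eta> x = 0"
      "\<And>x h. \<bar>dderiv \<eta> h x\<bar> \<le> 2 * L / t * norm h"
      using L(2)[OF r(1) \<rho>'(1), of x0] unfolding Lt cutoff_def by blast
    have outE: "\<forall>x. x \<notin> ball x0 \<rho>' \<longrightarrow> \<eta> x = 0" using \<eta>(5) by blast
    define A where "A = {x. u0 x > k}"
    define H where "H = (\<lambda>x. \<eta> x *\<^sub>R (indicator A x *\<^sub>R G0 x) + w k x *\<^sub>R sgrad \<eta> x)"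
    have comp: "wgrad (\<lambda>x. \<eta> x * w k x) H" "norm (sgrad \<eta> x) \<le> 2 * L / t" "x \<notin> ball x0 r \<Longrightarrow> sgrad \<eta> x = 0" for x
      using competitor[where k=k and \<eta>=\<eta> and \<rho>'=\<rho>' and c="2 * L / t" and m=1, OF kk \<eta>(1) _ _ \<rho>'(3) outE] \<eta>(2,3,6) \<rho>'(2)
      by (auto simp: H_def A_def)
    define e where "e = (\<lambda>x. indicator (ball x0 \<rho>') x * (indicator A x * norm (G0 x) powr p))"
    define g where "g = (\<lambda>x. indicator (ball x0 r) x * w k x powr p)"
    define cc where "cc = (2 * L / t) powr p"
    have ie: "integrable lborel e" and ig: "integrable lborel g"
      unfolding e_def g_def A_def using integrable_w[of _ k] \<rho>' r kk by auto
    have eg: "(LBINT x. e x) = \<Phi> k \<rho>'" "(LBINT x. g x) \<le> S k r" "0 \<le> (LBINT x. g x)"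
      using S_split[OF r(3) kk] by (auto simp: e_def g_def \<Phi>_def A_def)
    have Hb: "norm (H x) powr p \<le> 2 powr p * (e x + cc * g x)" for x
    proof (cases "x \<in> ball x0 r")
      case True
      have "norm (H x) \<le> indicator (ball x0 \<rho>') x * (indicator A x * norm (G0 x)) + w k x * (2 * L / t)"
        unfolding H_def
      proof (intro order_trans[OF norm_triangle_ineq] add_mono)
        show "norm (\<eta> x *\<^sub>R indicat_real A x *\<^sub>R G0 x) \<le> indicator (ball x0 \<rho>') x * (indicator A x * norm (G0 x))"
          using \<eta>(2,3,5)[of x] by (auto simp: indicator_def mult_left_le_one_le)
        show "norm (w k x *\<^sub>R sgrad \<eta> x) \<le> w k x * (2 * L / t)"
          using mult_left_mono[OF comp(2)[of x] w_nonneg[of k x]] w_nonneg[of k x] by simp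
      qed
      hence "norm (H x) powr p \<le> (indicator (ball x0 \<rho>') x * (indicator A x * norm (G0 x)) + w k x * (2 * L / t)) powr p"
        using p by (intro powr_mono2) auto
      also have "\<dots> \<le> 2 powr p * ((indicator (ball x0 \<rho>') x * (indicator A x * norm (G0 x))) powr p + (w k x * (2 * L / t)) powr p)"
        using p w_nonneg[of k x] L(1) t by (intro powr_add_le) auto
      also have "(indicator (ball x0 \<rho>') x * (indicator A x * norm (G0 x))) powr p = e x"
        by (auto simp: e_def indicator_def)
      also have "(w k x * (2 * L / t)) powr p = cc * g x" using True by (simp only: g_def cc_def powr_mult indicator_simps) simp
      finally show ?thesis .
    next
      case False
      have "\<eta> x = 0" using False \<rho>'(2) by (intro \<eta>(5)) auto
      hence "H x = 0" using comp(3)[OF False] by (simp add: H_def)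
      moreover have "0 \<le> e x" "0 \<le> g x" "0 \<le> cc" by (auto simp: e_def g_def cc_def)
      ultimately show ?thesis by simp
    qed
    define Z where "Z = t powr (- bexp) * ((k - h) powr (- q) * Y h r powr (1 / \<gamma>'))"
    have Z: "Z \<ge> 0" by (simp add: Z_def)
    have SZ: "t powr (- bexp) * S k r \<le> B * Z"
      using mult_left_mono[OF B(2)[OF hk r(3) Y1], of "t powr (- bexp)"] by (simp add: Z_def mult_ac)
    have "(\<integral>\<^sub>+x. norm (H x) powr p) \<le> (\<integral>\<^sub>+x. 2 powr p * (e x + cc * g x))"
      by (intro nn_integral_mono ennreal_leI Hb)
    also have "\<dots> = ennreal (LBINT x. 2 powr p * (e x + cc * g x))"
    proof (rule nn_integral_eq_integral)
      show "integrable lborel (\<lambda>x. 2 powr p * (e x + cc * g x))" using ie ig by simp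
      show "AE x in lborel. 0 \<le> 2 powr p * (e x + cc * g x)" by (intro AE_I2) (auto simp: e_def g_def cc_def)
    qed
    also have "(LBINT x. 2 powr p * (e x + cc * g x)) = 2 powr p * (\<Phi> k \<rho>' + cc * (LBINT x. g x))"
      using ie ig by (simp add: eg(1))
    also have "ennreal \<dots> \<le> ennreal (C1 * Z)"
    proof (rule ennreal_leI)
      have "\<Phi> k \<rho>' \<le> Cc * S k r * (t / 2) powr (- bexp)" using Cc(2)[OF kk \<rho>'(4,2) r(3)] by (simp add: \<rho>'(5))
      also have "(t / 2) powr (- bexp) = t powr (- bexp) * 2 powr bexp"
        unfolding powr_divide powr_minus_divide[of 2] by simp
      also have "Cc * S k r * (t powr (- bexp) * 2 powr bexp) = Cc * 2 powr bexp * (t powr (- bexp) * S k r)" by (simp only: mult_ac)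
      also have "\<dots> \<le> Cc * 2 powr bexp * (B * Z)" using Cc(1) SZ by (intro mult_left_mono) auto
      finally have 1: "\<Phi> k \<rho>' \<le> Cc * 2 powr bexp * (B * Z)" .
      have tp: "t powr (- p) \<le> t powr (- bexp)" using t bexp by (intro powr_mono') auto
      have "cc = (2 * L) powr p * t powr (- p)" unfolding cc_def powr_divide powr_minus_divide[of t] by simp
      hence "cc * (LBINT x. g x) = (2 * L) powr p * (t powr (- p) * (LBINT x. g x))" by simp
      also have "\<dots> \<le> (2 * L) powr p * (t powr (- bexp) * S k r)"
        using tp eg by (intro mult_left_mono mult_mono) auto
      also have "\<dots> \<le> (2 * L) powr p * (B * Z)" using SZ by (intro mult_left_mono) auto
      finally have 2: "cc * (LBINT x. g x) \<le> (2 * L) powr p * (B * Z)" .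
      have "2 powr p * (\<Phi> k \<rho>' + cc * (LBINT x. g x)) \<le> 2 powr p * (Cc * 2 powr bexp * (B * Z) + (2 * L) powr p * (B * Z))"
        by (intro mult_left_mono add_mono 1 2) auto
      also have "\<dots> = C1 * Z" unfolding C1_def distrib_left distrib_right by (simp only: mult_ac)
      finally show "2 powr p * (\<Phi> k \<rho>' + cc * (LBINT x. g x)) \<le> C1 * Z" .
    qed
    finally have HA: "(\<integral>\<^sub>+x. norm (H x) powr p) \<le> ennreal (C1 * Z)" .
    have z: "\<eta> x * w k x = 0" "H x = 0" if "norm x > M" for x
    proof -
      have "x \<notin> ball x0 \<rho>'" "x \<notin> ball x0 r" using out[OF that] \<rho>'(3) r(3) by auto
      thus "\<eta> x * w k x = 0" "H x = 0" using \<eta>(5)[of x] comp(3)[of x] by (auto simp: H_def)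
    qed
    have "ennreal (Y k \<rho>) = (\<integral>\<^sub>+x. indicator (ball x0 \<rho>) x * w k x powr q)"
      using nn_integral_eq_Y[of \<rho> k] r kk by simp
    also have "\<dots> \<le> (\<integral>\<^sub>+x. \<bar>\<eta> x * w k x\<bar> powr q)"
      using \<eta>(4) w_nonneg by (intro nn_integral_mono ennreal_leI) (auto simp: indicator_def)
    also have "\<dots> \<le> ennreal (Cs * (C1 * Z) powr (q / p))"
      by (rule Cs(2)[OF comp(1) z(1) z(2) HA]) (use C1 Z in auto)
    finally have "Y k \<rho> \<le> Cs * (C1 * Z) powr (q / p)" using Cs(1) by (subst (asm) ennreal_le_iff) auto
    also have "\<dots> = Cs * C1 powr (q / p) * Z powr (q / p)" by (simp only: powr_mult mult.assoc)
    finally show "Y k \<rho> \<le> Cs * C1 powr (q / p) * ((r - \<rho>) powr (- bexp) * ((k - h) powr (- q) * Y h r powr (1 / \<gamma>'))) powr (q / p)"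
      by (simp only: Z_def t_def)
  qed
qed

text \<open>The initial smallness in the iteration is obtained by raising the level on the full
  ball.\<close>

lemma Y_tendsto_0: "(\<lambda>n. Y (real n) R) \<longlonglongrightarrow> 0"
proof -
  have "(\<lambda>n. \<integral>x. indicator (ball x0 R) x * w (real n) x powr q \<partial>lborel) \<longlonglongrightarrow> (\<integral>x. 0 \<partial>(lborel :: 'a measure))"
  proof (rule integral_dominated_convergence[where w="\<lambda>x. indicator (cball x0 R) x * \<bar>u0 x\<bar> powr q"])
    show "integrable lborel (\<lambda>x. indicator (cball x0 R) x * \<bar>u0 x\<bar> powr q)" by (rule u0_Lq[OF R(1) ball_\<Omega>])
    show "(\<lambda>x. indicator (ball x0 R) x * w (real n) x powr q) \<in> borel_measurable lborel" for n
      by (intro borel_measurable_times powr_real_measurable borel_measurable_indicator borel_measurable_const) auto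
    show "AE x in lborel. norm (indicator (ball x0 R) x * w (real n) x powr q) \<le> indicator (cball x0 R) x * \<bar>u0 x\<bar> powr q" for n
      using w_le[of "real n"] w_nonneg q by (intro AE_I2) (auto simp: indicator_def intro!: powr_mono2)
    show "AE x in lborel. (\<lambda>n. indicator (ball x0 R) x * w (real n) x powr q) \<longlonglongrightarrow> 0"
    proof (rule AE_I2)
      fix x
      have "\<forall>\<^sub>F n in sequentially. indicator (ball x0 R) x * w (real n) x powr q = 0"
        using eventually_ge_at_top[of "nat \<lceil>u0 x\<rceil>"]
      proof eventually_elim
        case (elim n)
        hence "u0 x \<le> real n" by linarith
        thus ?case by (simp add: w_def)
      qed
      thus "(\<lambda>n. indicator (ball x0 R) x * w (real n) x powr q) \<longlonglongrightarrow> 0" by (rule tendsto_eventually)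
    qed
  qed simp
  thus ?thesis by (simp add: Y_def)
qed

lemma bounded_above_ball:
  obtains C where "AE x in lborel. x \<in> ball x0 (R / 2) \<longrightarrow> u0 x \<le> C"
proof -
  obtain C where C: "C > 0" "\<And>h k \<rho> r. \<lbrakk>0 \<le> h; h < k; k - h \<le> 1; 0 < \<rho>; \<rho> < r; r \<le> R; Y h r \<le> 1\<rbrakk> \<Longrightarrow>
    Y k \<rho> \<le> C * ((r - \<rho>) powr (- bexp) * ((k - h) powr (- q) * Y h r powr (1 / \<gamma>'))) powr (q / p)"
    using de_giorgi_step by blast
  \<comment> \<open>One step raises Y to the power q/(p \<gamma>') = 1 + \<delta>; positivity of
    \<delta> is the condition \<gamma>' < q/p.\<close>
  define \<delta> where "\<delta> = q / p / \<gamma>' - 1"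
  have \<delta>: "\<delta> > 0" using \<gamma>' by (simp add: \<delta>_def pos_less_divide_eq mult.commute)
  define c where "c = C * ((R / 4) powr (- bexp) * (1 / 2) powr (- q)) powr (q / p)"
  define b :: real where "b = ((1 / 2) powr (- bexp) * (1 / 2) powr (- q)) powr (q / p)"
  have c: "c > 0" using C(1) R by (simp add: c_def)
  have b: "b > 1"
  proof -
    have "(1 / 2 :: real) powr (- bexp) * (1 / 2) powr (- q) = 2 powr (bexp + q)"
      by (simp add: powr_minus powr_divide powr_add)
    moreover have "(1::real) < 2 powr (bexp + q)" using bexp q by (intro gr_one_powr) auto
    ultimately show ?thesis using q p bexp(1) unfolding b_def by (simp only:) (intro gr_one_powr, auto)
  qed
  obtain \<epsilon> where \<epsilon>: "\<epsilon> > 0" "\<epsilon> \<le> 1" "\<And>y. \<lbrakk>\<And>n. y n \<ge> 0; y 0 \<le> \<epsilon>; \<And>n. y n \<le> 1 \<Longrightarrow> y (Suc n) \<le> c * b ^ n * y n powr (1 + \<delta>)\<rbrakk> \<Longrightarrow> y \<longlonglongrightarrow> 0"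
    using fast_geometric_convergence[OF c b \<delta>] by blast
  have "\<forall>\<^sub>F n in sequentially. Y (real n) R < \<epsilon>" using order_tendstoD(2)[OF Y_tendsto_0 \<epsilon>(1)] .
  then obtain n0 where n0: "Y (real n0) R < \<epsilon>" by (auto simp: eventually_sequentially)
  define K where "K = real n0"
  \<comment> \<open>Levels rise from K to K + 1 and radii shrink from R to R/2, both geometrically.
    A level gap is at most one and enters the recursion only through powers of 1/2, which produce
    the base b.\<close>
  define \<kappa> where "\<kappa> = (\<lambda>j. K + 1 - (1 / 2) ^ j)"
  define r where "r = (\<lambda>j. R / 2 * (1 + (1 / 2) ^ j))"
  have \<kappa>: "0 \<le> \<kappa> j" "\<kappa> (Suc j) - \<kappa> j = 1 / 2 * (1 / 2) ^ j" "\<kappa> j \<le> K + 1" for j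
    using power_le_one[of "1 / 2 :: real" j] by (auto simp: \<kappa>_def K_def)
  have r: "0 < r j" "r j \<le> R" "r j - r (Suc j) = R / 4 * (1 / 2) ^ j" "R / 2 \<le> r j" for j
    using R(1) power_le_one[of "1 / 2 :: real" j] zero_le_power[of "1 / 2 :: real" j]
    by (auto simp: r_def field_simps add_pos_nonneg)
  have lim: "(\<lambda>j. Y (\<kappa> j) (r j)) \<longlonglongrightarrow> 0"
  proof (rule \<epsilon>(3))
    show "Y (\<kappa> j) (r j) \<ge> 0" for j by (rule Y_nonneg)
    show "Y (\<kappa> 0) (r 0) \<le> \<epsilon>" using n0 by (simp add: \<kappa>_def r_def K_def)
    fix j assume Y1: "Y (\<kappa> j) (r j) \<le> 1"
    have h2: "(0::real) < (1 / 2) ^ j" "(1 / 2) ^ j \<le> (1::real)" by (auto simp: power_le_one)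
    have d: "\<kappa> j < \<kappa> (Suc j)" "\<kappa> (Suc j) - \<kappa> j \<le> 1" using \<kappa>(2)[of j] h2 by linarith+
    have dr: "r (Suc j) < r j" using r(3)[of j] h2 R(1) mult_pos_pos[of "R / 4" "(1 / 2) ^ j"] by linarith
    have "Y (\<kappa> (Suc j)) (r (Suc j)) \<le> C * ((R / 4 * (1 / 2) ^ j) powr (- bexp) * ((1 / 2 * (1 / 2) ^ j) powr (- q) * Y (\<kappa> j) (r j) powr (1 / \<gamma>'))) powr (q / p)"
      using C(2)[OF \<kappa>(1) d r(1) dr r(2) Y1] unfolding \<kappa>(2) r(3) .
    also have "\<dots> = c * b ^ j * Y (\<kappa> j) (r j) powr (1 / \<gamma>' * (q / p))"
      unfolding powr_mult power_powr powr_powr c_def b_def power_mult_distrib by (simp only: mult_ac)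
    also have "1 / \<gamma>' * (q / p) = 1 + \<delta>" by (simp add: \<delta>_def)
    finally show "Y (\<kappa> (Suc j)) (r (Suc j)) \<le> c * b ^ j * Y (\<kappa> j) (r j) powr (1 + \<delta>)" .
  qed
  \<comment> \<open>Every stage dominates the quantity at the limiting level and radius, which must
    therefore vanish.\<close>
  have le: "Y (K + 1) (R / 2) \<le> Y (\<kappa> j) (r j)" for j
    unfolding Y_def
  proof (rule integral_mono)
    show "integrable lborel (\<lambda>x. indicator (ball x0 (R / 2)) x * w (K + 1) x powr q)"
      "integrable lborel (\<lambda>x. indicator (ball x0 (r j)) x * w (\<kappa> j) x powr q)"
      using R r(2) \<kappa>(1) by (auto intro!: integrable_w simp: K_def)
    fix x
    have "w (K + 1) x powr q \<le> w (\<kappa> j) x powr q" using \<kappa>(3)[of j] q by (intro powr_mono2) (auto simp: w_def)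
    thus "indicator (ball x0 (R / 2)) x * w (K + 1) x powr q \<le> indicator (ball x0 (r j)) x * w (\<kappa> j) x powr q"
      using r(4)[of j] by (auto simp: indicator_def)
  qed
  have "Y (K + 1) (R / 2) \<le> 0" by (rule LIMSEQ_le_const[OF lim]) (use le in blast)
  hence "Y (K + 1) (R / 2) = 0" using Y_nonneg[of "K + 1" "R / 2"] by simp
  moreover have "integrable lborel (\<lambda>x. indicator (ball x0 (R / 2)) x * w (K + 1) x powr q)"
    using R by (intro integrable_w) (auto simp: K_def)
  ultimately have "AE x in lborel. indicator (ball x0 (R / 2)) x * w (K + 1) x powr q = 0"
    unfolding Y_def by (subst (asm) integral_nonneg_eq_0_iff_AE) auto
  hence "AE x in lborel. x \<in> ball x0 (R / 2) \<longrightarrow> u0 x \<le> K + 1"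
    by eventually_elim (auto simp: w_def max_def split: if_splits)
  thus ?thesis by (rule that)
qed

end

section \<open>Local boundedness\<close>

lemma is_weak_gradient_unique:
  assumes U: "open U" and G: "is_weak_gradient U v G" and H: "is_weak_gradient U v H"
  shows "AE x in lebesgue_on U. G x = H x"
proof -
  have Ub: "U \<in> sets borel" using U by simp
  have m: "v \<in> borel_measurable (lebesgue_on U)" "G \<in> borel_measurable (lebesgue_on U)" "H \<in> borel_measurable (lebesgue_on U)"
    using G H by (auto simp: is_weak_gradient_def Lspace_loc_def)
  obtain v' where v': "v' \<in> borel_measurable borel" "AE x\<in>U in lborel. v x = v' x" by (rule borel_representative[OF Ub m(1)])
  obtain G' where G': "G' \<in> borel_measurable borel" "AE x\<in>U in lborel. G x = G' x" by (rule borel_representative_vector[OF Ub m(2)])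
  obtain H' where H': "H' \<in> borel_measurable borel" "AE x\<in>U in lborel. H x = H' x" by (rule borel_representative_vector[OF Ub m(3)])
  have "AE x\<in>U in lborel. G' x = H' x"
    by (rule lwgrad_unique[OF U lwgrad_of_is_weak_gradient[OF U G v' G'] lwgrad_of_is_weak_gradient[OF U H v' H']])
  hence "AE x\<in>U in lborel. G x = H x" using G'(2) H'(2) by eventually_elim auto
  thus ?thesis unfolding AE_lebesgue_on_iff[OF Ub] .
qed

lemma weak_gradient_works: "weakly_differentiable_on v U \<Longrightarrow> is_weak_gradient U v (weak_gradient U v)"
  using someI_ex[of "is_weak_gradient U v"] by (simp add: weakly_differentiable_on_def weak_gradient_def)

lemma Lspace_loc_uminus: "g \<in> Lspace_loc r U \<Longrightarrow> (\<lambda>x. - g x) \<in> Lspace_loc r U"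
  by (auto simp: Lspace_loc_def Lspace_def)

lemma is_weak_gradient_uminus:
  assumes "is_weak_gradient U v G" shows "is_weak_gradient U (\<lambda>x. - v x) (\<lambda>x. - G x)"
  using assms by (auto simp: is_weak_gradient_def Lspace_loc_uminus)

text \<open>Completeness of Lebesgue measure. It is needed because the chosen weak gradient of -v
  equals minus that of v only almost everywhere.\<close>

lemma lebesgue_on_measurable_AE:
  fixes h g :: "'a::euclidean_space \<Rightarrow> real"
  assumes U: "U \<in> sets borel" and h: "h \<in> borel_measurable (lebesgue_on U)" and AE: "AE x in lebesgue_on U. h x = g x"
  shows "g \<in> borel_measurable (lebesgue_on U)"
proof -
  have U': "U \<inter> space lebesgue \<in> sets lebesgue" using U by simp
  have "AE x in lebesgue. indicator U x *\<^sub>R h x = indicator U x *\<^sub>R g x"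
    using AE unfolding AE_lebesgue_on_iff[OF U] AE_lebesgue_iff by eventually_elim (auto simp: indicator_def)
  from borel_measurable_AE[OF _ this] show ?thesis
    using h unfolding borel_measurable_restrict_space_iff[OF U'] by blast
qed

text \<open>The weak gradients of v and -v are chosen independently, so the local integrands agree
  only almost everywhere, by uniqueness; the nonlocal integrands coincide identically.\<close>

lemma energy_uminus:
  assumes U: "open U"
  shows "energy (\<lambda>x \<xi>. F x (- \<xi>)) (\<lambda>x. - f x) K q U (\<lambda>x. - v x) = energy F f K q U v"
proof (cases "weakly_differentiable_on v U")
  case True
  note wv = weak_gradient_works[OF True]
  have Ub: "U \<in> sets borel" using U by simp
  have True': "weakly_differentiable_on (\<lambda>x. - v x) U"
    using is_weak_gradient_uminus[OF wv] by (auto simp: weakly_differentiable_on_def)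
  let ?h = "local_integrand F f U v" and ?g = "local_integrand (\<lambda>x \<xi>. F x (- \<xi>)) (\<lambda>x. - f x) U (\<lambda>x. - v x)"
  have "AE x in lebesgue_on U. weak_gradient U (\<lambda>x. - v x) x = - weak_gradient U v x"
    by (rule is_weak_gradient_unique[OF U weak_gradient_works[OF True'] is_weak_gradient_uminus[OF wv]])
  hence AE: "AE x in lebesgue_on U. ?h x = ?g x"
    by eventually_elim (simp add: local_integrand_def)
  hence AE': "AE x in lebesgue_on U. ?g x = ?h x" by eventually_elim simp
  have "integrable (lebesgue_on U) ?h \<longleftrightarrow> integrable (lebesgue_on U) ?g"
  proof
    assume "integrable (lebesgue_on U) ?h"
    from this borel_measurable_integrable[OF this] show "integrable (lebesgue_on U) ?g"
      using integrable_cong_AE[OF _ lebesgue_on_measurable_AE[OF Ub _ AE] AE] by blast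
  next
    assume "integrable (lebesgue_on U) ?g"
    from this borel_measurable_integrable[OF this] show "integrable (lebesgue_on U) ?h"
      using integrable_cong_AE[OF _ lebesgue_on_measurable_AE[OF Ub _ AE'] AE'] by blast
  qed
  moreover have "(\<integral>x. ?h x \<partial>lebesgue_on U) = (\<integral>x. ?g x \<partial>lebesgue_on U)" if "integrable (lebesgue_on U) ?h"
    by (rule integral_cong_AE[OF borel_measurable_integrable[OF that] lebesgue_on_measurable_AE[OF Ub borel_measurable_integrable[OF that] AE] AE])
  moreover have "nonlocal_integrand K q (\<lambda>x. - v x) = nonlocal_integrand K q v"
    by (auto simp: nonlocal_integrand_def fun_eq_iff abs_minus_commute)
  ultimately show ?thesis using True True' by (auto simp: energy_def)
next
  case False
  have "\<not> weakly_differentiable_on (\<lambda>x. - v x) U"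
  proof
    assume "weakly_differentiable_on (\<lambda>x. - v x) U"
    then obtain G where "is_weak_gradient U (\<lambda>x. - v x) G" by (auto simp: weakly_differentiable_on_def)
    from is_weak_gradient_uminus[OF this] show False using False by (auto simp: weakly_differentiable_on_def)
  qed
  thus ?thesis using False by (simp add: energy_def)
qed

lemma minimizer_uminus:
  assumes U: "open U" and m: "minimizer F f K p q U u"
  shows "minimizer (\<lambda>x \<xi>. F x (- \<xi>)) (\<lambda>x. - f x) K p q U (\<lambda>x. - u x)"
  unfolding minimizer_def
proof (intro conjI ballI impI)
  show "(\<lambda>x. - u x) \<in> admissible (\<lambda>x \<xi>. F x (- \<xi>)) (\<lambda>x. - f x) K p q U"
    using m by (auto simp: minimizer_def admissible_def Lspace_def energy_uminus[OF U])
  fix v assume v: "v \<in> borel_measurable lebesgue" "AE x in lebesgue_on (- U). v x = - u x"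
  have "AE x in lebesgue_on (- U). - v x = u x" using v(2) by eventually_elim simp
  hence "energy F f K q U u \<le> energy F f K q U (\<lambda>x. - v x)" using m v(1) by (auto simp: minimizer_def)
  also have "\<dots> = energy (\<lambda>x \<xi>. F x (- \<xi>)) (\<lambda>x. - f x) K q U v"
    using energy_uminus[OF U, of F f K q "\<lambda>x. - v x"] by simp
  finally show "energy (\<lambda>x \<xi>. F x (- \<xi>)) (\<lambda>x. - f x) K q U (\<lambda>x. - u x) \<le> energy (\<lambda>x \<xi>. F x (- \<xi>)) (\<lambda>x. - f x) K q U v"
    by (simp add: energy_uminus[OF U])
qed

lemma lebesgue_borel_representative:
  fixes h :: "'a::euclidean_space \<Rightarrow> real"
  assumes "h \<in> borel_measurable lebesgue"
  obtains h0 where "h0 \<in> borel_measurable borel" "AE x in lborel. h x = h0 x"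
  using completion_ex_borel_measurable_real[OF assms] by auto

context nonlocal_problem
begin

lemma representative:
  obtains u0 G0 f0 a0 where "nonlocal_problem_rep \<Omega> F a f u s p q \<gamma> \<Lambda> u0 G0 f0 a0"
proof -
  have \<Omega>b: "\<Omega> \<in> sets borel" using open_\<Omega> by simp
  have um: "u \<in> borel_measurable lebesgue" and wd: "weakly_differentiable_on u \<Omega>"
    using min by (auto simp: minimizer_def admissible_def energy_def split: if_splits)
  obtain u0 where u0: "u0 \<in> borel_measurable borel" "AE x in lborel. u x = u0 x" by (rule lebesgue_borel_representative[OF um])
  have u0': "AE x\<in>\<Omega> in lborel. u x = u0 x" using u0(2) by eventually_elim simp
  note wg = weak_gradient_works[OF wd]
  have "weak_gradient \<Omega> u \<in> borel_measurable (lebesgue_on \<Omega>)" using wg by (auto simp: is_weak_gradient_def Lspace_loc_def)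
  then obtain G0 where G0: "G0 \<in> borel_measurable borel" "AE x\<in>\<Omega> in lborel. weak_gradient \<Omega> u x = G0 x"
    by (rule borel_representative_vector[OF \<Omega>b])
  have "f \<in> borel_measurable (lebesgue_on \<Omega>)" using f_loc by (simp add: Lspace_loc_def)
  then obtain f0 where f0: "f0 \<in> borel_measurable borel" "AE x\<in>\<Omega> in lborel. f x = f0 x"
    by (rule borel_representative[OF \<Omega>b])
  obtain a1 where a1: "a1 \<in> borel_measurable borel" "AE z in lborel. case_prod a z = a1 z"
    by (rule lebesgue_borel_representative[OF a_measurable])
  \<comment> \<open>Absolute value and symmetrisation repair a Borel representative on the null set
    where nonnegativity or symmetry could fail, without changing it elsewhere up to null
    sets.\<close>
  define a0 where "a0 = (\<lambda>z. (\<bar>a1 z\<bar> + \<bar>a1 (snd z, fst z)\<bar>) / 2)"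
  have sw: "(\<lambda>z::'a \<times> 'a. (snd z, fst z)) \<in> borel_measurable borel" by (intro borel_measurable_continuous_onI continuous_intros)
  show ?thesis
  proof (rule that, unfold_locales)
    show "AE x in lborel. u x = u0 x" by (rule u0)
    show "lwgrad \<Omega> u0 G0" by (rule lwgrad_of_is_weak_gradient[OF open_\<Omega> wg u0(1) u0' G0])
    show "AE x\<in>\<Omega> in lborel. weak_gradient \<Omega> u x = G0 x" by (rule G0)
    show "f0 \<in> borel_measurable borel" "AE x\<in>\<Omega> in lborel. f x = f0 x" by (rule f0)+
    show "a0 \<in> borel_measurable borel" unfolding a0_def
      by (intro borel_measurable_divide borel_measurable_add borel_measurable_abs a1(1) measurable_compose[OF sw a1(1)] borel_measurable_const)
    show "AE z in lborel. case_prod a z = a0 z"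
      using a1(2) AE_lborel_swap[OF a1(2)]
    proof eventually_elim
      case (elim z)
      have "a1 z = a (fst z) (snd z)" "a1 (snd z, fst z) = a (fst z) (snd z)"
        using elim a_sym[of "fst z" "snd z"] by (auto simp: case_prod_unfold)
      thus ?case using a_nonneg by (simp add: a0_def case_prod_unfold)
    qed
    show "a0 z \<ge> 0" for z by (simp add: a0_def)
    show "a0 (x, y) = a0 (y, x)" for x y by (simp add: a0_def)
  qed
qed

lemma locally_bounded_above:
  assumes "x0 \<in> \<Omega>"
  obtains r C where "r > 0" "AE x in lborel. x \<in> ball x0 r \<longrightarrow> u x \<le> C"
proof -
  obtain e where e: "e > 0" "cball x0 e \<subseteq> \<Omega>" using open_\<Omega> assms by (auto simp: open_contains_cball)
  define R where "R = min 1 (e / 2)"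
  have R: "0 < R" "R \<le> 1" "2 * R \<le> e" using e by (auto simp: R_def)
  obtain u0 G0 f0 a0 where rep: "nonlocal_problem_rep \<Omega> F a f u s p q \<gamma> \<Lambda> u0 G0 f0 a0" by (rule representative)
  interpret nonlocal_problem_rep \<Omega> F a f u s p q \<gamma> \<Lambda> u0 G0 f0 a0 by (rule rep)
  interpret nonlocal_problem_ball \<Omega> F a f u s p q \<gamma> \<Lambda> u0 G0 f0 a0 x0 R
    by unfold_locales (use R e in auto)
  obtain C where "AE x in lborel. x \<in> ball x0 (R / 2) \<longrightarrow> u0 x \<le> C" by (rule bounded_above_ball)
  hence "AE x in lborel. x \<in> ball x0 (R / 2) \<longrightarrow> u x \<le> C" using u0_AE by eventually_elim simp
  thus ?thesis using R by (intro that[of "R / 2" C]) auto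
qed

lemma nonlocal_problem_uminus: "nonlocal_problem \<Omega> (\<lambda>x \<xi>. F x (- \<xi>)) a (\<lambda>x. - f x) (\<lambda>x. - u x) s p q \<gamma> \<Lambda>"
proof unfold_locales
  show "caratheodory \<Omega> (\<lambda>x \<xi>. F x (- \<xi>))"
    unfolding caratheodory_def
  proof (intro conjI allI)
    show "(\<lambda>x. F x (- \<xi>)) \<in> borel_measurable (lebesgue_on \<Omega>)" for \<xi> using caratheodory by (simp add: caratheodory_def)
    have "AE x in lebesgue_on \<Omega>. continuous_on UNIV (F x)" using caratheodory by (simp add: caratheodory_def)
    thus "AE x in lebesgue_on \<Omega>. continuous_on UNIV (\<lambda>\<xi>. F x (- \<xi>))"
      by eventually_elim (erule continuous_on_compose2, auto intro: continuous_intros)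
  qed
  show "AE x in lebesgue_on \<Omega>. \<forall>\<xi>. inverse \<Lambda> * norm \<xi> powr p \<le> F x (- \<xi>) \<and> F x (- \<xi>) \<le> \<Lambda> * norm \<xi> powr p"
    using growth by eventually_elim (metis norm_minus_cancel)
  show "(\<lambda>x. - f x) \<in> Lspace_loc \<gamma> \<Omega>" by (rule Lspace_loc_uminus[OF f_loc])
  show "minimizer (\<lambda>x \<xi>. F x (- \<xi>)) (\<lambda>x. - f x) (nonlocal_kernel a s q) p q \<Omega> (\<lambda>x. - u x)"
    by (rule minimizer_uminus[OF open_\<Omega> min])
  show "(\<lambda>x. - u x) \<in> weighted_tail_space a s q \<Omega>"
    using tail by (auto simp: weighted_tail_space_def Lspace_loc_uminus)
qed (use dim open_\<Omega> s p pN \<Lambda> a_measurable a_nonneg a_sym a_loc qp \<gamma>1 \<gamma>2 in auto)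

lemma locally_bounded:
  assumes "x0 \<in> \<Omega>"
  obtains r C where "r > 0" "AE x in lborel. x \<in> ball x0 r \<longrightarrow> \<bar>u x\<bar> \<le> C"
proof -
  obtain r1 C1 where 1: "r1 > 0" "AE x in lborel. x \<in> ball x0 r1 \<longrightarrow> u x \<le> C1"
    by (rule locally_bounded_above[OF assms])
  obtain r2 C2 where 2: "r2 > 0" "AE x in lborel. x \<in> ball x0 r2 \<longrightarrow> - u x \<le> C2"
    by (rule nonlocal_problem.locally_bounded_above[OF nonlocal_problem_uminus assms])
  have "AE x in lborel. x \<in> ball x0 (min r1 r2) \<longrightarrow> \<bar>u x\<bar> \<le> max C1 C2"
    using 1(2) 2(2) by eventually_elim auto
  thus ?thesis using 1(1) 2(1) by (intro that[of "min r1 r2"]) auto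
qed

end

text \<open>
  For \<open>p > N\<close> the composition \<open>\<phi> u\<close> with \<open>\<phi> t = (1 + t\<^sup>2) powr (\<beta> / 2) - 1\<close>,
  \<open>\<beta> = 1 - 1 / p\<close>, lies in \<open>W\<close> with exponent \<open>p\<close>: \<open>\<bar>\<phi>' t\<bar> powr p \<le> (1 + t\<^sup>2) powr (- 1 / 2)\<close> compensates the
  growth of \<open>f u\<close>, which is only known to be integrable together with \<open>F (Du)\<close>.
\<close>

lemma supercritical_locally_bounded:
  fixes \<Omega> :: "'a::euclidean_space set" and u :: "'a \<Rightarrow> real" and p \<Lambda> :: real
  assumes \<Omega>: "open \<Omega>" and p: "1 < p" "p > DIM('a)" and F: "caratheodory \<Omega> F" and \<Lambda>: "\<Lambda> > 1"
    and growth: "AE x in lebesgue_on \<Omega>. \<forall>\<xi>. inverse \<Lambda> * norm \<xi> powr p \<le> F x \<xi> \<and> F x \<xi> \<le> \<Lambda> * norm \<xi> powr p"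
    and f: "f \<in> Lspace_loc 1 \<Omega>" and u: "u \<in> borel_measurable lebesgue" "u \<in> Lspace p \<Omega>"
    and wd: "weakly_differentiable_on u \<Omega>" and int: "integrable (lebesgue_on \<Omega>) (local_integrand F f \<Omega> u)"
    and x0: "x0 \<in> \<Omega>"
  obtains r C where "r > 0" "AE x in lborel. x \<in> ball x0 r \<longrightarrow> \<bar>u x\<bar> \<le> C"
proof -
  have \<Omega>b [measurable]: "\<Omega> \<in> sets borel" using \<Omega> by simp
  obtain u0 where u0: "u0 \<in> borel_measurable borel" "AE x in lborel. u x = u0 x" by (rule lebesgue_borel_representative[OF u(1)])
  have u0': "AE x\<in>\<Omega> in lborel. u x = u0 x" using u0(2) by eventually_elim simp
  note wg = weak_gradient_works[OF wd]
  have "weak_gradient \<Omega> u \<in> borel_measurable (lebesgue_on \<Omega>)" using wg by (auto simp: is_weak_gradient_def Lspace_loc_def)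
  then obtain G0 where G0: "G0 \<in> borel_measurable borel" "AE x\<in>\<Omega> in lborel. weak_gradient \<Omega> u x = G0 x"
    by (rule borel_representative_vector[OF \<Omega>b])
  have "f \<in> borel_measurable (lebesgue_on \<Omega>)" using f by (simp add: Lspace_loc_def)
  then obtain f0 where f0: "f0 \<in> borel_measurable borel" "AE x\<in>\<Omega> in lborel. f x = f0 x"
    by (rule borel_representative[OF \<Omega>b])
  obtain l where l: "l \<in> borel_measurable borel" "AE x\<in>\<Omega> in lborel. local_integrand F f \<Omega> u x = l x"
    using borel_representative[OF \<Omega>b borel_measurable_integrable[OF int]] by blast
  have il: "integrable lborel (\<lambda>x. indicator \<Omega> x *\<^sub>R l x)"
    using lebesgue_on_borel(1)[OF \<Omega>b borel_measurable_integrable[OF int] l] int by simp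
  note [measurable] = u0(1) G0(1) f0(1)
  have lw: "lwgrad \<Omega> u0 G0" by (rule lwgrad_of_is_weak_gradient[OF \<Omega> wg u0(1) u0' G0])
  obtain e where e: "e > 0" "cball x0 e \<subseteq> \<Omega>" using \<Omega> x0 by (auto simp: open_contains_cball)
  define K where "K = cball x0 e"
  obtain \<kappa> c where \<kappa>t: "\<kappa> \<in> test_functions \<Omega>" and \<kappa>: "\<And>x. 0 \<le> \<kappa> x" "\<And>x. \<kappa> x \<le> 1" "\<And>x. x \<in> cball x0 (e / 2) \<Longrightarrow> \<kappa> x = 1"
    and \<kappa>z: "\<And>x. x \<notin> K \<Longrightarrow> \<kappa> x = 0" "\<And>x. x \<notin> K \<Longrightarrow> sgrad \<kappa> x = 0" and c: "c \<ge> 0" "\<And>x. norm (sgrad \<kappa> x) \<le> c"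
    using test_cutoff[of "e / 2" e x0 \<Omega>] e unfolding K_def by auto
  \<comment> \<open>The cut-off is applied before the nonlinear function, so that
    \<open>wgrad_chain\<close> acts on a globally integrable function.\<close>
  define z where "z = (\<lambda>x. \<kappa> x * u0 x)"
  define Z where "Z = (\<lambda>x. \<kappa> x *\<^sub>R G0 x + u0 x *\<^sub>R sgrad \<kappa> x)"
  have wz: "wgrad z Z" unfolding z_def Z_def by (rule lwgrad_cutoff[OF lw \<kappa>t])
  \<comment> \<open>Chosen so that (\<beta>-1) p = -1: the p-th power of \<phi>' then decays like
    1/|t|.\<close>
  define \<beta> where "\<beta> = 1 - 1 / p"
  have \<beta>: "0 < \<beta>" "\<beta> < 1" "(\<beta> - 1) * p = - 1" using p(1) by (auto simp: \<beta>_def field_simps)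
  define \<phi> where "\<phi> = (\<lambda>t::real. (1 + t\<^sup>2) powr (\<beta> / 2) - 1)"
  define \<phi>' where "\<phi>' = (\<lambda>t::real. \<beta> * t * (1 + t\<^sup>2) powr (\<beta> / 2 - 1))"
  have pos: "1 + t\<^sup>2 > 0" "1 + t\<^sup>2 \<ge> 1" for t :: real using zero_le_power2[of t] by linarith+
  have der: "(\<phi> has_real_derivative \<phi>' t) (at t)" for t
  proof -
    have "((\<lambda>t. 1 + t\<^sup>2) has_real_derivative 2 * t) (at t)" by (auto intro!: derivative_eq_intros)
    from DERIV_chain2[OF has_real_derivative_powr[OF pos(1)[of t], of "\<beta> / 2"] this]
    have "((\<lambda>t. (1 + t\<^sup>2) powr (\<beta> / 2)) has_real_derivative \<phi>' t) (at t)" by (simp add: \<phi>'_def mult_ac)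
    from DERIV_diff[OF this DERIV_const[of 1]] show ?thesis by (simp add: \<phi>_def)
  qed
  have cont: "continuous_on UNIV \<phi>'"
    unfolding \<phi>'_def by (intro continuous_intros) (use pos(1) in \<open>auto simp: less_imp_neq[symmetric]\<close>)
  have b: "\<bar>\<phi>' t\<bar> \<le> (1 + t\<^sup>2) powr ((\<beta> - 1) / 2)" for t
  proof -
    have "\<bar>t\<bar> = (t\<^sup>2) powr (1 / 2)" by (simp add: powr_half_sqrt)
    also have "\<dots> \<le> (1 + t\<^sup>2) powr (1 / 2)" by (intro powr_mono2) auto
    finally have "\<bar>t\<bar> * (1 + t\<^sup>2) powr (\<beta> / 2 - 1) \<le> (1 + t\<^sup>2) powr (1 / 2) * (1 + t\<^sup>2) powr (\<beta> / 2 - 1)"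
      by (intro mult_right_mono) auto
    also have "\<dots> = (1 + t\<^sup>2) powr ((\<beta> - 1) / 2)" by (simp add: powr_add[symmetric] diff_divide_distrib)
    finally have le: "\<bar>t\<bar> * (1 + t\<^sup>2) powr (\<beta> / 2 - 1) \<le> (1 + t\<^sup>2) powr ((\<beta> - 1) / 2)" .
    have "\<bar>\<phi>' t\<bar> = \<beta> * (\<bar>t\<bar> * (1 + t\<^sup>2) powr (\<beta> / 2 - 1))" using \<beta> by (simp add: \<phi>'_def abs_mult)
    also have "\<dots> \<le> 1 * (\<bar>t\<bar> * (1 + t\<^sup>2) powr (\<beta> / 2 - 1))" using \<beta> by (intro mult_right_mono) auto
    finally show ?thesis using le by simp
  qed
  have b1: "\<bar>\<phi>' t\<bar> \<le> 1" for t
  proof -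
    have "(1 + t\<^sup>2) powr ((\<beta> - 1) / 2) \<le> (1 + t\<^sup>2) powr 0" using \<beta> pos(2) by (intro powr_mono) auto
    thus ?thesis using b[of t] pos(1)[of t] by simp
  qed
  have bp: "\<bar>\<phi>' t\<bar> powr p \<le> (1 + t\<^sup>2) powr (- (1 / 2))" for t
  proof -
    have "\<bar>\<phi>' t\<bar> powr p \<le> ((1 + t\<^sup>2) powr ((\<beta> - 1) / 2)) powr p" using b p by (intro powr_mono2) auto
    also have "\<dots> = (1 + t\<^sup>2) powr ((\<beta> - 1) * p / 2)" by (simp add: powr_powr)
    finally show ?thesis by (simp add: \<beta>(3))
  qed
  have wv: "wgrad (\<lambda>x. \<phi> (z x)) (\<lambda>x. \<phi>' (z x) *\<^sub>R Z x)"
    by (rule wgrad_chain[OF wz der cont b1]) (simp add: \<phi>_def)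
  define V where "V = (\<lambda>x. \<phi>' (z x) *\<^sub>R Z x)"
  define E where "E = (\<lambda>x. 2 powr p * (\<Lambda> * (\<bar>indicator \<Omega> x *\<^sub>R l x\<bar> + indicator K x * norm (f0 x) powr 1) + c powr p * (indicator \<Omega> x * norm (u0 x) powr p)))"
  have iE: "integrable lborel E"
  proof -
    have "f \<in> Lspace 1 K" using f e(2) by (auto simp: Lspace_loc_def K_def)
    moreover have "AE x\<in>K in lborel. f x = f0 x" using f0(2) by eventually_elim (use e(2) in \<open>auto simp: K_def\<close>)
    ultimately have "integrable lborel (\<lambda>x. indicator K x * norm (f0 x) powr 1)"
      by (intro Lspace_integrable[of f] f0(1)) (auto simp: K_def)
    moreover have "integrable lborel (\<lambda>x. indicator \<Omega> x * norm (u0 x) powr p)"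
      by (rule Lspace_integrable[OF u(2) \<Omega>b u0(1) u0'])
    ultimately show ?thesis unfolding E_def
      by (intro integrable_mult_right Bochner_Integration.integrable_add integrable_abs il)
  qed
  have VE: "AE x in lborel. norm (V x) powr p \<le> E x"
    using l(2) f0(2) u0(2) G0(2) growth[unfolded AE_lebesgue_on_iff[OF \<Omega>b]]
  proof eventually_elim
    case (elim x)
    have E0: "E x \<ge> 0" using \<Lambda> by (auto simp: E_def intro!: mult_nonneg_nonneg add_nonneg_nonneg)
    show ?case
    proof (cases "x \<in> K")
      case True
      hence x: "x \<in> \<Omega>" using e(2) by (auto simp: K_def)
      let ?d = "\<bar>\<phi>' (z x)\<bar>"
      have lx: "l x = F x (G0 x) - f0 x * u0 x" using elim x by (simp add: local_integrand_def)
      have "inverse \<Lambda> * norm (G0 x) powr p \<le> F x (G0 x)" using elim x by blast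
      also have "\<dots> = l x + f0 x * u0 x" by (simp add: lx)
      also have "\<dots> \<le> \<bar>l x\<bar> + \<bar>f0 x\<bar> * \<bar>u0 x\<bar>" by (simp add: abs_mult[symmetric] add_mono)
      finally have "\<Lambda> * (inverse \<Lambda> * norm (G0 x) powr p) \<le> \<Lambda> * (\<bar>l x\<bar> + \<bar>f0 x\<bar> * \<bar>u0 x\<bar>)"
        using \<Lambda> by (intro mult_left_mono) auto
      hence Gp: "norm (G0 x) powr p \<le> \<Lambda> * (\<bar>l x\<bar> + \<bar>f0 x\<bar> * \<bar>u0 x\<bar>)"
        using \<Lambda> by (simp add: field_simps)
      have \<kappa>p: "\<kappa> x powr p \<le> \<kappa> x"
        using powr_mono'[of 1 p "\<kappa> x"] \<kappa>(1,2)[of x] p(1) by simp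
      \<comment> \<open>The decay of \<phi>' at z cancels the factor u that multiplies f. The
        cut-off is compatible with this since 0 \<le> \<kappa> \<le> 1 and p > 1 give \<kappa>^p |u|
        \<le> |z|.\<close>
      have dz: "?d powr p * (\<kappa> x powr p * \<bar>u0 x\<bar>) \<le> 1"
      proof -
        have "\<kappa> x powr p * \<bar>u0 x\<bar> \<le> \<bar>z x\<bar>" using \<kappa>p \<kappa>(1)[of x] by (simp add: z_def abs_mult mult_right_mono)
        also have "\<dots> = ((z x)\<^sup>2) powr (1 / 2)" by (simp add: powr_half_sqrt)
        also have "\<dots> \<le> (1 + (z x)\<^sup>2) powr (1 / 2)" by (intro powr_mono2) auto
        finally have "?d powr p * (\<kappa> x powr p * \<bar>u0 x\<bar>) \<le> (1 + (z x)\<^sup>2) powr (- (1 / 2)) * (1 + (z x)\<^sup>2) powr (1 / 2)"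
          by (intro mult_mono bp) auto
        also have "\<dots> = 1" using pos(1)[of "z x"] by (simp add: powr_add[symmetric])
        finally show ?thesis .
      qed
      have d\<kappa>: "?d powr p * \<kappa> x powr p \<le> 1"
        using b1[of "z x"] \<kappa>(1,2)[of x] p(1) by (intro mult_le_one powr_le1) auto
      have "norm (V x) \<le> ?d * (\<kappa> x * norm (G0 x)) + ?d * (\<bar>u0 x\<bar> * norm (sgrad \<kappa> x))"
        unfolding V_def Z_def using norm_triangle_ineq[of "\<kappa> x *\<^sub>R G0 x" "u0 x *\<^sub>R sgrad \<kappa> x"] \<kappa>(1)[of x]
        by (simp add: distrib_left[symmetric] mult_left_mono)
      also have "?d * (\<bar>u0 x\<bar> * norm (sgrad \<kappa> x)) \<le> 1 * (\<bar>u0 x\<bar> * c)"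
        using b1 c by (intro mult_mono mult_left_mono) auto
      finally have "norm (V x) \<le> ?d * (\<kappa> x * norm (G0 x)) + c * \<bar>u0 x\<bar>" by (simp add: mult.commute)
      hence "norm (V x) powr p \<le> (?d * (\<kappa> x * norm (G0 x)) + c * \<bar>u0 x\<bar>) powr p" using p(1) by (intro powr_mono2) auto
      also have "\<dots> \<le> 2 powr p * ((?d * (\<kappa> x * norm (G0 x))) powr p + (c * \<bar>u0 x\<bar>) powr p)"
        using p(1) c \<kappa>(1)[of x] by (intro powr_add_le) auto
      also have "\<dots> \<le> E x"
        unfolding E_def
      proof (intro mult_left_mono add_mono)
        have "(?d * (\<kappa> x * norm (G0 x))) powr p = ?d powr p * \<kappa> x powr p * norm (G0 x) powr p" by (simp add: powr_mult)
        also have "\<dots> \<le> ?d powr p * \<kappa> x powr p * (\<Lambda> * (\<bar>l x\<bar> + \<bar>f0 x\<bar> * \<bar>u0 x\<bar>))" by (intro mult_left_mono Gp) auto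
        also have "\<dots> = \<Lambda> * ((?d powr p * \<kappa> x powr p) * \<bar>l x\<bar> + (?d powr p * (\<kappa> x powr p * \<bar>u0 x\<bar>)) * \<bar>f0 x\<bar>)"
          by (simp only: distrib_left mult_ac)
        also have "\<dots> \<le> \<Lambda> * (1 * \<bar>l x\<bar> + 1 * \<bar>f0 x\<bar>)"
          using \<Lambda> by (intro mult_left_mono add_mono mult_right_mono d\<kappa> dz) auto
        finally show "(?d * (\<kappa> x * norm (G0 x))) powr p \<le> \<Lambda> * (\<bar>indicator \<Omega> x *\<^sub>R l x\<bar> + indicator K x * norm (f0 x) powr 1)"
          using x True by simp
        show "(c * \<bar>u0 x\<bar>) powr p \<le> c powr p * (indicator \<Omega> x * norm (u0 x) powr p)" using x by (simp add: powr_mult)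
      qed auto
      finally show ?thesis .
    next
      case False
      thus ?thesis using E0 \<kappa>z[OF False] by (simp add: V_def Z_def)
    qed
  qed
  define M where "M = norm x0 + e + 1"
  have M: "M > 0" using e by (simp add: M_def add_nonneg_pos)
  have out: "x \<notin> K" if "norm x > M" for x
    using that norm_triangle_ineq2[of x x0] by (auto simp: M_def K_def dist_norm norm_minus_commute)
  have "(\<integral>\<^sub>+x. norm (V x) powr p) \<le> (\<integral>\<^sub>+x. norm (E x))"
    using VE by (intro nn_integral_mono_AE) (auto elim!: eventually_mono intro: ennreal_leI)
  also have "\<dots> < \<infinity>" using iE by (simp add: integrable_iff_bounded)
  finally have Vp: "(\<integral>\<^sub>+x. norm (V x) powr p) < \<infinity>" .
  obtain C where C: "AE x in lborel. \<bar>\<phi> (z x)\<bar> \<le> C"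
  proof (rule morrey_bounded[OF p wv[folded V_def] M _ _ Vp])
    fix x :: 'a assume "norm x > M"
    note out[OF this]
    thus "\<phi> (z x) = 0" "V x = 0" using \<kappa>z[of x] by (auto simp: \<phi>_def z_def V_def Z_def)
  qed
  have "AE x in lborel. x \<in> ball x0 (e / 2) \<longrightarrow> \<bar>u x\<bar> \<le> (1 + C) powr (1 / \<beta>)"
    using C u0(2)
  proof eventually_elim
    case (elim x)
    show ?case
    proof
      assume "x \<in> ball x0 (e / 2)"
      hence zx: "z x = u x" using \<kappa>(3)[of x] elim(2) by (simp add: z_def)
      have "\<bar>u x\<bar> powr \<beta> = ((u x)\<^sup>2) powr (\<beta> / 2)"
      proof -
        have "((u x)\<^sup>2) powr (\<beta> / 2) = (((u x)\<^sup>2) powr (1 / 2)) powr \<beta>" by (simp only: powr_powr) simp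
        thus ?thesis by (simp add: powr_half_sqrt)
      qed
      also have "\<dots> \<le> (1 + (u x)\<^sup>2) powr (\<beta> / 2)" using \<beta> by (intro powr_mono2) auto
      also have "\<dots> \<le> 1 + C" using elim(1) zx by (simp add: \<phi>_def)
      finally have "(\<bar>u x\<bar> powr \<beta>) powr (1 / \<beta>) \<le> (1 + C) powr (1 / \<beta>)" using \<beta> by (intro powr_mono2) auto
      thus "\<bar>u x\<bar> \<le> (1 + C) powr (1 / \<beta>)" using \<beta> by (simp add: powr_powr)
    qed
  qed
  thus ?thesis using e(1) by (intro that[of "e / 2"]) auto
qed

section \<open>From bounds on small balls to compact sets, and the theorem\<close>

text \<open>Finitely many of the balls cover a compact set. The sum of their bounds is used instead
  of the maximum, so an empty cover needs no separate treatment.\<close>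

lemma Linf_locI:
  fixes u :: "'a::euclidean_space \<Rightarrow> real"
  assumes u: "u \<in> borel_measurable (lebesgue_on U)"
    and b: "\<And>x. x \<in> U \<Longrightarrow> \<exists>r>0. \<exists>C. AE y in lborel. y \<in> ball x r \<longrightarrow> \<bar>u y\<bar> \<le> C"
  shows "u \<in> Linf_loc U"
  unfolding Linf_loc_def
proof (intro CollectI conjI allI impI u)
  fix K assume K: "compact K \<and> K \<subseteq> U"
  hence Kb: "K \<in> sets borel" by (simp add: borel_closed compact_imp_closed)
  obtain r C where rC: "\<And>x. x \<in> U \<Longrightarrow> r x > 0" "\<And>x. x \<in> U \<Longrightarrow> AE y in lborel. y \<in> ball x (r x) \<longrightarrow> \<bar>u y\<bar> \<le> C x"
    using b by metis
  have "K \<subseteq> (\<Union>x\<in>K. ball x (r x))" using K rC(1) by force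
  then obtain T where T: "T \<subseteq> K" "finite T" "K \<subseteq> (\<Union>x\<in>T. ball x (r x))"
    using compactE_image[of K K "\<lambda>x. ball x (r x)"] K by (metis open_ball)
  have "AE y in lborel. \<forall>x\<in>T. y \<in> ball x (r x) \<longrightarrow> \<bar>u y\<bar> \<le> C x"
    using T K rC(2) by (intro AE_finite_allI) auto
  hence "AE y\<in>K in lborel. norm (u y) \<le> (\<Sum>x\<in>T. \<bar>C x\<bar>)"
  proof eventually_elim
    case (elim y)
    show ?case
    proof
      assume "y \<in> K"
      then obtain x where x: "x \<in> T" "y \<in> ball x (r x)" using T by auto
      have "\<bar>u y\<bar> \<le> \<bar>C x\<bar>" using elim x by force
      also have "\<dots> \<le> (\<Sum>x\<in>T. \<bar>C x\<bar>)" using x(1) T(2) by (intro member_le_sum) auto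
      finally show "norm (u y) \<le> (\<Sum>x\<in>T. \<bar>C x\<bar>)" by simp
    qed
  qed
  thus "\<exists>C. AE y in lebesgue_on K. norm (u y) \<le> C" unfolding AE_lebesgue_on_iff[OF Kb] by blast
qed

theorem theorem2:
  fixes \<Omega> :: "'a::euclidean_space set"
    and F :: "'a \<Rightarrow> 'a \<Rightarrow> real"
    and a :: "'a \<Rightarrow> 'a \<Rightarrow> real"
    and f u :: "'a \<Rightarrow> real"
    and s p q \<gamma> \<Lambda> :: real
  assumes "DIM('a) \<ge> 2"
    and "open \<Omega>" "connected \<Omega>" "\<Omega> \<noteq> {}" "bounded \<Omega>"
    and "0 < s" "s < 1" "1 < p" "p \<le> s * q"
    and "caratheodory \<Omega> F"
    and "\<Lambda> > 1"
    and "AE x in lebesgue_on \<Omega>. \<forall>\<xi>.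
           inverse \<Lambda> * norm \<xi> powr p \<le> F x \<xi> \<and> F x \<xi> \<le> \<Lambda> * norm \<xi> powr p"
    and "case_prod a \<in> borel_measurable lebesgue"
    and "\<And>x y. a x y \<ge> 0"
    and "\<And>x y. a x y = a y x"
    and "case_prod a \<in> Linf_loc (\<Omega> \<times> \<Omega>)"
    and "p < DIM('a) \<Longrightarrow> q / p \<le> 1 + p / (DIM('a) - p)"
    and "f \<in> Lspace_loc \<gamma> \<Omega>"
    and "p \<le> DIM('a) \<Longrightarrow> \<gamma> > Max {q / (q - p), p / (p - 1), DIM('a) / p}"
    and "p > DIM('a) \<Longrightarrow> \<gamma> = 1"
    and "minimizer F f (nonlocal_kernel a s q) p q \<Omega> u"
    and "u \<in> weighted_tail_space a s q \<Omega>"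
  shows "u \<in> Linf_loc \<Omega>"
proof (rule Linf_locI)
  have u: "u \<in> borel_measurable lebesgue" "u \<in> Lspace p \<Omega>" "weakly_differentiable_on u \<Omega>"
    "integrable (lebesgue_on \<Omega>) (local_integrand F f \<Omega> u)"
    using assms(21) by (auto simp: minimizer_def admissible_def energy_def split: if_splits)
  show "u \<in> borel_measurable (lebesgue_on \<Omega>)" using u(1) by (rule measurable_restrict_space1)
  fix x assume x: "x \<in> \<Omega>"
  show "\<exists>r>0. \<exists>C. AE y in lborel. y \<in> ball x r \<longrightarrow> \<bar>u y\<bar> \<le> C"
  \<comment> \<open>The two ranges of the hypothesis on \<gamma>: De Giorgi's method for p \<le> N,
    and for p > N an argument that uses finite energy and no comparison functions.\<close>
  proof (cases "p \<le> DIM('a)")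
    case True
    interpret nonlocal_problem \<Omega> F a f u s p q \<gamma> \<Lambda>
      by unfold_locales (use assms True in simp_all)
    show ?thesis using locally_bounded[OF x] by metis
  next
    case False
    hence p: "p > DIM('a)" by simp
    have "f \<in> Lspace_loc 1 \<Omega>" using assms(18,20) p by simp
    from supercritical_locally_bounded[OF assms(2,8) p assms(10-12) this u x] show ?thesis by metis
  qed
qed

end
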